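(* Fix $\alpha\in(0,1)\cup(1,2)$ and $\beta\in[-1,1]$, and set $\gamma=\alpha^{-1}$. Let $T$ be the Thaler map with parameter $\gamma$, let $Y=(x^\star,1]$ with probability measure $\mu_Y$, let $\tau_0,\tau_1,\dots$ be the successive return times to $Y$ (random variables on $(Y,\mu_Y)$), and let $d_\alpha,\ell_\alpha$ be the constants, all as defined in the context. Let $\delta_0,\delta_1,\dots$ be independent random variables with $\mathbb{P}(\delta_j=\pm1)=\frac12(1\pm\beta)$, with $(\delta_j)_{j\ge0}$ independent of $(\tau_j)_{j\ge0}$. Define $$W_n(t)=n^{-\gamma}\, d_\alpha^{-\gamma}\Big(\sum_{j=0}^{\lfloor nt\rfloor-1}\delta_j\tau_j-nt\beta\ell_\alpha\Big),\qquad t\ge0 .$$ Then $W_n$ converges weakly to $W_{\alpha,1,\beta}$ in $D[0,\infty)$ with the Skorohod $\mathcal{M}_1$ topology as $n\to\infty$. All processes $W_{\alpha,\eta,\beta}=\eta W_{\alpha,1,\beta}$ (equality in law), $\eta>0$, can be obtained in this way, as weak limits of $\eta W_n$. In particular, taking $\delta_j\equiv\pm1$ (i.e. $\beta=\pm1$) one obtains the processes $W_{\alpha,1,\pm1}$.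
   Context: Stable laws: for $\alpha\in(0,1)\cup(1,2)$, $\eta>0$, $\beta\in[-1,1]$, $X_{\alpha,\eta,\beta}$ denotes a real random variable with characteristic function $$\mathbb{E}(e^{itX_{\alpha,\eta,\beta}})=\exp\Big\{-\eta^\alpha|t|^\alpha\Big(1-i\beta\,\mathrm{sgn}(t)\tan\frac{\alpha\pi}{2}\Big)\Big\},\quad t\in\mathbb{R}.$$ Stable Lévy processes: $W_{\alpha,\eta,\beta}$ denotes the càdlàg process in $D[0,\infty)$ with independent stationary increments such that $W_{\alpha,\eta,\beta}(t)=_d t^{1/\alpha}X_{\alpha,\eta,\beta}$ for $t\ge0$. Here $D[0,\infty)$ is the space of real-valued càdlàg functions on $[0,\infty)$. Skorohod $\mathcal{M}_1$ topology: for $f\in D[0,S]$, its completed graph is $\{(t,x):0\le t\le S,\ x=\theta f(t^-)+(1-\theta)f(t),\ \theta\in[0,1]\}$ (with $f(0^-)=f(0)$), ordered by $(t_1,x_1)\le(t_2,x_2)$ if $t_1<t_2$, or $t_1=t_2=t$ and $|f(t^-)-x_1|\le|f(t^-)-x_2|$. A parametrisation is a continuous nondecreasing (in this order) surjection from $[0,1]$ onto the completed graph. The $\mathcal{M}_1$ distance of two functions is the infimum over pairs of parametrisations of the maximum of the uniform distances of the time components and of the space components. On $D[0,\infty)$, $f_n\to f$ in $\mathcal{M}_1$ means that $f_n|_{[0,S]}\to f|_{[0,S]}$ in $\mathcal{M}_1$ for all continuity points $S>0$ of $f$. Thaler map: for $\gamma\in(0,1)\cup(1,\infty)$, $T:[0,1]\to[0,1]$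 is $$Tx=x\Big(1+\Big(\frac{x}{1+x}\Big)^{\gamma-1}-x^{\gamma-1}\Big)^{1/(1-\gamma)}\bmod 1,$$ equivalently $Tx=(x^{1-\gamma}+(1+x)^{1-\gamma}-1)^{1/(1-\gamma)}\bmod 1$ (with $T0=0$). Let $x^\star\in(0,1)$ be the unique solution of ${x^\star}^{1-\gamma}+(1+x^\star)^{1-\gamma}=2$, and $Y=(x^\star,1]$. Measure: let $h(x)=x^{-\gamma}+(x+1)^{-\gamma}$, and let $\mu_Y$ be the probability measure on $Y$ with density $\frac{1-\gamma}{2^{1-\gamma}-1}\,h|_Y$ with respect to Lebesgue measure. Return times: for $y_0\in Y$ (defined $\mu_Y$-almost everywhere), $\tau_0\ge1$ is the least integer such that $T^{\tau_0}y_0\in Y$; inductively, given $\tau_0,\dots,\tau_{j-1}$, $\tau_j\ge1$ is the least integer such that $T^{\tau_0+\dots+\tau_j}y_0\in Y$. These are random variables on $(Y,\mu_Y)$, the randomness being the choice of $y_0$. Constants: with $\gamma=\alpha^{-1}$, $g_\alpha=\Gamma(1-\alpha)\cos\frac{\alpha\pi}{2}$, $d_\alpha=\alpha^\alpha\,\frac{1-\gamma}{2^{1-\gamma}-1}\,g_\alpha$, and $\ell_\alpha=0$ if $\alpha\in(0,1)$, $\ell_\alpha=(1-2^{\gamma-1})^{-1}$ if $\alpha\in(1,2)$. *)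

theory Defs
  imports "HOL-Probability.Probability"
begin

text \<open>A function on $[0,\infty)$ is a function on the reals that is \<^term>\<open>undefined\<close> on the
  negative half-line, so that equality in the space is equality on $[0,\infty)$.\<close>

definition cadlag_space :: "(real \<Rightarrow> real) set" where
  "cadlag_space = {f \<in> extensional {0..}.
     (\<forall>t\<ge>0. (f \<longlongrightarrow> f t) (at_right t)) \<and> (\<forall>t>0. \<exists>l. (f \<longlongrightarrow> l) (at_left t))}"

definition left_limit :: "(real \<Rightarrow> real) \<Rightarrow> real \<Rightarrow> real" where
  "left_limit f t = (if t = 0 then f 0 else Lim (at_left t) f)"

text \<open>The notions for $D[0,S]$ below take \<^term>\<open>S\<close> as a parameter and only depend on the
  restriction of the functions to $[0,S]$.\<close>

definition completed_graph :: "real \<Rightarrow> (real \<Rightarrow> real) \<Rightarrow> (real \<times> real) set" where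
  "completed_graph S f =
     {(t, x). 0 \<le> t \<and> t \<le> S \<and> (\<exists>\<theta>\<in>{0..1}. x = \<theta> * left_limit f t + (1 - \<theta>) * f t)}"

definition graph_le :: "(real \<Rightarrow> real) \<Rightarrow> real \<times> real \<Rightarrow> real \<times> real \<Rightarrow> bool" where
  "graph_le f = (\<lambda>(t1, x1) (t2, x2). t1 < t2 \<or>
     (t1 = t2 \<and> \<bar>left_limit f t1 - x1\<bar> \<le> \<bar>left_limit f t1 - x2\<bar>))"

definition parametrisations :: "real \<Rightarrow> (real \<Rightarrow> real) \<Rightarrow> (real \<Rightarrow> real \<times> real) set" where
  "parametrisations S f = {p. continuous_on {0..1} p \<and> p ` {0..1} = completed_graph S f \<and>
     (\<forall>s\<in>{0..1}. \<forall>s'\<in>{0..1}. s \<le> s' \<longrightarrow> graph_le f (p s) (p s'))}"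

definition M1_dist :: "real \<Rightarrow> (real \<Rightarrow> real) \<Rightarrow> (real \<Rightarrow> real) \<Rightarrow> real" where
  "M1_dist S f g = (INF (p, q)\<in>parametrisations S f \<times> parametrisations S g.
     max (SUP s\<in>{0..1}. \<bar>fst (p s) - fst (q s)\<bar>) (SUP s\<in>{0..1}. \<bar>snd (p s) - snd (q s)\<bar>))"

definition M1_converges :: "(nat \<Rightarrow> real \<Rightarrow> real) \<Rightarrow> (real \<Rightarrow> real) \<Rightarrow> bool" where
  "M1_converges F f \<longleftrightarrow> (\<forall>S>0. isCont f S \<longrightarrow> (\<lambda>n. M1_dist S (F n) f) \<longlonglongrightarrow> 0)"

text \<open>The M1 topology on $D[0,\infty)$ is metrizable, hence it is determined by its convergent
  sequences: the open sets are the sequentially open ones.\<close>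

definition M1_topology :: "(real \<Rightarrow> real) topology" where
  "M1_topology = topology (\<lambda>U. U \<subseteq> cadlag_space \<and>
     (\<forall>f\<in>U. \<forall>F. range F \<subseteq> cadlag_space \<and> M1_converges F f \<longrightarrow> eventually (\<lambda>n. F n \<in> U) sequentially))"

lemma openin_M1_topology:
  "openin M1_topology U \<longleftrightarrow> U \<subseteq> cadlag_space \<and>
     (\<forall>f\<in>U. \<forall>F. range F \<subseteq> cadlag_space \<and> M1_converges F f \<longrightarrow> eventually (\<lambda>n. F n \<in> U) sequentially)"
proof -
  let ?P = "\<lambda>U. U \<subseteq> cadlag_space \<and>
     (\<forall>f\<in>U. \<forall>F. range F \<subseteq> cadlag_space \<and> M1_converges F f \<longrightarrow> eventually (\<lambda>n. F n \<in> U) sequentially)"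
  have "?P (A \<inter> B)" if "?P A" "?P B" for A B
    using that by (auto intro: eventually_conj)
  moreover have "?P (\<Union>K)" if K: "\<forall>U\<in>K. ?P U" for K
  proof (intro conjI ballI allI impI)
    show "\<Union>K \<subseteq> cadlag_space" using K by blast
  next
    fix f F assume "f \<in> \<Union>K" and F: "range F \<subseteq> cadlag_space \<and> M1_converges F f"
    then obtain U where U: "U \<in> K" "f \<in> U" by blast
    with K F have "eventually (\<lambda>n. F n \<in> U) sequentially" by blast
    then show "eventually (\<lambda>n. F n \<in> \<Union>K) sequentially"
      by (rule eventually_mono) (use U in blast)
  qed
  ultimately have "istopology ?P" unfolding istopology_def by blast
  then show ?thesis unfolding M1_topology_def by simp
qed

lemma topspace_M1_topology [simp]: "topspace M1_topology = cadlag_space"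
proof
  show "topspace M1_topology \<subseteq> cadlag_space"
    using openin_topspace[of M1_topology] unfolding openin_M1_topology by blast
  have "openin M1_topology cadlag_space"
    unfolding openin_M1_topology by (auto intro: always_eventually)
  then show "cadlag_space \<subseteq> topspace M1_topology" by (rule openin_subset)
qed

definition borel_of :: "'c topology \<Rightarrow> 'c measure" where
  "borel_of X = sigma (topspace X) {U. openin X U}"

definition converges_weakly ::
    "'c topology \<Rightarrow> 'a measure \<Rightarrow> (nat \<Rightarrow> 'a \<Rightarrow> 'c) \<Rightarrow> 'b measure \<Rightarrow> ('b \<Rightarrow> 'c) \<Rightarrow> bool" where
  "converges_weakly X M Z N W \<longleftrightarrow>
     (\<forall>n. Z n \<in> measurable M (borel_of X)) \<and> W \<in> measurable N (borel_of X) \<and>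
     (\<forall>\<phi> :: 'c \<Rightarrow> real. continuous_map X euclideanreal \<phi> \<and> bounded (\<phi> ` topspace X) \<longrightarrow>
        (\<lambda>n. \<integral>\<omega>. \<phi> (Z n \<omega>) \<partial>M) \<longlonglongrightarrow> (\<integral>\<omega>. \<phi> (W \<omega>) \<partial>N))"

definition equal_in_law ::
    "'c topology \<Rightarrow> 'a measure \<Rightarrow> ('a \<Rightarrow> 'c) \<Rightarrow> 'b measure \<Rightarrow> ('b \<Rightarrow> 'c) \<Rightarrow> bool" where
  "equal_in_law X M V N W \<longleftrightarrow>
     V \<in> measurable M (borel_of X) \<and> W \<in> measurable N (borel_of X) \<and>
     distr M (borel_of X) V = distr N (borel_of X) W"

definition stable_cf :: "real \<Rightarrow> real \<Rightarrow> real \<Rightarrow> real \<Rightarrow> complex" where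
  "stable_cf \<alpha> \<eta> \<beta> t = exp (- (of_real (\<eta> powr \<alpha> * \<bar>t\<bar> powr \<alpha>) *
     (1 - \<i> * of_real (\<beta> * sgn t * tan (\<alpha> * pi / 2)))))"

definition stable_law :: "real \<Rightarrow> real \<Rightarrow> real \<Rightarrow> real measure \<Rightarrow> bool" where
  "stable_law \<alpha> \<eta> \<beta> \<nu> \<longleftrightarrow> real_distribution \<nu> \<and> (\<forall>t. char \<nu> t = stable_cf \<alpha> \<eta> \<beta> t)"

text \<open>\<^term>\<open>W\<close> is a version of the stable process, defined on some probability
  space \<^term>\<open>N\<close>; the law of such a \<^term>\<open>W\<close> is uniquely determined.\<close>

definition stable_process ::
    "real \<Rightarrow> real \<Rightarrow> real \<Rightarrow> 'b measure \<Rightarrow> ('b \<Rightarrow> real \<Rightarrow> real) \<Rightarrow> bool" where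
  "stable_process \<alpha> \<eta> \<beta> N W \<longleftrightarrow> prob_space N \<and>
     (\<forall>\<omega>\<in>space N. W \<omega> \<in> cadlag_space) \<and>
     (\<forall>t\<ge>0. (\<lambda>\<omega>. W \<omega> t) \<in> borel_measurable N) \<and>
     (\<forall>(m::nat) s. 0 \<le> s 0 \<and> (\<forall>i<m. s i \<le> s (Suc i)) \<longrightarrow>
        prob_space.indep_vars N (\<lambda>_. borel) (\<lambda>i \<omega>. W \<omega> (s (Suc i)) - W \<omega> (s i)) {..<m}) \<and>
     (\<forall>s\<ge>0. \<forall>t\<ge>0. distr N borel (\<lambda>\<omega>. W \<omega> (s + t) - W \<omega> s) =
        distr N borel (\<lambda>\<omega>. W \<omega> t - W \<omega> 0)) \<and>
     (\<exists>\<nu>. stable_law \<alpha> \<eta> \<beta> \<nu> \<and>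
        (\<forall>t\<ge>0. distr N borel (\<lambda>\<omega>. W \<omega> t) = distr \<nu> borel (\<lambda>x. t powr (1 / \<alpha>) * x)))"

text \<open>The leading factor \<^term>\<open>x\<close> makes the value at $0$ equal to $0$.\<close>

definition thaler_map :: "real \<Rightarrow> real \<Rightarrow> real" where
  "thaler_map \<gamma> x = frac (x *
     (1 + (x / (1 + x)) powr (\<gamma> - 1) - x powr (\<gamma> - 1)) powr (1 / (1 - \<gamma>)))"

definition x_star :: "real \<Rightarrow> real" where
  "x_star \<gamma> = (THE x. 0 < x \<and> x < 1 \<and> x powr (1 - \<gamma>) + (1 + x) powr (1 - \<gamma>) = 2)"

definition Y_set :: "real \<Rightarrow> real set" where
  "Y_set \<gamma> = {x_star \<gamma> <.. 1}"

definition mu_Y :: "real \<Rightarrow> real measure" where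
  "mu_Y \<gamma> = density (restrict_space lborel (Y_set \<gamma>))
     (\<lambda>x. ennreal ((1 - \<gamma>) / (2 powr (1 - \<gamma>) - 1) * (x powr (- \<gamma>) + (x + 1) powr (- \<gamma>))))"

text \<open>The value is arbitrary on the null set where there is no return.\<close>

fun return_time :: "real \<Rightarrow> nat \<Rightarrow> real \<Rightarrow> nat" where
  "return_time \<gamma> j y = (LEAST k. 1 \<le> k \<and>
     (thaler_map \<gamma> ^^ ((\<Sum>i<j. return_time \<gamma> i y) + k)) y \<in> Y_set \<gamma>)"

declare return_time.simps [simp del]

definition g_const :: "real \<Rightarrow> real" where
  "g_const \<alpha> = Gamma (1 - \<alpha>) * cos (\<alpha> * pi / 2)"

definition d_const :: "real \<Rightarrow> real" where
  "d_const \<alpha> = (let \<gamma> = 1 / \<alpha> in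
     \<alpha> powr \<alpha> * ((1 - \<gamma>) / (2 powr (1 - \<gamma>) - 1)) * g_const \<alpha>)"

definition l_const :: "real \<Rightarrow> real" where
  "l_const \<alpha> = (if \<alpha> < 1 then 0 else 1 / (1 - 2 powr (1 / \<alpha> - 1)))"

text \<open>For fixed realisations \<^term>\<open>\<delta>\<close> of the signs and \<^term>\<open>y\<close> of the starting point.\<close>

definition W_path ::
    "real \<Rightarrow> real \<Rightarrow> (nat \<Rightarrow> real) \<Rightarrow> real \<Rightarrow> nat \<Rightarrow> real \<Rightarrow> real" where
  "W_path \<alpha> \<beta> \<delta> y n = (let \<gamma> = 1 / \<alpha> in
     (\<lambda>t\<in>{0..}. real n powr (- \<gamma>) * d_const \<alpha> powr (- \<gamma>) *
        ((\<Sum>j<nat \<lfloor>real n * t\<rfloor>. \<delta> j * real (return_time \<gamma> j y)) - real n * t * \<beta> * l_const \<alpha>)))"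

definition scale_path :: "real \<Rightarrow> (real \<Rightarrow> real) \<Rightarrow> real \<Rightarrow> real" where
  "scale_path \<eta> f = (\<lambda>t\<in>{0..}. \<eta> * f t)"

end

(* Read backwards in time, the return times form a functional of a Markov chain on Y: from the state y
   the waiting time k has the tail prod_{i<k} q (orb_i y) along the left inverse branches, and the next
   state is the corresponding preimage. The chain is stochastically monotone, and the two extreme states
   can be coupled, so oscillations of decreasing functions contract geometrically. The tail of the
   waiting time is asymptotic to a constant times k^(-al); comparing it with the coefficients of
   (1 - z)^(al - 1) yields the characteristic function of one step, and with the mixing that of the sums.
   Tightness rests on the rarity of blocks with two large jumps: every other block admits a single time
   change that brings the path close to a step path through its values at the grid points. *)

theory Submission imports Defs
begin

text \<open>All return times are functions of one starting point, so they are not independent; what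
  is explicit is the past given the future. The density \<open>h\<close> at \<open>z\<close> is the
  sum of the contributions of the two preimages of \<open>z\<close>, which gives the reversed chain
  closed transition weights. Its starting state is random, so every estimate is made uniform in the
  state and is integrated over \<open>mu\<close> only when it is carried over to the walk. The
  characteristic function of a sum is obtained through a martingale: the exponential of the sum
  divided by the product of the conditional characteristic functions has expectation
  \<open>1\<close>, so it suffices that this product concentrates. Its logarithm is nearly a sum of
  \<open>rh\<close> over the visited states, and for \<open>al > 1\<close> also of conditional
  means. Convergence is proved for a metric \<open>pdist\<close> of J1 type. Since M1-open sets are
  sequentially open and convergence in \<open>pdist\<close> implies M1 convergence, Lipschitz
  functions for \<open>pdist\<close> decide Borel measurability and weak convergence; completed
  graphs enter only where the two notions are compared.\<close>

no_notation (ASCII) disj (infixr "|" 30)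
notation iff (infixr "<->" 25)
notation abs ("|_|")
notation LIMSEQ ("((_)/ ----> (_))" [60, 60] 60)
abbreviation pmf_expectation ("\<E>") where "\<E> p == integral\<^sup>L (measure_pmf p)"
abbreviation pmf_probability ("\<P>") where "\<P> p == measure (measure_pmf p)"

section \<open>The Thaler map, its lift and the inverse branches\<close>

locale thaler =
 fixes ga :: real
 assumes ga_pos: "0 < ga" and ga_ne: "ga ~= 1"
begin

text \<open>An antiderivative of \<open>x powr (- ga)\<close>. The formula of the map says that the
  lift \<open>w\<close> of \<open>x\<close> solves \<open>U x + U (x + 1) = U w + U 1\<close>, and
  the left side is the antiderivative \<open>H\<close> of \<open>h\<close>; integrals of
  \<open>h\<close> over images of branches thus become values of \<open>U\<close>.\<close>

definition U :: "real => real" where "U x = x powr (1 - ga) / (1 - ga)"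

definition h :: "real => real" where "h x = x powr (- ga) + (x + 1) powr (- ga)"

definition H :: "real => real" where "H x = U x + U (x + 1)"

text \<open>\<^term>\<open>ibr w\<close> is the preimage of \<^term>\<open>w\<close> under the lift of the Thaler map to
  $(0,1] \to (0,2]$; the two inverse branches of the map itself are \<^term>\<open>ibr z\<close> and
  \<^term>\<open>ibr (1 + z)\<close>.\<close>

definition ibr :: "real => real" where "ibr w = (THE x. 0 < x & H x = U w + U 1)"

lemma U_deriv: "0 < x ==> (U has_real_derivative x powr (- ga)) (at x)"
proof -
 assume "0 < x"
 hence "((%x. x powr (1 - ga) / (1 - ga)) has_real_derivative (1 - ga) * x powr (1 - ga - 1) / (1 - ga)) (at x)"
  by (intro DERIV_cdivide has_real_derivative_powr)
 thus ?thesis using ga_ne by (simp add: U_def[abs_def])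
qed

lemma U_strict: "0 < x ==> x < y ==> U x < U y"
proof (rule DERIV_pos_imp_increasing[of x y U])
 fix z assume "0 < x" "x <= z"
 hence "(U has_real_derivative z powr (- ga)) (at z)" "0 < z powr (- ga)" using U_deriv[of z] by auto
 thus "EX d. (U has_real_derivative d) (at z) & 0 < d" by blast
qed

lemma U_mono: "0 < x ==> x <= y ==> U x <= U y" using U_strict[of x y] by (cases "x = y") auto

lemma h_pos: "0 < x ==> 0 < h x" unfolding h_def by (intro add_pos_pos) auto

lemma U_shift_deriv: "0 < x + c ==> ((%x. U (x + c)) has_real_derivative (x + c) powr (- ga)) (at x)"
 using U_deriv[of "x + c"] by (simp only: DERIV_shift)

lemma H_deriv: "0 < x ==> (H has_real_derivative h x) (at x)"
 unfolding H_def h_def by (intro DERIV_add U_deriv U_shift_deriv) auto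

lemma H_strict: "0 < x ==> x < y ==> H x < H y" unfolding H_def using U_strict[of x y] U_strict[of "x + 1" "y + 1"] by simp

lemma H_less_iff: "0 < x ==> 0 < y ==> H x < H y <-> x < y"
 using H_strict[of x y] H_strict[of y x] by (cases x y rule: linorder_cases) auto

lemma H_eq_iff: "0 < x ==> 0 < y ==> H x = H y <-> x = y"
 using H_strict[of x y] H_strict[of y x] by (cases x y rule: linorder_cases) auto

text \<open>Concavity of \<open>U\<close>: its derivative decreases.\<close>

lemma U_increment_antimono:
 assumes "0 < s" "s <= t" "0 <= x"
 shows "U (t + x) - U t <= U (s + x) - U s"
proof (rule DERIV_nonpos_imp_nonincreasing[OF assms(2), of "%s. U (s + x) - U s"])
 fix r assume r: "s <= r" "r <= t"
 have "((%s. U (s + x) - U s) has_real_derivative ((r + x) powr (- ga) - r powr (- ga))) (at r)"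
  using r assms by (intro DERIV_diff U_shift_deriv U_deriv) auto
 moreover have "(r + x) powr (- ga) <= r powr (- ga)" using r assms ga_pos by (intro powr_mono2') auto
 ultimately show "EX y. ((%s. U (s + x) - U s) has_real_derivative y) (at r) & y <= 0" by auto
qed

text \<open>Intermediate value theorem on a bracket that stays away from \<open>0\<close>, where
  \<open>U\<close> may tend to minus infinity. For \<open>w <= 2\<close> concavity of
  \<open>U\<close> puts \<open>H (w / 2)\<close> below the target.\<close>

lemma ibr_ex:
 assumes "0 < w"
 shows "EX x. min (w / 2) 1 <= x & x <= w & H x = U w + U 1"
proof (rule IVT')
 show "H (min (w / 2) 1) <= U w + U 1"
 proof (cases "w <= 2")
  case True
  hence "U (1 + w / 2) - U 1 <= U (w / 2 + w / 2) - U (w / 2)" using assms by (intro U_increment_antimono) auto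
  thus ?thesis using True by (simp add: H_def add.commute)
 next
  case False
  thus ?thesis using U_mono[of 2 w] by (simp add: H_def)
 qed
 show "U w + U 1 <= H w" using U_mono[of 1 "w + 1"] assms by (simp add: H_def)
 show "min (w / 2) 1 <= w" using assms by auto
 show "continuous_on {min (w / 2) 1..w} H"
  using assms by (intro DERIV_continuous_on[of _ H h] DERIV_subset[OF H_deriv]) (auto simp: min_def split: if_splits)
qed

lemma ibr:
 assumes "0 < w"
 shows H_ibr: "H (ibr w) = U w + U 1" and ibr_ge: "min (w / 2) 1 <= ibr w" and ibr_pos: "0 < ibr w" and ibr_less: "ibr w < w"
proof -
 obtain x where x: "min (w / 2) 1 <= x" "x <= w" "H x = U w + U 1" using ibr_ex[OF assms] by blast
 have pos: "0 < x" using x(1) assms by (auto simp: min_def split: if_splits)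
 have eq: "ibr w = x" unfolding ibr_def by (rule the_equality) (use pos x H_eq_iff[of _ x] in auto)
 show "H (ibr w) = U w + U 1" "min (w / 2) 1 <= ibr w" "0 < ibr w" using x pos by (auto simp: eq)
 have "H x < H w" using U_strict[of 1 "w + 1"] assms x(3) by (simp add: H_def)
 thus "ibr w < w" using H_less_iff pos assms by (simp add: eq)
qed

lemma ibr_eqI: "0 < w ==> 0 < x ==> H x = U w + U 1 ==> ibr w = x" using H_eq_iff[of "ibr w" x] H_ibr ibr_pos by auto

lemma ibr_strict: "0 < w ==> w < w' ==> ibr w < ibr w'"
 using H_less_iff[of "ibr w" "ibr w'"] ibr[of w] ibr[of w'] U_strict[of w w'] by auto

lemma ibr_mono: "0 < w ==> w <= w' ==> ibr w <= ibr w'" using ibr_strict[of w w'] by (cases "w = w'") auto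

lemma ibr_2: "ibr 2 = 1" by (rule ibr_eqI) (auto simp: H_def)

lemma ibr_deriv:
 assumes "0 < w"
 shows "(ibr has_real_derivative w powr (- ga) / h (ibr w)) (at w)"
proof -
 \<comment> \<open>The inverse of \<open>H\<close> on its range; \<open>ibr\<close> is
   \<open>Hi\<close> composed with \<open>U w + U 1\<close>, so the inverse function rule is needed
   for \<open>H\<close> alone.\<close>
 define Hi where "Hi = (%v. THE x. 0 < x & H x = v)"
 have HiH: "Hi (H x) = x" if "0 < x" for x unfolding Hi_def by (rule the_equality) (use that H_eq_iff in auto)
 define x where "x = ibr w"
 have x: "0 < x" "H x = U w + U 1" unfolding x_def using ibr assms by auto
 have Hcont: "isCont H z" if "0 < z" for z using H_deriv[OF that] by (rule DERIV_isCont)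
 have HHi: "H (Hi v) = v" if "H (x / 2) < v" "v < H (2 * x)" for v
 proof -
  have "EX z. x / 2 <= z & z <= 2 * x & H z = v"
   using x(1) that Hcont by (intro IVT') (auto intro!: continuous_at_imp_continuous_on)
  thus ?thesis using HiH x(1) by auto
 qed
 have "DERIV Hi (H x) :> inverse (h x)"
 proof (rule DERIV_inverse_function[where f = H and a = "H (x / 2)" and b = "H (2 * x)"])
  show "DERIV H (Hi (H x)) :> h x" using HiH[OF x(1)] H_deriv[OF x(1)] by simp
  show "isCont Hi (H x)"
  proof (rule isCont_inverse_function[where d = "x / 2" and f = H])
   fix z assume "|z - x| <= x / 2"
   hence "0 < z" using x(1) by linarith
   thus "Hi (H z) = z" "isCont H z" using HiH Hcont by auto
  qed (use x(1) in simp)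
 qed (use x(1) h_pos[OF x(1)] H_strict HHi in auto)
 hence "((%w. Hi (U w + U 1)) has_real_derivative inverse (h x) * w powr (- ga)) (at w)" unfolding x(2) using U_deriv[OF assms]
  by (intro DERIV_chain2[of Hi]) (auto intro!: derivative_eq_intros)
 moreover have "(%w. Hi (U w + U 1)) = ibr" by (auto simp: Hi_def ibr_def)
 ultimately show ?thesis by (simp add: x_def field_simps)
qed

lemma ibr_isCont: "0 < w ==> isCont ibr w" using ibr_deriv DERIV_isCont by blast

abbreviation xs :: real where "xs \<equiv> ibr 1"

lemma xs_bds: "0 < xs" "xs < 1" using ibr[of 1] by auto

lemma x_star_eq: "x_star ga = xs" unfolding x_star_def
proof (rule the_equality)
 have eq: "x powr (1 - ga) + (1 + x) powr (1 - ga) = 2 <-> H x = U 1 + U 1" for x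
  using ga_ne by (simp add: H_def U_def add_divide_distrib[symmetric] add.commute)
 show "0 < xs & xs < 1 & xs powr (1 - ga) + (1 + xs) powr (1 - ga) = 2" using xs_bds H_ibr[of 1] eq[of xs] by simp
 fix x assume "0 < x & x < 1 & x powr (1 - ga) + (1 + x) powr (1 - ga) = 2"
 thus "x = xs" using ibr_eqI[of 1 x] eq[of x] by simp
qed

text \<open>The bracket in the formula of the map collapses to \<open>(w / x) powr (1 - ga)\<close>,
  so the lift takes \<open>ibr w\<close> to \<open>w\<close> exactly.\<close>

lemma thaler_map_ibr:
 assumes "0 < w"
 shows "thaler_map ga (ibr w) = frac w"
proof -
 define x where "x = ibr w"
 have x: "0 < x" "H x = U w + U 1" unfolding x_def using ibr assms by auto
 have "(1 - ga) * H x = (1 - ga) * (U w + U 1)" using x(2) by simp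
 hence e: "x powr (1 - ga) + (1 + x) powr (1 - ga) = w powr (1 - ga) + 1"
  using ga_ne by (simp add: H_def U_def distrib_left add.commute)
 have "(x / (1 + x)) powr (ga - 1) = (1 + x) powr (1 - ga) / x powr (1 - ga)"
  using x(1) powr_minus[of x "1 - ga"] powr_minus[of "1 + x" "1 - ga"] by (simp add: powr_divide field_simps)
 moreover have "x powr (ga - 1) = 1 / x powr (1 - ga)" using powr_minus[of x "1 - ga"] by (simp add: field_simps)
 moreover have "1 = x powr (1 - ga) / x powr (1 - ga)" using x(1) by simp
 ultimately have "1 + (x / (1 + x)) powr (ga - 1) - x powr (ga - 1)
   = (x powr (1 - ga) + (1 + x) powr (1 - ga) - 1) / x powr (1 - ga)" by (metis add_divide_distrib diff_divide_distrib)
 also have "... = (w / x) powr (1 - ga)" using e assms x(1) by (simp add: powr_divide)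
 finally have "1 + (x / (1 + x)) powr (ga - 1) - x powr (ga - 1) = (w / x) powr (1 - ga)" .
 hence "(1 + (x / (1 + x)) powr (ga - 1) - x powr (ga - 1)) powr (1 / (1 - ga)) = w / x"
  using assms x(1) ga_ne by (simp add: powr_powr)
 thus ?thesis using x(1) unfolding thaler_map_def x_def[symmetric] by simp
qed

text \<open>Share of the left preimage in the density: \<open>h z\<close> is the sum of
  \<open>h\<close> times the derivative of the branch over \<open>ibr z\<close> and
  \<open>ibr (1 + z)\<close>, with values \<open>z powr (- ga)\<close> and
  \<open>(z + 1) powr (- ga)\<close>.\<close>

definition q :: "real => real" where "q x = x powr (- ga) / h x"

lemma q_alt: "0 < x ==> q x = 1 / (1 + (x / (x + 1)) powr ga)" using powr_gt_zero[of x ga]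
 by (simp add: q_def h_def powr_minus powr_divide field_simps)

lemma q_bds: "0 < x ==> 0 < q x & q x < 1" by (simp add: q_alt field_simps add_pos_pos)

lemma q_compl: "0 < x ==> (x + 1) powr (- ga) = (1 - q x) * h x"
 using h_pos[of x] by (simp add: q_def left_diff_distrib) (simp add: h_def)

lemma q_antimono: "0 < x ==> x <= y ==> q y <= q x"
proof -
 assume xy: "0 < x" "x <= y"
 hence "x / (x + 1) <= y / (y + 1)" by (simp add: field_simps)
 hence "(x / (x + 1)) powr ga <= (y / (y + 1)) powr ga" using xy ga_pos by (intro powr_mono2) auto
 thus ?thesis using xy by (simp add: q_alt frac_le add_pos_pos)
qed

section \<open>Orbits along the left branch, weights of the waiting time and next states\<close>

definition orb :: "nat => real => real" where "orb k = ibr ^^ k"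

lemma orb_0 [simp]: "orb 0 y = y" and orb_Suc: "orb (Suc k) y = ibr (orb k y)" by (simp_all add: orb_def)

lemma orb_Suc2: "orb (Suc k) y = orb k (ibr y)" by (simp add: orb_def funpow_swap1)

lemma orbp: "0 < y ==> 0 < orb k y" by (induction k) (auto simp: orb_Suc ibr_pos)

lemma orb_strict: "0 < y ==> y < y' ==> orb k y < orb k y'" by (induction k) (auto simp: orb_Suc intro: ibr_strict orbp)

lemma orb_mono: "0 < y ==> y <= y' ==> orb k y <= orb k y'" using orb_strict[of y y' k] by (cases "y = y'") auto

lemma orb_decr: "0 < y ==> orb (Suc k) y < orb k y" by (simp add: orb_Suc ibr_less orbp)

lemma orb_le: "0 < y ==> orb k y <= y" by (induction k) (auto intro: order_trans less_imp_le[OF orb_decr])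

lemma orb_antimono: "0 < y ==> i <= j ==> orb j y <= orb i y"
 by (rule lift_Suc_antimono_le[of "%k. orb k y"]) (auto intro: less_imp_le orb_decr)

text \<open>Tail and mass function of the waiting time, shifted by one, before the right branch is taken
  when the inverse branches are followed from \<^term>\<open>y\<close>.\<close>

definition tail :: "nat => real => real" where "tail k y = (\<Prod>i<k. q (orb i y))"

definition mass :: "nat => real => real" where "mass k y = tail k y * (1 - q (orb k y))"

text \<open>Preimage of \<open>y\<close> under \<open>k\<close> left branches followed by the right
  one; its return time is \<open>k + 1\<close>, whence the shift by one throughout.\<close>

definition rbr :: "nat => real => real" where "rbr k y = ibr (orb k y + 1)"

lemma tail_0 [simp]: "tail 0 y = 1" and tail_Suc: "tail (Suc k) y = tail k y * q (orb k y)" by (simp_all add: tail_def)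

lemma tail_Suc2: "tail (Suc k) y = q y * tail k (ibr y)"
 unfolding tail_def by (subst prod.lessThan_Suc_shift) (simp add: orb_Suc2 del: funpow.simps)

lemma mass_eq: "mass k y = tail k y - tail (Suc k) y" by (simp add: mass_def tail_Suc algebra_simps)

lemma tail_pos: "0 < y ==> 0 < tail k y" unfolding tail_def by (intro prod_pos) (auto simp: q_bds orbp)

lemma tail_le_1: "0 < y ==> tail k y <= 1" unfolding tail_def by (intro prod_le_1) (auto simp: q_bds orbp less_imp_le)

lemma mass_ge0: "0 < y ==> 0 <= mass k y" unfolding mass_def using tail_pos[of y k] q_bds[OF orbp, of y k] by auto

lemma tail_decr: "0 < y ==> tail (Suc k) y <= tail k y" using mass_ge0[of y k] by (simp add: mass_eq)

lemma tail_anti: "0 < y ==> y <= y' ==> tail k y' <= tail k y" unfolding tail_def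
 by (intro prod_mono conjI q_antimono orb_mono orbp less_imp_le[OF conjunct1[OF q_bds]]) auto

lemma rbr_mono: "0 < y ==> y <= y' ==> rbr k y <= rbr k y'"
 unfolding rbr_def using orbp[of y k] by (intro ibr_mono add_mono orb_mono) auto

lemma rbr_strict: "0 < y ==> y < y' ==> rbr k y < rbr k y'"
 unfolding rbr_def using orbp[of y k] by (intro ibr_strict add_strict_right_mono orb_strict) auto

lemma rbr_antimono: "0 < y ==> i <= j ==> rbr j y <= rbr i y"
 unfolding rbr_def using orbp[of y j] by (intro ibr_mono add_mono orb_antimono) auto

lemma rbr_range:
 assumes "xs <= y" "y <= 1"
 shows "xs < rbr k y" "rbr k y <= 1"
proof -
 have y: "0 < y" using assms xs_bds by auto
 show "xs < rbr k y" unfolding rbr_def using orbp[OF y, of k] by (intro ibr_strict) auto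
 have "rbr k y <= ibr 2" unfolding rbr_def using orbp[OF y, of k] orb_le[OF y, of k] assms by (intro ibr_mono) auto
 thus "rbr k y <= 1" by (simp add: ibr_2)
qed

lemma rbr_0_1: "rbr 0 1 = 1" by (simp add: rbr_def ibr_2)

text \<open>Since \<open>orb 1 1 = xs\<close>, the ranges of the maps \<open>rbr k\<close> over
  \<open>[xs, 1]\<close> are adjacent intervals.\<close>

lemma rbr_Suc_1: "rbr (Suc k) 1 = rbr k xs" by (simp add: rbr_def orb_Suc2)

lemma H_rbr: "0 < y ==> H (rbr k y) = U (orb k y + 1) + U 1" unfolding rbr_def using orbp[of y k] by (intro H_ibr) auto

text \<open>Chain rule; each factor is \<open>q\<close> times a quotient of values of
  \<open>h\<close>, and these quotients telescope.\<close>

lemma orb_deriv: "0 < y ==> (orb k has_real_derivative tail k y * h y / h (orb k y)) (at y)"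
proof (induction k)
 case 0
 thus ?case using h_pos[of y] by (simp add: orb_def)
next
 case (Suc k)
 have o: "0 < orb k y" "0 < h (orb k y)" using Suc(2) orbp h_pos by auto
 have "((%y. ibr (orb k y)) has_real_derivative
  (orb k y powr (- ga) / h (orb (Suc k) y)) * (tail k y * h y / h (orb k y))) (at y)"
  unfolding orb_Suc by (intro DERIV_chain2[of ibr] ibr_deriv o Suc)
 moreover have "(orb k y powr (- ga) / h (orb (Suc k) y)) * (tail k y * h y / h (orb k y))
   = tail (Suc k) y * h y / h (orb (Suc k) y)" using o by (simp add: tail_Suc q_def field_simps)
 moreover have "(%y. ibr (orb k y)) = orb (Suc k)" by (auto simp: orb_Suc)
 ultimately show ?case by simp
qed

lemma rbr_deriv:
 assumes "0 < y"
 shows "(rbr k has_real_derivative mass k y * h y / h (rbr k y)) (at y)"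
proof -
 have o: "0 < orb k y" "0 < h (orb k y)" using assms orbp h_pos by auto
 have "((%y. ibr (orb k y + 1)) has_real_derivative
  ((orb k y + 1) powr (- ga) / h (rbr k y)) * (tail k y * h y / h (orb k y))) (at y)" unfolding rbr_def using o
  by (intro DERIV_chain2[of ibr] ibr_deriv) (auto intro!: derivative_eq_intros orb_deriv assms)
 moreover have "((orb k y + 1) powr (- ga) / h (rbr k y)) * (tail k y * h y / h (orb k y)) = mass k y * h y / h (rbr k y)"
  using o unfolding q_compl[OF o(1)] by (simp add: mass_def)
 moreover have "(%y. ibr (orb k y + 1)) = rbr k" by (auto simp: rbr_def)
 ultimately show ?thesis by simp
qed

lemma orb_isCont: "0 < y ==> isCont (orb k) y" using orb_deriv DERIV_isCont by blast
lemma rbr_isCont: "0 < y ==> isCont (rbr k) y" using rbr_deriv DERIV_isCont by blast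

lemma h_isCont: "0 < x ==> isCont h x" unfolding h_def by (intro continuous_intros) auto

lemma q_isCont: "0 < x ==> isCont q x" unfolding q_def using h_pos[of x] by (intro continuous_intros h_isCont) auto

lemma tail_isCont: "0 < y ==> isCont (tail k) y"
proof (induction k)
 case (Suc k)
 have "isCont (%y. q (orb k y)) y" by (rule isCont_o2[OF orb_isCont q_isCont[OF orbp]]) (use Suc in auto)
 hence "isCont (%y. tail k y * q (orb k y)) y" using Suc by (intro continuous_intros) auto
 thus ?case by (simp add: tail_Suc[abs_def])
qed (simp add: tail_def[abs_def])

lemma mass_isCont: "0 < y ==> isCont (mass k) y" unfolding mass_eq[abs_def] by (intro continuous_intros tail_isCont)

text \<open>A positive limit of the decreasing orbit would be a fixed point, against
  \<open>ibr w < w\<close>.\<close>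

lemma orb_1_tendsto: "(%k. orb k 1) ----> 0"
proof -
 have "decseq (%k. orb k 1)" by (rule decseq_SucI) (simp add: orb_decr less_imp_le)
 moreover have "0 <= orb k 1" for k using orbp[of 1 k] by simp
 ultimately obtain L where L: "(%k. orb k 1) ----> L" "!!k. L <= orb k 1" using decseq_convergent[of "%k. orb k 1" 0] by metis
 have "0 <= L" using L(1) by (rule LIMSEQ_le_const) (use orbp[of 1] in \<open>auto intro: less_imp_le\<close>)
 moreover have False if "0 < L"
 proof -
  have "(%k. ibr (orb k 1)) ----> ibr L" by (rule isCont_tendsto_compose[OF ibr_isCont[OF that] L(1)])
  moreover have "(%k. orb (Suc k) 1) ----> L" using L(1) by (rule LIMSEQ_Suc)
  ultimately have "ibr L = L" unfolding orb_Suc using LIMSEQ_unique by blast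
  thus False using ibr_less[OF that] by simp
 qed
 ultimately show ?thesis using L(1) by (cases "L = 0") auto
qed

end

section \<open>The probability measure on Y and integrals along the branches\<close>

context thaler
begin

abbreviation mu :: "real measure" where "mu \<equiv> mu_Y ga"

text \<open>\<open>U 2 - U 1\<close> is the mass \<open>H 1 - H xs\<close> of \<open>h\<close> on
  \<open>Y\<close>; in this form positivity is clear for \<open>ga\<close> on either side of
  \<open>1\<close>.\<close>

definition c0 :: real where "c0 = 1 / (U 2 - U 1)"

lemma c0_pos: "0 < c0" using U_strict[of 1 2] by (simp add: c0_def)

lemma c0_eq: "(1 - ga) / (2 powr (1 - ga) - 1) = c0" by (simp add: c0_def U_def diff_divide_distrib[symmetric])

lemma Y_set_eq: "Y_set ga = {xs<..1}" by (simp add: Y_set_def x_star_eq)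

lemma mu_eq: "mu = density (restrict_space lborel {xs<..1}) (%x. ennreal (c0 * h x))"
 by (simp add: mu_Y_def Y_set_eq c0_eq h_def)

lemma space_mu [simp]: "space mu = {xs<..1}" by (simp add: mu_eq space_restrict_space)

lemma sets_mu [measurable_cong]: "sets mu = sets (restrict_space borel {xs<..1})" by (simp add: mu_eq sets_restrict_space)

lemma h_measurable [measurable]: "h : borel_measurable borel" unfolding h_def[abs_def] by measurable

lemma continuous_measurable_mu:
 assumes "!!y. 0 < y ==> isCont f y"
 shows "f : borel_measurable mu"
proof -
 have "continuous_on {xs<..1} f" using assms xs_bds by (intro continuous_at_imp_continuous_on) auto
 from borel_measurable_continuous_on_restrict[OF this] show ?thesis by (simp add: measurable_cong_sets[OF sets_mu refl])
qed

lemma mass_measurable [measurable]: "mass k : borel_measurable mu" by (rule continuous_measurable_mu) (rule mass_isCont)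

lemma tail_measurable [measurable]: "tail k : borel_measurable mu" by (rule continuous_measurable_mu) (rule tail_isCont)

lemma rbr_measurable [measurable]: "rbr k : measurable mu mu"
proof -
 have "rbr k : borel_measurable mu" by (rule continuous_measurable_mu) (rule rbr_isCont)
 hence "rbr k : measurable mu (restrict_space borel {xs<..1})" using rbr_range by (intro measurable_restrict_space2) auto
 thus ?thesis by (simp add: measurable_cong_sets[OF refl sets_mu])
qed

lemma borel_measurable_mu: "f : borel_measurable borel ==> f : borel_measurable mu"
 by (simp add: measurable_cong_sets[OF sets_mu refl] measurable_restrict_space1)

lemma nn_integral_mu:
 assumes f: "f : borel_measurable mu"
 shows "(\<integral>\<^sup>+x. f x \<partial>mu) = (\<integral>\<^sup>+x. f x * ennreal (c0 * h x) * indicator {xs<..1} x \<partial>lborel)"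
proof -
 have "f : borel_measurable (restrict_space lborel {xs<..1})" using f by (simp add: mu_eq)
 hence "(\<integral>\<^sup>+x. f x \<partial>mu) = (\<integral>\<^sup>+x. ennreal (c0 * h x) * f x \<partial>restrict_space lborel {xs<..1})"
  unfolding mu_eq by (intro nn_integral_density measurable_restrict_space1[where f = "%x. ennreal (c0 * h x)"]) auto
 also have "... = (\<integral>\<^sup>+x. ennreal (c0 * h x) * f x * indicator {xs<..1} x \<partial>lborel)"
  by (subst nn_integral_restrict_space) auto
 finally show ?thesis by (simp add: mult_ac)
qed

lemma AE_mu_countable: "countable C ==> AE y in mu. y \<notin> C"
proof -
 assume "countable C"
 hence "AE y in lborel. y \<notin> C" by (intro AE_not_in countable_imp_null_set_lborel)
 hence "AE y in restrict_space lborel {xs<..1}. y \<notin> C" by (subst AE_restrict_space_iff) auto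
 thus ?thesis unfolding mu_eq by (subst AE_density) (auto intro!: measurable_restrict_space1)
qed

lemma nn_integral_mu_Icc:
 assumes "xs <= a" "a <= b" "b <= 1"
 shows "(\<integral>\<^sup>+x. indicator {a..b} x \<partial>mu) = ennreal (c0 * (H b - H a))"
proof -
 have "(\<integral>\<^sup>+x. indicator {a..b} x \<partial>mu)
   = (\<integral>\<^sup>+x. indicator {a..b} x * ennreal (c0 * h x) * indicator {xs<..1} x \<partial>lborel)"
  by (intro nn_integral_mu borel_measurable_mu) auto
 also have "... = (\<integral>\<^sup>+x. ennreal (c0 * h x) * indicator {a..b} x \<partial>lborel)"
 proof (rule nn_integral_cong_AE)
  show "AE x in lborel. indicator {a..b} x * ennreal (c0 * h x) * indicator {xs<..1} x
    = ennreal (c0 * h x) * indicator {a..b} x" using AE_not_in[OF countable_imp_null_set_lborel[of "{xs}"]]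
   by (auto elim!: eventually_mono simp: indicator_def) (use assms in auto)
 qed
 also have "... = ennreal (c0 * H b - c0 * H a)" using assms xs_bds c0_pos
  by (intro nn_integral_FTC_Icc) (auto intro!: DERIV_cmult H_deriv mult_nonneg_nonneg less_imp_le[OF h_pos])
 finally show ?thesis by (simp add: right_diff_distrib)
qed

lemma prob_space_mu: "prob_space mu"
proof
 have "emeasure mu (space mu) = (\<integral>\<^sup>+x. 1 \<partial>mu)" by simp
 also have "... = (\<integral>\<^sup>+x. indicator {xs..1} x \<partial>mu)" by (rule nn_integral_cong) auto
 also have "... = ennreal (c0 * (H 1 - H xs))" using xs_bds by (intro nn_integral_mu_Icc) auto
 also have "H 1 - H xs = U 2 - U 1" using H_ibr[of 1] by (simp add: H_def)
 finally show "emeasure mu (space mu) = 1" using U_strict[of 1 2] by (simp add: c0_def)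
qed

sublocale mu: prob_space mu by (rule prob_space_mu)

text \<open>Change of variables along one branch: the derivative of \<open>rbr k\<close> carries the
  weight \<open>c0 * h\<close> at the image to \<open>mass k\<close> times \<open>c0 * h\<close> at
  the source.\<close>

lemma nn_integral_rbr:
 assumes f [measurable]: "f : borel_measurable mu"
 shows "(\<integral>\<^sup>+x. f x * indicator {rbr k xs..rbr k 1} x \<partial>mu)
   = (\<integral>\<^sup>+y. f (rbr k y) * ennreal (mass k y) \<partial>mu)"
proof -
 let ?r = "rbr k"
 \<comment> \<open>Extension by zero: the substitution takes place on the line, whereas
   \<open>f\<close> is measurable on \<open>Y\<close> only.\<close>
 define f' where "f' = (%x. f x * indicator {xs<..1} x)"
 have f' [measurable]: "f' : borel_measurable borel"
 proof -
  have "f : borel_measurable (restrict_space borel {xs<..1})" using f by (simp add: measurable_cong_sets[OF sets_mu refl])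
  thus ?thesis unfolding f'_def by (subst (asm) borel_measurable_restrict_space_iff_ennreal) auto
 qed
 have range: "xs < ?r xs" "?r 1 <= 1" using rbr_range xs_bds by auto
 have [measurable]: "(%x. indicator {?r xs..?r 1} x :: ennreal) : borel_measurable mu" by (rule borel_measurable_mu) simp
 have "(\<integral>\<^sup>+x. f x * indicator {?r xs..?r 1} x \<partial>mu)
   = (\<integral>\<^sup>+x. f x * indicator {?r xs..?r 1} x * ennreal (c0 * h x) * indicator {xs<..1} x \<partial>lborel)"
  by (rule nn_integral_mu) measurable
 also have "... = (\<integral>\<^sup>+x. (f' x * ennreal (c0 * h x)) * indicator {?r xs..?r 1} x \<partial>lborel)"
  by (intro nn_integral_cong) (use range in \<open>auto simp: f'_def indicator_def\<close>)
 also have "... = (\<integral>\<^sup>+y. (f' (?r y) * ennreal (c0 * h (?r y))) * ennreal (mass k y * h y / h (?r y))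
   * indicator {xs..1} y \<partial>lborel)"
 proof (rule nn_integral_substitution_aux)
  fix y assume "y : {xs..1}"
  hence y: "0 < y" using xs_bds by auto
  show "(?r has_real_derivative mass k y * h y / h (?r y)) (at y)" by (rule rbr_deriv[OF y])
  show "0 <= mass k y * h y / h (?r y)" using mass_ge0[OF y] h_pos[OF y] h_pos[of "?r y"] ibr_pos orbp[OF y, of k]
   by (auto simp: rbr_def intro!: divide_nonneg_pos mult_nonneg_nonneg)
 next
  have pos: "0 < y" if "y : {xs..1}" for y using that xs_bds by auto
  have rpos: "0 < ?r y" if "y : {xs..1}" for y using rbr_range[of y k] that xs_bds by auto
  show "continuous_on {xs..1} (%y. mass k y * h y / h (?r y))"
  proof (rule continuous_at_imp_continuous_on, rule ballI)
   fix y assume y: "y : {xs..1}"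
   have "isCont (%y. h (?r y)) y" by (rule isCont_o2[OF rbr_isCont h_isCont]) (use pos[OF y] rpos[OF y] in auto)
   thus "isCont (%y. mass k y * h y / h (?r y)) y" using pos[OF y] rpos[OF y] h_pos[of "?r y"]
    by (intro continuous_intros mass_isCont h_isCont) auto
  qed
 qed (use xs_bds in auto)
 also have "... = (\<integral>\<^sup>+y. f (?r y) * ennreal (mass k y) * ennreal (c0 * h y) * indicator {xs<..1} y \<partial>lborel)"
 proof (rule nn_integral_cong_AE)
  have "f' (?r y) * ennreal (c0 * h (?r y)) * ennreal (mass k y * h y / h (?r y)) * indicator {xs..1} y
    = f (?r y) * ennreal (mass k y) * ennreal (c0 * h y) * indicator {xs<..1} y" if "y ~= xs" for y
  proof (cases "y : {xs<..1}")
   case True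
   hence y: "xs <= y" "y <= 1" "0 < y" using xs_bds by auto
   have r: "?r y : {xs<..1}" using rbr_range[OF y(1,2)] by auto
   have hp: "0 < h (?r y)" "0 < h y" using r y xs_bds by (auto intro!: h_pos)
   have "ennreal (c0 * h (?r y)) * ennreal (mass k y * h y / h (?r y)) = ennreal (c0 * h (?r y) * (mass k y * h y / h (?r y)))"
    using c0_pos hp mass_ge0[OF y(3), of k] by (intro ennreal_mult[symmetric]) auto
   also have "... = ennreal (mass k y * (c0 * h y))" using hp by (simp add: field_simps)
   also have "... = ennreal (mass k y) * ennreal (c0 * h y)"
    using c0_pos hp mass_ge0[OF y(3), of k] by (intro ennreal_mult) auto
   finally show ?thesis using True r by (simp add: f'_def mult.assoc)
  next
   case False
   with that show ?thesis by (auto simp: indicator_def)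
  qed
  moreover have "AE y in lborel. y \<notin> {xs}" by (intro AE_not_in countable_imp_null_set_lborel) auto
  ultimately show "AE y in lborel. f' (?r y) * ennreal (c0 * h (?r y)) * ennreal (mass k y * h y / h (?r y)) * indicator {xs..1} y
    = f (?r y) * ennreal (mass k y) * ennreal (c0 * h y) * indicator {xs<..1} y" by (auto elim!: eventually_mono)
 qed
 also have "... = (\<integral>\<^sup>+y. f (?r y) * ennreal (mass k y) \<partial>mu)"
  by (rule nn_integral_mu[symmetric]) measurable
 finally show ?thesis .
qed

lemma prob_mu [simp]: "mu.prob {xs<..1} = 1" using mu.prob_space by simp

lemma bounded_integrable_mu:
 fixes f :: "real => real"
 assumes "f : borel_measurable mu" "!!y. xs <= y ==> y <= 1 ==> |f y| <= B"
 shows "integrable mu f" by (rule mu.integrable_const_bound[where B = B]) (use assms in auto)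

lemma tail_integrable: "integrable mu (tail k)"
proof (rule bounded_integrable_mu[where B = 1])
 fix y assume "xs <= y"
 hence "0 < y" using xs_bds by simp
 thus "|tail k y| <= 1" using tail_pos[of y k] tail_le_1[of y k] by simp
qed measurable

lemma mass_le_1: "0 < y ==> mass k y <= 1" using tail_pos[of y "Suc k"] tail_le_1[of y k] by (simp add: mass_eq)

text \<open>The integral is the measure of the range of \<open>rbr k\<close>, and \<open>H\<close>
  at the end points of this range is explicit by \<open>H_rbr\<close>.\<close>

lemma integral_mass: "(\<integral>y. mass k y \<partial>mu) = c0 * (U (orb k 1 + 1) - U (orb (Suc k) 1 + 1))"
proof -
 have r: "0 <= mass k y" if "y : space mu" for y using that xs_bds by (auto intro!: mass_ge0)
 have HU: "H (rbr k 1) - H (rbr k xs) = U (orb k 1 + 1) - U (orb (Suc k) 1 + 1)"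
  using H_rbr[of 1 k] H_rbr[of xs k] xs_bds by (simp add: orb_Suc2)
 have "(\<integral>\<^sup>+y. ennreal (mass k y) \<partial>mu) = (\<integral>\<^sup>+x. indicator {rbr k xs..rbr k 1} x \<partial>mu)"
  using nn_integral_rbr[of "%_. 1" k] by simp
 also have "... = ennreal (c0 * (H (rbr k 1) - H (rbr k xs)))"
  using rbr_range[of xs k] rbr_range[of 1 k] rbr_mono[of xs 1 k] xs_bds by (intro nn_integral_mu_Icc) auto
 finally have "(\<integral>\<^sup>+y. ennreal (mass k y) \<partial>mu) = ennreal (c0 * (U (orb k 1 + 1) - U (orb (Suc k) 1 + 1)))"
  unfolding HU .
 moreover have "0 <= c0 * (U (orb k 1 + 1) - U (orb (Suc k) 1 + 1))"
  using c0_pos U_mono[of "orb (Suc k) 1 + 1" "orb k 1 + 1"] orbp[of 1 "Suc k"] orb_decr[of 1 k]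
  by (intro mult_nonneg_nonneg) auto
 ultimately show ?thesis by (intro integral_eq_nn_integral[THEN trans]) (use r in \<open>auto simp: AE_I2\<close>)
qed

lemma integral_tail: "(\<integral>y. tail k y \<partial>mu) = c0 * (U (orb k 1 + 1) - U 1)"
proof (induction k)
 case 0
 thus ?case using U_strict[of 1 2] by (simp add: c0_def mu.prob_space)
next
 case (Suc k)
 have "tail (Suc k) = (%y. tail k y - mass k y)" by (auto simp: mass_eq)
 moreover have "integrable mu (mass k)"
 proof (rule bounded_integrable_mu[where B = 1])
  fix y assume "xs <= y"
  hence "0 < y" using xs_bds by simp
  thus "|mass k y| <= 1" using mass_ge0[of y k] mass_le_1[of y k] by simp
 qed measurable
 ultimately have "(\<integral>y. tail (Suc k) y \<partial>mu) = (\<integral>y. tail k y \<partial>mu) - (\<integral>y. mass k y \<partial>mu)"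
  by (simp add: tail_integrable)
 thus ?case by (simp add: Suc integral_mass algebra_simps)
qed

text \<open>\<open>tail k\<close> decreases in the state, so at the largest state it is at most its
  mean, which is explicit.\<close>

lemma tail_1_le: "tail k 1 <= c0 * (U (orb k 1 + 1) - U 1)"
proof -
 have "(\<integral>y. tail k 1 \<partial>mu) <= (\<integral>y. tail k y \<partial>mu)"
  using xs_bds by (intro integral_mono tail_integrable) (auto intro!: tail_anti)
 thus ?thesis by (simp add: mu.prob_space integral_tail)
qed

lemma tail_xs: "tail k xs = tail (Suc k) 1 / q 1" using q_bds[of 1] by (simp add: tail_Suc2)

text \<open>The converse comparison: \<open>xs\<close> is the next point on the orbit of
  \<open>1\<close>, so it differs from \<open>1\<close> only by the first factor
  \<open>q 1\<close>.\<close>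

lemma tail_le_tail_1: "xs <= y ==> tail k y <= tail k 1 / q 1"
proof -
 assume "xs <= y"
 hence "tail k y <= tail k xs" using xs_bds by (intro tail_anti) auto
 also have "... <= tail k 1 / q 1" unfolding tail_xs using q_bds[of 1] tail_decr[of 1 k] by (intro divide_right_mono) auto
 finally show ?thesis .
qed

lemma tail_tendsto_0:
 assumes "xs <= y"
 shows "(%k. tail k y) ----> 0"
proof (rule tendsto_sandwich[where f = "%_. 0"])
 have "isCont U 1" using U_deriv[of 1] DERIV_isCont by simp
 hence "(%k. U (orb k 1 + 1)) ----> U 1"
  using tendsto_add[OF orb_1_tendsto tendsto_const, of 1] by (intro isCont_tendsto_compose[of 1 U]) auto
 hence "(%k. c0 * (U (orb k 1 + 1) - U 1) / q 1) ----> c0 * (U 1 - U 1) / q 1"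
  by (intro tendsto_intros) (use q_bds[of 1] in auto)
 thus "(%k. c0 * (U (orb k 1 + 1) - U 1) / q 1) ----> 0" by simp
 show "\<forall>\<^sub>F k in sequentially. tail k y <= c0 * (U (orb k 1 + 1) - U 1) / q 1" using q_bds[of 1]
  by (intro always_eventually allI order_trans[OF tail_le_tail_1[OF assms]] divide_right_mono tail_1_le) auto
 show "\<forall>\<^sub>F k in sequentially. 0 <= tail k y"
  using tail_pos[of y] assms xs_bds by (auto intro!: always_eventually less_imp_le)
qed simp

lemma sum_mass: "(\<Sum>k<n. mass k y) = 1 - tail n y" unfolding mass_eq by (induction n) auto

lemma mass_sums: "xs <= y ==> (%k. mass k y) sums 1"
 unfolding sums_def sum_mass using tendsto_diff[OF tendsto_const tail_tendsto_0] by simp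

definition wait :: "real => nat pmf" where "wait y = embed_pmf (%k. mass k y)"

lemma pmf_wait:
 assumes "xs <= y"
 shows "pmf (wait y) k = mass k y" unfolding wait_def
proof (rule pmf_embed_pmf)
 have pos: "0 <= mass k y" for k using assms xs_bds by (auto intro!: mass_ge0)
 thus "!!k. 0 <= mass k y" .
 have "(\<integral>\<^sup>+k. ennreal (mass k y) \<partial>count_space UNIV) = (\<Sum>k. ennreal (mass k y))"
  by (rule nn_integral_count_space_nat)
 also have "... = ennreal 1" using mass_sums[OF assms] by (intro suminf_ennreal_eq pos)
 finally show "(\<integral>\<^sup>+k. ennreal (mass k y) \<partial>count_space UNIV) = 1" by simp
qed

section \<open>Return times and the reversed chain\<close>

lemma AE_mu_branch: "AE y in mu. EX k y'. xs < y' & y' < 1 & y = rbr k y'"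
proof -
 have "AE y in mu. y \<notin> range (%k. rbr k 1)" by (rule AE_mu_countable) auto
 moreover have "AE y in mu. y : {xs<..1}" using AE_space[of mu] by simp
 ultimately show ?thesis
 proof eventually_elim
  case (elim y)
  have "(%k. rbr k 1) ----> xs" unfolding rbr_def using tendsto_add[OF orb_1_tendsto tendsto_const, of 1]
   by (intro isCont_tendsto_compose[OF ibr_isCont]) auto
  hence "\<forall>\<^sub>F k in sequentially. rbr k 1 < y" using elim by (intro order_tendstoD) auto
  hence "EX k. rbr k xs < y" unfolding rbr_Suc_1[symmetric] eventually_sequentially by (auto intro: le_SucI)
  \<comment> \<open>The first branch whose range starts below \<open>y\<close>; as its range ends
    where that of the preceding branch begins, \<open>y\<close> lies in it.\<close>
  then obtain k where k: "rbr k xs < y" "!!j. j < k ==> \<not> rbr j xs < y"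
   using exists_least_iff[of "%k. rbr k xs < y"] by blast
  have "y <= rbr k 1" using k(2)[of "k - 1"] elim by (cases k) (auto simp: rbr_0_1 rbr_Suc_1)
  hence "y < rbr k 1" using elim by (metis less_eq_real_def rangeI)
  have "EX y'. xs <= y' & y' <= 1 & rbr k y' = y" using k(1) `y < rbr k 1` xs_bds
   by (intro IVT') (auto intro!: continuous_at_imp_continuous_on rbr_isCont)
  then obtain y' where y': "xs <= y'" "y' <= 1" "rbr k y' = y" by blast
  hence "y' ~= xs" "y' ~= 1" using k(1) `y < rbr k 1` by auto
  thus ?case using y' by (intro exI[of _ k] exI[of _ y']) auto
 qed
qed

text \<open>The strict bound \<open>y < 1\<close> keeps \<open>frac\<close> from sending the lift
  value \<open>1\<close> to \<open>0\<close>.\<close>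

lemma thaler_map_orb:
 assumes "xs < y" "y < 1"
 shows "j <= k ==> (thaler_map ga ^^ j) (orb k y) = orb (k - j) y"
proof (induction j)
 case (Suc j)
 then obtain i where i: "k - j = Suc i" by (metis Suc_diff_Suc Suc_le_eq)
 have o: "0 < orb i y" "orb i y < 1" using assms xs_bds orbp[of y i] orb_le[of y i] by auto
 hence "thaler_map ga (orb (Suc i) y) = orb i y" by (simp add: orb_Suc thaler_map_ibr frac_eq)
 moreover have "k - Suc j = i" using i by simp
 ultimately show ?case using Suc i by simp
qed simp

lemma thaler_map_rbr:
 assumes "xs < y" "y < 1"
 shows "thaler_map ga (rbr k y) = orb k y"
proof -
 have o: "0 < orb k y" "orb k y < 1" using assms xs_bds orbp[of y k] orb_le[of y k] by auto
 hence "frac (orb k y + 1) = orb k y" by (simp add: frac_unique_iff)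
 thus ?thesis using o by (simp add: rbr_def thaler_map_ibr)
qed

definition fret :: "real => nat" where "fret y = (LEAST k. 1 <= k & (thaler_map ga ^^ k) y : Y_set ga)"

lemma thaler_map_rbr_pow:
 assumes "xs < y" "y < 1"
 shows "(thaler_map ga ^^ Suc k) (rbr k y) = y"
 using thaler_map_orb[OF assms, of k k] thaler_map_rbr[OF assms, of k] by (simp add: funpow_swap1)

lemma fret_rbr:
 assumes "xs < y" "y < 1"
 shows "fret (rbr k y) = Suc k" unfolding fret_def
proof (rule Least_equality)
 show "1 <= Suc k & (thaler_map ga ^^ Suc k) (rbr k y) : Y_set ga"
  using thaler_map_rbr_pow[OF assms] assms by (simp add: Y_set_eq)
 fix j assume j: "1 <= j & (thaler_map ga ^^ j) (rbr k y) : Y_set ga"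
 show "Suc k <= j"
 proof (rule ccontr)
  assume "\<not> Suc k <= j"
  with j obtain i where i: "j = Suc i" "i < k" by (cases j) auto
  have "(thaler_map ga ^^ j) (rbr k y) = orb (k - i) y" using thaler_map_orb[OF assms, of i k] thaler_map_rbr[OF assms, of k] i
   by (simp add: funpow_swap1)
  \<comment> \<open>The intermediate points are images under \<open>ibr\<close> of points at most
    \<open>1\<close>, hence at most \<open>xs\<close> and outside \<open>Y\<close>.\<close>
  also have "... = ibr (orb (k - Suc i) y)" using i by (simp flip: orb_Suc add: Suc_diff_Suc)
  also have "... <= xs" using assms xs_bds orbp[of y "k - Suc i"] orb_le[of y "k - Suc i"] by (intro ibr_mono) auto
  finally show False using j by (simp add: Y_set_eq)
 qed
qed

lemma thaler_map_measurable [measurable]: "thaler_map ga : borel_measurable borel"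
 unfolding thaler_map_def[abs_def] frac_def by measurable

lemma thaler_pow_measurable [measurable]: "(thaler_map ga ^^ n) : borel_measurable borel"
 by (induction n) (auto simp: comp_def intro: measurable_compose[OF _ thaler_map_measurable])

lemma Y_set_borel [measurable]: "Y_set ga : sets borel" by (simp add: Y_set_eq)

lemma fret_measurable [measurable]: "fret : measurable borel (count_space UNIV)" unfolding fret_def[abs_def] by measurable

text \<open>Duality between the return map and one reversed step: up to a null set
  \<open>fret = Suc k\<close> describes the range of \<open>rbr k\<close>, and there the return map
  inverts \<open>rbr k\<close>.\<close>

lemma nn_integral_fret:
 assumes f [measurable]: "f : borel_measurable mu" and g [measurable]: "g : borel_measurable borel"
 shows "(\<integral>\<^sup>+y. f y * (indicator {y. fret y = Suc k} y * g ((thaler_map ga ^^ Suc k) y)) \<partial>mu)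
   = (\<integral>\<^sup>+y. ennreal (mass k y) * f (rbr k y) * g y \<partial>mu)"
proof -
 let ?F = "%y. f y * g ((thaler_map ga ^^ Suc k) y)"
 have gT [measurable]: "(%y. g ((thaler_map ga ^^ Suc k) y)) : borel_measurable mu" by (rule borel_measurable_mu) measurable
 have "AE y in mu. y \<notin> range (%k. rbr k 1)" by (rule AE_mu_countable) auto
 with AE_mu_branch have "AE y in mu. indicator {y. fret y = Suc k} y = (indicator {rbr k xs..rbr k 1} y :: ennreal)"
 proof eventually_elim
  case (elim y)
  then obtain j y' where y': "xs < y'" "y' < 1" "y = rbr j y'" by blast
  have fr: "fret y = Suc j" using fret_rbr[OF y'(1,2)] y'(3) by simp
  have lo: "rbr j xs < y" and hi: "y < rbr j 1" using y' xs_bds by (auto intro!: rbr_strict)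
  have "y : {rbr k xs..rbr k 1} <-> k = j"
  proof (cases k j rule: linorder_cases)
   case less
   hence "rbr j 1 <= rbr (Suc k) 1" by (intro rbr_antimono) auto
   thus ?thesis using hi less by (auto simp: rbr_Suc_1)
  next
   case greater
   hence "rbr k 1 <= rbr (Suc j) 1" by (intro rbr_antimono) auto
   thus ?thesis using lo greater by (auto simp: rbr_Suc_1)
  qed (use lo hi in auto)
  thus ?case using fr by (auto simp: indicator_def)
 qed
 hence "(\<integral>\<^sup>+y. f y * (indicator {y. fret y = Suc k} y * g ((thaler_map ga ^^ Suc k) y)) \<partial>mu)
   = (\<integral>\<^sup>+y. ?F y * indicator {rbr k xs..rbr k 1} y \<partial>mu)"
  by (intro nn_integral_cong_AE) (auto elim!: eventually_mono simp: mult_ac)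
 also have "... = (\<integral>\<^sup>+y. ?F (rbr k y) * ennreal (mass k y) \<partial>mu)" by (intro nn_integral_rbr) measurable
 also have "... = (\<integral>\<^sup>+y. ennreal (mass k y) * f (rbr k y) * g y \<partial>mu)"
 proof (rule nn_integral_cong_AE)
  have "AE y in mu. y \<notin> {1}" by (rule AE_mu_countable) auto
  moreover have "AE y in mu. y : {xs<..1}" using AE_space[of mu] by simp
  ultimately show "AE y in mu. ?F (rbr k y) * ennreal (mass k y) = ennreal (mass k y) * f (rbr k y) * g y"
  proof eventually_elim
   case (elim y)
   thus ?case using thaler_map_rbr_pow[of y k] by (simp add: mult_ac)
  qed
 qed
 finally show ?thesis .
qed

text \<open>Probability, under the reversed chain started from \<^term>\<open>y\<close>, of the given sequence of
  shifted waiting times.\<close>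

fun path_prob :: "nat list => real => ennreal" where "path_prob [] y = 1"
| "path_prob (k # ks) y = ennreal (mass k y) * path_prob ks (rbr k y)"

lemma path_prob_measurable [measurable]: "path_prob ks : borel_measurable mu"
 by (induction ks) (auto intro!: borel_measurable_times measurable_compose[OF rbr_measurable])

definition rcyl :: "nat list => real set" where "rcyl ks = {y. ALL j<length ks. return_time ga j y = Suc (ks ! j)}"

lemma funpow_add': "(f ^^ (m + n)) x = (f ^^ n) ((f ^^ m) x)" by (simp add: add.commute[of m] funpow_add)

lemma return_time_cylinder:
 assumes "y : rcyl ks"
 shows "return_time ga (length ks) y = fret ((thaler_map ga ^^ sum_list (map Suc ks)) y)"
proof -
 have "(\<Sum>i<length ks. return_time ga i y) = sum_list (map Suc ks)" unfolding sum_list_sum_nth using assms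
  by (intro sum.cong) (auto simp: rcyl_def atLeast0LessThan)
 thus ?thesis by (subst return_time.simps) (simp add: fret_def funpow_add')
qed

lemma rcyl_snoc: "rcyl (ks @ [k]) =
  {y : rcyl ks. fret ((thaler_map ga ^^ sum_list (map Suc ks)) y) = Suc k}"
proof -
 have "y : rcyl (ks @ [k]) <-> y : rcyl ks & return_time ga (length ks) y = Suc k" for y
  by (auto simp: rcyl_def nth_append less_Suc_eq)
 thus ?thesis using return_time_cylinder by auto
qed

lemma rcyl_measurable [measurable]: "rcyl ks : sets borel"
proof (induction ks rule: rev_induct)
 case (snoc k ks)
 note [measurable] = snoc
 show ?case unfolding rcyl_snoc by measurable
qed (simp add: rcyl_def)

text \<open>The function \<open>g\<close> of the end point carries the induction:
  \<open>nn_integral_fret\<close> peels off the last return time, which becomes the first one of the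
  reversed path. Hence \<open>rev\<close>.\<close>

lemma nn_integral_rcyl:
 assumes "g : borel_measurable borel"
 shows "(\<integral>\<^sup>+y. indicator (rcyl ks) y * g ((thaler_map ga ^^ sum_list (map Suc ks)) y) \<partial>mu)
   = (\<integral>\<^sup>+y. path_prob (rev ks) y * g y \<partial>mu)" using assms
proof (induction ks arbitrary: g rule: rev_induct)
 case Nil
 thus ?case by (simp add: rcyl_def)
next
 case (snoc k ks)
 note [measurable] = snoc.prems
 let ?g = "%w. indicator {w. fret w = Suc k} w * g ((thaler_map ga ^^ Suc k) w)"
 let ?n = "sum_list (map Suc ks)"
 have "(thaler_map ga ^^ sum_list (map Suc (ks @ [k]))) y = (thaler_map ga ^^ Suc k) ((thaler_map ga ^^ ?n) y)" for y
  using funpow_add'[of ?n "Suc k" "thaler_map ga" y] by (simp del: funpow.simps)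
 hence "(\<integral>\<^sup>+y. indicator (rcyl (ks @ [k])) y
   * g ((thaler_map ga ^^ sum_list (map Suc (ks @ [k]))) y) \<partial>mu)
   = (\<integral>\<^sup>+y. indicator (rcyl ks) y * ?g ((thaler_map ga ^^ ?n) y) \<partial>mu)"
  by (intro nn_integral_cong) (auto simp: rcyl_snoc indicator_def)
 also have "... = (\<integral>\<^sup>+y. path_prob (rev ks) y * ?g y \<partial>mu)" by (rule snoc.IH) measurable
 also have "... = (\<integral>\<^sup>+y. ennreal (mass k y) * path_prob (rev ks) (rbr k y) * g y \<partial>mu)"
  by (rule nn_integral_fret) measurable
 finally show ?case by simp
qed

lemma emeasure_rcyl: "emeasure mu (rcyl ks \<inter> space mu) = (\<integral>\<^sup>+y. path_prob (rev ks) y \<partial>mu)"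
proof -
 have "(\<integral>\<^sup>+y. path_prob (rev ks) y \<partial>mu) = (\<integral>\<^sup>+y. indicator (rcyl ks) y \<partial>mu)"
  using nn_integral_rcyl[of "%_. 1" ks] by simp
 also have "... = (\<integral>\<^sup>+y. indicator (rcyl ks \<inter> space mu) y \<partial>mu)"
  by (rule nn_integral_cong) (auto simp: indicator_def)
 also have "rcyl ks \<inter> space mu : sets mu"
  unfolding sets_mu sets_restrict_space by (auto intro!: image_eqI[of _ _ "rcyl ks"])
 hence "(\<integral>\<^sup>+y. indicator (rcyl ks \<inter> space mu) y \<partial>mu) = emeasure mu (rcyl ks \<inter> space mu)"
  by simp
 finally show ?thesis by simp
qed

end

section \<open>Bounded expectations under discrete distributions\<close>

lemma int_pmf_bdd:
 fixes f :: "'a => 'b :: {banach, second_countable_topology}"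
 assumes "!!x. x : set_pmf p ==> norm (f x) <= B"
 shows "integrable (measure_pmf p) f"
 by (rule measure_pmf.integrable_const_bound[where B = B]) (use assms in \<open>auto simp: AE_measure_pmf_iff\<close>)

lemma norm_exp_pmf:
 fixes f :: "'a => 'b :: {banach, second_countable_topology}"
 assumes "!!x. x : set_pmf p ==> norm (f x) <= B"
 shows "norm (\<E> p f) <= B"
proof -
 have "norm (\<E> p f) <= \<E> p (%x. norm (f x))" by (rule integral_norm_bound)
 also have "... <= \<E> p (%_. B)" by (rule integral_mono_AE)
   (use assms in \<open>auto simp: AE_measure_pmf_iff intro!: int_pmf_bdd[where B = B]\<close>)
 finally show ?thesis by simp
qed

text \<open>The shift by \<open>B\<close> makes the integrand nonnegative, so that the rule for
  nonnegative integrals over a bind applies.\<close>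

lemma exp_bind_pmf:
 fixes f :: "'b => real"
 assumes B: "!!x. |f x| <= B"
 shows "\<E> (bind_pmf p g) f = \<E> p (%x. \<E> (g x) f)"
proof -
 have int: "integrable (measure_pmf r) f" for r by (rule int_pmf_bdd[where B = B]) (use B in auto)
 have nonneg: "0 <= f x + B" for x using B[of x] by linarith
 have nn: "(\<integral>\<^sup>+x. ennreal (f x + B) \<partial>measure_pmf r) = ennreal (\<E> r f + B)" for r
  using int by (subst nn_integral_eq_integral) (auto simp: nonneg)
 have b: "|\<E> r f| <= B" for r using norm_exp_pmf[of r f B] B by simp
 have "ennreal (\<E> (bind_pmf p g) f + B)
   = (\<integral>\<^sup>+x. ennreal (f x + B) \<partial>measure_pmf (bind_pmf p g))" by (rule nn[symmetric])
 also have "... = (\<integral>\<^sup>+x. ennreal (\<E> (g x) f + B) \<partial>measure_pmf p)"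
  by (subst nn_integral_bind_pmf) (simp only: nn)
 also have "... = ennreal (\<E> p (%x. \<E> (g x) f) + B)"
 proof (subst nn_integral_eq_integral)
  show "integrable (measure_pmf p) (%x. \<E> (g x) f + B)"
   by (rule int_pmf_bdd[where B = "B + |B|"]) (use b in \<open>auto intro: order_trans[OF abs_triangle_ineq]\<close>)
  have "integrable (measure_pmf p) (%x. \<E> (g x) f)" by (rule int_pmf_bdd[where B = B]) (use b in auto)
  thus "ennreal (\<integral>x. \<E> (g x) f + B \<partial>measure_pmf p) = ennreal (\<E> p (%x. \<E> (g x) f) + B)" by simp
  show "AE x in measure_pmf p. 0 <= \<E> (g x) f + B"
  proof (rule AE_I2)
   show "0 <= \<E> (g x) f + B" for x using b[of "g x"] by linarith
  qed
 qed
 finally show ?thesis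
 proof (subst (asm) ennreal_inj)
  show "0 <= \<E> (bind_pmf p g) f + B" using b[of "bind_pmf p g"] by linarith
  have "|\<E> p (%x. \<E> (g x) f) | <= B" using norm_exp_pmf[of p "%x. \<E> (g x) f" B] b by simp
  thus "0 <= \<E> p (%x. \<E> (g x) f) + B" by linarith
 qed simp
qed

lemma expectation_bind_pmf:
 fixes f :: "'b => complex"
 assumes B: "!!x. norm (f x) <= B"
 shows "\<E> (bind_pmf p g) f = \<E> p (%x. \<E> (g x) f)"
proof -
 have int: "integrable (measure_pmf r) f" for r by (rule int_pmf_bdd[where B = B]) (use B in auto)
 have int2: "integrable (measure_pmf p) (%x. \<E> (g x) f)"
  by (rule int_pmf_bdd[where B = B]) (use B in \<open>auto intro: norm_exp_pmf\<close>)
 have re: "|Re (f x) | <= B" and im: "|Im (f x) | <= B" for x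
  using B[of x] abs_Re_le_cmod[of "f x"] abs_Im_le_cmod[of "f x"] by linarith+
 show ?thesis
 proof (rule complex_eqI)
  show "Re (\<E> (bind_pmf p g) f) = Re (\<E> p (%x. \<E> (g x) f))" using exp_bind_pmf[of "%x. Re (f x)" B p g] re
   by (simp add: integral_Re[OF int] integral_Re[OF int2, symmetric])
  show "Im (\<E> (bind_pmf p g) f) = Im (\<E> p (%x. \<E> (g x) f))" using exp_bind_pmf[of "%x. Im (f x)" B p g] im
   by (simp add: integral_Im[OF int] integral_Im[OF int2, symmetric])
 qed
qed

section \<open>The Markov operator of the reversed chain: monotonicity, invariance, mixing\<close>

context thaler
begin

text \<open>Summation by parts, which replaces masses by tails.\<close>

lemma wait_sum:
 fixes g :: "nat => 'a :: real_vector"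
 shows "(\<Sum>k<n. mass k y *\<^sub>R g (Suc k)) = g 0 + (\<Sum>k<n. tail k y *\<^sub>R (g (Suc k) - g k)) - tail n y *\<^sub>R g n"
 by (induction n) (simp_all add: mass_eq scaleR_diff_left scaleR_diff_right algebra_simps)

lemma prob_wait_atLeast: "xs <= y ==> \<P> (wait y) {n..} = tail n y"
proof -
 assume y: "xs <= y"
 have "\<P> (wait y) {..<n} = 1 - tail n y" using y by (simp add: measure_measure_pmf_finite pmf_wait sum_mass)
 moreover have "{n..} = UNIV - {..<n}" by auto
 ultimately show ?thesis using measure_pmf.prob_compl[of "{..<n}" "wait y"] by simp
qed

text \<open>The waiting time itself is \<^term>\<open>Suc k\<close> with \<^term>\<open>k\<close> drawn from \<^term>\<open>wait y\<close>.\<close>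

lemma wait_expectation_approx:
 fixes g :: "nat => 'a :: {banach, second_countable_topology}"
 assumes y: "xs <= y" and B: "!!k. norm (g k) <= B"
 shows "norm (\<E> (wait y) (%k. g (Suc k)) - (g 0 + (\<Sum>k<n. tail k y *\<^sub>R (g (Suc k) - g k)))) <= 2 * B * tail n y"
proof -
 have tp: "0 <= tail n y" using tail_pos[of y n] y xs_bds by simp
 let ?E = "\<E> (wait y)"
 \<comment> \<open>The part beyond \<open>n\<close> costs at most \<open>B * tail n y\<close>, and
   so does the boundary term of the summation by parts; hence the factor \<open>2\<close>.\<close>
 let ?g1 = "%k. indicator {..<n} k *\<^sub>R g (Suc k)" and ?g2 = "%k. indicator {n..} k *\<^sub>R g (Suc k)"
 have int: "integrable (measure_pmf (wait y)) (%k. indicator A k *\<^sub>R g (Suc k))" for A by (rule int_pmf_bdd[where B = B])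
   (use B in \<open>auto simp: indicator_def intro: order_trans[OF norm_ge_zero]\<close>)
 have "?E (%k. g (Suc k)) = ?E (%k. ?g1 k + ?g2 k)" by (intro Bochner_Integration.integral_cong) (auto simp: indicator_def)
 also have "... = ?E ?g1 + ?E ?g2" by (intro Bochner_Integration.integral_add int)
 also have "?E ?g1 = (\<Sum>k<n. mass k y *\<^sub>R g (Suc k))"
  by (subst integral_measure_pmf[of "{..<n}"]) (auto simp: pmf_wait[OF y] indicator_def split: if_splits)
 finally have E: "?E (%k. g (Suc k)) - (g 0 + (\<Sum>k<n. tail k y *\<^sub>R (g (Suc k) - g k)))
   = ?E ?g2 - tail n y *\<^sub>R g n" by (simp add: wait_sum)
 have "norm (?E ?g2) <= ?E (%k. norm (?g2 k))" by (rule integral_norm_bound)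
 also have "... <= ?E (%k. B * indicator {n..} k)" by (intro integral_mono integrable_norm int int_pmf_bdd[where B = "|B|"])
   (use B in \<open>auto simp: indicator_def\<close>)
 also have "... = B * tail n y" using prob_wait_atLeast[OF y] by simp
 finally have "norm (?E ?g2) <= B * tail n y" .
 moreover have "norm (tail n y *\<^sub>R g n) <= B * tail n y"
  using mult_right_mono[OF B[of n] tp] tp by (simp add: mult.commute)
 ultimately show ?thesis unfolding E using norm_triangle_ineq4[of "?E ?g2" "tail n y *\<^sub>R g n"] by simp
qed

lemma wait_exp_lim:
 fixes g :: "nat => 'a :: {banach, second_countable_topology}"
 assumes y: "xs <= y" and B: "!!k. norm (g k) <= B"
 shows "(%n. g 0 + (\<Sum>k<n. tail k y *\<^sub>R (g (Suc k) - g k))) ----> \<E> (wait y) (%k. g (Suc k))"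
proof (rule Lim_transform2[OF tendsto_const])
 have "(%n. 2 * B * tail n y) ----> 2 * B * 0" by (intro tendsto_intros tail_tendsto_0[OF y])
 hence lim: "(%n. 2 * B * tail n y) ----> 0" by simp
 show "(%n. \<E> (wait y) (%k. g (Suc k)) - (g 0 + (\<Sum>k<n. tail k y *\<^sub>R (g (Suc k) - g k)))) ----> 0"
  by (rule Lim_null_comparison[OF _ lim], rule always_eventually) (intro allI wait_expectation_approx[OF assms])
qed

lemma wait_expectation_sums:
 fixes g :: "nat => 'a :: {banach, second_countable_topology}"
 assumes y: "xs <= y" and B: "!!k. norm (g k) <= B"
 shows "(%k. mass k y *\<^sub>R g k) sums \<E> (wait y) g"
proof -
 \<comment> \<open>The limit formula concerns values at \<open>Suc k\<close>; padding with
   \<open>0\<close> at index \<open>0\<close> shifts it back.\<close>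
 define g' where "g' = (%k. case k of 0 => 0 | Suc k => g k)"
 have B0: "0 <= B" using B[of 0] norm_ge_zero order_trans by blast
 have B': "norm (g' k) <= B" for k using B B0 by (auto simp: g'_def split: nat.split)
 have t0: "(%n. tail n y *\<^sub>R g' n) ----> 0"
 proof (rule Lim_null_comparison[OF always_eventually])
  have "0 <= tail n y" for n using tail_pos[of y n] y xs_bds by simp
  thus "ALL n. norm (tail n y *\<^sub>R g' n) <= tail n y * B" using B' by (auto intro: mult_left_mono)
  show "(%n. tail n y * B) ----> 0" using tendsto_mult_right[OF tail_tendsto_0[OF y], of B] by simp
 qed
 have "(%n. g' 0 + (\<Sum>k<n. tail k y *\<^sub>R (g' (Suc k) - g' k)) - tail n y *\<^sub>R g' n)
   ----> \<E> (wait y) (%k. g' (Suc k)) - 0" by (intro tendsto_diff wait_exp_lim[OF y B'] t0)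
 thus ?thesis unfolding wait_sum[symmetric] sums_def by (simp add: g'_def)
qed

definition markov :: "(real => real) => real => real" where "markov f y = \<E> (wait y) (%k. f (rbr k y))"

definition decr :: "(real => real) => bool" where
 "decr f <-> f : borel_measurable mu & (ALL x y. xs <= x --> x <= y --> y <= 1 --> f y <= f x)"

definition osc :: "(real => real) => real" where "osc f = f xs - f 1"

lemma decreasingD: "decr f ==> xs <= x ==> x <= y ==> y <= 1 ==> f y <= f x" by (simp add: decr_def)

lemma decr_range: "decr f ==> xs <= y ==> y <= 1 ==> f 1 <= f y & f y <= f xs" using xs_bds by (auto intro: decreasingD)

lemma decr_bounded: "decr f ==> xs <= y ==> y <= 1 ==> |f y| <= |f 1| + |f xs|" using decr_range[of f y] by linarith

lemma osc_nonneg: "decr f ==> 0 <= osc f" using decr_range[of f 1] xs_bds by (simp add: osc_def)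

lemma rbr_in: "xs <= y ==> y <= 1 ==> xs <= rbr k y & rbr k y <= 1" using rbr_range[of y k] by auto

lemma markov_bounds:
 assumes f: "!!y. xs <= y ==> y <= 1 ==> a <= f y & f y <= b" and y: "xs <= y" "y <= 1"
 shows "a <= markov f y & markov f y <= b"
proof -
 have fr: "a <= f (rbr k y)" "f (rbr k y) <= b" for k using f rbr_in[OF y] by auto
 have int: "integrable (measure_pmf (wait y)) (%k. f (rbr k y))"
  by (rule int_pmf_bdd[where B = "|a| + |b|"]) (use fr in \<open>smt (verit) real_norm_def\<close>)
 have "\<E> (wait y) (%k. a) <= markov f y" unfolding markov_def by (intro integral_mono int fr) auto
 moreover have "markov f y <= \<E> (wait y) (%k. b)" unfolding markov_def by (intro integral_mono int fr) auto
 ultimately show ?thesis by simp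
qed

lemma markov_abs_le:
 assumes f: "!!y. xs <= y ==> y <= 1 ==> |f y| <= B" and y: "xs <= y" "y <= 1"
 shows "|markov f y| <= B"
proof -
 have "- B <= f y & f y <= B" if "xs <= y" "y <= 1" for y using f[OF that] by (simp add: abs_le_iff)
 from markov_bounds[of "- B" f B, OF this y] show ?thesis by (simp add: abs_le_iff)
qed

text \<open>A larger state makes the waiting time stochastically smaller and the next state larger, so
  the chain is stochastically monotone.\<close>

lemma markov_antimono:
 assumes f: "decr f" and y: "xs <= y" "y <= y'" "y' <= 1"
 shows "markov f y' <= markov f y"
proof -
 have yp: "0 < y" using y xs_bds by auto
 \<comment> \<open>\<open>g\<close> increases, since \<open>rbr k y'\<close> decreases in
   \<open>k\<close> and \<open>f\<close> is decreasing; repeating the first value makes the first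
   increment vanish. The waiting-time law is changed first, by comparing tails, and the next state
   afterwards.\<close>
 define g where "g = (%k. case k of 0 => f (rbr 0 y') | Suc k => f (rbr k y'))"
 have gm: "g k <= g (Suc k)" for k using f rbr_in[of y' k] rbr_in[of y' "k - 1"] rbr_antimono[of y' "k - 1" k] y yp
  by (cases k) (auto simp: g_def intro: decreasingD)
 have in': "xs <= rbr k y'" "rbr k y' <= 1" for k using rbr_in[of y' k] y by auto
 have gb: "norm (g k) <= |f 1| + |f xs|" for k using decr_bounded[OF f in'] by (auto simp: g_def split: nat.split)
 have lim: "(%n. g 0 + (\<Sum>k<n. tail k x *\<^sub>R (g (Suc k) - g k)))
   ----> \<E> (wait x) (%k. f (rbr k y'))" if "xs <= x" for x using wait_exp_lim[OF that, of g, OF gb] by (simp add: g_def)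
 have "markov f y' <= \<E> (wait y) (%k. f (rbr k y'))" unfolding markov_def
 proof (rule LIMSEQ_le[OF lim lim])
  have "tail k y' *\<^sub>R (g (Suc k) - g k) <= tail k y *\<^sub>R (g (Suc k) - g k)" for k
   using tail_anti[OF yp y(2), of k] gm[of k] by (simp add: mult_right_mono)
  thus "EX N. ALL n>=N. g 0 + (\<Sum>k<n. tail k y' *\<^sub>R (g (Suc k) - g k))
    <= g 0 + (\<Sum>k<n. tail k y *\<^sub>R (g (Suc k) - g k))" by (intro exI[of _ 0] allI impI add_left_mono sum_mono)
 qed (use y in auto)
 also have "... <= markov f y" unfolding markov_def
 proof (rule integral_mono)
  have iny: "xs <= rbr k y" "rbr k y <= 1" for k using rbr_in[of y k] y by auto
  show "integrable (measure_pmf (wait y)) (%k. f (rbr k y'))"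
   by (rule int_pmf_bdd[where B = "|f 1| + |f xs|"]) (use decr_bounded[OF f in'] in auto)
  show "integrable (measure_pmf (wait y)) (%k. f (rbr k y))"
   by (rule int_pmf_bdd[where B = "|f 1| + |f xs|"]) (use decr_bounded[OF f iny] in auto)
  show "f (rbr k y') <= f (rbr k y)" for k by (rule decreasingD[OF f]) (use iny in' rbr_mono[OF yp y(2)] in auto)
 qed
 finally show ?thesis .
qed

lemma markov_sums:
 assumes "!!y. xs <= y ==> y <= 1 ==> |f y| <= B" "xs <= y" "y <= 1"
 shows "(%k. mass k y * f (rbr k y)) sums markov f y"
 using wait_expectation_sums[of y "%k. f (rbr k y)" B] assms rbr_in[OF assms(2,3)] by (simp add: markov_def)

lemma markov_measurable:
 assumes [measurable]: "f : borel_measurable mu" and B: "!!y. xs <= y ==> y <= 1 ==> |f y| <= B"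
 shows "markov f : borel_measurable mu"
proof (rule borel_measurable_LIMSEQ_real)
 show "(%y. \<Sum>k<n. mass k y * f (rbr k y)) : borel_measurable mu" for n by measurable
 show "(%n. \<Sum>k<n. mass k y * f (rbr k y)) ----> markov f y" if "y : space mu" for y
  using markov_sums[OF B, where y = y] that by (simp add: sums_def)
qed

lemma decr_markov: "decr f ==> decr (markov f)" unfolding decr_def[of "markov f"]
proof (intro conjI allI impI)
 assume f: "decr f"
 thus "markov f : borel_measurable mu" by (intro markov_measurable[OF _ decr_bounded[OF f]]) (auto simp: decr_def)
qed (rule markov_antimono)

definition contr :: real where "contr = 1 - q 1"

lemma contr_bounds: "0 < contr" "contr < 1" using q_bds[of 1] by (auto simp: contr_def)

text \<open>The largest state either stays put or behaves like the smallest one; this makes the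
  oscillation of decr functions contract.\<close>

lemma osc_markov_le:
 assumes f: "decr f"
 shows "osc (markov f) <= contr * osc f"
proof -
 note B = decr_bounded[OF f]
 have m0: "mass 0 1 = 1 - q 1" "mass (Suc k) 1 = q 1 * mass k xs" for k by (simp_all add: mass_def tail_Suc2 orb_Suc2)
 have "(%k. mass k 1 * f (rbr k 1)) sums markov f 1" by (rule markov_sums[OF B]) (use xs_bds in auto)
 hence "(%k. mass (Suc k) 1 * f (rbr (Suc k) 1)) sums (markov f 1 - mass 0 1 * f (rbr 0 1))"
  by (simp add: sums_Suc_iff[of "%k. mass k 1 * f (rbr k 1)"])
 hence "(%k. q 1 * (mass k xs * f (rbr k xs))) sums (markov f 1 - (1 - q 1) * f 1)"
  by (simp add: m0 rbr_0_1 rbr_Suc_1 mult.assoc)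
 moreover have "(%k. q 1 * (mass k xs * f (rbr k xs))) sums (q 1 * markov f xs)"
  by (intro sums_mult markov_sums[OF B]) (use xs_bds in auto)
 ultimately have "markov f 1 - (1 - q 1) * f 1 = q 1 * markov f xs" by (rule sums_unique2)
 hence "osc (markov f) = contr * (markov f xs - f 1)" by (simp add: osc_def contr_def algebra_simps)
 also have "... <= contr * osc f"
  unfolding osc_def using contr_bounds markov_bounds[of "f 1" f "f xs" xs] decr_range[OF f] xs_bds
  by (intro mult_left_mono) auto
 finally show ?thesis .
qed

definition mpow :: "nat => (real => real) => real => real" where "mpow j = markov ^^ j"

lemma mpow_0 [simp]: "mpow 0 f = f" and mpow_Suc: "mpow (Suc j) f = markov (mpow j f)" by (simp_all add: mpow_def)

lemma decr_mpow: "decr f ==> decr (mpow j f)" by (induction j) (auto simp: mpow_Suc decr_markov)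

lemma osc_mpow: "decr f ==> osc (mpow j f) <= contr ^ j * osc f"
proof (induction j)
 case (Suc j)
 have "osc (mpow (Suc j) f) <= contr * osc (mpow j f)" unfolding mpow_Suc by (rule osc_markov_le[OF decr_mpow[OF Suc(2)]])
 also have "... <= contr * (contr ^ j * osc f)" using Suc contr_bounds by (intro mult_left_mono) auto
 finally show ?case by (simp add: mult.assoc)
qed simp

definition mean :: "(real => real) => real" where "mean f = (\<integral>y. f y \<partial>mu)"

lemma decr_integrable: "decr f ==> integrable mu f"
 using decr_bounded[of f] by (intro bounded_integrable_mu) (auto simp: decr_def)

lemma mean_range: "decr f ==> f 1 <= mean f & mean f <= f xs"
proof -
 assume f: "decr f"
 have "(\<integral>y. f 1 \<partial>mu) <= mean f" "mean f <= (\<integral>y. f xs \<partial>mu)"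
  unfolding mean_def by (rule integral_mono; use decr_range[OF f] decr_integrable[OF f] in simp)+
 thus ?thesis by simp
qed

text \<open>Invariance of \<open>mu\<close>: the duality with the return map is summed over
  \<open>k\<close>, and the events \<open>fret = Suc k\<close> form a partition up to a null
  set.\<close>

lemma nn_integral_markov:
 assumes [measurable]: "f : borel_measurable mu" and f: "!!y. xs <= y ==> y <= 1 ==> 0 <= f y & f y <= B"
 shows "(\<integral>\<^sup>+y. ennreal (markov f y) \<partial>mu) = (\<integral>\<^sup>+y. ennreal (f y) \<partial>mu)"
proof -
 let ?I = "%k y. indicator {y. fret y = Suc k} y :: ennreal"
 have [measurable]: "(%y. ?I k y) : borel_measurable mu" for k by (rule borel_measurable_mu) measurable
 have abs: "|f y| <= B" if "xs <= y" "y <= 1" for y using f[OF that] by auto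
 have "ennreal (markov f y) = (\<Sum>k. ennreal (mass k y) * ennreal (f (rbr k y)))" if y: "y : space mu" for y
 proof -
  have nn: "0 <= mass k y" "0 <= f (rbr k y)" for k using y xs_bds f rbr_in[of y k] by (auto intro!: mass_ge0)
  have "(\<Sum>k. ennreal (mass k y * f (rbr k y))) = ennreal (markov f y)"
   using markov_sums[OF abs, where y = y] y by (intro suminf_ennreal_eq) (auto intro!: mult_nonneg_nonneg nn)
  thus ?thesis using nn by (simp add: ennreal_mult)
 qed
 hence "(\<integral>\<^sup>+y. ennreal (markov f y) \<partial>mu)
   = (\<integral>\<^sup>+y. (\<Sum>k. ennreal (mass k y) * ennreal (f (rbr k y))) \<partial>mu)" by (rule nn_integral_cong)
 also have "... = (\<Sum>k. \<integral>\<^sup>+y. ennreal (mass k y) * ennreal (f (rbr k y)) \<partial>mu)"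
  by (intro nn_integral_suminf) measurable
 also have "... = (\<Sum>k. \<integral>\<^sup>+y. ennreal (f y) * ?I k y \<partial>mu)"
  using nn_integral_fret[of "%y. ennreal (f y)" "%_. 1"] by simp
 also have "... = (\<integral>\<^sup>+y. (\<Sum>k. ennreal (f y) * ?I k y) \<partial>mu)"
  by (intro nn_integral_suminf[symmetric]) measurable
 also have "... = (\<integral>\<^sup>+y. ennreal (f y) \<partial>mu)"
 proof (rule nn_integral_cong_AE, rule eventually_mono[OF AE_mu_branch])
  fix y assume "EX k y'. xs < y' & y' < 1 & y = rbr k y'"
  then obtain k where k: "fret y = Suc k" using fret_rbr by blast
  have "(\<Sum>j. ?I j y) = indicator (\<Union>j. {y. fret y = Suc j}) y"
   by (rule suminf_indicator) (auto simp: disjoint_family_on_def)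
  also have "... = 1" using k by auto
  finally show "(\<Sum>k. ennreal (f y) * ?I k y) = ennreal (f y)" by (subst ennreal_suminf_cmult) auto
 qed
 finally show ?thesis .
qed

lemma mean_markov:
 assumes f: "decr f"
 shows "mean (markov f) = mean f"
proof -
 have fm: "f : borel_measurable mu" using f by (simp add: decr_def)
 \<comment> \<open>\<open>f 1\<close> is the least value of \<open>f\<close>, so the invariance for
   nonnegative integrands applies to the difference.\<close>
 define g where "g = (%y. f y - f 1)"
 have gm: "g : borel_measurable mu" unfolding g_def using fm by measurable
 have g: "0 <= g y & g y <= osc f" if "xs <= y" "y <= 1" for y using decr_range[OF f that] by (simp add: g_def osc_def)
 have mg: "markov g y = markov f y - f 1" if "y : space mu" for y
 proof -
  have "integrable (measure_pmf (wait y)) (%k. f (rbr k y))" by (rule int_pmf_bdd[where B = "|f 1| + |f xs|"])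
    (use decr_bounded[OF f] rbr_in[of y] that in auto)
  thus ?thesis by (simp add: markov_def g_def)
 qed
 have "ennreal (mean f - f 1) = (\<integral>\<^sup>+y. ennreal (g y) \<partial>mu)" using decr_integrable[OF f] g
  by (subst nn_integral_eq_integral) (auto simp: g_def mean_def)
 also have "... = (\<integral>\<^sup>+y. ennreal (markov g y) \<partial>mu)" by (rule nn_integral_markov[symmetric, OF gm g])
 also have "... = (\<integral>\<^sup>+y. ennreal (markov f y - f 1) \<partial>mu)" using mg by (intro nn_integral_cong) simp
 also have "... = ennreal (mean (markov f) - f 1)"
  using decr_integrable[OF decr_markov[OF f]] markov_bounds[of "f 1" f "f xs"] decr_range[OF f]
  by (subst nn_integral_eq_integral) (auto simp: mean_def)
 finally show ?thesis
 proof (subst (asm) ennreal_inj)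
  show "0 <= mean f - f 1" using mean_range[OF f] by simp
  have "f 1 <= markov f 1" using markov_bounds[of "f 1" f "f xs" 1] decr_range[OF f] xs_bds by auto
  thus "0 <= mean (markov f) - f 1" using mean_range[OF decr_markov[OF f]] by simp
 qed simp
qed

lemma mean_mpow: "decr f ==> mean (mpow j f) = mean f" by (induction j) (auto simp: mpow_Suc mean_markov decr_mpow)

text \<open>The mean is invariant and lies between the extreme values of \<open>mpow j f\<close>, so
  the deviation is at most the oscillation, which contracts.\<close>

lemma mixing:
 assumes f: "decr f" and y: "xs <= y" "y <= 1"
 shows "|mpow j f y - mean f| <= contr ^ j * osc f"
proof -
 have "|mpow j f y - mean f| <= osc (mpow j f)"
  using decr_range[OF decr_mpow[OF f] y, of j] mean_range[OF decr_mpow[OF f], of j]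
  unfolding mean_mpow[OF f] osc_def by linarith
 with osc_mpow[OF f, of j] show ?thesis by linarith
qed

text \<open>Truncated Neumann series for the Poisson equation
  \<open>V - markov V = f - mean f\<close>; stopping at \<open>n\<close> leaves the error
  \<open>mpow n f - mean f\<close>.\<close>

definition potential :: "nat => (real => real) => real => real" where "potential n f y = (\<Sum>j<n. mpow j f y - mean f)"

lemma potential_bound:
 assumes f: "decr f" and y: "xs <= y" "y <= 1"
 shows "|potential n f y| <= osc f / q 1"
proof -
 have "|potential n f y| <= (\<Sum>j<n. contr ^ j * osc f)"
  unfolding potential_def using mixing[OF f y] by (intro order_trans[OF sum_abs] sum_mono)
 also have "... = (\<Sum>j<n. contr ^ j) * osc f" by (simp add: sum_distrib_right)
 also have "(\<Sum>j<n. contr ^ j) = (1 - contr ^ n) / (1 - contr)" using contr_bounds by (simp add: sum_gp_strict)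
 also have "... * osc f <= (1 / (1 - contr)) * osc f"
  using contr_bounds osc_nonneg[OF f] by (intro mult_right_mono divide_right_mono) auto
 finally show ?thesis by (simp add: contr_def)
qed

lemma potential_eq:
 assumes f: "decr f" and y: "xs <= y" "y <= 1"
 shows "potential n f y - markov (potential n f) y = f y - mpow n f y"
proof -
 have int: "integrable (measure_pmf (wait y)) (%k. mpow j f (rbr k y))" for j
  by (rule int_pmf_bdd[where B = "|mpow j f 1| + |mpow j f xs|"]) (use decr_bounded[OF decr_mpow[OF f]] rbr_in[OF y] in auto)
 have "markov (potential n f) y = (\<Sum>j<n. mpow (Suc j) f y - mean f)"
  unfolding markov_def potential_def mpow_Suc using int by (subst Bochner_Integration.integral_sum) auto
 thus ?thesis unfolding potential_def
  using sum_lessThan_telescope'[of "%j. mpow j f y" n] by (simp add: sum_subtractf[symmetric])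
qed

text \<open>\<^term>\<open>n * contr ^ n\<close> is dominated by the geometric series.\<close>

lemma n_contr_bound: "real n * contr ^ n <= 1 / q 1"
proof -
 have "real n * contr ^ n = (\<Sum>j<n. contr ^ n)" by simp
 also have "... <= (\<Sum>j<n. contr ^ j)" using contr_bounds by (intro sum_mono power_decreasing) auto
 also have "... = (1 - contr ^ n) / (1 - contr)" using contr_bounds by (simp add: sum_gp_strict)
 also have "... <= 1 / (1 - contr)" using contr_bounds by (intro divide_right_mono) auto
 finally show ?thesis by (simp add: contr_def)
qed

end

section \<open>Tail asymptotics of the waiting time\<close>

lemma cesaro_mean:
 fixes d :: "nat => real"
 assumes "d ----> L"
 shows "(%n. (\<Sum>j<n. d j) / n) ----> L"
proof (rule LIMSEQ_I)
 fix r :: real assume "0 < r"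
 then obtain N where N: "!!j. N <= j ==> |d j - L| < r / 2" using LIMSEQ_D[OF assms, of "r / 2"] by auto
 define C where "C = (\<Sum>j<N. |d j - L| )"
 have "(%n. C / real n) ----> 0" by (rule lim_const_over_n)
 hence "\<forall>\<^sub>F n in sequentially. C / real n < r / 2" using `0 < r` by (intro order_tendstoD) auto
 hence "\<forall>\<^sub>F n in sequentially. norm ((\<Sum>j<n. d j) / n - L) < r" using eventually_gt_at_top[of N]
 proof eventually_elim
  case (elim n)
  have "(\<Sum>j<n. d j) / n - L = (\<Sum>j<n. d j - L) / n" using elim by (simp add: sum_subtractf field_simps)
  also have "|... | <= (\<Sum>j<n. |d j - L| ) / n" by (simp add: divide_right_mono)
  also have "(\<Sum>j<n. |d j - L| ) = C + (\<Sum>j=N..<n. |d j - L| )"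
   unfolding C_def using elim by (subst sum.atLeastLessThan_concat[of 0 N n, symmetric, unfolded atLeast0LessThan]) auto
  also have "(\<Sum>j=N..<n. |d j - L| ) <= (\<Sum>j=N..<n. r / 2)"
   by (intro sum_mono) (use N in \<open>auto intro: less_imp_le\<close>)
  also have "... <= n * (r / 2)" using `0 < r` by (simp add: mult_right_mono)
  finally have "| (\<Sum>j<n. d j) / n - L| <= (C + n * (r / 2)) / n" by (simp add: divide_right_mono)
  also have "... = C / n + r / 2" using elim by (simp add: field_simps)
  finally show ?case using elim unfolding real_norm_def by linarith
 qed
 thus "EX no. ALL n>=no. norm ((\<Sum>j<n. d j) / n - L) < r" unfolding eventually_sequentially .
qed

context thaler
begin

abbreviation al :: real where "al \<equiv> 1 / ga"

lemma U_inc_bds: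
 assumes "0 < a" "a <= b"
 shows "(b - a) * b powr (- ga) <= U b - U a" "U b - U a <= (b - a) * a powr (- ga)"
proof -
 have "EX z. a <= z & z <= b & U b - U a = (b - a) * z powr (- ga)"
 proof (cases "a = b")
  case False
  then obtain z where "a < z" "z < b" "U b - U a = (b - a) * z powr (- ga)"
   using MVT2[of a b U "%x. x powr (- ga)"] U_deriv assms by auto
  thus ?thesis by (intro exI[of _ z]) auto
 qed auto
 then obtain z where z: "a <= z" "z <= b" "U b - U a = (b - a) * z powr (- ga)" by blast
 have "b powr (- ga) <= z powr (- ga)" "z powr (- ga) <= a powr (- ga)" using z assms ga_pos by (auto intro!: powr_mono2')
 thus "(b - a) * b powr (- ga) <= U b - U a" "U b - U a <= (b - a) * a powr (- ga)"
  using z assms by (auto intro!: mult_left_mono)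
qed

text \<open>Compares the increments of \<open>v powr (- ga)\<close> and of \<open>U\<close> between
  \<open>x\<close> and \<open>w\<close>: the ratio of the derivatives is \<open>- ga / v\<close>,
  and \<open>U w - U x = U (x + 1) - U 1\<close> is about \<open>x\<close>. So a left branch raises
  \<open>v powr (- ga)\<close> by nearly \<open>ga\<close> when \<open>w\<close> is small.\<close>

lemma ibr_increment:
 assumes w: "0 < w" defines "x \<equiv> ibr w"
 shows "x powr (- ga) - w powr (- ga) <= ga" and "ga * (x + 1) powr (- ga) / (1 + w powr ga) <= x powr (- ga) - w powr (- ga)"
proof -
 have x: "0 < x" "x < w" "U w - U x = U (x + 1) - U 1" unfolding x_def using ibr[OF w] by (auto simp: H_def)
 have D: "((%v. v powr (- ga) + c * U v) has_real_derivative (ga * v powr (- ga) * (c / ga - 1 / v))) (at v)" if "0 < v" for v c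
 proof -
  have "((%v. v powr (- ga) + c * U v) has_real_derivative (- ga * v powr (- ga - 1) + c * v powr (- ga))) (at v)"
   by (intro DERIV_add DERIV_cmult U_deriv has_real_derivative_powr that)
  moreover have "- ga * v powr (- ga - 1) + c * v powr (- ga) = ga * v powr (- ga) * (c / ga - 1 / v)"
   using that ga_pos by (simp add: powr_diff field_simps)
  ultimately show ?thesis by simp
 qed
 have inc: "U (x + 1) - U 1 <= x" "x * (x + 1) powr (- ga) <= U (x + 1) - U 1" using U_inc_bds[of 1 "x + 1"] x(1) by auto
 have "x powr (- ga) + ga / x * U x <= w powr (- ga) + ga / x * U w"
 proof (rule DERIV_nonneg_imp_nondecreasing[OF less_imp_le[OF x(2)], of "%v. v powr (- ga) + ga / x * U v"])
  fix v assume v: "x <= v" "v <= w"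
  have "0 <= ga * v powr (- ga) * ((ga / x) / ga - 1 / v)" using v x ga_pos by (intro mult_nonneg_nonneg) (auto simp: frac_le)
  thus "EX y. ((%v. v powr (- ga) + ga / x * U v) has_real_derivative y) (at v) & 0 <= y" using D[of v "ga / x"] v x by auto
 qed
 hence "x powr (- ga) - w powr (- ga) <= ga / x * (U w - U x)" by (simp add: algebra_simps)
 also have "... <= ga / x * x" using inc x ga_pos by (intro mult_left_mono) auto
 finally show "x powr (- ga) - w powr (- ga) <= ga" using x by simp
 have "w powr (- ga) + ga / w * U w <= x powr (- ga) + ga / w * U x"
 proof (rule DERIV_nonpos_imp_nonincreasing[OF less_imp_le[OF x(2)], of "%v. v powr (- ga) + ga / w * U v"])
  fix v assume v: "x <= v" "v <= w"
  have "ga * v powr (- ga) * ((ga / w) / ga - 1 / v) <= 0" using v x ga_pos by (intro mult_nonneg_nonpos) (auto simp: frac_le)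
  thus "EX y. ((%v. v powr (- ga) + ga / w * U v) has_real_derivative y) (at v) & y <= 0" using D[of v "ga / w"] v x by auto
 qed
 hence "ga / w * (U w - U x) <= x powr (- ga) - w powr (- ga)" by (simp add: algebra_simps)
 moreover have "ga / w * (x * (x + 1) powr (- ga)) <= ga / w * (U w - U x)" using inc x ga_pos w by (intro mult_left_mono) auto
 moreover have "ga * (x + 1) powr (- ga) / (1 + w powr ga) <= ga / w * (x * (x + 1) powr (- ga))"
 proof -
  \<comment> \<open>The lower estimate loses a factor \<open>x / w\<close>; comparing
    \<open>w - x\<close> with \<open>x\<close> shows that it is close to \<open>1\<close> for small
    \<open>w\<close>.\<close>
  have "(w - x) * w powr (- ga) <= x" using U_inc_bds(1)[OF x(1) less_imp_le[OF x(2)]] inc x by simp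
  hence "w - x <= x * w powr ga" using w by (simp add: powr_minus field_simps)
  hence "1 / (1 + w powr ga) <= x / w" using w powr_ge_zero[of w ga] by (simp add: field_simps add_pos_nonneg)
  hence "1 / (1 + w powr ga) * (ga * (x + 1) powr (- ga)) <= x / w * (ga * (x + 1) powr (- ga))"
   using ga_pos by (intro mult_right_mono) auto
  thus ?thesis by (simp add: field_simps)
 qed
 ultimately show "ga * (x + 1) powr (- ga) / (1 + w powr ga) <= x powr (- ga) - w powr (- ga)" by linarith
qed

text \<open>The increments of \<open>orb k 1 powr (- ga)\<close> tend to \<open>ga\<close>, so by
  Cesaro averages this power grows like \<open>ga * n\<close>; raising to the power
  \<open>- al\<close> inverts it.\<close>

lemma orb_asymptotic: "(%k. orb k 1 * real k powr al) ----> al powr al"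
proof -
 define d where "d = (%k. orb (Suc k) 1 powr (- ga) - orb k 1 powr (- ga))"
 have op: "0 < orb k 1" for k by (simp add: orbp)
 have "d ----> ga"
 proof (rule tendsto_sandwich)
  have "(%k. ga * (orb (Suc k) 1 + 1) powr (- ga) / (1 + orb k 1 powr ga)) ----> ga * (0 + 1) powr (- ga) / (1 + 0)"
   using ga_pos by (intro tendsto_intros LIMSEQ_Suc[OF orb_1_tendsto] tendsto_zero_powrI[OF orb_1_tendsto tendsto_const]
     always_eventually) (auto intro: less_imp_le op)
  thus "(%k. ga * (orb (Suc k) 1 + 1) powr (- ga) / (1 + orb k 1 powr ga)) ----> ga" by simp
  show "\<forall>\<^sub>F k in sequentially. ga * (orb (Suc k) 1 + 1) powr (- ga) / (1 + orb k 1 powr ga) <= d k"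
   "\<forall>\<^sub>F k in sequentially. d k <= ga" using ibr_increment[OF op] by (auto simp: d_def orb_Suc)
 qed simp
 hence "(%n. (\<Sum>j<n. d j) / n) ----> ga" by (rule cesaro_mean)
 moreover have "(\<Sum>j<n. d j) = orb n 1 powr (- ga) - 1" for n unfolding d_def by (subst sum_lessThan_telescope) simp
 ultimately have "(%n. (orb n 1 powr (- ga) - 1) / n + 1 / n) ----> ga + 0" by (intro tendsto_add lim_1_over_n) simp
 hence "(%n. orb n 1 powr (- ga) / n) ----> ga" by (simp add: add_divide_distrib[symmetric])
 hence "(%n. (orb n 1 powr (- ga) / n) powr (- al)) ----> ga powr (- al)"
  using ga_pos by (intro tendsto_powr tendsto_const) auto
 moreover have "ga powr (- al) = al powr al" using ga_pos by (simp add: powr_minus powr_divide field_simps)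
 moreover have "\<forall>\<^sub>F n in sequentially. (orb n 1 powr (- ga) / n) powr (- al) = orb n 1 * real n powr al"
  using eventually_gt_at_top[of 0]
 proof eventually_elim
  case (elim n)
  have "(orb n 1 powr (- ga) / n) powr (- al) = (orb n 1 powr (- ga)) powr (- al) / real n powr (- al)"
   by (simp add: powr_divide)
  also have "(orb n 1 powr (- ga)) powr (- al) = orb n 1" using op[of n] ga_pos by (simp add: powr_powr)
  finally show ?case by (simp add: powr_minus field_simps)
 qed
 ultimately show ?thesis using tendsto_cong by fastforce
qed

definition tconst :: real where "tconst = c0 * al powr al"

lemma tconst_pos: "0 < tconst" using c0_pos ga_pos by (simp add: tconst_def)

lemma mean_tail: "mean (tail k) = c0 * (U (orb k 1 + 1) - U 1)" by (simp add: mean_def integral_tail)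

text \<open>\<open>U (x + 1) - U 1\<close> is asymptotic to \<open>x\<close> at \<open>0\<close>, so
  the asymptotics of the orbit carry over.\<close>

lemma mean_tail_asymptotic: "(%k. real k powr al * mean (tail k)) ----> tconst"
proof (rule tendsto_sandwich[where f = "%k. c0 * (orb k 1 * real k powr al) * (orb k 1 + 1) powr (- ga)"
   and h = "%k. c0 * (orb k 1 * real k powr al)"])
 let ?x = "%k. orb k 1"
 have op: "0 < orb k 1" for k by (simp add: orbp)
 have b: "?x k * (?x k + 1) powr (- ga) <= U (?x k + 1) - U 1" "U (?x k + 1) - U 1 <= ?x k" for k
  using U_inc_bds[of 1 "?x k + 1"] op[of k] by auto
 have 1: "(%k. c0 * (?x k * real k powr al)) ----> c0 * al powr al" by (intro tendsto_intros orb_asymptotic)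
 thus "(%k. c0 * (?x k * real k powr al)) ----> tconst" by (simp add: tconst_def)
 have "(%k. c0 * (?x k * real k powr al) * (?x k + 1) powr (- ga)) ----> c0 * al powr al * (0 + 1) powr (- ga)"
  by (intro tendsto_intros 1 orb_1_tendsto) auto
 thus "(%k. c0 * (?x k * real k powr al) * (?x k + 1) powr (- ga)) ----> tconst" by (simp add: tconst_def)
 have "c0 * (?x k * real k powr al) * (?x k + 1) powr (- ga) <= real k powr al * mean (tail k)"
  "real k powr al * mean (tail k) <= c0 * (?x k * real k powr al)" for k
 proof -
  have c: "0 <= c0 * real k powr al" using c0_pos by simp
  show "c0 * (?x k * real k powr al) * (?x k + 1) powr (- ga) <= real k powr al * mean (tail k)"
   "real k powr al * mean (tail k) <= c0 * (?x k * real k powr al)"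
   using mult_left_mono[OF b(1)[of k] c] mult_left_mono[OF b(2)[of k] c] by (simp_all add: mean_tail mult_ac)
 qed
 thus "\<forall>\<^sub>F k in sequentially. c0 * (?x k * real k powr al) * (?x k + 1) powr (- ga) <= real k powr al * mean (tail k)"
  "\<forall>\<^sub>F k in sequentially. real k powr al * mean (tail k) <= c0 * (?x k * real k powr al)" by auto
qed

text \<open>The tail ratios increase in \<^term>\<open>k\<close>; their bounded distortion is a telescoping effect,
  because \<^term>\<open>xs\<close> is the image of \<^term>\<open>1::real\<close> under the left inverse branch.\<close>

definition ratio :: "nat => real => real" where "ratio k y = tail k y / tail k 1"

definition rlim :: "real => real" where "rlim y = (SUP k. ratio k y)"

context
 fixes y :: real
 assumes y: "xs <= y" "y <= 1"
begin

lemma y_pos: "0 < y" using y xs_bds by simp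

lemma tails_pos: "0 < tail k y" "0 < tail k 1" by (simp_all add: tail_pos y_pos)

lemma ratio_bds: "1 <= ratio k y" "ratio k y <= 1 / q 1"
 using tail_anti[OF y_pos y(2), of k] tail_le_tail_1[OF y(1), of k] tails_pos[of k] by (auto simp: ratio_def field_simps)

lemma ratio_mono: "k <= l ==> ratio k y <= ratio l y"
proof (rule lift_Suc_mono_le[of "%k. ratio k y"])
 fix n
 have "q (orb n 1) <= q (orb n y)" by (intro q_antimono orb_mono orbp y_pos y)
 moreover have "0 < q (orb n 1)" by (simp add: q_bds orbp)
 ultimately have "1 <= q (orb n y) / q (orb n 1)" by simp
 hence "ratio n y * 1 <= ratio n y * (q (orb n y) / q (orb n 1))" using ratio_bds[of n] by (intro mult_left_mono) auto
 thus "ratio n y <= ratio (Suc n) y" by (simp add: ratio_def tail_Suc)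
qed

lemma tail_add: "tail (k + j) z = tail k z * tail j (orb k z)"
proof -
 have "orb (k + j) z = orb j (orb k z)" for j by (simp add: orb_def funpow_add')
 thus ?thesis by (induction j) (simp_all add: tail_Suc)
qed

text \<open>Since \<open>xs = orb 1 1 <= y\<close>, the orbit of \<open>y\<close> never falls below
  that of \<open>1\<close> shifted by one step; from index \<open>k\<close> on this shift costs only
  the factor \<open>q (orb k 1)\<close>.\<close>

lemma ratio_le: "ratio l y <= ratio k y / q (orb k 1)"
proof (cases "k <= l")
 case True
 define j where "j = l - k"
 have l: "l = k + j" using True by (simp add: j_def)
 define z where "z = orb k 1"
 have z: "0 < z" "0 < q z" unfolding z_def by (auto simp: q_bds orbp)
 have "orb k y >= ibr z" using orb_mono[OF xs_bds(1) y(1), of k] by (simp add: z_def orb_Suc[symmetric] orb_Suc2)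
 hence "tail j (orb k y) <= tail j (ibr z)" by (intro tail_anti ibr_pos z) auto
 also have "... = tail (Suc j) z / q z" using z by (simp add: tail_Suc2)
 also have "... <= tail j z / q z" using z tail_decr[of z j] by (intro divide_right_mono) auto
 finally have "tail j (orb k y) / tail j z <= 1 / q z" using tail_pos[OF z(1), of j] by (simp add: field_simps)
 hence "ratio k y * (tail j (orb k y) / tail j z) <= ratio k y * (1 / q z)" using ratio_bds[of k] by (intro mult_left_mono) auto
 thus ?thesis by (simp add: l ratio_def tail_add z_def)
next
 case False
 have "ratio l y * 1 <= ratio k y * (1 / q (orb k 1))" using ratio_mono[of l k] False ratio_bds[of l] q_bds[OF orbp, of 1 k]
  by (intro mult_mono) auto
 thus ?thesis by simp
qed

lemma rlim_bounds: "ratio k y <= rlim y" "rlim y <= ratio k y / q (orb k 1)"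
proof -
 have "bdd_above (range (%k. ratio k y))" using ratio_bds(2) by (auto intro!: bdd_aboveI)
 thus "ratio k y <= rlim y" unfolding rlim_def by (intro cSUP_upper) auto
 show "rlim y <= ratio k y / q (orb k 1)" unfolding rlim_def by (intro cSUP_least ratio_le) auto
qed

lemma rlim_ge_1: "1 <= rlim y" and rlim_le: "rlim y <= 1 / q 1" using rlim_bounds[of 0] by (auto simp: ratio_def)

end

lemma q_orb_tendsto: "(%k. q (orb k 1)) ----> 1"
proof -
 have op: "0 < orb k 1" for k by (simp add: orbp)
 have "(%k. 1 / (1 + (orb k 1 / (orb k 1 + 1)) powr ga)) ----> 1 / (1 + 0)"
  using ga_pos tendsto_divide[OF orb_1_tendsto tendsto_add[OF orb_1_tendsto tendsto_const], of 1]
  by (intro tendsto_intros tendsto_zero_powrI[OF _ tendsto_const] always_eventually allI divide_nonneg_pos add_pos_pos less_imp_le[OF op]) (auto intro: op)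
 thus ?thesis using q_alt[OF op] by simp
qed

lemma decr_ratio: "decr (ratio k)" unfolding decr_def
proof (intro conjI allI impI)
 show "ratio k : borel_measurable mu" unfolding ratio_def[abs_def] by measurable
 show "ratio k y <= ratio k x" if "xs <= x" "x <= y" "y <= 1" for x y
  unfolding ratio_def using that xs_bds tail_pos[of 1 k] by (intro divide_right_mono tail_anti) auto
qed

lemma decr_rlim: "decr rlim" unfolding decr_def
proof (intro conjI allI impI)
 have lim: "(%k. ratio k y) ----> rlim y" if "xs <= y" "y <= 1" for y unfolding rlim_def
  by (rule LIMSEQ_incseq_SUP) (use ratio_bds(2)[OF that] ratio_mono[OF that] in \<open>auto intro!: bdd_aboveI incseq_SucI\<close>)
 show "rlim : borel_measurable mu"
  by (rule borel_measurable_LIMSEQ_real[where u = ratio]) (use lim decr_ratio in \<open>auto simp: decr_def\<close>)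
 show "rlim y <= rlim x" if "xs <= x" "x <= y" "y <= 1" for x y
  by (rule LIMSEQ_le[OF lim lim]) (use that decreasingD[OF decr_ratio] in auto)
qed

text \<open>Dependence of the tail constant on the state, normalised to mean \<open>1\<close>; by
  the law of large numbers its sum over \<open>n\<close> steps of the chain is then close to
  \<open>n\<close>.\<close>

definition rh :: "real => real" where "rh y = rlim y / mean rlim"

lemma mean_ratio_ge_1: "1 <= mean (ratio k)" "1 <= mean rlim" using mean_range[OF decr_ratio, of k] mean_range[OF decr_rlim]
  ratio_bds(1)[of 1 k] rlim_ge_1[of 1] xs_bds by auto

lemma decr_rh: "decr rh" using decr_rlim mean_ratio_ge_1(2) by (auto simp: decr_def rh_def[abs_def] intro!: divide_right_mono)

lemma mean_rh: "mean rh = 1" using mean_ratio_ge_1(2) by (simp add: mean_def rh_def[abs_def])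

lemma rh_bounds: "xs <= y ==> y <= 1 ==> 0 < rh y & rh y <= 1 / q 1"
proof -
 assume y: "xs <= y" "y <= 1"
 have "rlim y / mean rlim <= rlim y / 1" using mean_ratio_ge_1(2) rlim_ge_1[OF y] by (intro divide_left_mono) auto
 thus ?thesis using rlim_le[OF y] rlim_ge_1[OF y] mean_ratio_ge_1(2) by (auto simp: rh_def)
qed

lemma mean_tail_eq: "mean (tail k) = tail k 1 * mean (ratio k)"
proof -
 have "tail k = (%y. tail k 1 * ratio k y)" using tail_pos[of 1 k] by (auto simp: ratio_def)
 thus ?thesis unfolding mean_def by (metis (no_types) integral_mult_right_zero)
qed

lemma mean_rlim_bounds: "mean (ratio k) <= mean rlim" "mean rlim <= mean (ratio k) / q (orb k 1)"
proof -
 note int = decr_integrable[OF decr_ratio, of k] decr_integrable[OF decr_rlim]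
 show "mean (ratio k) <= mean rlim" unfolding mean_def using int rlim_bounds(1) by (intro integral_mono) auto
 have "mean rlim <= (\<integral>y. ratio k y / q (orb k 1) \<partial>mu)"
  unfolding mean_def using int rlim_bounds(2) by (intro integral_mono) auto
 thus "mean rlim <= mean (ratio k) / q (orb k 1)" by (simp add: mean_def)
qed

text \<open>\<open>ratio k y / mean (ratio k)\<close> agrees with \<open>rh y\<close> up to a factor
  between \<open>q (orb k 1)\<close> and its inverse. This factor is free of \<open>y\<close> and
  tends to \<open>1\<close>; the mean tail has known asymptotics.\<close>

lemma tail_asymptotic:
 obtains err :: "nat => real" where "err ----> 0"
  "!!k y. xs <= y ==> y <= 1 ==> |real k powr al * tail k y - tconst * rh y| <= err k"
proof -
 define m where "m = (%k. real k powr al * mean (tail k))"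
 define e where "e = (%k. 1 / q (orb k 1) - 1)"
 have qk: "0 < q (orb k 1)" "q (orb k 1) < 1" for k using q_bds[OF orbp, of 1 k] by auto
 show ?thesis
 proof (rule that[of "%k. |m k - tconst| / q 1 + tconst * (e k / q 1)"])
  have "(%k. |m k - tconst| / q 1 + tconst * (e k / q 1)) ----> |tconst - tconst| / q 1 + tconst * ((1 / 1 - 1) / q 1)"
   unfolding e_def m_def using q_bds[of 1] by (intro tendsto_intros mean_tail_asymptotic q_orb_tendsto) auto
  thus "(%k. |m k - tconst| / q 1 + tconst * (e k / q 1)) ----> 0" by simp
  fix k y assume y: "xs <= y" "y <= 1"
  define r where "r = ratio k y / mean (ratio k)"
  have mr: "1 <= mean (ratio k)" "0 < mean rlim" using mean_ratio_ge_1(1)[of k] mean_ratio_ge_1(2) by auto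
  have r: "0 <= r" "r <= 1 / q 1"
  proof -
   show "0 <= r" using ratio_bds(1)[OF y, of k] mr by (simp add: r_def)
   have "r <= ratio k y / 1" unfolding r_def using ratio_bds(1)[OF y, of k] mr by (intro divide_left_mono) auto
   thus "r <= 1 / q 1" using ratio_bds(2)[OF y, of k] by simp
  qed
  have tl: "real k powr al * tail k y = m k * r" using mr tail_pos[of 1 k] by (simp add: m_def r_def mean_tail_eq ratio_def)
  have "rh y <= (ratio k y / q (orb k 1)) / mean (ratio k)"
   unfolding rh_def using rlim_bounds[OF y, of k] mean_rlim_bounds[of k] mr rlim_ge_1[OF y] by (intro frac_le) auto
  hence up: "rh y <= r / q (orb k 1)" by (simp add: r_def field_simps)
  have "ratio k y / (mean (ratio k) / q (orb k 1)) <= rh y"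
   unfolding rh_def using rlim_bounds[OF y, of k] mean_rlim_bounds[of k] mr ratio_bds[OF y, of k] qk by (intro frac_le) auto
  hence lo: "r * q (orb k 1) <= rh y" by (simp add: r_def field_simps)
  have "1 - q (orb k 1) <= e k"
  proof -
   have "(1 - q (orb k 1)) * 1 <= (1 - q (orb k 1)) * (1 / q (orb k 1))" using qk[of k] by (intro mult_left_mono) auto
   thus ?thesis using qk[of k] by (simp add: e_def field_simps)
  qed
  hence "r * (1 - q (orb k 1)) <= r * e k" using r by (intro mult_left_mono) auto
  hence "|r - rh y| <= r * e k" using up lo by (simp add: abs_le_iff e_def algebra_simps)
  moreover have "r * e k <= 1 / q 1 * e k" using r qk[of k] by (intro mult_right_mono) (auto simp: e_def)
  ultimately have rr: "|r - rh y| <= e k / q 1" by simp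
  have "|m k * r - tconst * rh y| = | (m k - tconst) * r + tconst * (r - rh y) |" by (simp add: algebra_simps)
  also have "... <= |m k - tconst| * r + tconst * |r - rh y|"
   using r tconst_pos by (intro order_trans[OF abs_triangle_ineq]) (simp add: abs_mult)
  also have "... <= |m k - tconst| * (1 / q 1) + tconst * (e k / q 1)"
   using r rr tconst_pos by (intro add_mono mult_left_mono) auto
  finally show "|real k powr al * tail k y - tconst * rh y| <= |m k - tconst| / q 1 + tconst * (e k / q 1)" by (simp add: tl)
 qed
qed

lemma tail_powr_bound:
 obtains C where "0 < C" "!!k y. xs <= y ==> y <= 1 ==> 0 < k ==> tail k y <= C * real k powr (- al)"
proof -
 have "Bseq (%k. real k powr al * mean (tail k))" using mean_tail_asymptotic convergentI convergent_imp_Bseq by blast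
 then obtain K where K: "0 < K" "!!k. |real k powr al * mean (tail k) | <= K" unfolding Bseq_def by auto
 show ?thesis
 proof (rule that[of "K / q 1"])
  show "0 < K / q 1" using K q_bds[of 1] by simp
  fix k y assume y: "xs <= y" "y <= 1" and k: "0 < (k :: nat)"
  have "tail k y <= tail k 1 / q 1" by (rule tail_le_tail_1[OF y(1)])
  also have "... <= mean (tail k) / q 1" using tail_1_le[of k] q_bds[of 1] by (intro divide_right_mono) (auto simp: mean_tail)
  also have "mean (tail k) <= K * real k powr (- al)" using K(2)[of k] k by (simp add: powr_minus field_simps abs_le_iff)
  finally show "tail k y <= K / q 1 * real k powr (- al)" using q_bds[of 1] by (simp add: divide_right_mono)
 qed
qed

end

section \<open>Power sums and the coefficients of $(1-z)^{a-1}$\<close>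

lemma iexp_minus_1_le: "cmod (iexp x - 1) <= |x|" using iexp_approx1[of x 0] by simp

lemma iexp_minus_linear_le: "cmod (iexp x - 1 - \<i> * x) <= x\<^sup>2 / 2"
 using iexp_approx1[of x 1] by (simp add: diff_diff_eq power2_eq_square)

lemma sum_powr_le:
 fixes a :: real
 assumes "0 < a" "a < 1"
 shows "(\<Sum>k=1..<A. real k powr (- a)) <= real A powr (1 - a) / (1 - a)"
proof -
 \<comment> \<open>Only \<open>U\<close> and its increment bounds are wanted, with the exponent
   \<open>a\<close>.\<close>
 interpret th: thaler a by standard (use assms in auto)
 have "(\<Sum>k=1..<A. real k powr (- a)) <= (real A - 1) powr (1 - a) / (1 - a)" if "1 <= A" using that
 proof (induction A rule: dec_induct)
  case (step n)
  have "real n powr (- a) <= real n powr (1 - a) / (1 - a) - (real n - 1) powr (1 - a) / (1 - a)"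
  proof (cases "n = 1")
   case True
   thus ?thesis using assms by (simp add: field_simps)
  next
   case False
   thus ?thesis using th.U_inc_bds(1)[of "real n - 1" "real n"] step by (simp add: th.U_def)
  qed
  thus ?case using step by simp
 qed simp
 moreover have "(real A - 1) powr (1 - a) / (1 - a) <= real A powr (1 - a) / (1 - a)" if "1 <= A"
  using that assms by (intro divide_right_mono powr_mono2) auto
 ultimately show ?thesis using assms by (cases "1 <= A") (auto intro: order_trans)
qed

lemma sum_powr_tail_le:
 fixes a :: real
 assumes "1 < a" "1 <= A"
 shows "(\<Sum>k=A..<N. real k powr (- a)) <= (1 + 1 / (a - 1)) * real A powr (1 - a)"
proof -
 interpret th: thaler a by standard (use assms in auto)
 have *: "(\<Sum>k=Suc A..<N. real k powr (- a)) <= (real A powr (1 - a) - real (N - 1) powr (1 - a)) / (a - 1)"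
  if "Suc A <= N" using that
 proof (induction N rule: dec_induct)
  case (step n)
  have "real n powr (- a) <= th.U (real n) - th.U (real (n - 1))"
   using th.U_inc_bds(1)[of "real (n - 1)" "real n"] step assms by (simp add: of_nat_diff)
  also have "... = (real (n - 1) powr (1 - a) - real n powr (1 - a)) / (a - 1)"
   by (simp add: th.U_def) (metis diff_divide_distrib minus_diff_eq minus_divide_divide)
  finally show ?case using step by (simp add: diff_divide_distrib)
 qed simp
 show ?thesis
 proof (cases "A < N")
  case True
  hence "(\<Sum>k=A..<N. real k powr (- a)) = real A powr (- a) + (\<Sum>k=Suc A..<N. real k powr (- a))"
   by (simp add: sum.atLeast_Suc_lessThan)
  also have "(\<Sum>k=Suc A..<N. real k powr (- a)) <= real A powr (1 - a) / (a - 1)"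
   using assms(1) by (intro order_trans[OF *[OF Suc_leI[OF True]]] divide_right_mono) auto
  also have "real A powr (- a) <= real A powr (1 - a)" using assms by (intro powr_mono) auto
  finally show ?thesis by (simp add: field_simps)
 qed (use assms in auto)
qed

text \<open>Toeplitz averaging: the finitely many large weights contribute a bounded amount, which
  the growing normalisation absorbs.\<close>

lemma weighted_sum_small:
 fixes a :: real and v :: "nat => real"
 assumes a: "0 < a" "a < 1" and v: "v ----> 0"
 shows "(%A. (\<Sum>k=1..<A. v k * real k powr (- a)) / real A powr (1 - a)) ----> 0"
proof (rule LIMSEQ_I)
 fix r :: real assume "0 < r"
 define e where "e = r / 2 * (1 - a)"
 have "0 < e" using `0 < r` a by (simp add: e_def)
 then obtain M0 where M0: "!!k. M0 <= k ==> |v k| < e" using LIMSEQ_D[OF v, of e] by auto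
 define M where "M = max M0 1"
 have M: "1 <= M" "!!k. M <= k ==> |v k| <= e" using M0 by (auto simp: M_def intro: less_imp_le)
 define C where "C = (\<Sum>k=1..<M. |v k| * real k powr (- a))"
 have "(%A. C * (real A powr (- (1 - a)))) ----> C * 0"
  using a by (intro tendsto_intros tendsto_neg_powr filterlim_real_sequentially) auto
 hence "\<forall>\<^sub>F A in sequentially. C * (real A powr (- (1 - a))) < r / 2" using `0 < r` by (intro order_tendstoD) auto
 hence "\<forall>\<^sub>F A in sequentially. norm ((\<Sum>k=1..<A. v k * real k powr (- a)) / real A powr (1 - a) - 0) < r"
  using eventually_gt_at_top[of M]
 proof eventually_elim
  case (elim A)
  have "|\<Sum>k=1..<A. v k * real k powr (- a) | <= (\<Sum>k=1..<A. |v k| * real k powr (- a))"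
   by (rule order_trans[OF sum_abs]) (simp add: abs_mult)
  also have "... = C + (\<Sum>k=M..<A. |v k| * real k powr (- a))"
   unfolding C_def using elim M(1) by (subst sum.atLeastLessThan_concat) auto
  also have "(\<Sum>k=M..<A. |v k| * real k powr (- a)) <= (\<Sum>k=M..<A. e * real k powr (- a))"
   using M(2) by (intro sum_mono mult_right_mono) auto
  also have "... <= (\<Sum>k=1..<A. e * real k powr (- a))" using M(1) `0 < e` by (intro sum_mono2) auto
  also have "... = e * (\<Sum>k=1..<A. real k powr (- a))" by (simp add: sum_distrib_left)
  also have "... <= e * (real A powr (1 - a) / (1 - a))" using `0 < e` by (intro mult_left_mono sum_powr_le a) auto
  also have "... = e / (1 - a) * real A powr (1 - a)" by simp
  also have "e / (1 - a) = r / 2" unfolding e_def using a by (intro nonzero_mult_div_cancel_right) simp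
  finally have "|\<Sum>k=1..<A. v k * real k powr (- a) | <= C + r / 2 * real A powr (1 - a)" by simp
  moreover have "C < r / 2 * real A powr (1 - a)"
  proof -
   have "0 < real A powr (1 - a)" using elim by simp
   moreover have "C / real A powr (1 - a) < r / 2" using elim(1) by (simp only: powr_minus divide_inverse)
   ultimately show ?thesis by (simp only: pos_divide_less_eq)
  qed
  ultimately have "|\<Sum>k=1..<A. v k * real k powr (- a) | < r * real A powr (1 - a)" by simp
  thus ?case using elim by (simp add: field_simps)
 qed
 thus "EX no. ALL A>=no. norm ((\<Sum>k=1..<A. v k * real k powr (- a)) / real A powr (1 - a) - 0) < r"
  unfolding eventually_sequentially .
qed

text \<open>Abel summation. The factors \<open>c\<close> say that from \<open>A\<close> on the
  weights keep their sign and shrink in modulus, whatever the sign is; this covers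
  \<open>btail a\<close>, which is negative from index \<open>1\<close> on when
  \<open>1 < a < 2\<close>.\<close>

lemma abel_bound:
 fixes w :: "nat => real" and z :: complex
 assumes w: "!!k. A <= k ==> EX c:{0..1}. w (Suc k) = c * w k" and z: "norm z <= 1"
 shows "norm ((z - 1) * (\<Sum>k=A..<N. of_real (w k) * z ^ k)) <= 2 * |w A|"
proof (cases "A <= N")
 case True
 have zk: "norm (z ^ k) <= 1" for k using z by (simp add: norm_power power_le_one)
 \<comment> \<open>Carrying the boundary term along turns the bound into
   \<open>2 * |w A| - |w N|\<close>, which is stable under one more step.\<close>
 have "norm ((z - 1) * (\<Sum>k=A..<N. of_real (w k) * z ^ k) - of_real (w N) * z ^ N) <= 2 * |w A| - |w N|" using True
 proof (induction N rule: dec_induct)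
  case base
  thus ?case using mult_left_mono[OF zk[of A], of "|w A|"] by (simp add: norm_mult)
 next
  case (step n)
  obtain c where c: "0 <= c" "c <= 1" "w (Suc n) = c * w n" using w[of n] step by auto
  have "(z - 1) * (\<Sum>k=A..<Suc n. of_real (w k) * z ^ k) - of_real (w (Suc n)) * z ^ Suc n
   = ((z - 1) * (\<Sum>k=A..<n. of_real (w k) * z ^ k) - of_real (w n) * z ^ n) + of_real (w n - w (Suc n)) * z ^ Suc n"
   using step by (simp add: algebra_simps)
  also have "norm ... <= 2 * |w A| - |w n| + |w n - w (Suc n) | * 1"
   using mult_left_mono[OF zk[of "Suc n"], of "|w n - w (Suc n) |"]
   by (intro order_trans[OF norm_triangle_ineq] add_mono step.IH) (simp add: norm_mult del: of_real_diff)
  also have "|w n - w (Suc n) | = |w n| - |w (Suc n) |"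
  proof -
   have "w n - w (Suc n) = (1 - c) * w n" using c by (simp add: algebra_simps)
   hence "|w n - w (Suc n) | = (1 - c) * |w n|" using c by (simp add: abs_mult)
   moreover have "|w (Suc n) | = c * |w n|" using c by (simp add: abs_mult)
   ultimately show ?thesis by (simp add: algebra_simps)
  qed
  finally show ?case by simp
 qed
 moreover have "norm (of_real (w N) * z ^ N) <= |w N|" using mult_left_mono[OF zk[of N], of "|w N|"] by (simp add: norm_mult)
 ultimately show ?thesis
  using norm_triangle_sub[of "(z - 1) * (\<Sum>k=A..<N. of_real (w k) * z ^ k)" "of_real (w N) * z ^ N"] by simp
qed auto

text \<open>Coefficients of $(1-z)^{a-1}$; up to a factor they are the tail of the Sibuya law when
  \<^term>\<open>a < 1\<close>.\<close>

definition btail :: "real => nat => real" where "btail a k = (-1) ^ k * ((a - 1) gchoose k)"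

lemma btail_Suc: "btail a (Suc k) = (1 - a / (real k + 1)) * btail a k"
proof -
 have "(real k + 1) * ((a - 1) gchoose (Suc k)) = ((a - 1) - real k) * ((a - 1) gchoose k)"
  using gbinomial_mult_1[of "a - 1" k] by (simp add: algebra_simps)
 hence "((a - 1) gchoose (Suc k)) = ((a - 1) - real k) / (real k + 1) * ((a - 1) gchoose k)" by (simp add: field_simps)
 moreover have "- (((a - 1) - real k) / (real k + 1)) = 1 - a / (real k + 1)" by (simp add: field_simps)
 ultimately show ?thesis unfolding btail_def by (metis mult.assoc mult.left_commute mult_minus_left power_Suc mult_minus1)
qed

lemma btail_0 [simp]: "btail a 0 = 1" by (simp add: btail_def)

lemma btail_decr: "0 < a ==> a < 2 ==> 1 <= k ==> EX c:{0..1}. btail a (Suc k) = c * btail a k"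
 unfolding btail_Suc by (rule bexI[of _ "1 - a / (real k + 1)"]) (auto simp: field_simps)

lemma btail_asymptotic: "(%k. btail a k * real k powr a) ----> inverse (Gamma (1 - a))"
proof -
 have "(%n. ((a - 1) gchoose n) / ((-1) ^ n / exp ((a - 1 + 1) * of_real (ln (real n)))))
   ----> inverse (Gamma (- (a - 1)))" by (rule gbinomial_asymptotic)
 moreover have "\<forall>\<^sub>F n in sequentially. ((a - 1) gchoose n) / ((-1) ^ n / exp ((a - 1 + 1) * of_real (ln (real n))))
   = btail a n * real n powr a" using eventually_gt_at_top[of 0]
 proof eventually_elim
  case (elim n)
  have "(-1) ^ n * ((-1) ^ n :: real) = 1" by (simp add: power_mult_distrib[symmetric])
  hence "x / ((-1) ^ n / y) = (-1) ^ n * x * (y :: real)" for x y by (cases "even n") auto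
  thus ?case using elim by (simp add: btail_def powr_def)
 qed
 ultimately show ?thesis by (simp add: Lim_transform_eventually)
qed

lemma btail_power_series:
 fixes z :: complex
 assumes "norm z < 1"
 shows "(%k. of_real (btail a k) * z ^ k) sums (1 - z) powr of_real (a - 1)"
proof -
 have og: "of_real ((a - 1) gchoose k) = (of_real (a - 1) gchoose k :: complex)" for k by (simp add: gbinomial_prod_rev)
 have "(%k. (of_real (a - 1) gchoose k) * (- z) ^ k) sums (1 + - z) powr of_real (a - 1)"
  by (rule gen_binomial_complex) (use assms in simp)
 moreover have "(of_real (a - 1) gchoose k) * (- z) ^ k = of_real (btail a k) * z ^ k" for k
  by (simp add: btail_def og[symmetric] power_minus[of z] mult_ac del: of_real_diff)
 ultimately show ?thesis by simp
qed

text \<open>Inside the disc the full series is known, and \<open>abel_bound\<close> controls its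
  remainder after \<open>A\<close> terms. This bound is independent of the modulus and passes to the
  circle along a radius.\<close>

lemma btail_circle:
 fixes z :: complex
 assumes a: "0 < a" "a < 2" and A: "1 <= A" and z: "norm z = 1" "z ~= 1"
 shows "norm ((z - 1) * (\<Sum>k<A. of_real (btail a k) * z ^ k) + (1 - z) powr of_real a) <= 2 * |btail a A|"
proof -
 let ?f = "%w :: complex. norm ((w - 1) * (\<Sum>k<A. of_real (btail a k) * w ^ k) + (1 - w) powr of_real a)"
 have inside: "?f w <= 2 * |btail a A|" if w: "norm w < 1" for w
 proof -
  have w1: "1 - w ~= 0" using w by auto
  have "(%N. (w - 1) * (\<Sum>k<N. of_real (btail a k) * w ^ k)) ----> (w - 1) * (1 - w) powr of_real (a - 1)"
   using btail_power_series[OF w] by (intro tendsto_intros) (simp add: sums_def)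
  also have "(w - 1) * (1 - w) powr of_real (a - 1) = - ((1 - w) powr of_real a)"
   using w1 powr_diff[of "1 - w" "of_real a" 1] by (simp add: field_simps)
  finally have lim: "(%N. norm ((w - 1) * (\<Sum>k<N. of_real (btail a k) * w ^ k)
    - (w - 1) * (\<Sum>k<A. of_real (btail a k) * w ^ k)))
   ----> norm (- ((1 - w) powr of_real a) - (w - 1) * (\<Sum>k<A. of_real (btail a k) * w ^ k))" by (intro tendsto_intros)
  have "norm (- ((1 - w) powr of_real a) - (w - 1) * (\<Sum>k<A. of_real (btail a k) * w ^ k)) <= 2 * |btail a A|"
  proof (rule LIMSEQ_le_const2[OF lim], intro exI[of _ A] allI impI)
   fix N assume "A <= N"
   hence "(\<Sum>k<N. of_real (btail a k) * w ^ k) - (\<Sum>k<A. of_real (btail a k) * w ^ k)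
     = (\<Sum>k=A..<N. of_real (btail a k) * w ^ k)" by (simp add: lessThan_atLeast0 sum_diff_nat_ivl)
   thus "norm ((w - 1) * (\<Sum>k<N. of_real (btail a k) * w ^ k)
    - (w - 1) * (\<Sum>k<A. of_real (btail a k) * w ^ k)) <= 2 * |btail a A|"
    using abel_bound[of A "btail a" w N] btail_decr[OF a] A w by (simp add: right_diff_distrib[symmetric])
  qed
  moreover have "norm (- x - y) = norm (y + x)" for x y :: complex
  proof -
   have "- x - y = - (y + x)" by simp
   thus ?thesis by (simp only: norm_minus_cancel)
  qed
  ultimately show ?thesis by simp
 qed
 \<comment> \<open>The limit point \<open>1 - z\<close> is off the branch cut, so the power is
   continuous there.\<close>
 have Re: "0 < Re (1 - z)"
 proof -
  have "Re z <= 1" using complex_Re_le_cmod[of z] z(1) by simp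
  moreover have "Re z ~= 1"
  proof
   assume "Re z = 1"
   hence "Im z = 0" using z(1) cmod_power2[of z] by simp
   with `Re z = 1` z(2) show False by (simp add: complex_eq_iff)
  qed
  ultimately have "Re z < 1" by simp
  thus ?thesis by simp
 qed
 have "((%r. ?f (of_real r * z)) \<longlongrightarrow> ?f (of_real 1 * z)) (at_left 1)"
  using Re by (intro tendsto_intros) (auto simp: complex_nonpos_Reals_iff)
 moreover have "\<forall>\<^sub>F r in at_left (1::real). ?f (of_real r * z) <= 2 * |btail a A|"
  using eventually_at_left_real[of 0 1]
 proof (rule eventually_mono)
  fix r :: real assume "r : {0<..<1}"
  thus "?f (of_real r * z) <= 2 * |btail a A|" by (intro inside) (simp add: norm_mult z)
 qed simp
 ultimately show ?thesis using tendsto_upperbound[of "%r. ?f (of_real r * z)"] by fastforce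
qed

text \<open>The partial sums are the coefficients for \<open>a - 1\<close>, and these decay when
  \<open>1 < a\<close>.\<close>

lemma btail_partial_sums:
 assumes "1 < a"
 shows "(%N. \<Sum>k<N. btail a k) ----> 0"
proof -
 have eq: "(\<Sum>k<Suc N. btail a k) = btail (a - 1) N" for N
  unfolding btail_def lessThan_Suc_atMost using gbinomial_sum_lower_neg[of "a - 1" N] by (simp add: mult.commute)
 have "(%N. (btail (a - 1) N * real N powr (a - 1)) * real N powr (- (a - 1))) ----> inverse (Gamma (1 - (a - 1))) * 0"
  using assms by (intro tendsto_mult btail_asymptotic tendsto_neg_powr filterlim_real_sequentially) auto
 moreover have "\<forall>\<^sub>F N in sequentially.
   (btail (a - 1) N * real N powr (a - 1)) * real N powr (- (a - 1)) = btail (a - 1) N"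
  using eventually_gt_at_top[of 0] by eventually_elim (simp add: powr_add[symmetric] mult.assoc)
 ultimately have "(%N. btail (a - 1) N) ----> 0" by (simp add: Lim_transform_eventually)
 hence "(%N. \<Sum>k<Suc N. btail a k) ----> 0" by (simp only: eq)
 thus ?thesis by (rule LIMSEQ_imp_Suc)
qed

lemma iexp_ne_1: "0 < |s| ==> |s| < 1 ==> iexp s ~= 1"
proof
 assume s: "0 < |s|" "|s| < 1" and "iexp s = 1"
 hence "|s| <= s\<^sup>2 / 2" using iexp_minus_linear_le[of s] by (simp add: norm_mult)
 also have "s\<^sup>2 = |s| * |s|" by (simp add: power2_eq_square)
 also have "... <= 1 * |s|" using s by (intro mult_right_mono) auto
 also have "1 * |s| / 2 < |s|" using s by simp
 finally show False by simp
qed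

section \<open>Characteristic function of one waiting time\<close>

locale thaler_stable = thaler +
 assumes ga_half: "1 / 2 < ga"
begin

lemma al_bounds: "0 < al" "al < 2" "al ~= 1" "1 < al <-> ga < 1" using ga_pos ga_ne ga_half by (auto simp: field_simps)

text \<open>Conditional mean of the waiting time as a sum of tails. For \<open>ga > 1\<close> this
  sum diverges and nothing is centred, which the value \<open>0\<close> encodes; both cases then
  have the same formulas.\<close>

definition wmean :: "real => real" where "wmean y = (if ga < 1 then \<Sum>k. tail k y else 0)"

definition ell :: real where "ell = (if ga < 1 then c0 * U 2 else 0)"

lemma l_const_eq: "l_const al = ell"
proof (cases "ga < 1")
 case True
 have "1 < 2 powr (1 - ga)" using True by simp
 have "c0 * U 2 = 2 powr (1 - ga) / (2 powr (1 - ga) - 1)" using ga_ne by (simp add: c0_eq[symmetric] U_def)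
 also have "... = 1 / (1 - 2 powr (ga - 1))"
 proof -
  have "2 powr (ga - 1) = 1 / 2 powr (1 - ga)" using powr_minus[of 2 "1 - ga"] by (simp add: field_simps)
  moreover have "x / (x - 1) = 1 / (1 - 1 / x)" if "1 < x" for x :: real using that by (simp add: field_simps)
  ultimately show ?thesis using `1 < 2 powr (1 - ga)` by simp
 qed
 finally show ?thesis using True ga_pos al_bounds by (simp add: l_const_def ell_def)
next
 case False
 thus ?thesis using ga_ne ga_pos by (simp add: l_const_def ell_def field_simps)
qed

lemma summable_tail:
 assumes "ga < 1" "xs <= y" "y <= 1"
 shows "summable (%k. tail k y)"
proof -
 obtain C where C: "!!k y. xs <= y ==> y <= 1 ==> 0 < k ==> tail k y <= C * real k powr (- al)" using tail_powr_bound by metis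
 have "summable (%k. C * real k powr (- al))"
  using assms(1) al_bounds by (intro summable_mult) (simp add: summable_real_powr_iff)
 thus ?thesis
 proof (rule summable_comparison_test_ev[rotated])
  show "\<forall>\<^sub>F k in sequentially. norm (tail k y) <= C * real k powr (- al)" using eventually_gt_at_top[of 0]
   by eventually_elim (use C[OF assms(2,3)] tail_pos[of y] assms xs_bds in \<open>auto simp: abs_of_pos\<close>)
 qed
qed

lemma decr_wmean: "decr wmean" unfolding decr_def
proof (intro conjI allI impI)
 show "wmean : borel_measurable mu" unfolding wmean_def[abs_def] by (cases "ga < 1") (auto intro!: borel_measurable_suminf)
 fix x y assume xy: "xs <= x" "x <= y" "y <= (1 :: real)"
 show "wmean y <= wmean x" using summable_tail[of x] summable_tail[of y] xy xs_bds
  by (auto simp: wmean_def intro!: suminf_le tail_anti)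
qed

text \<open>By \<open>H (ibr w) = U w + U 1\<close> the mean tails telescope along the orbit of
  \<open>1\<close>; for \<open>ga < 1\<close> the remaining term \<open>U (orb n 1)\<close> tends to
  \<open>0\<close>.\<close>

lemma mean_wmean: "mean wmean = ell"
proof (cases "ga < 1")
 case True
 have I: "xs <= y" "y <= 1" if "y : space mu" for y using that by auto
 have sx: "summable (%k. tail k xs)" using summable_tail[OF True, of xs] xs_bds by simp
 have "mean wmean = (\<integral>y. (\<Sum>k. tail k y) \<partial>mu)" using True by (simp add: mean_def wmean_def)
 also have "... = (\<Sum>k. \<integral>y. tail k y \<partial>mu)"
 proof (rule integral_suminf[OF tail_integrable])
  have pos: "0 <= tail k y" if "y : space mu" for k y using tail_pos[of y k] that xs_bds by auto
  show "AE y in mu. summable (%k. norm (tail k y))" using summable_tail[OF True I] pos by (intro AE_I2) simp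
  have le: "(\<integral>y. norm (tail k y) \<partial>mu) <= tail k xs" for k
  proof -
   have "(\<integral>y. norm (tail k y) \<partial>mu) <= (\<integral>y. tail k xs \<partial>mu)"
    by (rule integral_mono) (use pos xs_bds tail_integrable in \<open>auto intro!: tail_anti\<close>)
   thus ?thesis by simp
  qed
  show "summable (%k. \<integral>y. norm (tail k y) \<partial>mu)" by (rule summable_comparison_test[OF _ sx]) (use le in auto)
 qed
 also have "... = (\<Sum>k. c0 * (U (orb k 1 + 1) - U 1))" by (simp add: integral_tail)
 also have "(%k. c0 * (U (orb k 1 + 1) - U 1)) sums (c0 * U 2)"
 proof -
  have "(\<Sum>k<Suc n. U (orb k 1 + 1) - U 1) = U 2 - U (orb n 1)" for n
  proof (induction n)
   case (Suc n)
   have "H (orb (Suc n) 1) = U (orb n 1) + U 1" unfolding orb_Suc by (rule H_ibr) (simp add: orbp)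
   hence "U (orb (Suc n) 1 + 1) - U 1 = U (orb n 1) - U (orb (Suc n) 1)" by (simp add: H_def)
   thus ?case using Suc by simp
  qed simp
  moreover have "(%n. U 2 - U (orb n 1)) ----> U 2 - 0 / (1 - ga)" unfolding U_def using True ga_ne orbp[of 1]
   by (intro tendsto_intros tendsto_zero_powrI[OF orb_1_tendsto tendsto_const] always_eventually) (auto intro: less_imp_le)
  ultimately have "(%n. \<Sum>k<Suc n. U (orb k 1 + 1) - U 1) ----> U 2" by simp
  hence "(%k. U (orb k 1 + 1) - U 1) sums U 2" unfolding sums_def by (rule LIMSEQ_imp_Suc)
  thus ?thesis by (rule sums_mult)
 qed
 hence "(\<Sum>k. c0 * (U (orb k 1 + 1) - U 1)) = ell" using True by (simp add: sums_unique[symmetric] ell_def)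
 finally show ?thesis .
qed (simp add: mean_def wmean_def ell_def)

text \<open>\<open>1 - al\<close> is no pole of Gamma, because \<open>al\<close> lies strictly
  between \<open>0\<close> and \<open>2\<close> and is not \<open>1\<close>; at a pole the value
  would be \<open>0\<close> by convention.\<close>

lemma Gamma_ne: "Gamma (1 - al) ~= 0"
proof -
 have "1 - al \<notin> \<int>\<^sub>\<le>\<^sub>0"
 proof
  assume "1 - al : \<int>\<^sub>\<le>\<^sub>0"
  then obtain n where "1 - al = - of_nat n" by (auto elim!: nonpos_Ints_cases')
  hence "al = of_nat (n + 1)" by simp
  thus False using al_bounds by (cases n) auto
 qed
 thus ?thesis by (simp add: Gamma_eq_zero_iff)
qed

text \<open>Chosen so that \<open>kaa y * btail al k\<close> has the asymptotics of
  \<open>tail k y\<close>: the coefficients behave like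
  \<open>k powr (- al) / Gamma (1 - al)\<close>.\<close>

definition kaa :: "real => real" where "kaa y = tconst * Gamma (1 - al) * rh y"

lemma kaa_bounded: obtains K where "0 < K" "!!y. xs <= y ==> y <= 1 ==> |kaa y| <= K"
proof (rule that[of "|tconst * Gamma (1 - al) | * (1 / q 1)"])
 show "0 < |tconst * Gamma (1 - al) | * (1 / q 1)" using tconst_pos Gamma_ne q_bds[of 1] by auto
 show "|kaa y| <= |tconst * Gamma (1 - al) | * (1 / q 1)" if "xs <= y" "y <= 1" for y
  unfolding kaa_def abs_mult[of _ "rh y"] using rh_bounds[OF that] by (intro mult_left_mono) auto
qed

lemma tail_vs_btail:
 obtains et :: "nat => real" where "et ----> 0"
  "!!k y. xs <= y ==> y <= 1 ==> 1 <= k ==> |tail k y - kaa y * btail al k| <= et k * real k powr (- al)"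
proof -
 obtain err where err: "err ----> 0" "!!k y. xs <= y ==> y <= 1 ==> |real k powr al * tail k y - tconst * rh y| <= err k"
  using tail_asymptotic by metis
 obtain K where K: "0 < K" "!!y. xs <= y ==> y <= 1 ==> |kaa y| <= K" using kaa_bounded by metis
 define d where "d = (%k. |inverse (Gamma (1 - al)) - btail al k * real k powr al| )"
 show ?thesis
 proof (rule that[of "%k. err k + K * d k"])
  have "(%k. err k + K * d k) ----> 0 + K * |inverse (Gamma (1 - al)) - inverse (Gamma (1 - al)) |"
   unfolding d_def by (intro tendsto_intros err btail_asymptotic)
  thus "(%k. err k + K * d k) ----> 0" by simp
  fix k y assume y: "xs <= y" "y <= 1" and k: "1 <= (k :: nat)"
  have kp: "0 < real k powr al" using k by simp
  have "kaa y * inverse (Gamma (1 - al)) = tconst * rh y" using Gamma_ne by (simp add: kaa_def)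
  hence "real k powr al * tail k y - kaa y * btail al k * real k powr al = (real k powr al * tail k y - tconst * rh y)
    + kaa y * (inverse (Gamma (1 - al)) - btail al k * real k powr al)" by (simp add: algebra_simps)
  also have "|... | <= err k + K * d k" unfolding d_def using err(2)[OF y] K(2)[OF y]
   by (intro order_trans[OF abs_triangle_ineq] add_mono) (auto simp: abs_mult intro: mult_right_mono)
  finally have "|tail k y - kaa y * btail al k| * real k powr al <= err k + K * d k"
   using kp by (simp add: abs_mult_pos' algebra_simps abs_mult_pos)
  thus "|tail k y - kaa y * btail al k| <= (err k + K * d k) * real k powr (- al)"
   using kp by (simp add: powr_minus field_simps)
 qed
qed

text \<open>The expansion is read off by comparing the tail with the coefficients of $(1-z)^{\alpha-1}$;
  the sums are cut at the order $1/|s|$.\<close>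

lemma wait_cf_lt_1:
 assumes lt: "1 < ga" and "0 < e"
 obtains d :: real where "0 < d" "d <= 1" "!!(s::real) (y::real). s ~= 0 ==> |s| < d ==> xs <= y ==> y <= 1 ==>
  norm (\<E> (wait y) (%k. iexp (s * real (Suc k))) - 1 + kaa y * (1 - iexp s) powr of_real al) <= e * |s| powr al"
proof -
 have al1: "al < 1" "0 < al" using lt ga_pos by auto
 obtain et where et: "et ----> 0"
  "!!k y. xs <= y ==> y <= 1 ==> 1 <= k ==> |tail k y - kaa y * btail al k| <= et k * real k powr (- al)"
  using tail_vs_btail by metis
 obtain K where K: "0 < K" "!!y. xs <= y ==> y <= 1 ==> |kaa y| <= K" using kaa_bounded by metis
 obtain C where C: "0 < C" "!!k y. xs <= y ==> y <= 1 ==> 0 < k ==> tail k y <= C * real k powr (- al)"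
  using tail_powr_bound by metis
 have "Bseq (%k. btail al k * real k powr al)" using btail_asymptotic convergentI convergent_imp_Bseq by blast
 then obtain CS where CS: "0 < CS" "!!k. |btail al k * real k powr al| <= CS" unfolding Bseq_def by auto
 have CS': "|btail al k| <= CS * real k powr (- al)" if "0 < k" for k
  using CS(2)[of k] that by (simp add: abs_mult powr_minus field_simps)
 define D where "D = 2 * C + 2 * K * CS"
 have D: "0 < D" using C K CS by (auto simp: D_def intro!: add_pos_pos)
 \<comment> \<open>The sums are cut at \<open>A\<close>, about \<open>B / |s|\<close>. This
   \<open>B\<close> makes the two remainders at the cut, each of order
   \<open>(B / |s|) powr (- al)\<close>, use at most half of the tolerance.\<close>
 define B where "B = max 1 ((2 * D / e) powr (1 / al))"
 have B: "1 <= B" "D * B powr (- al) <= e / 2"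
 proof -
  have "((2 * D / e) powr (1 / al)) powr al <= B powr al" using al1 by (intro powr_mono2) (auto simp: B_def)
  hence "2 * D / e <= B powr al" using D `0 < e` al1 by (simp add: powr_powr)
  moreover have "0 < B powr al" by (auto simp: B_def)
  ultimately show "D * B powr (- al) <= e / 2" using `0 < e` by (simp add: powr_minus field_simps)
 qed (simp add: B_def)
 define thh where "thh = (%A. (\<Sum>k=1..<A. et k * real k powr (- al)) / real A powr (1 - al))"
 have "thh ----> 0" unfolding thh_def by (rule weighted_sum_small[OF al1(2,1) et(1)])
 moreover have "0 < e / (4 * (2 * B) powr (1 - al))" using `0 < e` B(1) by simp
 ultimately obtain A0 where A0: "!!A. A0 <= A ==> |thh A| < e / (4 * (2 * B) powr (1 - al))"
  using LIMSEQ_D[of thh 0] by (metis diff_zero real_norm_def)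
 \<comment> \<open>The second bound forces \<open>A >= A0\<close>; the third makes the error from
   the single index \<open>0\<close>, of order \<open>|s|\<close>, negligible against
   \<open>|s| powr al\<close>, which is possible as \<open>al < 1\<close>.\<close>
 define d where "d = min 1 (min (B / (real A0 + 1)) ((e / (4 * (1 + K))) powr (1 / (1 - al))))"
 show ?thesis
 proof (rule that[of d])
  show "0 < d" using B K `0 < e` by (auto simp: d_def intro!: divide_pos_pos add_nonneg_pos)
  show "d <= 1" by (simp add: d_def)
  fix s y :: real assume s: "s ~= 0" "|s| < d" and y: "xs <= y" "y <= 1"
  have s1: "0 < |s|" "|s| < 1" "|s| < B / (real A0 + 1)" "|s| < (e / (4 * (1 + K))) powr (1 / (1 - al))"
   using s by (auto simp: d_def)
  define z where "z = iexp s"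
  have "z ~= 1" unfolding z_def using s1 by (intro iexp_ne_1) auto
  have nz: "norm z = 1" by (simp add: z_def)
  have zk: "iexp (s * k) = z ^ k" for k :: nat by (simp add: z_def exp_of_nat_mult[symmetric] mult_ac)
  define A where "A = nat \<lceil>B / |s|\<rceil>"
  have "0 < B / |s|" using B s1 by simp
  hence A: "B / |s| <= real A" "real A <= B / |s| + 1" unfolding A_def by linarith+
  have A1: "1 <= A" using A `0 < B / |s| ` by (simp add: A_def) linarith
  have "1 <= B / |s|" using B(1) s1 by (simp add: field_simps)
  with A have A2: "real A <= 2 * B / |s|" by simp
  have "real A0 + 1 < B / |s|" using s1 by (simp add: field_simps)
  with A have AA0: "A0 <= A" by linarith
  define Us where "Us = (%k. tail k y - kaa y * btail al k)"
  let ?E = "\<E> (wait y) (%k. z ^ Suc k)"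
  have E: "norm (?E - (1 + (\<Sum>k<A. tail k y *\<^sub>R (z ^ Suc k - z ^ k)))) <= 2 * 1 * tail A y"
   using wait_expectation_approx[OF y(1), of "%k. z ^ k" 1 A] nz by (simp add: norm_power)
  have circ: "norm ((z - 1) * (\<Sum>k<A. of_real (btail al k) * z ^ k) + (1 - z) powr of_real al) <= 2 * |btail al A|"
   by (rule btail_circle) (use al_bounds A1 nz `z ~= 1` in auto)
  \<comment> \<open>Three errors: cutting the expectation, cutting the comparison series, and the
    difference of tail and coefficients before the cut.\<close>
  have split: "?E - 1 + kaa y * (1 - z) powr of_real al = (?E - (1 + (\<Sum>k<A. tail k y *\<^sub>R (z ^ Suc k - z ^ k))))
    + kaa y * ((z - 1) * (\<Sum>k<A. of_real (btail al k) * z ^ k) + (1 - z) powr of_real al)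
    + (z - 1) * (\<Sum>k<A. of_real (Us k) * z ^ k)"
  proof -
   have e1: "(\<Sum>k<A. tail k y *\<^sub>R (z ^ Suc k - z ^ k)) = (z - 1) * (\<Sum>k<A. of_real (tail k y) * z ^ k)"
    by (simp add: sum_distrib_left scaleR_conv_of_real algebra_simps)
   have e2: "(\<Sum>k<A. of_real (Us k) * z ^ k)
     = (\<Sum>k<A. of_real (tail k y) * z ^ k) - kaa y * (\<Sum>k<A. of_real (btail al k) * z ^ k)"
    by (simp add: Us_def sum_distrib_left sum_subtractf[symmetric] algebra_simps)
   show ?thesis unfolding e1 e2 by (simp add: algebra_simps)
  qed
  have Apow: "real A powr (- al) <= B powr (- al) * |s| powr al"
  proof -
   have "real A powr (- al) <= (B / |s| ) powr (- al)" using A `0 < B / |s| ` al1 by (intro powr_mono2') auto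
   also have "... = B powr (- al) * |s| powr al" using B s1 by (simp add: powr_divide powr_minus field_simps)
   finally show ?thesis .
  qed
  have part1: "2 * tail A y + |kaa y| * (2 * |btail al A| ) <= e / 2 * |s| powr al"
  proof -
   have "2 * tail A y + |kaa y| * (2 * |btail al A| ) <= 2 * (C * real A powr (- al)) + K * (2 * (CS * real A powr (- al)))"
    using C(2)[OF y, of A] K(2)[OF y] CS'[of A] A1 K(1) tail_pos[of y A] y xs_bds by (intro add_mono mult_mono) auto
   also have "... = D * real A powr (- al)" by (simp add: D_def algebra_simps)
   also have "... <= D * (B powr (- al) * |s| powr al)" using D Apow by (intro mult_left_mono) auto
   also have "... <= e / 2 * |s| powr al" unfolding mult.assoc[symmetric] by (rule mult_right_mono[OF B(2)]) simp
   finally show ?thesis .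
  qed
  have "norm (\<Sum>k<A. of_real (Us k) * z ^ k) <= (\<Sum>k<A. |Us k| )"
   using nz by (intro order_trans[OF norm_sum]) (simp add: norm_mult norm_power)
  also have "(\<Sum>k<A. |Us k| ) = |Us 0| + (\<Sum>k=1..<A. |Us k| )"
   using A1 by (simp add: lessThan_atLeast0 sum.atLeast_Suc_lessThan)
  also have "... <= (1 + K) + (\<Sum>k=1..<A. et k * real k powr (- al))"
   using K(2)[OF y] et(2)[OF y] by (intro add_mono sum_mono) (auto simp: Us_def)
  also have "(\<Sum>k=1..<A. et k * real k powr (- al)) = thh A * real A powr (1 - al)" using A1 by (simp add: thh_def)
  also have "... <= e / (4 * (2 * B) powr (1 - al)) * (2 * B / |s| ) powr (1 - al)"
   using A0[OF AA0] A2 al1 `0 < e` by (intro mult_mono powr_mono2) auto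
  also have "... = e / 4 * |s| powr (al - 1)" using B s1 powr_minus[of "|s|" "1 - al"] by (simp add: powr_divide field_simps)
  finally have sumU: "norm (\<Sum>k<A. of_real (Us k) * z ^ k) <= (1 + K) + e / 4 * |s| powr (al - 1)" by simp
  have "norm ((z - 1) * (\<Sum>k<A. of_real (Us k) * z ^ k)) <= |s| * ((1 + K) + e / 4 * |s| powr (al - 1))"
   unfolding norm_mult using iexp_minus_1_le[of s] sumU by (intro mult_mono) (auto simp: z_def)
  also have "... = |s| * (1 + K) + e / 4 * |s| powr al" using s1 by (simp add: distrib_left powr_diff)
  also have "|s| * (1 + K) <= e / 4 * |s| powr al"
  proof -
   have "|s| powr (1 - al) <= ((e / (4 * (1 + K))) powr (1 / (1 - al))) powr (1 - al)" using s1 al1 by (intro powr_mono2) auto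
   also have "... = e / (4 * (1 + K))" using al1 K `0 < e` by (simp add: powr_powr)
   finally have "|s| powr (1 - al) * (1 + K) <= e / 4" using K by (simp add: field_simps)
   hence "|s| powr al * ( |s| powr (1 - al) * (1 + K)) <= |s| powr al * (e / 4)" by (intro mult_left_mono) auto
   moreover have "|s| powr al * |s| powr (1 - al) = |s|" using s1 by (simp add: powr_add[symmetric])
   ultimately have "|s| * (1 + K) <= |s| powr al * (e / 4)" by (simp only: mult.assoc[symmetric])
   thus ?thesis by (simp only: mult.commute)
  qed
  finally have part2: "norm ((z - 1) * (\<Sum>k<A. of_real (Us k) * z ^ k)) <= e / 2 * |s| powr al" by simp
  have "norm (?E - 1 + kaa y * (1 - z) powr of_real al) <= 2 * tail A y + |kaa y| * (2 * |btail al A| ) + e / 2 * |s| powr al"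
   unfolding split
  proof (intro order_trans[OF norm_triangle_ineq] add_mono part2)
   show "norm (?E - (1 + (\<Sum>k<A. tail k y *\<^sub>R (z ^ Suc k - z ^ k)))) <= 2 * tail A y" using E by simp
   show "norm (kaa y * ((z - 1) * (\<Sum>k<A. of_real (btail al k) * z ^ k) + (1 - z) powr of_real al))
     <= |kaa y| * (2 * |btail al A| )" unfolding norm_mult norm_of_real by (intro mult_left_mono circ) auto
  qed
  with part1 have "norm (?E - 1 + kaa y * (1 - z) powr of_real al) <= e * |s| powr al" by simp
  thus "norm (\<E> (wait y) (%k. iexp (s * real (Suc k))) - 1 + kaa y * (1 - iexp s) powr of_real al) <= e * |s| powr al"
   by (simp only: zk z_def[symmetric])
 qed
qed

text \<open>The expansion goes one order further. Summing against \<open>z ^ k - 1\<close> splits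
  off the linear term: the tails sum to \<open>wmean y\<close>, the comparison coefficients to
  \<open>0\<close>. The factor \<open>z ^ k - 1\<close> is at most \<open>k * |s|\<close> before the
  cut \<open>1 / |s|\<close> and at most \<open>2\<close> after it.\<close>

lemma wait_cf_gt_1:
 assumes lt: "ga < 1" and "0 < e"
 obtains d :: real where "0 < d" "d <= 1" "!!(s::real) (y::real). s ~= 0 ==> |s| < d ==> xs <= y ==> y <= 1 ==>
  norm (\<E> (wait y) (%k. iexp (s * real (Suc k))) - 1 - (iexp s - 1) * wmean y
   + kaa y * (1 - iexp s) powr of_real al) <= e * |s| powr al"
proof -
 have al1: "1 < al" "al < 2" using lt al_bounds by auto
 obtain et where et: "et ----> 0"
  "!!k y. xs <= y ==> y <= 1 ==> 1 <= k ==> |tail k y - kaa y * btail al k| <= et k * real k powr (- al)"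
  using tail_vs_btail by metis
 define Ca where "Ca = 1 + 1 / (al - 1)"
 have Ca: "0 < Ca" using al1 by (auto simp: Ca_def intro!: add_pos_pos)
 define thh where "thh = (%A. (\<Sum>k=1..<A. et k * real k powr (- (al - 1))) / real A powr (1 - (al - 1)))"
 have "thh ----> 0" unfolding thh_def using al1 by (intro weighted_sum_small et(1)) auto
 moreover have "0 < e / (2 * 2 powr (2 - al))" using `0 < e` by simp
 ultimately obtain A0 where A0: "!!A. A0 <= A ==> |thh A| < e / (2 * 2 powr (2 - al))"
  using LIMSEQ_D[of thh 0] by (metis diff_zero real_norm_def)
 have "0 < e / (4 * Ca)" using `0 < e` Ca by simp
 then obtain A1 where A1: "!!k. A1 <= k ==> |et k| < e / (4 * Ca)" using LIMSEQ_D[OF et(1)] by (metis diff_zero real_norm_def)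
 define d where "d = 1 / (real A0 + real A1 + 1)"
 show ?thesis
 proof (rule that[of d])
  show "0 < d" "d <= 1" by (auto simp: d_def)
  fix s y :: real assume s: "s ~= 0" "|s| < d" and y: "xs <= y" "y <= 1"
  have s1: "0 < |s|" "|s| < 1" using s `d <= 1` by auto
  define z where "z = iexp s"
  have "z ~= 1" unfolding z_def using s1 by (intro iexp_ne_1) auto
  have nz: "norm z = 1" by (simp add: z_def)
  have zk: "iexp (s * k) = z ^ k" for k :: nat by (simp add: z_def exp_of_nat_mult[symmetric] mult_ac)
  define A where "A = nat \<lceil>1 / |s|\<rceil>"
  have "1 <= 1 / |s|" using s1 by simp
  hence A: "1 / |s| <= real A" "real A <= 1 / |s| + 1" unfolding A_def by linarith+
  have Age: "1 <= A" using A `1 <= 1 / |s| ` by linarith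
  have A2: "real A <= 2 / |s|" using A `1 <= 1 / |s| ` by simp
  have "real A0 + real A1 + 1 < 1 / |s|" using s s1 unfolding d_def by (simp add: field_simps)
  with A have AA: "A0 <= A" "A1 <= A" by linarith+
  define Us where "Us = (%k. tail k y - kaa y * btail al k)"
  let ?E = "\<E> (wait y) (%k. z ^ Suc k)"
  \<comment> \<open>Uniform in \<open>N >= A\<close>, so that it passes to the limit of the series
    without a further remainder.\<close>
  have bound: "norm ((z - 1) * (\<Sum>k<N. of_real (Us k) * (z ^ k - 1))) <= e * |s| powr al" if N: "A <= N" for N
  proof -
   have zk1: "norm (z ^ k - 1) <= real k * |s|" "norm (z ^ k - 1) <= 2" for k
    using iexp_minus_1_le[of "s * k"] norm_triangle_ineq4[of "z ^ k" 1] nz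
    by (auto simp: zk[symmetric] abs_mult mult.commute norm_power)
   have "norm (\<Sum>k<N. of_real (Us k) * (z ^ k - 1)) <= (\<Sum>k<N. |Us k| * norm (z ^ k - 1))"
    by (intro order_trans[OF norm_sum]) (simp add: norm_mult)
   also have "... = (\<Sum>k=1..<A. |Us k| * norm (z ^ k - 1)) + (\<Sum>k=A..<N. |Us k| * norm (z ^ k - 1))"
    using N Age by (simp add: sum.atLeastLessThan_concat lessThan_atLeast0 sum.atLeast_Suc_lessThan)
   also have "(\<Sum>k=1..<A. |Us k| * norm (z ^ k - 1)) <= (\<Sum>k=1..<A. |s| * (et k * real k powr (- (al - 1))))"
   proof (rule sum_mono)
    fix k assume k: "k : {1..<A}"
    have "|Us k| * norm (z ^ k - 1) <= (et k * real k powr (- al)) * (real k * |s| )"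
     using et(2)[OF y, of k] k zk1(1)[of k] by (intro mult_mono) (auto simp: Us_def intro: order_trans[OF abs_ge_zero])
    also have "real k powr (- (al - 1)) = real k powr (- al) * real k"
     using k powr_add[of "real k" "- al" 1] by (simp add: algebra_simps)
    hence "(et k * real k powr (- al)) * (real k * |s| ) = |s| * (et k * real k powr (- (al - 1)))" by simp
    finally show "|Us k| * norm (z ^ k - 1) <= |s| * (et k * real k powr (- (al - 1)))" .
   qed
   also have "... = |s| * (thh A * real A powr (2 - al))" using Age by (simp add: thh_def sum_distrib_left)
   also have "... <= |s| * (e / (2 * 2 powr (2 - al)) * (2 / |s| ) powr (2 - al))"
    using A0[OF AA(1)] A2 al1 `0 < e` by (intro mult_left_mono mult_mono powr_mono2) auto
   also have "... = e / 2 * |s| powr (al - 1)"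
   proof -
    have "|s| powr (al - 1) = |s| / |s| powr (2 - al)" using s1 powr_diff[of "|s|" 1 "2 - al"] by simp
    thus ?thesis by (simp add: powr_divide)
   qed
   also have "(\<Sum>k=A..<N. |Us k| * norm (z ^ k - 1)) <= (\<Sum>k=A..<N. e / (2 * Ca) * real k powr (- al))"
   proof (rule sum_mono)
    fix k assume k: "k : {A..<N}"
    have "|Us k| <= et k * real k powr (- al)" using et(2)[OF y, of k] k Age by (simp add: Us_def)
    also have "... <= e / (4 * Ca) * real k powr (- al)" using A1[of k] k AA by (intro mult_right_mono) auto
    finally have "|Us k| * norm (z ^ k - 1) <= (e / (4 * Ca) * real k powr (- al)) * 2"
     using zk1(2)[of k] `0 < e` Ca by (intro mult_mono) auto
    thus "|Us k| * norm (z ^ k - 1) <= e / (2 * Ca) * real k powr (- al)" by simp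
   qed
   also have "... = e / (2 * Ca) * (\<Sum>k=A..<N. real k powr (- al))" by (simp add: sum_distrib_left)
   also have "... <= e / (2 * Ca) * (Ca * real A powr (1 - al))"
    unfolding Ca_def[symmetric] using sum_powr_tail_le[OF al1(1) Age, of N] `0 < e` Ca
    by (intro mult_left_mono) (auto simp: Ca_def)
   also have "... = e / 2 * real A powr (1 - al)" using Ca by simp
   also have "... <= e / 2 * |s| powr (al - 1)"
   proof -
    have "real A powr (1 - al) <= (1 / |s| ) powr (1 - al)" using A s1 al1 by (intro powr_mono2') auto
    also have "... = |s| powr (al - 1)" using s1 powr_minus[of "|s|" "1 - al"] by (simp add: powr_divide field_simps)
    finally show ?thesis using `0 < e` by (intro mult_left_mono) auto
   qed
   finally have "norm (\<Sum>k<N. of_real (Us k) * (z ^ k - 1)) <= e * |s| powr (al - 1)" by simp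
   hence "norm ((z - 1) * (\<Sum>k<N. of_real (Us k) * (z ^ k - 1))) <= |s| * (e * |s| powr (al - 1))"
    unfolding norm_mult using iexp_minus_1_le[of s] by (intro mult_mono) (auto simp: z_def)
   thus ?thesis using s1 by (simp add: powr_diff)
  qed
  have lim: "(%N. (z - 1) * (\<Sum>k<N. of_real (Us k) * (z ^ k - 1)))
    ----> (?E - 1) - kaa y * (- ((1 - z) powr of_real al)) - (z - 1) * (of_real (wmean y) - kaa y * of_real 0)"
  proof -
   have "(%N. (1 + (\<Sum>k<N. tail k y *\<^sub>R (z ^ Suc k - z ^ k))) - 1) ----> ?E - 1"
    using wait_exp_lim[OF y(1), of "%k. z ^ k" 1] nz by (intro tendsto_diff tendsto_const) (simp add: norm_power)
   hence l1: "(%N. (z - 1) * (\<Sum>k<N. of_real (tail k y) * z ^ k)) ----> ?E - 1"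
    by (simp add: sum_distrib_left scaleR_conv_of_real algebra_simps)
   have l2: "(%N. (z - 1) * (\<Sum>k<N. of_real (btail al k) * z ^ k)) ----> - ((1 - z) powr of_real al)"
   proof (rule Lim_transform2[OF tendsto_const])
    have "(%k. |btail al k * real k powr al| * real k powr (- al)) ----> |inverse (Gamma (1 - al)) | * 0"
     using al_bounds by (intro tendsto_intros btail_asymptotic tendsto_neg_powr filterlim_real_sequentially) auto
    moreover have "\<forall>\<^sub>F k in sequentially. |btail al k * real k powr al| * real k powr (- al) = |btail al k|"
     using eventually_gt_at_top[of 0] by eventually_elim (simp add: abs_mult powr_minus)
    ultimately have "(%k. |btail al k| ) ----> 0" by (simp add: Lim_transform_eventually)
    hence b0: "(%k. 2 * |btail al k| ) ----> 0" using tendsto_mult_right_zero by blast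
    show "(%N. - ((1 - z) powr of_real al) - (z - 1) * (\<Sum>k<N. of_real (btail al k) * z ^ k)) ----> 0"
    proof (rule Lim_null_comparison[OF _ b0])
     show "\<forall>\<^sub>F N in sequentially. norm (- ((1 - z) powr of_real al) - (z - 1) * (\<Sum>k<N. of_real (btail al k) * z ^ k))
     <= 2 * |btail al N|" using eventually_ge_at_top[of 1]
     proof eventually_elim
     case (elim N)
     have "- a - b = - (b + a)" for a b :: complex by simp
     thus ?case using btail_circle[OF _ _ elim nz `z ~= 1`, of al] al_bounds by (simp only: norm_minus_cancel)
     qed
    qed
   qed
   have l3: "(%N. \<Sum>k<N. tail k y) ----> wmean y"
    using summable_sums[OF summable_tail[OF lt y]] lt by (simp add: sums_def wmean_def)
   have "(%N. (z - 1) * (\<Sum>k<N. of_real (tail k y) * z ^ k) - kaa y * ((z - 1) * (\<Sum>k<N. of_real (btail al k) * z ^ k))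
     - (z - 1) * (of_real (\<Sum>k<N. tail k y) - kaa y * of_real (\<Sum>k<N. btail al k)))
    ----> (?E - 1) - kaa y * (- ((1 - z) powr of_real al)) - (z - 1) * (of_real (wmean y) - kaa y * of_real 0)"
    by (intro tendsto_diff tendsto_mult tendsto_const l1 l2 tendsto_of_real l3 btail_partial_sums al1)
   moreover have "(z - 1) * (\<Sum>k<N. of_real (tail k y) * z ^ k)
     - kaa y * ((z - 1) * (\<Sum>k<N. of_real (btail al k) * z ^ k))
     - (z - 1) * (of_real (\<Sum>k<N. tail k y) - kaa y * of_real (\<Sum>k<N. btail al k))
     = (z - 1) * (\<Sum>k<N. of_real (Us k) * (z ^ k - 1))" for N
   proof -
    have e: "(\<Sum>k<N. of_real (Us k) * (z ^ k - 1))
     = (\<Sum>k<N. of_real (tail k y) * z ^ k) - kaa y * (\<Sum>k<N. of_real (btail al k) * z ^ k)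
     - (of_real (\<Sum>k<N. tail k y) - kaa y * of_real (\<Sum>k<N. btail al k))"
     by (simp add: Us_def of_real_sum sum_distrib_left sum_subtractf[symmetric] sum.distrib[symmetric] algebra_simps)
    show ?thesis unfolding e by (simp add: algebra_simps)
   qed
   ultimately show ?thesis by simp
  qed
  have "norm ((?E - 1) - kaa y * (- ((1 - z) powr of_real al)) - (z - 1) * (of_real (wmean y) - kaa y * of_real 0))
    <= e * |s| powr al" by (rule LIMSEQ_le_const2[OF tendsto_norm[OF lim]]) (use bound in blast)
  hence "norm (?E - 1 - (z - 1) * wmean y + kaa y * (1 - z) powr of_real al) <= e * |s| powr al" by (simp add: algebra_simps)
  thus "norm (\<E> (wait y) (%k. iexp (s * real (Suc k))) - 1 - (iexp s - 1) * wmean y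
   + kaa y * (1 - iexp s) powr of_real al) <= e * |s| powr al" by (simp only: zk z_def[symmetric])
 qed
qed

end

text \<open>The bound is asked for on the support only, as for quotients by products that are under
  control only for lists of the right length.\<close>

lemma expectation_bind_pmf_set:
 fixes f :: "'b => complex"
 assumes B: "!!x. x : set_pmf (bind_pmf p g) ==> norm (f x) <= B"
 shows "\<E> (bind_pmf p g) f = \<E> p (%x. \<E> (g x) f)"
proof -
 let ?S = "set_pmf (bind_pmf p g)"
 define f' where "f' = (%x. if x : ?S then f x else 0)"
 have "0 <= B" using B set_pmf_not_empty[of "bind_pmf p g"] norm_ge_zero order_trans by (metis ex_in_conv)
 hence "\<E> (bind_pmf p g) f' = \<E> p (%x. \<E> (g x) f')"
  by (intro expectation_bind_pmf[where B = B]) (use B in \<open>auto simp: f'_def\<close>)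
 moreover have "\<E> (bind_pmf p g) f' = \<E> (bind_pmf p g) f"
  by (intro integral_cong_AE) (auto simp: AE_measure_pmf_iff f'_def simp del: set_bind_pmf)
 moreover have "\<E> p (%x. \<E> (g x) f') = \<E> p (%x. \<E> (g x) f)"
 proof (intro integral_cong_AE)
  show "AE x in measure_pmf p. \<E> (g x) f' = \<E> (g x) f" unfolding AE_measure_pmf_iff
  proof
   fix x assume x: "x : set_pmf p"
   show "\<E> (g x) f' = \<E> (g x) f"
    by (intro integral_cong_AE) (use x in \<open>auto simp: AE_measure_pmf_iff f'_def\<close>)
  qed
 qed auto
 ultimately show ?thesis by simp
qed

section \<open>Truncated moments\<close>

context thaler_stable
begin

lemma truncated_mean_eq: "xs <= y ==> (\<Sum>k<m. mass k y * real (Suc k)) = (\<Sum>k<m. tail k y) - tail m y * real m"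
 using wait_sum[where g=real and n=m and y=y] by simp

lemma truncated_square_eq:
 "(\<Sum>k<m. mass k y * (real (Suc k))\<^sup>2) = (\<Sum>k<m. tail k y * (2 * real k + 1)) - tail m y * (real m)\<^sup>2"
 using wait_sum[where g="%k. (real k)\<^sup>2" and n=m and y=y] by (simp add: power2_eq_square algebra_simps)

text \<open>Summation by parts turns truncated moments into sums of tails, which the tail bound and
  the power sums control. The first moment is compared with \<open>0\<close> when the mean is
  infinite and with the mean otherwise.\<close>

lemma truncated_moments:
 obtains C where "0 < C" "!!m y. xs <= y ==> y <= 1 ==> 1 <= m ==> tail m y <= C * real m powr (- al)"
  "!!m y. xs <= y ==> y <= 1 ==> 1 <= m ==> | (\<Sum>k<m. mass k y * real (Suc k)) - wmean y| <= C * real m powr (1 - al)"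
  "!!m y. xs <= y ==> y <= 1 ==> 1 <= m ==> (\<Sum>k<m. mass k y * (real (Suc k))\<^sup>2) <= C * real m powr (2 - al)"
proof -
 obtain C where C: "0 < C" "!!k y. xs <= y ==> y <= 1 ==> 0 < k ==> tail k y <= C * real k powr (- al)"
  using tail_powr_bound by metis
 have tp: "0 <= tail k y" if "xs <= y" for k y using tail_pos[of y k] that xs_bds by simp
 have head: "(\<Sum>k<m. f k) = f 0 + (\<Sum>k=1..<m. f k)" if "1 <= m" for m and f :: "nat => real"
  using that by (simp add: lessThan_atLeast0 sum.atLeast_Suc_lessThan)
 have "EX C1>0. ALL m y. xs <= y --> y <= 1 --> 1 <= m -->
   | (\<Sum>k<m. mass k y * real (Suc k)) - wmean y| <= C1 * real m powr (1 - al)"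
 proof (cases "ga < 1")
  case False
  hence al1: "0 < al" "al < 1" using ga_ne ga_pos by auto
  show ?thesis
  proof (intro exI[of _ "1 + C / (1 - al)"] conjI allI impI)
   show "0 < 1 + C / (1 - al)" using C al1 by (intro add_pos_pos divide_pos_pos) auto
   fix m :: nat and y assume y: "xs <= y" "y <= 1" and m: "1 <= m"
   have "0 <= (\<Sum>k<m. mass k y * real (Suc k))" using y xs_bds by (intro sum_nonneg mult_nonneg_nonneg mass_ge0) auto
   moreover have "(\<Sum>k<m. mass k y * real (Suc k)) <= (\<Sum>k<m. tail k y)"
    using truncated_mean_eq[OF y(1)] tp[OF y(1)] by simp
   moreover have "(\<Sum>k<m. tail k y) <= 1 + (\<Sum>k=1..<m. C * real k powr (- al))"
    unfolding head[OF m] using C(2)[OF y] by (intro add_mono sum_mono) auto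
   moreover have "(\<Sum>k=1..<m. C * real k powr (- al)) <= C * (real m powr (1 - al) / (1 - al))"
    unfolding sum_distrib_left[symmetric] using C(1) by (intro mult_left_mono sum_powr_le al1) auto
   moreover have "1 <= real m powr (1 - al)" using m al1 by (intro ge_one_powr_ge_zero) auto
   ultimately have "|\<Sum>k<m. mass k y * real (Suc k) | <= real m powr (1 - al) + C * (real m powr (1 - al) / (1 - al))"
    by linarith
   thus "| (\<Sum>k<m. mass k y * real (Suc k)) - wmean y| <= (1 + C / (1 - al)) * real m powr (1 - al)"
    using False by (simp add: wmean_def algebra_simps)
  qed
 next
  case True
  hence al1: "1 < al" using al_bounds by simp
  define Ca where "Ca = 1 + 1 / (al - 1)"
  have Ca: "0 < Ca" unfolding Ca_def using al1 by (intro add_pos_pos divide_pos_pos) auto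
  show ?thesis
  proof (intro exI[of _ "C * Ca + C"] conjI allI impI)
   show "0 < C * Ca + C" using C Ca by (intro add_pos_pos mult_pos_pos) auto
   fix m :: nat and y assume y: "xs <= y" "y <= 1" and m: "1 <= m"
   note sm = summable_tail[OF True y]
   have wm: "wmean y = (\<Sum>k. tail k y)" using True by (simp add: wmean_def)
   have ge: "(\<Sum>k<m. tail k y) <= wmean y" unfolding wm using tp[OF y(1)] by (intro sum_le_suminf sm) auto
   have "wmean y <= (\<Sum>k<m. tail k y) + C * (Ca * real m powr (1 - al))" unfolding wm
   proof (rule suminf_le_const[OF sm])
    fix N
    show "(\<Sum>k<N. tail k y) <= (\<Sum>k<m. tail k y) + C * (Ca * real m powr (1 - al))"
    proof (cases "m <= N")
     case True
     have "(\<Sum>k<N. tail k y) = (\<Sum>k<m. tail k y) + (\<Sum>k=m..<N. tail k y)"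
     using True by (simp add: lessThan_atLeast0 sum.atLeastLessThan_concat)
     also have "(\<Sum>k=m..<N. tail k y) <= (\<Sum>k=m..<N. C * real k powr (- al))"
     using C(2)[OF y] m by (intro sum_mono) auto
     also have "... <= C * (Ca * real m powr (1 - al))" unfolding sum_distrib_left[symmetric] Ca_def
     using C(1) m by (intro mult_left_mono sum_powr_tail_le al1) auto
     finally show ?thesis by simp
    next
     case False
     hence "(\<Sum>k<N. tail k y) <= (\<Sum>k<m. tail k y)" using tp[OF y(1)] by (intro sum_mono2) auto
     moreover have "0 <= C * (Ca * real m powr (1 - al))" using C Ca by simp
     ultimately show ?thesis by linarith
    qed
   qed
   moreover have "tail m y * real m <= C * real m powr (1 - al)"
   proof -
    have "tail m y * real m <= (C * real m powr (- al)) * real m" using C(2)[OF y, of m] m by (intro mult_right_mono) auto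
    also have "... = C * real m powr (1 - al)" using m powr_add[of "real m" "- al" 1] by simp
    finally show ?thesis .
   qed
   moreover have "0 <= tail m y * real m" using tp[OF y(1)] by simp
   ultimately show "| (\<Sum>k<m. mass k y * real (Suc k)) - wmean y| <= (C * Ca + C) * real m powr (1 - al)"
    unfolding truncated_mean_eq[OF y(1)] using ge by (simp add: algebra_simps abs_le_iff)
  qed
 qed
 then obtain C1 where C1: "0 < C1" "!!m y. xs <= y ==> y <= 1 ==> 1 <= m ==>
   | (\<Sum>k<m. mass k y * real (Suc k)) - wmean y| <= C1 * real m powr (1 - al)" by blast
 have "EX C3>0. ALL m>=1. (\<Sum>k=1..<m. real k powr (1 - al)) <= C3 * real m powr (2 - al)"
 proof (cases "ga < 1")
  case True
  hence a: "0 < al - 1" "al - 1 < 1" using al_bounds by auto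
  show ?thesis using sum_powr_le[OF a] a by (intro exI[of _ "1 / (2 - al)"]) (auto simp: algebra_simps)
 next
  case False
  hence al1: "0 < al" "al < 1" using ga_ne ga_pos by auto
  have "(\<Sum>k=1..<m. real k powr (1 - al)) <= 1 * real m powr (2 - al)" if "1 <= m" for m :: nat
  proof -
   have "(\<Sum>k=1..<m. real k powr (1 - al)) <= (\<Sum>k=1..<m. real m powr (1 - al))"
    using al1 by (intro sum_mono powr_mono2) auto
   also have "... = real (m - 1) * real m powr (1 - al)" by simp
   also have "... <= real m * real m powr (1 - al)" by (intro mult_right_mono) auto
   also have "... = real m powr (2 - al)" using that powr_add[of "real m" 1 "1 - al"] by simp
   finally show ?thesis by simp
  qed
  thus ?thesis by (intro exI[of _ 1]) auto
 qed
 then obtain C3 where C3: "0 < C3" "!!m. 1 <= m ==> (\<Sum>k=1..<m. real k powr (1 - al)) <= C3 * real m powr (2 - al)" by blast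
 define C2 where "C2 = 1 + 3 * C * C3"
 have C2: "0 < C2" using C C3 unfolding C2_def by (intro add_pos_pos mult_pos_pos) auto
 have sq: "(\<Sum>k<m. mass k y * (real (Suc k))\<^sup>2) <= C2 * real m powr (2 - al)"
  if y: "xs <= y" "y <= 1" and m: "1 <= m" for m y
 proof -
  have "(\<Sum>k<m. mass k y * (real (Suc k))\<^sup>2) <= (\<Sum>k<m. tail k y * (2 * real k + 1))"
   unfolding truncated_square_eq using tp[OF y(1)] by simp
  also have "... = 1 + (\<Sum>k=1..<m. tail k y * (2 * real k + 1))" by (simp add: head[OF m])
  finally have 1: "(\<Sum>k<m. mass k y * (real (Suc k))\<^sup>2) <= 1 + (\<Sum>k=1..<m. tail k y * (2 * real k + 1))" .
  have "(\<Sum>k=1..<m. tail k y * (2 * real k + 1)) <= (\<Sum>k=1..<m. 3 * C * real k powr (1 - al))"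
  proof (rule sum_mono)
   fix k assume k: "k : {1..<m}"
   have "tail k y * (2 * real k + 1) <= (C * real k powr (- al)) * (3 * real k)"
    using C(2)[OF y, of k] C(1) k by (intro mult_mono) auto
   also have "... = 3 * C * real k powr (1 - al)" using k powr_add[of "real k" "- al" 1] by simp
   finally show "tail k y * (2 * real k + 1) <= 3 * C * real k powr (1 - al)" .
  qed
  also have "... <= 3 * C * (C3 * real m powr (2 - al))"
   unfolding sum_distrib_left[symmetric] using C3(2)[OF m] C(1) by (intro mult_left_mono) auto
  finally have 2: "(\<Sum>k=1..<m. tail k y * (2 * real k + 1)) <= 3 * C * (C3 * real m powr (2 - al))" .
  have "1 <= real m powr (2 - al)" using m al_bounds by (intro ge_one_powr_ge_zero) auto
  with 2 have "(\<Sum>k<m. mass k y * (real (Suc k))\<^sup>2) <= real m powr (2 - al) + 3 * C * (C3 * real m powr (2 - al))"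
   using 1 by linarith
  thus ?thesis by (simp only: C2_def algebra_simps)
 qed
 show ?thesis
 proof (rule that[of "max C (max C1 C2)"])
  show "0 < max C (max C1 C2)" using C by simp
  fix m :: nat and y assume *: "xs <= y" "y <= 1" "1 <= m"
  have mono: "a * real m powr p <= max C (max C1 C2) * real m powr p" if "a : {C, C1, C2}" for a p
   using that by (intro mult_right_mono) auto
  show "tail m y <= max C (max C1 C2) * real m powr (- al)" using C(2)[of y m] * by (intro order_trans[OF _ mono]) auto
  show "| (\<Sum>k<m. mass k y * real (Suc k)) - wmean y| <= max C (max C1 C2) * real m powr (1 - al)"
   using C1(2)[OF *] by (intro order_trans[OF _ mono]) auto
  show "(\<Sum>k<m. mass k y * (real (Suc k))\<^sup>2) <= max C (max C1 C2) * real m powr (2 - al)"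
   using sq[OF *] by (intro order_trans[OF _ mono]) auto
 qed
qed

end

section \<open>The signed reversed chain, a maximal inequality and the law of large numbers\<close>

locale sthaler = thaler_stable +
 fixes be :: real
 assumes be_ge: "- 1 <= be" and be_le: "be <= 1"
begin

definition b :: real where "b = (1 + be) / 2"

lemma b_bounds: "0 <= b" "b <= 1" "2 * b - 1 = be" using be_ge be_le by (auto simp: b_def field_simps)

definition nxt :: "real => bool \<times> nat => real" where "nxt y z = rbr (snd z) y"

definition jump :: "bool \<times> nat => real" where "jump z = (if fst z then 1 else - 1) * real (Suc (snd z))"

definition step :: "real => (bool \<times> nat) pmf" where "step y = pair_pmf (bernoulli_pmf b) (wait y)"

text \<open>The signed return times, generated backwards in time from the current state.\<close>

fun chain :: "nat => real => (bool \<times> nat) list pmf" where "chain 0 y = return_pmf []"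
| "chain (Suc n) y = bind_pmf (step y) (%z. map_pmf ((#) z) (chain n (nxt y z)))"

fun msum :: "(real => bool \<times> nat => real) => real => (bool \<times> nat) list => real" where "msum D y [] = 0"
| "msum D y (z # zs) = D y z + msum D (nxt y z) zs"

lemma nxt_in: "xs <= y ==> y <= 1 ==> xs <= nxt y z & nxt y z <= 1" by (simp add: nxt_def rbr_in)

lemma chain_len: "zs : set_pmf (chain n y) ==> length zs = n" by (induction n arbitrary: y zs) auto

lemma expectation_step_complex:
 fixes f :: "bool \<times> nat => complex"
 assumes "!!z. norm (f z) <= B"
 shows "\<E> (step y) f = b * \<E> (wait y) (%k. f (True, k)) + (1 - b) * \<E> (wait y) (%k. f (False, k))"
proof -
 have "\<E> (step y) f = \<E> (bernoulli_pmf b) (%e. \<E> (wait y) (%k. f (e, k)))"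
  unfolding step_def pair_pmf_def using assms by (simp add: expectation_bind_pmf[where B = B])
 also have "... = b * \<E> (wait y) (%k. f (True, k)) + (1 - b) * \<E> (wait y) (%k. f (False, k))"
  by (subst integral_measure_pmf[of UNIV]) (use b_bounds in \<open>auto simp: UNIV_bool scaleR_conv_of_real\<close>)
 finally show ?thesis .
qed

lemma expectation_step_real:
 fixes f :: "bool \<times> nat => real"
 assumes "!!z. |f z| <= B"
 shows "\<E> (step y) f = b * \<E> (wait y) (%k. f (True, k)) + (1 - b) * \<E> (wait y) (%k. f (False, k))"
 unfolding step_def pair_pmf_def using assms b_bounds by (simp add: exp_bind_pmf[where B = B] mult.commute)

lemma expectation_chain_Suc:
 fixes f :: "(bool \<times> nat) list => real"
 assumes "!!zs. |f zs| <= B"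
 shows "\<E> (chain (Suc n) y) f = \<E> (step y) (%z. \<E> (chain n (nxt y z)) (%zs. f (z # zs)))"
 using assms by (simp add: exp_bind_pmf[where B = B])

lemma expectation_chain_Suc_complex:
 fixes f :: "(bool \<times> nat) list => complex"
 assumes "!!zs. zs : set_pmf (chain (Suc n) y) ==> norm (f zs) <= B"
 shows "\<E> (chain (Suc n) y) f = \<E> (step y) (%z. \<E> (chain n (nxt y z)) (%zs. f (z # zs)))"
 unfolding chain.simps by (subst expectation_bind_pmf_set[where B = B]) (use assms in auto)

lemma prob_chain_Suc: "\<P> (chain (Suc n) y) A = \<E> (step y) (%z. \<P> (chain n (nxt y z)) {zs. z # zs : A})"
proof -
 have "\<P> (chain (Suc n) y) A = \<E> (chain (Suc n) y) (indicator A)" by simp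
 also have "... = \<E> (step y) (%z. \<E> (chain n (nxt y z)) (%zs. indicator A (z # zs)))"
  by (rule expectation_chain_Suc[where B = 1]) (simp add: indicator_def)
 also have "(%z zs. indicator A (z # zs) :: real) = (%z. indicator {zs. z # zs : A})" by (intro ext) (simp add: indicator_def)
 finally show ?thesis by simp
qed

text \<open>Kolmogorov's inequality for martingale differences. The accumulated value
  \<open>c\<close> is part of the induction: once it exceeds \<open>l\<close> the bound is at least
  \<open>1\<close>; otherwise one more step raises the expected square by at most
  \<open>v\<close>.\<close>

lemma kolmogorov:
 assumes "0 < l" and D: "!!y z. xs <= y ==> y <= 1 ==> |D y z| <= B" "!!y. xs <= y ==> y <= 1 ==> \<E> (step y) (D y) = 0"
  "!!y. xs <= y ==> y <= 1 ==> \<E> (step y) (%z. (D y z)\<^sup>2) <= v" and y: "xs <= y" "y <= 1"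
 shows "\<P> (chain n y) {zs. EX m<=n. l < |c + msum D y (take m zs) | } <= (c\<^sup>2 + n * v) / l\<^sup>2" using y
proof (induction n arbitrary: c y)
 case 0
 show ?case
 proof (cases "l < |c|")
  case True
  hence "l\<^sup>2 <= |c|\<^sup>2" using `0 < l` by (intro power_mono) auto
  hence "1 <= c\<^sup>2 / l\<^sup>2" using `0 < l` by simp
  thus ?thesis using measure_pmf.prob_le_1 by (force intro: order_trans)
 qed (simp add: indicator_def measure_return_pmf)
next
 case (Suc n)
 note y = Suc.prems
 have v: "0 <= v"
 proof -
  have "0 <= \<E> (step y) (%z. (D y z)\<^sup>2)" by simp
  with D(3)[OF y] show ?thesis by linarith
 qed
 show ?case
 proof (cases "l < |c|")
  case True
  hence "l\<^sup>2 <= |c|\<^sup>2" using `0 < l` by (intro power_mono) auto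
  hence "l\<^sup>2 <= c\<^sup>2 + Suc n * v" using v by (simp add: add_increasing2)
  hence "1 <= (c\<^sup>2 + Suc n * v) / l\<^sup>2" using `0 < l` by simp
  thus ?thesis using measure_pmf.prob_le_1 order_trans by blast
 next
  case False
  have ev: "z # zs : {zs. EX m<=Suc n. l < |c + msum D y (take m zs) | }
    <-> (EX m<=n. l < | (c + D y z) + msum D (nxt y z) (take m zs) | )" for z zs
  proof
   assume "z # zs : {zs. EX m<=Suc n. l < |c + msum D y (take m zs) | }"
   then obtain m where m: "m <= Suc n" "l < |c + msum D y (take m (z # zs)) |" by auto
   then obtain m' where "m = Suc m'" using False by (cases m) auto
   thus "EX m<=n. l < | (c + D y z) + msum D (nxt y z) (take m zs) |" using m by (intro exI[of _ m']) (auto simp: add.assoc)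
  next
   assume "EX m<=n. l < | (c + D y z) + msum D (nxt y z) (take m zs) |"
   then obtain m where "m <= n" "l < | (c + D y z) + msum D (nxt y z) (take m zs) |" by blast
   thus "z # zs : {zs. EX m<=Suc n. l < |c + msum D y (take m zs) | }"
    by (intro CollectI exI[of _ "Suc m"]) (auto simp: add.assoc)
  qed
  have int: "integrable (measure_pmf (step y)) (D y)" "integrable (measure_pmf (step y)) (%z. (D y z)\<^sup>2)"
  proof -
   show "integrable (measure_pmf (step y)) (D y)" by (rule int_pmf_bdd[where B = B]) (use D(1)[OF y] in auto)
   have "(D y z)\<^sup>2 <= B\<^sup>2" for z using D(1)[OF y, of z] by (metis abs_le_square_iff abs_of_nonneg abs_ge_zero order_trans)
   thus "integrable (measure_pmf (step y)) (%z. (D y z)\<^sup>2)" by (intro int_pmf_bdd[where B = "B\<^sup>2"]) auto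
  qed
  have "\<P> (chain (Suc n) y) {zs. EX m<=Suc n. l < |c + msum D y (take m zs) | } = \<E> (step y) (%z. \<P> (chain n (nxt y z))
     {zs. EX m<=n. l < | (c + D y z) + msum D (nxt y z) (take m zs) | })" unfolding prob_chain_Suc ev by simp
  also have "... <= \<E> (step y) (%z. ((c + D y z)\<^sup>2 + n * v) / l\<^sup>2)"
  proof (rule integral_mono)
   show "integrable (measure_pmf (step y)) (%z. \<P> (chain n (nxt y z))
     {zs. EX m<=n. l < | (c + D y z) + msum D (nxt y z) (take m zs) | })" by (rule int_pmf_bdd[where B = 1]) auto
   show "integrable (measure_pmf (step y)) (%z. ((c + D y z)\<^sup>2 + n * v) / l\<^sup>2)" using int by (simp add: power2_sum)
   show "\<P> (chain n (nxt y z)) {zs. EX m<=n. l < | (c + D y z) + msum D (nxt y z) (take m zs) | }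
     <= ((c + D y z)\<^sup>2 + n * v) / l\<^sup>2" for z using nxt_in[OF y] by (intro Suc.IH) auto
  qed
  also have "... = (c\<^sup>2 + \<E> (step y) (%z. (D y z)\<^sup>2) + n * v) / l\<^sup>2"
   using int D(2)[OF y] by (simp add: power2_sum)
  also have "... <= (c\<^sup>2 + v + n * v) / l\<^sup>2" using D(3)[OF y] by (intro divide_right_mono) auto
  finally show ?thesis by (simp add: algebra_simps)
 qed
qed

lemma msum_abs_le:
 assumes "!!y z. xs <= y ==> y <= 1 ==> |D y z| <= (B :: real)" "xs <= y" "y <= 1"
 shows "|msum D y zs| <= real (length zs) * B" using assms(2,3)
proof (induction zs arbitrary: y)
 case (Cons z zs)
 hence "|msum D (nxt y z) zs| <= real (length zs) * B" "|D y z| <= B"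
  using Cons.IH[of "nxt y z"] nxt_in[of y z] assms(1)[of y z] by auto
 thus ?case by (simp add: algebra_simps)
qed simp

lemma msum_telescope: "msum (%y z. V (nxt y z) - V y) y zs = V (foldl nxt y zs) - V y" by (induction zs arbitrary: y) auto

lemma foldl_nxt_in: "xs <= y ==> y <= 1 ==> xs <= foldl nxt y zs & foldl nxt y zs <= 1"
 by (induction zs arbitrary: y) (use nxt_in in auto)

lemma prob_chain_mono:
 assumes "!!zs. zs : A ==> length zs = n ==> zs : B"
 shows "\<P> (chain n y) A <= \<P> (chain n y) B" by (rule measure_pmf.finite_measure_mono_AE)
  (use assms chain_len in \<open>auto simp: AE_measure_pmf_iff\<close>)

text \<open>The law of large numbers with its maximal form, through the solution of the Poisson equation
  provided by \<^const>\<open>potential\<close>.\<close>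

lemma decr_sum_deviation:
 assumes f: "decr f" and y: "xs <= y" "y <= 1" and l: "6 * (osc f / q 1) <= l" "0 < l"
 shows "\<P> (chain n y) {zs. EX m<=n. l < |msum (%y z. f y - mean f) y (take m zs) | }
   <= 16 * (osc f / q 1)\<^sup>2 * n / l\<^sup>2"
proof -
 define w where "w = osc f / q 1"
 have w: "0 <= w" "osc f <= w" "6 * w <= l"
  using mult_left_le[of "q 1" "osc f"] osc_nonneg[OF f] q_bds[of 1] l by (auto simp: w_def field_simps)
 define V where "V = potential n f"
 define D where "D = (%y z. V (nxt y z) - markov V y)"
 have V: "|V y| <= w" if "xs <= y" "y <= 1" for y using potential_bound[OF f that] by (simp add: V_def w_def)
 have PV: "|markov V y| <= w" if "xs <= y" "y <= 1" for y using markov_abs_le[OF V that] .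
 have Db: "|D y z| <= 2 * w" if "xs <= y" "y <= 1" for y z using V[of "nxt y z"] PV[OF that] nxt_in[OF that, of z]
  unfolding D_def by (auto intro: order_trans[OF abs_triangle_ineq4])
 have DE: "\<E> (step y) (D y) = 0" if "xs <= y" "y <= 1" for y
 proof -
  have "integrable (measure_pmf (wait y)) (%k. V (rbr k y))" by (rule int_pmf_bdd[where B = w]) (use V rbr_in[OF that] in auto)
  hence "\<E> (wait y) (%k. V (rbr k y) - markov V y) = 0" by (simp add: markov_def)
  thus ?thesis by (subst expectation_step_real[where B = "2 * w"]) (use Db[OF that] in \<open>auto simp: D_def nxt_def\<close>)
 qed
 have DV: "\<E> (step y) (%z. (D y z)\<^sup>2) <= (2 * w)\<^sup>2" if "xs <= y" "y <= 1" for y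
 proof -
  have "(D y z)\<^sup>2 <= (2 * w)\<^sup>2" for z using Db[OF that, of z] w(1) by (intro abs_le_square_iff[THEN iffD1]) simp
  thus ?thesis using norm_exp_pmf[of "step y" "%z. (D y z)\<^sup>2" "(2 * w)\<^sup>2"] by auto
 qed
 have "\<P> (chain n y) {zs. EX m<=n. l < |msum (%y z. f y - mean f) y (take m zs) | }
   <= \<P> (chain n y) {zs. EX m<=n. l / 2 < |0 + msum D y (take m zs) | }"
 proof (rule prob_chain_mono)
  fix zs :: "(bool \<times> nat) list"
  assume "zs : {zs. EX m<=n. l < |msum (%y z. f y - mean f) y (take m zs) | }" "length zs = n"
  then obtain m where m: "m <= n" "l < |msum (%y z. f y - mean f) y (take m zs) |" by auto
  let ?us = "take m zs"
  \<comment> \<open>The summand becomes a martingale difference \<open>D\<close>, the remainder of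
    the truncated series and a telescoping term. The latter two sum to at most \<open>3 * w\<close>,
    which is half of \<open>l\<close> at most.\<close>
  have eq: "f y - mean f = V y - markov V y + (mpow n f y - mean f)" if "xs <= y" "y <= 1" for y
   using potential_eq[OF f that, of n] by (simp add: V_def)
  have "msum (%y z. f y - mean f) y us = msum (%y z. D y z + ((mpow n f y - mean f) - (V (nxt y z) - V y))) y us"
   if "xs <= y" "y <= 1" for y us using that
  proof (induction us arbitrary: y)
   case (Cons u us)
   thus ?case using nxt_in[of y u] eq[of y] by (simp add: D_def)
  qed simp
  also have "msum (%y z. D y z + ((mpow n f y - mean f) - (V (nxt y z) - V y))) y us
    = msum D y us + (msum (%y z. mpow n f y - mean f) y us - (V (foldl nxt y us) - V y))" for y us
  proof -
   have "msum (%y z. D y z + (E y z - F y z)) y us = msum D y us + (msum E y us - msum F y us)" for E F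
    by (induction us arbitrary: y) auto
   thus ?thesis by (simp only: msum_telescope)
  qed
  finally have split: "msum (%y z. f y - mean f) y ?us
    = msum D y ?us + (msum (%y z. mpow n f y - mean f) y ?us - (V (foldl nxt y ?us) - V y))" using y by blast
  have "|msum (%y z. mpow n f y - mean f) y ?us| <= length ?us * (contr ^ n * osc f)"
   by (rule msum_abs_le[OF _ y]) (rule mixing[OF f])
  also have "... <= n * (contr ^ n * osc f)" using m(1) contr_bounds osc_nonneg[OF f] by (intro mult_right_mono) auto
  also have "... = (n * contr ^ n) * osc f" by simp
  also have "... <= 1 / q 1 * osc f" by (intro mult_right_mono n_contr_bound osc_nonneg[OF f])
  also have "... = w" by (simp add: w_def)
  finally have "|msum (%y z. mpow n f y - mean f) y ?us| <= w" .
  moreover have "|V (foldl nxt y ?us) | <= w" "|V y| <= w" using V foldl_nxt_in[OF y] y by auto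
  ultimately have "l - 3 * w < |msum D y ?us|" using m(2) unfolding split by linarith
  thus "zs : {zs. EX m<=n. l / 2 < |0 + msum D y (take m zs) | }" using m(1) w(3) by (intro CollectI exI[of _ m]) auto
 qed
 also have "... <= (0\<^sup>2 + n * (2 * w)\<^sup>2) / (l / 2)\<^sup>2" by (rule kolmogorov[OF _ Db DE DV y]) (use l in auto)
 also have "... = 16 * w\<^sup>2 * n / l\<^sup>2" by (simp add: power2_eq_square field_simps)
 finally show ?thesis by (simp add: w_def)
qed

end

section \<open>Maximal fluctuation and blocks with a single large jump\<close>

context sthaler
begin

definition cent :: "bool \<times> nat => real" where "cent z = jump z - be * ell"

lemma be_mult_le: "|be * x| <= |x|" unfolding abs_mult using be_ge be_le by (intro mult_left_le_one_le) auto

definition csum :: "(bool \<times> nat) list => real" where "csum zs = sum_list (map cent zs)"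

lemma csum_simps [simp]: "csum [] = 0" "csum (z # zs) = cent z + csum zs" "csum (us @ zs) = csum us + csum zs"
 by (auto simp: csum_def)

lemma expectation_wait_truncated: "xs <= y ==> \<E> (wait y) (%k. if k < m then g k else 0) = (\<Sum>k<m. mass k y * g k)"
 by (subst integral_measure_pmf[of "{..<m}"]) (auto simp: pmf_wait split: if_splits)

lemma prob_large_wait:
 assumes p: "!!y. xs <= y ==> y <= 1 ==> tail m y <= p" and y: "xs <= y" "y <= 1"
 shows "\<P> (chain n y) {zs. EX z:set zs. m <= snd z} <= n * p" using y
proof (induction n arbitrary: y)
 case (Suc n)
 note y = Suc.prems
 let ?E = "%n y. \<P> (chain n y) {zs. EX z:set zs. m <= snd z}"
 have "?E (Suc n) y <= \<E> (step y) (%z. indicator {z. m <= snd z} z + n * p)" unfolding prob_chain_Suc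
 proof (rule integral_mono)
  show "integrable (measure_pmf (step y)) (%z. \<P> (chain n (nxt y z)) {zs. z # zs : {zs. EX z:set zs. m <= snd z}})"
   by (rule int_pmf_bdd[where B = 1]) auto
  show "integrable (measure_pmf (step y)) (%z. indicator {z. m <= snd z} z + n * p)"
   by (rule int_pmf_bdd[where B = "1 + |n * p|"]) (auto simp: indicator_def)
  fix z
  have "?E n (nxt y z) <= n * p" using nxt_in[OF y] by (intro Suc.IH) auto
  moreover from this have "0 <= n * p" by (rule order_trans[OF measure_nonneg])
  ultimately show "\<P> (chain n (nxt y z)) {zs. z # zs : {zs. EX z:set zs. m <= snd z}} <= indicator {z. m <= snd z} z + n * p"
   by (cases "m <= snd z") auto
 qed
 also have "... = \<P> (step y) {z. m <= snd z} + n * p"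
 proof -
  have "integrable (measure_pmf (step y)) (indicator {z. m <= snd z} :: _ => real)"
   by (rule int_pmf_bdd[where B = 1]) (simp add: indicator_def)
  thus ?thesis by simp
 qed
 also have "\<P> (step y) {z. m <= snd z} = \<P> (map_pmf snd (step y)) {m..}"
  unfolding measure_map_pmf by (rule arg_cong[where f = "\<P> (step y)"]) auto
 also have "... = tail m y" unfolding step_def map_snd_pair_pmf by (rule prob_wait_atLeast[OF y(1)])
 also have "... <= p" by (rule p[OF y])
 finally show ?case by (simp add: algebra_simps)
qed simp

lemma truncated_jump:
 fixes m :: nat
 assumes y: "xs <= y" "y <= 1"
 defines "X \<equiv> %z. if snd z < m then jump z else 0" and "t \<equiv> \<Sum>k<m. mass k y * real (Suc k)"
 shows "\<E> (step y) (%z. X z - be * t) = 0"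
  and "\<E> (step y) (%z. (X z - be * t)\<^sup>2) <= (\<Sum>k<m. mass k y * (real (Suc k))\<^sup>2)"
proof -
 have X: "|X z| <= real m" for z by (auto simp: X_def jump_def abs_mult)
 hence X2: "| (X z)\<^sup>2| <= (real m)\<^sup>2" for z by (simp add: abs_le_square_iff[symmetric])
 have int: "integrable (measure_pmf (step y)) X" "integrable (measure_pmf (step y)) (%z. (X z)\<^sup>2)"
  using X X2 by (auto intro!: int_pmf_bdd)
 have "\<E> (step y) X = b * (\<Sum>k<m. mass k y * real (Suc k)) + (1 - b) * (\<Sum>k<m. mass k y * - real (Suc k))"
  unfolding expectation_step_real[of X, OF X] expectation_wait_truncated[OF y(1), symmetric]
  by (simp add: X_def jump_def cong: if_cong)
 also have "(\<Sum>k<m. mass k y * - real (Suc k)) = - t" by (simp add: t_def sum_negf[symmetric] del: of_nat_Suc)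
 also have "b * (\<Sum>k<m. mass k y * real (Suc k)) + (1 - b) * - t = (2 * b - 1) * t"
  unfolding t_def[symmetric] by (simp add: algebra_simps)
 finally have EX: "\<E> (step y) X = be * t" by (simp add: b_bounds)
 thus "\<E> (step y) (%z. X z - be * t) = 0" using int by simp
 have sq: "(- 1 - real k)\<^sup>2 = (1 + real k)\<^sup>2" for k by (simp add: power2_eq_square algebra_simps)
 have "\<E> (step y) (%z. (X z)\<^sup>2)
   = b * (\<Sum>k<m. mass k y * (real (Suc k))\<^sup>2) + (1 - b) * (\<Sum>k<m. mass k y * (real (Suc k))\<^sup>2)"
  unfolding expectation_step_real[of "%z. (X z)\<^sup>2", OF X2] expectation_wait_truncated[OF y(1), symmetric]
  by (simp add: X_def jump_def if_distrib[of "%x. x\<^sup>2"] sq cong: if_cong)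
 also have "... = (\<Sum>k<m. mass k y * (real (Suc k))\<^sup>2)" by (simp add: algebra_simps)
 finally have "\<E> (step y) (%z. (X z)\<^sup>2) = (\<Sum>k<m. mass k y * (real (Suc k))\<^sup>2)" .
 moreover have "\<E> (step y) (%z. (X z - be * t)\<^sup>2) = \<E> (step y) (%z. (X z)\<^sup>2) - (be * t)\<^sup>2"
  using int EX by (simp add: power2_diff) (simp add: power2_eq_square algebra_simps)
 ultimately show "\<E> (step y) (%z. (X z - be * t)\<^sup>2) <= (\<Sum>k<m. mass k y * (real (Suc k))\<^sup>2)" by simp
qed

text \<open>The summands are split into a truncated martingale difference, the jumps exceeding the
  threshold, the error of the truncated mean, and the centred conditional mean.\<close>

lemma maximal_fluctuation:
 obtains C L where "0 < C" "1 <= L" "!!l n y. L <= l ==> xs <= y ==> y <= 1 ==>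
   \<P> (chain n y) {zs. EX j<=n. l < |csum (take j zs) | } <= C * n * l powr (- al)"
proof -
 obtain C where C: "0 < C" "!!m y. xs <= y ==> y <= 1 ==> 1 <= m ==> tail m y <= C * real m powr (- al)"
  "!!m y. xs <= y ==> y <= 1 ==> 1 <= m ==> | (\<Sum>k<m. mass k y * real (Suc k)) - wmean y| <= C * real m powr (1 - al)"
  "!!m y. xs <= y ==> y <= 1 ==> 1 <= m ==> (\<Sum>k<m. mass k y * (real (Suc k))\<^sup>2) <= C * real m powr (2 - al)"
  by (rule truncated_moments) blast
 define w where "w = osc wmean / q 1"
 have w: "0 <= w" using osc_nonneg[OF decr_wmean] q_bds[of 1] by (simp add: w_def)
 show ?thesis
 proof (rule that[of "9 * C + 64 * C + 256 * w\<^sup>2" "max 1 (24 * w)"])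
  show "0 < 9 * C + 64 * C + 256 * w\<^sup>2" using C(1) by (simp add: add_pos_nonneg)
  show "1 <= max 1 (24 * w)" by simp
  fix l :: real and n :: nat and y :: real
  assume l: "max 1 (24 * w) <= l" and y: "xs <= y" "y <= 1"
  \<comment> \<open>Truncation level: an integer between \<open>l\<close> and
    \<open>2 * l\<close>.\<close>
  define m where "m = nat \<lceil>l\<rceil>"
  have m: "1 <= m" "l <= real m" "real m <= 2 * l" using l unfolding m_def by linarith+
  have lp: "0 < l" "1 <= l" "6 * w <= l / 4" using l by auto
  define t where "t = (%y. \<Sum>k<m. mass k y * real (Suc k))"
  define D where "D = (%y z. (if snd z < m then jump z else 0) - be * t y)"
  let ?P = "\<P> (chain n y)"
  let ?A = "{zs. EX z:set zs. m <= snd z}" and ?B = "{zs. EX j<=n. l / 4 < |0 + msum D y (take j zs) | }"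
   and ?E = "{zs. EX j<=n. l / 4 < |msum (%y z. wmean y - mean wmean) y (take j zs) | }"
  have "?P ?A <= n * (C * l powr (- al))"
  proof (rule prob_large_wait[OF _ y])
   fix y assume y: "xs <= y" "y <= 1"
   have "tail m y <= C * real m powr (- al)" by (rule C(2)[OF y m(1)])
   also have "... <= C * l powr (- al)" using C(1) m lp al_bounds by (intro mult_left_mono powr_mono2') auto
   finally show "tail m y <= C * l powr (- al)" .
  qed
  moreover have "?P ?B <= 64 * C * n * l powr (- al)"
  proof -
   have "?P ?B <= (0\<^sup>2 + n * (C * real m powr (2 - al))) / (l / 4)\<^sup>2"
   proof (rule kolmogorov[OF _ _ _ _ y])
    show "0 < l / 4" using lp by simp
    fix y z assume y: "xs <= y" "y <= 1"
    have "0 <= t y" unfolding t_def using y xs_bds by (intro sum_nonneg mult_nonneg_nonneg mass_ge0) auto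
    moreover have "t y <= real m"
    proof -
     have "t y <= (\<Sum>k<m. tail k y)" unfolding t_def truncated_mean_eq[OF y(1)] using tail_pos[of y m] y xs_bds by simp
     also have "... <= (\<Sum>k<m. 1)" using tail_le_1 y xs_bds by (intro sum_mono) auto
     finally show ?thesis by simp
    qed
    moreover have "|be * t y| <= |t y|" by (rule be_mult_le)
    moreover have "|if snd z < m then jump z else 0| <= real m" by (auto simp: jump_def abs_mult)
    ultimately show "|D y z| <= 2 * real m" unfolding D_def by linarith
    show "\<E> (step y) (D y) = 0" unfolding D_def t_def by (rule truncated_jump[OF y])
    show "\<E> (step y) (%z. (D y z)\<^sup>2) <= C * real m powr (2 - al)"
     unfolding D_def t_def by (rule order_trans[OF truncated_jump(2)[OF y] C(4)[OF y m(1)]])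
   qed
   also have "... = 16 * C * n * (real m powr (2 - al) / l\<^sup>2)" by (simp add: power2_eq_square field_simps)
   also have "real m powr (2 - al) <= (2 * l) powr (2 - al)" using m al_bounds by (intro powr_mono2) auto
   also have "... = 2 powr (2 - al) * l powr (2 - al)" using lp by (simp add: powr_mult)
   also have "2 powr (2 - al) <= 2 powr (2::real)" using al_bounds by (intro powr_mono) auto
   also have "2 powr (2::real) * l powr (2 - al) / l\<^sup>2 = 4 * l powr (- al)" using lp powr_add[of l 2 "- al"] by simp
   finally show ?thesis using C(1) lp by (simp add: mult_left_mono divide_right_mono mult_right_mono)
  qed
  moreover have "?P ?E <= 256 * w\<^sup>2 * n * l powr (- al)"
  proof -
   have "?P ?E <= 16 * w\<^sup>2 * n / (l / 4)\<^sup>2"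
    unfolding w_def using lp by (intro decr_sum_deviation decr_wmean y) (auto simp: w_def)
   also have "... = 256 * w\<^sup>2 * n * l powr (- 2)" using lp by (simp add: powr_minus field_simps)
   also have "... <= 256 * w\<^sup>2 * n * l powr (- al)" using lp al_bounds by (intro mult_left_mono powr_mono) auto
   finally show ?thesis .
  qed
  \<comment> \<open>If the errors of the truncated means may add up to more than
    \<open>l / 4\<close>, the last summand is at least \<open>1\<close>; otherwise one of the three
    remaining causes must occur.\<close>
  moreover have "?P {zs. EX j<=n. l < |csum (take j zs) | } <= ?P ?A + ?P ?B + ?P ?E + 8 * C * n * l powr (- al)"
  proof (cases "n * (C * real m powr (1 - al)) <= l / 4")
   case False
   have "real m powr (1 - al) <= 2 * l powr (1 - al)"
   proof (cases "al <= 1")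
    case True
    hence "real m powr (1 - al) <= (2 * l) powr (1 - al)" using m by (intro powr_mono2) auto
    also have "... = 2 powr (1 - al) * l powr (1 - al)" using lp by (simp add: powr_mult)
    also have "... <= 2 powr 1 * l powr (1 - al)" using al_bounds by (intro mult_right_mono powr_mono) auto
    finally show ?thesis by simp
   next
    case False
    hence "real m powr (1 - al) <= l powr (1 - al)" using m lp by (intro powr_mono2') auto
    thus ?thesis using powr_ge_zero[of l "1 - al"] by linarith
   qed
   hence "n * (C * real m powr (1 - al)) <= n * (C * (2 * l powr (1 - al)))" using C(1) by (intro mult_left_mono) auto
   with False have "l / 4 <= n * (C * (2 * l powr (1 - al)))" by linarith
   also have "... = l * (2 * C * n * l powr (- al))" using lp powr_add[of l 1 "- al"] by simp
   finally have "1 <= 8 * C * n * l powr (- al)" using lp by (simp add: field_simps)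
   thus ?thesis using measure_pmf.prob_le_1[of "chain n y" "{zs. EX j<=n. l < |csum (take j zs) | }"]
     measure_nonneg[of "chain n y" ?A] measure_nonneg[of "chain n y" ?B] measure_nonneg[of "chain n y" ?E] by linarith
  next
   case True
   have "?P {zs. EX j<=n. l < |csum (take j zs) | } <= ?P (?A \<union> ?B \<union> ?E)"
   proof (rule prob_chain_mono)
    fix zs :: "(bool \<times> nat) list"
    assume "zs : {zs. EX j<=n. l < |csum (take j zs) | }" "length zs = n"
    then obtain j where j: "j <= n" "l < |csum (take j zs) |" by auto
    show "zs : ?A \<union> ?B \<union> ?E"
    proof (cases "zs : ?A")
     case False
     let ?us = "take j zs"
     have small: "snd z < m" if "z : set ?us" for z using False in_set_takeD[OF that] by force
     have dec0: "csum us = msum D v us + (msum (%y z. be * (t y - wmean y)) v us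
     + be * msum (%y z. wmean y - mean wmean) v us)" if "!!z. z : set us ==> snd z < m" for us v using that
     proof (induction us arbitrary: v)
     case (Cons u us)
     show ?case using Cons.IH[of "nxt v u"] Cons.prems[of u] Cons.prems by (simp add: D_def cent_def mean_wmean algebra_simps)
     qed simp
     have dec: "csum ?us = msum D y ?us + (msum (%y z. be * (t y - wmean y)) y ?us
     + be * msum (%y z. wmean y - mean wmean) y ?us)" by (rule dec0[OF small])
     have "|msum (%y z. be * (t y - wmean y)) y ?us| <= real (length ?us) * (C * real m powr (1 - al))"
     proof (rule msum_abs_le[OF _ y])
     fix y assume y: "xs <= y" "y <= 1"
     have "|be * (t y - wmean y) | <= |t y - wmean y|" by (rule be_mult_le)
     with C(3)[OF y m(1)] show "|be * (t y - wmean y) | <= C * real m powr (1 - al)" unfolding t_def by linarith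
     qed
     also have "... <= n * (C * real m powr (1 - al))" using j C(1) by (intro mult_right_mono) auto
     finally have 1: "|msum (%y z. be * (t y - wmean y)) y ?us| <= l / 4" using True by linarith
     have "l / 4 < |msum D y ?us| \<or> l / 4 < |msum (%y z. wmean y - mean wmean) y ?us|"
     using j(2) 1 be_mult_le[of "msum (%y z. wmean y - mean wmean) y ?us"] lp unfolding dec by linarith
     thus ?thesis using j(1) by auto
    qed simp
   qed
   also have "... <= ?P ?A + ?P ?B + ?P ?E"
    using measure_Un_le[of "?A \<union> ?B" "chain n y" ?E] measure_Un_le[of ?A "chain n y" ?B] by simp
   finally have "?P {zs. EX j<=n. l < |csum (take j zs) | } <= ?P ?A + ?P ?B + ?P ?E" .
   moreover have "0 <= 8 * C * n * l powr (- al)" using C(1) by simp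
   ultimately show ?thesis by linarith
  qed
  ultimately show "?P {zs. EX j<=n. l < |csum (take j zs) | } <= (9 * C + 64 * C + 256 * w\<^sup>2) * n * l powr (- al)"
   by (simp add: algebra_simps)
 qed
qed

fun exceeds :: "real => real => (bool \<times> nat) list => bool" where "exceeds l c [] = False"
| "exceeds l c (z # zs) = (l < |c + cent z| \<or> exceeds l (c + cent z) zs)"

text \<open>Two large movements: a first passage above \<open>l\<close>, followed by a partial sum
  above \<open>l / 2\<close> of the steps after it. The recursion makes the Markov property a matter
  of one step.\<close>

fun exc2 :: "real => real => (bool \<times> nat) list => bool" where "exc2 l c [] = False"
| "exc2 l c (z # zs) = (if l < |c + cent z|
  then EX j<=length zs. l / 2 < |csum (take j zs) | else exc2 l (c + cent z) zs)"

text \<open>A list that is, up to \<open>l\<close>, one jump: flat before \<open>p\<close> and flat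
  from \<open>p\<close> on, where the distance to the final value is expressed by the sum of the
  remaining steps.\<close>

definition split1 :: "real => (bool \<times> nat) list => bool" where
 "split1 l zs <-> (EX p<=length zs. (ALL j<p. |csum (take j zs) | <= l) & (ALL j>=p. |csum (drop j zs) | <= l))"

lemma exceeds_imp: "exceeds l c zs ==> EX j<=length zs. l < |c + csum (take j zs) |"
proof (induction zs arbitrary: c)
 case (Cons z zs)
 show ?case
 proof (cases "l < |c + cent z|")
  case True
  thus ?thesis by (intro exI[of _ 1]) auto
 next
  case False
  with Cons.prems Cons.IH[of "c + cent z"] obtain j where "j <= length zs" "l < |c + cent z + csum (take j zs) |" by auto
  thus ?thesis by (intro exI[of _ "Suc j"]) (auto simp: add.assoc)
 qed
qed simp

text \<open>The split is the first passage above \<open>l\<close>; afterwards a remaining sum is a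
  difference of two partial sums bounded by \<open>l / 2\<close>. Without a passage the split is the
  end of the list.\<close>

lemma split1_if: "\<not> exc2 l 0 zs ==> 0 <= l ==> split1 l zs"
proof -
 have "EX p<=length zs. (ALL j<p. |c + csum (take j zs) | <= l) & (ALL j>=p. |csum (drop j zs) | <= l)"
  if "\<not> exc2 l c zs" "0 <= l" "|c| <= l" for c using that
 proof (induction zs arbitrary: c)
  case (Cons z zs)
  show ?case
  proof (cases "l < |c + cent z|")
   case True
   hence small: "|csum (take j zs) | <= l / 2" if "j <= length zs" for j using Cons.prems that by force
   have "|csum (drop j zs) | <= l" for j
   proof (cases "j <= length zs")
    case True
    have "csum (drop j zs) = csum (take (length zs) zs) - csum (take j zs)"
     using csum_simps(3)[of "take j zs" "drop j zs"] by simp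
    thus ?thesis using small[OF True] small[of "length zs"] by linarith
   qed (use Cons.prems in simp)
   hence "|csum (drop j (z # zs)) | <= l" if "1 <= j" for j using that by (cases j) auto
   thus ?thesis using Cons.prems by (intro exI[of _ 1]) auto
  next
   case False
   with Cons.prems Cons.IH[of "c + cent z"] obtain p where p: "p <= length zs"
    "!!j. j < p ==> |c + cent z + csum (take j zs) | <= l" "!!j. p <= j ==> |csum (drop j zs) | <= l" by auto
   have "|c + csum (take j (z # zs)) | <= l" if "j < Suc p" for j using that p(2) Cons.prems by (cases j) (auto simp: add.assoc)
   moreover have "|csum (drop j (z # zs)) | <= l" if "Suc p <= j" for j using that p(3) by (cases j) auto
   ultimately show ?thesis using p(1) by (intro exI[of _ "Suc p"]) auto
  qed
 qed auto
 from this[of 0] show "\<not> exc2 l 0 zs ==> 0 <= l ==> split1 l zs" unfolding split1_def by simp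
qed

text \<open>Markov property at the first passage: given it, the second movement has probability at
  most \<open>F\<close>, uniformly in the state and in the remaining length.\<close>

lemma prob_exc2:
 assumes F: "!!m y. m <= n ==> xs <= y ==> y <= 1 ==> \<P> (chain m y) {zs. EX j<=m. l / 2 < |csum (take j zs) | } <= F"
  and y: "xs <= y" "y <= 1"
 shows "\<P> (chain n y) {zs. exc2 l c zs} <= F * \<P> (chain n y) {zs. exceeds l c zs}" using assms
proof (induction n arbitrary: c y)
 case (Suc n)
 note y = Suc.prems(2,3)
 have Fge: "0 <= F" using Suc.prems(1)[of 0 y] y measure_nonneg order_trans by blast
 let ?E = "%R z. \<P> (chain n (nxt y z)) {zs. z # zs : {zs. R l c zs}}"
 have int: "integrable (measure_pmf (step y)) (?E R)" for R :: "real => real => (bool \<times> nat) list => bool"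
  by (rule int_pmf_bdd[where B = 1]) auto
 have "\<E> (step y) (?E exc2) <= \<E> (step y) (%z. F * ?E exceeds z)"
 proof (rule integral_mono)
  fix z
  have ny: "xs <= nxt y z" "nxt y z <= 1" using nxt_in[OF y] by auto
  show "?E exc2 z <= F * ?E exceeds z"
  proof (cases "l < |c + cent z|")
   case True
   have "?E exc2 z <= \<P> (chain n (nxt y z)) {zs. EX j<=n. l / 2 < |csum (take j zs) | }"
    using True by (intro prob_chain_mono) auto
   also have "... <= F" using ny by (intro Suc.prems(1)) auto
   finally show ?thesis using True by simp
  next
   case False
   thus ?thesis using Suc.IH[OF Suc.prems(1), of "nxt y z" "c + cent z"] ny by simp
  qed
 qed (use int in \<open>auto simp del: exceeds.simps exc2.simps\<close>)
 thus ?case unfolding prob_chain_Suc using int by (simp del: exceeds.simps exc2.simps)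
qed simp

text \<open>The maximal inequality enters twice, for the first passage and for what follows it. The
  resulting square makes such blocks negligible even when summed over the time grid.\<close>

lemma no_split1:
 obtains C L where "0 < C" "1 <= L" "!!l n y. L <= l ==> xs <= y ==> y <= 1 ==>
   \<P> (chain n y) {zs. \<not> split1 l zs} <= (C * n * l powr (- al))\<^sup>2"
proof -
 obtain C L where C: "0 < C" "1 <= L" "!!l n y. L <= l ==> xs <= y ==> y <= 1 ==>
   \<P> (chain n y) {zs. EX j<=n. l < |csum (take j zs) | } <= C * n * l powr (- al)" by (rule maximal_fluctuation) blast
 show ?thesis
 proof (rule that[of "4 * C" "2 * L"])
  show "0 < 4 * C" "1 <= 2 * L" using C by auto
  fix l :: real and n :: nat and y :: real
  assume l: "2 * L <= l" and y: "xs <= y" "y <= 1"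
  define R where "R = C * n * l powr (- al)"
  have R: "0 <= R" using C by (simp add: R_def)
  have half: "(l / 2) powr (- al) <= 4 * l powr (- al)"
  proof -
   have "(l / 2) powr (- al) = l powr (- al) * 2 powr al" using l C by (simp add: powr_divide powr_minus field_simps)
   also have "2 powr al <= 2 powr (2::real)" using al_bounds by (intro powr_mono) auto
   finally show ?thesis by (simp add: mult_left_mono)
  qed
  have "\<P> (chain n y) {zs. \<not> split1 l zs} <= \<P> (chain n y) {zs. exc2 l 0 zs}"
   using split1_if[of l] l C by (intro prob_chain_mono) auto
  also have "... <= (4 * R) * \<P> (chain n y) {zs. exceeds l 0 zs}"
  proof (rule prob_exc2[OF _ y])
   fix m :: nat and y assume m: "m <= n" and y: "xs <= y" "y <= 1"
   have "\<P> (chain m y) {zs. EX j<=m. l / 2 < |csum (take j zs) | } <= C * m * (l / 2) powr (- al)"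
    using l y by (intro C) auto
   also have "... <= C * n * (4 * l powr (- al))" using m C half by (intro mult_mono) auto
   finally show "\<P> (chain m y) {zs. EX j<=m. l / 2 < |csum (take j zs) | } <= 4 * R" by (simp add: R_def)
  qed
  also have "... <= (4 * R) * R"
  proof (intro mult_left_mono)
   have "\<P> (chain n y) {zs. exceeds l 0 zs} <= \<P> (chain n y) {zs. EX j<=n. l < |csum (take j zs) | }"
    using exceeds_imp[of l 0] by (intro prob_chain_mono) auto
   also have "... <= R" unfolding R_def using l C(2) y by (intro C(3)) auto
   finally show "\<P> (chain n y) {zs. exceeds l 0 zs} <= R" .
  qed (use R in simp)
  also have "... <= (4 * R)\<^sup>2" using R by (simp add: power2_eq_square)
  finally show "\<P> (chain n y) {zs. \<not> split1 l zs} <= (4 * C * n * l powr (- al))\<^sup>2"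
   by (simp add: R_def mult.assoc)
 qed
qed

lemma chain_add: "chain (m + n) y = bind_pmf (chain m y) (%us. map_pmf ((@) us) (chain n (foldl nxt y us)))"
proof (induction m arbitrary: y)
 case (Suc m)
 have e: "(@) (z # us) = (%x. z # us @ x)" for z and us :: "(bool \<times> nat) list" by auto
 have "chain (Suc m + n) y = bind_pmf (step y) (%z. bind_pmf (chain m (nxt y z))
   (%us. map_pmf ((#) z) (map_pmf ((@) us) (chain n (foldl nxt (nxt y z) us)))))" by (simp add: Suc.IH map_bind_pmf)
 also have "... = bind_pmf (chain (Suc m) y) (%us. map_pmf ((@) us) (chain n (foldl nxt y us)))"
  by (simp add: bind_assoc_pmf bind_map_pmf pmf.map_comp o_def e)
 finally show ?case .
next
 case 0
 have "(@) [] = (%x :: (bool \<times> nat) list. x)" by auto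
 thus ?case by (simp add: bind_return_pmf)
qed

text \<open>Conditioning on the steps before the segment; this is why bounds are kept uniform in the
  starting state.\<close>

lemma prob_chain_segment:
 assumes p: "!!y. xs <= y ==> y <= 1 ==> \<P> (chain n y) A <= p" and y: "xs <= y" "y <= 1"
 shows "\<P> (chain (m + (n + r)) y) {zs. take n (drop m zs) : A} <= p" using y
proof (induction m arbitrary: y)
 case 0
 have "map_pmf (take n) (chain (n + r) y) = bind_pmf (chain n y) (%us. return_pmf us)"
  unfolding chain_add map_bind_pmf pmf.map_comp by (rule bind_pmf_cong) (auto simp: o_def chain_len map_pmf_const)
 hence "map_pmf (take n) (chain (n + r) y) = chain n y" by (simp add: bind_return_pmf')
 hence "\<P> (chain (n + r) y) (take n -` A) = \<P> (chain n y) A" by (metis measure_map_pmf)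
 thus ?case using p[OF 0] by (simp add: vimage_def)
next
 case (Suc m)
 have "\<P> (chain (Suc (m + (n + r))) y) {zs. take n (drop (Suc m) zs) : A} <= \<E> (step y) (%z. p)" unfolding prob_chain_Suc
 proof (rule integral_mono)
  show "integrable (measure_pmf (step y)) (%z. \<P> (chain (m + (n + r)) (nxt y z))
    {zs. z # zs : {zs. take n (drop (Suc m) zs) : A}})" by (rule int_pmf_bdd[where B = 1]) auto
  show "\<P> (chain (m + (n + r)) (nxt y z)) {zs. z # zs : {zs. take n (drop (Suc m) zs) : A}} <= p" for z
   using Suc.IH[of "nxt y z"] nxt_in[OF Suc.prems, of z] by simp
 qed simp
 thus ?case by simp
qed

end

text \<open>\<open>(1 - iexp s) / s\<close> tends to \<open>- \<i>\<close> from the right, and the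
  principal power of \<open>- \<i>\<close> is the phase in the statement; negative \<open>s\<close>
  follow by conjugation.\<close>

lemma one_minus_iexp_powr:
 fixes a :: real
 assumes "0 < e"
 obtains d where "0 < d" "!!s. s ~= 0 ==> |s| < d ==>
  norm ((1 - iexp s) powr of_real a - of_real ( |s| powr a) * iexp (- (sgn s * (a * pi / 2)))) <= e * |s| powr a"
proof -
 have "((%s::real. (1 - iexp s) / s + \<i>) \<longlongrightarrow> 0) (at_right 0)"
 proof (rule Lim_null_comparison)
  have "norm ((1 - iexp s) / s + \<i>) <= s / 2" if "0 < s" for s :: real
  proof -
   have "(1 - iexp s) / s + \<i> = - (iexp s - 1 - \<i> * s) / s" using that by (simp add: field_simps)
   hence "norm ((1 - iexp s) / s + \<i>) = norm (iexp s - 1 - \<i> * s) / s"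
    using that by (simp add: norm_divide del: minus_diff_eq)
   also have "... <= (s\<^sup>2 / 2) / s" using that by (intro divide_right_mono iexp_minus_linear_le) simp
   finally show ?thesis using that by (simp add: power2_eq_square)
  qed
  thus "\<forall>\<^sub>F s in at_right 0. norm ((1 - iexp s) / s + \<i>) <= s / 2" by (intro eventually_at_rightI[of 0 1]) auto
  show "((%s::real. s / 2) \<longlongrightarrow> 0) (at_right 0)" by real_asymp
 qed
 from tendsto_add[OF this tendsto_const[of "- \<i>"]]
 have "((%s::real. (1 - iexp s) / s) \<longlongrightarrow> - \<i>) (at_right 0)" by simp
 hence "((%s::real. ((1 - iexp s) / s) powr of_real a) \<longlongrightarrow> (- \<i>) powr of_real a) (at_right 0)"
  by (intro tendsto_powr_complex tendsto_const) (auto simp: complex_nonpos_Reals_iff)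
 moreover have "(- \<i>) powr of_real a = iexp (- (a * pi / 2))" by (simp add: powr_def algebra_simps)
 ultimately have "\<forall>\<^sub>F s::real in at_right 0. dist (((1 - iexp s) / s) powr of_real a) (iexp (- (a * pi / 2))) < e"
  using assms by (auto dest: tendstoD)
 then obtain d0 where d0: "0 < d0" "!!s. 0 < s ==> s < d0 ==>
   dist (((1 - iexp s) / s) powr of_real a) (iexp (- (a * pi / 2))) < e" unfolding eventually_at_right_field by auto
 define d where "d = min d0 1"
 have pos: "norm ((1 - iexp s) powr of_real a - of_real (s powr a) * iexp (- (a * pi / 2))) <= e * s powr a"
  if s: "0 < s" "s < d" for s
 proof -
  have ne: "(1 - iexp s) / s ~= 0" using iexp_ne_1[of s] s by (auto simp: d_def)
  \<comment> \<open>A positive real factor may be taken out of the principal power.\<close>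
  have "(1 - iexp s) powr of_real a = (of_real s * ((1 - iexp s) / s)) powr of_real a" using s by simp
  also have "... = of_real s powr of_real a * ((1 - iexp s) / s) powr of_real a" using s ne Ln_times_of_real[OF s(1) ne]
   unfolding powr_def by (simp add: Ln_of_real distrib_left exp_add del: nonzero_mult_div_cancel_left times_divide_eq_right)
  also have "of_real s powr of_real a = (of_real (s powr a) :: complex)" using s by (simp add: powr_of_real)
  finally have "(1 - iexp s) powr of_real a - of_real (s powr a) * iexp (- (a * pi / 2))
    = of_real (s powr a) * (((1 - iexp s) / s) powr of_real a - iexp (- (a * pi / 2)))" by (simp add: algebra_simps)
  hence "norm ((1 - iexp s) powr of_real a - of_real (s powr a) * iexp (- (a * pi / 2)))
    = s powr a * dist (((1 - iexp s) / s) powr of_real a) (iexp (- (a * pi / 2)))" by (simp add: norm_mult dist_norm)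
  also have "... <= s powr a * e" using d0(2)[of s] s by (intro mult_left_mono) (auto simp: d_def)
  finally show ?thesis by (simp add: mult.commute)
 qed
 show ?thesis
 proof (rule that[of d])
  show "0 < d" using d0 by (simp add: d_def)
  fix s :: real assume s: "s ~= 0" "|s| < d"
  show "norm ((1 - iexp s) powr of_real a - of_real ( |s| powr a) * iexp (- (sgn s * (a * pi / 2)))) <= e * |s| powr a"
  proof (cases "0 < s")
   case False
   hence s': "0 < - s" "- s < d" using s by auto
   have c: "(1 - iexp s) powr of_real a = cnj ((1 - iexp (- s)) powr of_real a)"
    by (subst cnj_powr) (auto simp: exp_cnj Re_exp Im_exp)
   have "norm ((1 - iexp s) powr of_real a - of_real ( |s| powr a) * iexp (- (sgn s * (a * pi / 2))))
     = norm (cnj ((1 - iexp (- s)) powr of_real a - of_real ((- s) powr a) * iexp (- (a * pi / 2))))"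
    using s' unfolding complex_cnj_diff complex_cnj_mult c[symmetric] by (simp add: exp_cnj)
   also have "... <= e * (- s) powr a" unfolding complex_mod_cnj by (rule pos[OF s'])
   finally show ?thesis using s' by simp
  qed (use pos[of s] s in simp)
 qed
qed

section \<open>Characteristic function of one signed step\<close>

context thaler_stable
begin

text \<open>For \<open>1 < al\<close> both factors are negative: the angle lies in the second
  quadrant, and Gamma is negative between \<open>- 1\<close> and \<open>0\<close>.\<close>

lemma g_const_pos: "0 < g_const al"
proof (cases "al < 1")
 case True
 hence "al * pi < 1 * pi" by (intro mult_strict_right_mono) auto
 moreover have "0 < al * pi" using al_bounds by simp
 moreover have "0 < cos (x / 2)" if "x < 1 * pi" "0 < x" for x using that by (intro cos_gt_zero_pi) linarith+
 ultimately have "0 < cos (al * pi / 2)" by blast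
 thus ?thesis using True unfolding g_const_def by (intro mult_pos_pos Gamma_real_pos) auto
next
 case False
 hence al1: "1 < al" "al < 2" using al_bounds by auto
 have "cos (x / 2) < 0" if "1 * pi < x" "x < 2 * pi" for x
 proof -
  have "0 < cos (pi - x / 2)" using that by (intro cos_gt_zero_pi) linarith+
  thus ?thesis by (simp add: cos_diff)
 qed
 hence "cos (al * pi / 2) < 0"
  using mult_strict_right_mono[OF al1(1) pi_gt_zero] mult_strict_right_mono[OF al1(2) pi_gt_zero] by blast
 moreover have "Gamma (1 - al) < 0"
 proof -
  have "0 < Gamma (1 + (1 - al))" using al1 by (intro Gamma_real_pos) auto
  also have "Gamma (1 + (1 - al)) = (1 - al) * Gamma (1 - al)"
   using Gamma_plus1[of "1 - al"] Gamma_ne Gamma_eq_zero_iff[of "1 - al"] by (simp add: add.commute)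
  finally show ?thesis using al1 by (simp add: zero_less_mult_iff)
 qed
 ultimately show ?thesis by (simp add: g_const_def mult_neg_neg)
qed

lemma d_const_eq: "d_const al = tconst * g_const al" by (simp add: d_const_def c0_eq[symmetric] tconst_def)

lemma d_const_pos: "0 < d_const al" by (simp add: d_const_eq tconst_pos g_const_pos)

lemma wmean_bounded: obtains G where "0 <= G" "!!y. xs <= y ==> y <= 1 ==> |wmean y| <= G"
 using decr_bounded[OF decr_wmean] by (intro that[of "|wmean 1| + |wmean xs|"]) auto

lemma wait_cf:
 assumes "0 < e"
 obtains d where "0 < d" "!!s y. s ~= 0 ==> |s| < d ==> xs <= y ==> y <= 1 ==>
  norm (\<E> (wait y) (%k. iexp (s * real (Suc k))) - 1 - (iexp s - 1) * wmean y
   + kaa y * (1 - iexp s) powr of_real al) <= e * |s| powr al"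
proof (cases "ga < 1")
 case True
 from wait_cf_gt_1[OF True `0 < e`] obtain d where d: "0 < d" "!!(s::real) (y::real). s ~= 0 ==> |s| < d ==> xs <= y ==> y <= 1 ==>
  norm (\<E> (wait y) (%k. iexp (s * real (Suc k))) - 1 - (iexp s - 1) * wmean y
   + kaa y * (1 - iexp s) powr of_real al) <= e * |s| powr al" by metis
 show ?thesis by (rule that[OF d])
next
 case False
 hence "1 < ga" using ga_ne by simp
 from wait_cf_lt_1[OF this `0 < e`] obtain d where d: "0 < d" "!!(s::real) (y::real). s ~= 0 ==> |s| < d ==> xs <= y ==> y <= 1 ==>
  norm (\<E> (wait y) (%k. iexp (s * real (Suc k))) - 1 + kaa y * (1 - iexp s) powr of_real al) <= e * |s| powr al" by metis
 show ?thesis by (rule that[OF d(1)]) (use d(2) False in \<open>simp add: wmean_def\<close>)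
qed

end

context sthaler
begin

definition expo :: "real => complex" where
 "expo s = of_real ( |s| powr al) * (1 - \<i> * of_real (be * sgn s * tan (al * pi / 2)))"

lemma Re_expo: "0 <= Re (expo s)" by (simp add: expo_def)

lemma expo_0 [simp]: "expo 0 = 0" by (simp add: expo_def)

lemma expo_scale: "0 < r ==> expo (r * s) = of_real (r powr al) * expo s" by (simp add: expo_def abs_mult powr_mult sgn_mult)

lemma stable_cf_eq: "0 < et ==> stable_cf al et be s = exp (- expo (et * s))"
 by (simp add: stable_cf_def expo_def abs_mult powr_mult sgn_mult)

text \<open>The two signs have conjugate phases. Their mixture is \<open>cos (al * pi / 2)\<close>
  times the skewness factor of the stable exponent; this cosine and the Gamma factor of
  \<open>kaa\<close> are what \<open>d_const\<close> collects.\<close>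

lemma kaa_expo: "of_real (kaa y * |s| powr al) * (b * iexp (- (sgn s * (al * pi / 2))) + (1 - b) * iexp (sgn s * (al * pi / 2)))
  = of_real (d_const al * rh y) * expo s"
proof (cases "s = 0")
 case False
 let ?c = "cos (al * pi / 2)" and ?S = "sin (al * pi / 2)"
 have c: "?c ~= 0" using g_const_pos by (auto simp: g_const_def)
 have e: "iexp t = of_real (cos t) + \<i> * of_real (sin t)" for t by (simp add: complex_eq_iff Re_exp Im_exp)
 have sg: "iexp (sgn s * x) = of_real (cos x) + \<i> * of_real (sgn s * sin x)"
  "iexp (- (sgn s * x)) = of_real (cos x) - \<i> * of_real (sgn s * sin x)" for x
  unfolding e using False by (cases "0 < s"; simp)+
 have "b * (of_real c - \<i> * of_real (u * v)) + (1 - b) * (of_real c + \<i> * of_real (u * v))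
   = of_real c - \<i> * of_real ((2 * b - 1) * u * v)" for c u v :: real by (simp add: algebra_simps)
 hence "b * iexp (- (sgn s * (al * pi / 2))) + (1 - b) * iexp (sgn s * (al * pi / 2))
   = of_real ?c - \<i> * of_real (be * sgn s * ?S)" unfolding sg b_bounds by simp
 also have "?S = ?c * tan (al * pi / 2)" using c by (simp add: tan_def)
 also have "of_real ?c - \<i> * of_real (be * sgn s * (?c * tan (al * pi / 2)))
   = of_real ?c * (1 - \<i> * of_real (be * sgn s * tan (al * pi / 2)))" by (simp only: of_real_mult algebra_simps mult_1_left)
 finally have *: "b * iexp (- (sgn s * (al * pi / 2))) + (1 - b) * iexp (sgn s * (al * pi / 2))
   = of_real ?c * (1 - \<i> * of_real (be * sgn s * tan (al * pi / 2)))" .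
 show ?thesis unfolding * expo_def kaa_def d_const_eq g_const_def by (simp only: of_real_mult ac_simps)
qed simp

text \<open>Centring by the conditional mean removes the term of order \<^term>\<open>s\<close>.\<close>

lemma step_cf:
 assumes "0 < e"
 obtains d where "0 < d" "!!s y. s ~= 0 ==> |s| < d ==> xs <= y ==> y <= 1 ==>
  norm (iexp (- (s * be * wmean y)) * \<E> (step y) (%z. iexp (s * jump z)) - 1
   + of_real (d_const al * rh y) * expo s) <= e * |s| powr al"
proof -
 obtain G where G: "0 <= G" "!!y. xs <= y ==> y <= 1 ==> |wmean y| <= G" by (rule wmean_bounded) blast
 obtain K where K: "0 < K" "!!y. xs <= y ==> y <= 1 ==> |kaa y| <= K" by (rule kaa_bounded) blast
 obtain d1 where d1: "0 < d1" "!!s y. s ~= 0 ==> |s| < d1 ==> xs <= y ==> y <= 1 ==>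
  norm (\<E> (wait y) (%k. iexp (s * real (Suc k))) - 1 - (iexp s - 1) * wmean y
   + kaa y * (1 - iexp s) powr of_real al) <= (e / 4) * |s| powr al"
  using wait_cf[of "e / 4"] assms by (metis divide_pos_pos zero_less_numeral)
 have "0 < e / (4 * K)" using assms K by simp
 then obtain d2 where d2: "0 < d2" "!!s. s ~= 0 ==> |s| < d2 ==>
  norm ((1 - iexp s) powr of_real al - of_real ( |s| powr al) * iexp (- (sgn s * (al * pi / 2)))) <= (e / (4 * K)) * |s| powr al"
  by (rule one_minus_iexp_powr) blast
 \<comment> \<open>Collects the quadratic errors of the linearisations and the product of phase and
   main term; both are negligible against \<open>|s| powr al\<close>, the former because
   \<open>al < 2\<close>.\<close>
 have "((%s::real. |s| powr (2 - al) * (G / 2 + G\<^sup>2 / 2) + K * G * |s| ) \<longlongrightarrow> 0 powr (2 - al) * (G / 2 + G\<^sup>2 / 2) + K * G * 0) (at 0)"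
  using al_bounds by (intro tendsto_intros tendsto_powr' tendsto_rabs_zero) auto
 hence "\<forall>\<^sub>F s::real in at 0. |s| powr (2 - al) * (G / 2 + G\<^sup>2 / 2) + K * G * |s| < e / 2"
  using assms by (intro order_tendstoD(2)) auto
 then obtain d3 where d3: "0 < d3" "!!s::real. s ~= 0 ==> |s| < d3 ==> |s| powr (2 - al) * (G / 2 + G\<^sup>2 / 2) + K * G * |s| < e / 2"
  unfolding eventually_at by (auto simp: dist_real_def)
 show ?thesis
 proof (rule that[of "min d1 (min d2 d3)"])
  show "0 < min d1 (min d2 d3)" using d1 d2 d3 by simp
  fix s y :: real assume s: "s ~= 0" "|s| < min d1 (min d2 d3)" and y: "xs <= y" "y <= 1"
  let ?g = "wmean y" and ?a = "|s| powr al"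
  define E where "E = (%s. \<E> (wait y) (%k. iexp (s * real (Suc k))))"
  define Q0 where "Q0 = (%s. of_real (kaa y * |s| powr al) * iexp (- (sgn s * (al * pi / 2))))"
  define R where "R = (%s. E s - 1 - \<i> * s * ?g + Q0 s)"
  have R: "norm (R u) <= (e / 2) * ?a + s\<^sup>2 * (G / 2)" if "u = s \<or> u = - s" for u
  proof -
   have u: "u ~= 0" "|u| = |s|" using that s by auto
   let ?A = "(1 - iexp u) powr of_real al"
   have "R u = (E u - 1 - (iexp u - 1) * ?g + kaa y * ?A) + (iexp u - 1 - \<i> * u) * ?g
     - kaa y * (?A - of_real ( |u| powr al) * iexp (- (sgn u * (al * pi / 2))))" by (simp add: R_def Q0_def algebra_simps)
   also have "norm ... <= norm (E u - 1 - (iexp u - 1) * ?g + kaa y * ?A) + norm ((iexp u - 1 - \<i> * u) * ?g)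
     + norm (kaa y * (?A - of_real ( |u| powr al) * iexp (- (sgn u * (al * pi / 2)))))"
    by (intro order_trans[OF norm_triangle_ineq4] add_mono norm_triangle_ineq order_refl)
   also have "... <= (e / 4) * |u| powr al + (u\<^sup>2 / 2) * G + K * ((e / (4 * K)) * |u| powr al)"
    unfolding norm_mult E_def norm_of_real
    using u s y by (intro add_mono mult_mono d1 d2 G K iexp_minus_linear_le) (auto simp: K less_imp_le)
   also have "... = (e / 2) * ?a + s\<^sup>2 * (G / 2)" using K u by (simp add: field_simps) (metis power2_abs)
   finally show ?thesis .
  qed
  define Q where "Q = of_real (d_const al * rh y) * expo s"
  have Qe: "Q = b * Q0 s + (1 - b) * Q0 (- s)" unfolding Q_def kaa_expo[symmetric] Q0_def by (simp add: sgn_minus algebra_simps)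
  have Q: "norm Q <= K * ?a"
  proof -
   have n: "norm (Q0 u) <= K * ?a" if "|u| = |s|" for u using K(2)[OF y] that by (simp add: Q0_def norm_mult mult_right_mono)
   have "norm Q <= norm (b * Q0 s) + norm ((1 - b) * Q0 (- s))" unfolding Qe by (rule norm_triangle_ineq)
   also have "... = b * norm (Q0 s) + (1 - b) * norm (Q0 (- s))" unfolding norm_mult norm_of_real using b_bounds by simp
   also have "... <= b * (K * ?a) + (1 - b) * (K * ?a)" using b_bounds n by (intro add_mono mult_left_mono) auto
   also have "... = K * ?a" by (simp only: distrib_right[symmetric]) simp
   finally show ?thesis .
  qed
  define x where "x = s * be * ?g"
  have x: "|x| <= |s| * G"
  proof -
   have "|x| = |s| * |be * ?g|" by (simp add: x_def abs_mult)
   also have "... <= |s| * G" using be_mult_le[of ?g] G(2)[OF y] by (intro mult_left_mono) auto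
   finally show ?thesis .
  qed
  define R' where "R' = b * R s + (1 - b) * R (- s)"
  have R': "norm R' <= (e / 2) * ?a + s\<^sup>2 * (G / 2)" (is "_ <= ?r")
  proof -
   have "norm R' <= norm (b * R s) + norm ((1 - b) * R (- s))" unfolding R'_def by (rule norm_triangle_ineq)
   also have "... = b * norm (R s) + (1 - b) * norm (R (- s))" unfolding norm_mult norm_of_real using b_bounds by simp
   also have "... <= b * ?r + (1 - b) * ?r" using b_bounds R by (intro add_mono mult_left_mono) auto
   also have "... = ?r" by (simp only: distrib_right[symmetric]) simp
   finally show ?thesis .
  qed
  have ES: "\<E> (step y) (%z. iexp (s * jump z)) = b * E s + (1 - b) * E (- s)"
   by (subst expectation_step_complex[where B = 1]) (auto simp: E_def jump_def simp del: of_nat_Suc)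
  also have "... = 1 + \<i> * s * (2 * b - 1) * ?g - Q + R'" unfolding R'_def R_def Qe by (simp add: algebra_simps)
  also have "... = 1 + \<i> * x - Q + R'" unfolding b_bounds(3) x_def by simp
  finally have ES: "\<E> (step y) (%z. iexp (s * jump z)) = 1 + \<i> * x - Q + R'" .
  have "iexp (- x) * (1 + \<i> * x - Q + R') - 1 + Q = iexp (- x) * (R' - (iexp x - 1 - \<i> * x)) - Q * (iexp (- x) - 1)"
   by (simp add: algebra_simps flip: exp_add)
  also have "norm ... <= norm (R' - (iexp x - 1 - \<i> * x)) + norm Q * norm (iexp (- x) - 1)"
   by (rule order_trans[OF norm_triangle_ineq4]) (simp add: norm_mult)
  also have "... <= (?r + x\<^sup>2 / 2) + (K * ?a) * |x|"
  proof (intro add_mono mult_mono Q)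
   show "norm (R' - (iexp x - 1 - \<i> * x)) <= ?r + x\<^sup>2 / 2"
    by (rule order_trans[OF norm_triangle_ineq4 add_mono[OF R' iexp_minus_linear_le]])
   show "norm (iexp (- x) - 1) <= |x|" using iexp_minus_1_le[of "- x"] by simp
  qed (use K in auto)
  also have "... <= (?r + ( |s| * G)\<^sup>2 / 2) + (K * ?a) * ( |s| * G)"
   using x K assms power_mono[of "|x|" "|s| * G" 2] by (intro add_mono mult_left_mono) auto
  also have "... = ?a * (e / 2 + ( |s| powr (2 - al) * (G / 2 + G\<^sup>2 / 2) + K * G * |s| ))"
  proof -
   have "s\<^sup>2 = ?a * |s| powr (2 - al)" using s(1) by (simp add: powr_add[symmetric])
   thus ?thesis by (simp add: power_mult_distrib algebra_simps)
  qed
  also have "... <= ?a * (e / 2 + e / 2)" using d3(2)[of s] s by (intro mult_left_mono add_left_mono) auto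
  finally show "norm (iexp (- (s * be * ?g)) * \<E> (step y) (%z. iexp (s * jump z)) - 1
   + of_real (d_const al * rh y) * expo s) <= e * ?a" unfolding ES Q_def[symmetric] x_def[symmetric] by (simp add: mult.commute)
 qed
qed

end

section \<open>Characteristic function of the sum over a block\<close>

lemma exp_lipschitz:
 fixes a b :: complex
 assumes "Re a <= 0" "Re b <= 0"
 shows "norm (exp a - exp b) <= norm (a - b)"
proof -
 have "norm (exp a - exp b) <= 1 * norm (a - b)"
 proof (rule field_differentiable_bound[where S = "{z. Re z <= 0}" and f' = exp])
  show "convex {z. Re z <= 0}" by (rule convex_halfspace_Re_le)
 qed (use assms in \<open>auto intro!: derivative_eq_intros\<close>)
 thus ?thesis by simp
qed

lemma exp_minus_linear_le: "norm (z :: complex) <= 1 ==> norm (exp z - 1 - z) <= 3 * (norm z)\<^sup>2"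
proof -
 assume z: "norm z <= 1"
 have "norm (exp z - 1 - z) <= exp |Re z| * (norm z)\<^sup>2"
  using Taylor_exp[of z 1] by (simp add: diff_diff_eq power2_eq_square)
 also have "exp |Re z| <= exp 1" using z abs_Re_le_cmod[of z] by simp
 also have "... <= 3" by (rule exp_le)
 finally show ?thesis by (simp add: mult_right_mono)
qed

lemma exp_minus_2_le: "0 <= x ==> x <= 1 / 2 ==> exp (- (2 * x)) <= 1 - x" for x :: real
proof -
 assume x: "0 <= x" "x <= 1 / 2"
 have "1 <= (1 - x) * (1 + 2 * x)" using x mult_left_mono[of x "1 / 2" x] by (simp add: algebra_simps)
 also have "... <= (1 - x) * exp (2 * x)" using x exp_ge_add_one_self[of "2 * x"] by (intro mult_left_mono) auto
 finally show ?thesis by (simp add: exp_minus field_simps)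
qed

context sthaler
begin

text \<open>Product of a state-dependent factor along the visited states; with conditional
  characteristic functions as factors it compensates the exponential of the sum.\<close>

primrec cprod :: "(real => complex) => real => (bool \<times> nat) list => complex" where "cprod c y [] = 1"
| "cprod c y (z # zs) = c y * cprod c (nxt y z) zs"

text \<open>Telescoping comparison of products whose factors lie in the unit disc.\<close>

lemma cprod_diff_le:
 assumes "!!y. xs <= y ==> y <= 1 ==> norm (c y) <= 1" "!!y. xs <= y ==> y <= 1 ==> norm (d y) <= 1"
  "!!y. xs <= y ==> y <= 1 ==> norm (c y - d y) <= e" "xs <= y" "y <= 1"
 shows "norm (cprod c y zs) <= 1 & norm (cprod d y zs) <= 1 & norm (cprod c y zs - cprod d y zs) <= real (length zs) * e"
 using assms(4,5)
proof (induction zs arbitrary: y)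
 case (Cons z zs)
 note y = Cons.prems
 let ?c = "cprod c (nxt y z) zs" and ?d = "cprod d (nxt y z) zs"
 have IH: "norm ?c <= 1" "norm ?d <= 1" "norm (?c - ?d) <= real (length zs) * e"
  using Cons.IH[of "nxt y z"] nxt_in[OF y] by auto
 have "c y * ?c - d y * ?d = (c y - d y) * ?c + d y * (?c - ?d)" by (simp add: algebra_simps)
 hence "norm (c y * ?c - d y * ?d) <= norm ((c y - d y) * ?c) + norm (d y * (?c - ?d))" by (metis norm_triangle_ineq)
 also have "... <= norm (c y - d y) * 1 + 1 * norm (?c - ?d)"
  unfolding norm_mult using IH assms(2)[OF y] by (intro add_mono mult_left_mono mult_right_mono) auto
 also have "... <= e + real (length zs) * e" using assms(3)[OF y] IH(3) by simp
 finally show ?case using IH assms(1,2)[OF y] by (auto simp: norm_mult algebra_simps intro!: mult_le_one)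
qed simp

lemma cprod_norm_ge:
 assumes "!!y. xs <= y ==> y <= 1 ==> r <= norm (c y)" "0 <= r" "xs <= y" "y <= 1"
 shows "r ^ length zs <= norm (cprod c y zs)" using assms(3,4)
proof (induction zs arbitrary: y)
 case (Cons z zs)
 thus ?case using Cons.IH[of "nxt y z"] nxt_in[of y z] assms(1)[of y] assms(2) by (auto simp: norm_mult intro!: mult_mono)
qed simp

lemma cprod_iexp: "cprod (%y. iexp (u * f y) * c y) y zs = iexp (u * msum (%y z. f y) y zs) * cprod c y zs"
 by (induction zs arbitrary: y) (simp_all add: distrib_left exp_add)

lemma cprod_exp_mult: "cprod (%y. exp (- (of_real (f y) * w))) y zs = exp (- (of_real (msum (%y z. f y) y zs) * w))"
 by (induction zs arbitrary: y) (simp_all add: algebra_simps flip: exp_add)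

lemma msum_shift: "msum (%y z. f y) y zs = msum (%y z. f y - a) y zs + real (length zs) * a"
 by (induction zs arbitrary: y) (simp_all add: algebra_simps)

text \<open>The exponential of the sum over the product of the conditional characteristic functions
  is a martingale; the lower bound \<open>r\<close> keeps the quotient bounded.\<close>

lemma expectation_csum_cprod:
 fixes s r :: real defines "c \<equiv> %y. \<E> (step y) (%z. iexp (s * cent z))"
 assumes c: "!!y. xs <= y ==> y <= 1 ==> r <= norm (c y)" and r: "0 < r" and y: "xs <= y" "y <= 1"
 shows "\<E> (chain n y) (%zs. iexp (s * csum zs) / cprod c y zs) = 1" using y
proof (induction n arbitrary: y)
 case (Suc n)
 note y = Suc.prems
 have "\<E> (chain (Suc n) y) (%zs. iexp (s * csum zs) / cprod c y zs) = \<E> (step y) (%z. \<E> (chain n (nxt y z))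
     (%zs. iexp (s * csum (z # zs)) / cprod c y (z # zs)))"
 proof (rule expectation_chain_Suc_complex[where B = "1 / r ^ Suc n"])
  fix zs assume "zs : set_pmf (chain (Suc n) y)"
  hence "length zs = Suc n" by (rule chain_len)
  hence ge: "r ^ Suc n <= norm (cprod c y zs)" using cprod_norm_ge[of r c y zs] c r y by simp
  from less_le_trans[OF zero_less_power[OF r, of "Suc n"] ge] ge have "1 / norm (cprod c y zs) <= 1 / r ^ Suc n"
   using r by (intro divide_left_mono mult_pos_pos) auto
  thus "norm (iexp (s * csum zs) / cprod c y zs) <= 1 / r ^ Suc n" by (simp add: norm_divide)
 qed
 also have "... = \<E> (step y) (%z. iexp (s * cent z) / c y *
   \<E> (chain n (nxt y z)) (%zs. iexp (s * csum zs) / cprod c (nxt y z) zs))"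
 proof (intro Bochner_Integration.integral_cong refl)
  fix z
  have "(%zs. iexp (s * csum (z # zs)) / cprod c y (z # zs))
    = (%zs. iexp (s * cent z) / c y * (iexp (s * csum zs) / cprod c (nxt y z) zs))" by (simp add: distrib_left exp_add)
  thus "\<E> (chain n (nxt y z)) (%zs. iexp (s * csum (z # zs)) / cprod c y (z # zs))
    = iexp (s * cent z) / c y * \<E> (chain n (nxt y z)) (%zs. iexp (s * csum zs) / cprod c (nxt y z) zs)"
   by (simp only: integral_mult_right_zero)
 qed
 also have "... = \<E> (step y) (%z. iexp (s * cent z) / c y)" using Suc.IH nxt_in[OF y] by simp
 also have "... = c y / c y" by (simp add: c_def)
 also have "... = 1" using c[OF y] r by auto
 finally show ?case .
qed simp

text \<open>If the product of the conditional characteristic functions is close to a constant, then so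
  is the characteristic function of the sum.\<close>

lemma csum_cf_close:
 fixes s r e :: real and a :: complex defines "c \<equiv> %y. \<E> (step y) (%z. iexp (s * cent z))"
 assumes c: "!!y. xs <= y ==> y <= 1 ==> r <= norm (c y)" and r: "0 < r" and y: "xs <= y" "y <= 1"
  and a: "norm a <= 1" and e: "0 <= e" and A: "!!zs. length zs = n ==> zs \<notin> A ==> norm (cprod c y zs - a) <= e"
 shows "norm (\<E> (chain n y) (%zs. iexp (s * csum zs)) - a) <= (e + 2 * \<P> (chain n y) A) / r ^ n"
proof -
 let ?p = "chain n y" and ?J = "%zs. iexp (s * csum zs)" and ?P = "cprod c y"
 have len: "length zs = n" if "zs : set_pmf ?p" for zs using that by (rule chain_len)
 have ge: "r ^ n <= norm (?P zs)" if "length zs = n" for zs using cprod_norm_ge[of r c y zs] c r y that by simp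
 have c1: "norm (c y) <= 1" for y unfolding c_def by (rule norm_exp_pmf) simp
 have P1: "norm (?P zs) <= 1" for zs using cprod_diff_le[of c c 0 y zs] c1 y by simp
 have inv: "1 / norm (?P zs) <= 1 / r ^ n" if "length zs = n" for zs
  using ge[OF that] r less_le_trans[OF zero_less_power[OF r] ge[OF that]] by (intro divide_left_mono mult_pos_pos) auto
 have iJ: "integrable (measure_pmf ?p) ?J" by (rule int_pmf_bdd[where B = 1]) simp
 have iJP: "integrable (measure_pmf ?p) (%zs. ?J zs / ?P zs)"
  by (rule int_pmf_bdd[where B = "1 / r ^ n"]) (use inv len in \<open>simp add: norm_divide\<close>)
 \<comment> \<open>Multiplies \<open>a\<close> by the martingale expectation \<open>1\<close>, so
   that only the distance of the product to \<open>a\<close> remains to be estimated.\<close>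
 have "\<E> ?p ?J - a = \<E> ?p ?J - a * \<E> ?p (%zs. ?J zs / ?P zs)"
  using expectation_csum_cprod[of r s y n] c r y unfolding c_def by simp
 also have "... = \<E> ?p (%zs. ?J zs - a * (?J zs / ?P zs))"
  by (simp only: Bochner_Integration.integral_diff[OF iJ integrable_mult_right[OF iJP]] integral_mult_right_zero)
 finally have "norm (\<E> ?p ?J - a) <= \<E> ?p (%zs. norm (?J zs - a * (?J zs / ?P zs)))" by (simp only: integral_norm_bound)
 also have "... <= \<E> ?p (%zs. (e + 2 * indicator A zs) / r ^ n)"
 proof (rule integral_mono_AE)
  show "integrable (measure_pmf ?p) (%zs. norm (?J zs - a * (?J zs / ?P zs)))"
   using iJ iJP by (intro integrable_norm Bochner_Integration.integrable_diff integrable_mult_right) auto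
  show "integrable (measure_pmf ?p) (%zs. (e + 2 * indicator A zs) / r ^ n)" by (rule int_pmf_bdd[where B = "(e + 2) / r ^ n"])
    (use e r in \<open>auto simp: indicator_def intro!: divide_right_mono\<close>)
  show "AE zs in measure_pmf ?p. norm (?J zs - a * (?J zs / ?P zs)) <= (e + 2 * indicator A zs) / r ^ n"
   unfolding AE_measure_pmf_iff
  proof
   fix zs assume "zs : set_pmf ?p"
   hence l: "length zs = n" by (rule len)
   have ne: "?P zs ~= 0" using less_le_trans[OF zero_less_power[OF r, of n] ge[OF l]] by simp
   have "?J zs - a * (?J zs / ?P zs) = ?J zs * ((?P zs - a) / ?P zs)" using ne by (simp add: field_simps)
   hence "norm (?J zs - a * (?J zs / ?P zs)) = norm (?P zs - a) * (1 / norm (?P zs))" by (simp add: norm_mult norm_divide)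
   also have "... <= (e + 2 * indicator A zs) * (1 / r ^ n)"
   proof (intro mult_mono inv l)
    have "norm (?P zs - a) <= 2" using P1[of zs] a by (intro order_trans[OF norm_triangle_ineq4]) linarith
    thus "norm (?P zs - a) <= e + 2 * indicator A zs" using A[OF l] e by (cases "zs : A") auto
   qed (use e in auto)
   finally show "norm (?J zs - a * (?J zs / ?P zs)) <= (e + 2 * indicator A zs) / r ^ n" by simp
  qed
 qed
 also have "... = (e + 2 * \<P> ?p A) / r ^ n"
 proof -
  have "integrable (measure_pmf ?p) (indicator A :: _ => real)" by (rule int_pmf_bdd[where B = 1]) (simp add: indicator_def)
  thus ?thesis by simp
 qed
 finally show ?thesis .
qed

end

context sthaler
begin

definition scl :: "real => nat => real" where "scl et n = et * (real n powr (- ga) * d_const al powr (- ga))"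

lemma scl_pos: "0 < et ==> 0 < n ==> 0 < scl et n" using d_const_pos by (simp add: scl_def)

lemma scl_tendsto: "scl et ----> 0"
proof -
 have "(%n. real n powr (- ga)) ----> 0" using ga_pos by (intro tendsto_neg_powr filterlim_real_sequentially) auto
 hence "(%n. et * (real n powr (- ga) * d_const al powr (- ga))) ----> et * (0 * d_const al powr (- ga))"
  by (intro tendsto_intros)
 thus ?thesis by (simp add: scl_def[abs_def])
qed

lemma scl_powr: "0 < et ==> 0 < n ==> scl et n powr al = et powr al / (real n * d_const al)"
proof -
 assume "0 < et" "0 < n"
 have "(x powr (- ga)) powr al = 1 / x" if "0 < x" for x
 proof -
  have "(x powr (- ga)) powr al = x powr (- ga * al)" by (rule powr_powr)
  also have "- ga * al = - 1" using ga_pos by simp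
  finally show ?thesis using that by (simp add: powr_minus_divide)
 qed
 thus ?thesis using d_const_pos `0 < et` `0 < n` by (simp add: scl_def powr_mult del: times_divide_eq_left)
qed

text \<open>Because \<open>1 / 2 < ga\<close>, fluctuations of order \<open>sqrt n\<close>, as those
  of the conditional means, vanish on the stable scale.\<close>

lemma scl_square_tendsto: "(%n. real n * (scl et n)\<^sup>2) ----> 0"
proof -
 have "(%n. real n powr (1 - 2 * ga)) ----> 0" using ga_half by (intro tendsto_neg_powr filterlim_real_sequentially) auto
 hence lim: "(%n. et\<^sup>2 * (d_const al powr (- ga))\<^sup>2 * real n powr (1 - 2 * ga)) ----> et\<^sup>2 * (d_const al powr (- ga))\<^sup>2 * 0"
  by (intro tendsto_intros)
 have "et\<^sup>2 * (d_const al powr (- ga))\<^sup>2 * real n powr (1 - 2 * ga) = real n * (scl et n)\<^sup>2" if "0 < n" for n :: nat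
 proof -
  have "real n powr (1 - 2 * ga) = real n * (real n powr (- ga))\<^sup>2"
   using that powr_add[of "real n" 1 "- 2 * ga"] powr_powr[of "real n" "- ga" 2] by (simp add: mult.commute)
  thus ?thesis by (simp add: scl_def power_mult_distrib algebra_simps)
 qed
 hence "\<forall>\<^sub>F n in sequentially. et\<^sup>2 * (d_const al powr (- ga))\<^sup>2 * real n powr (1 - 2 * ga) = real n * (scl et n)\<^sup>2"
  by (auto intro!: eventually_at_top_linorderI[of 1])
 with lim show ?thesis using Lim_transform_eventually by fastforce
qed

lemma msum_nonneg:
 assumes "!!y z. xs <= y ==> y <= 1 ==> 0 <= D y z" "xs <= y" "y <= 1"
 shows "0 <= msum D y zs" using assms(2,3)
proof (induction zs arbitrary: y)
 case (Cons z zs)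
 thus ?case using Cons.IH[of "nxt y z"] nxt_in[of y z] assms(1)[of y z] by auto
qed simp

text \<open>Each conditional characteristic function is close to a phase from the conditional mean
  times \<open>exp (- (rh y * Ps / n))\<close>. The product then depends on the path through the
  sums of \<open>wmean\<close> and \<open>rh\<close> only, and the law of large numbers controls
  both outside a set of small probability.\<close>

lemma block_cf:
 assumes et: "0 < et" and N: "(%n. real (N n) / real n) ----> t" and "0 < e"
 shows "\<forall>\<^sub>F n in sequentially. ALL y. xs <= y --> y <= 1 -->
  norm (\<E> (chain (N n) y) (%zs. iexp (thh * (scl et n * csum zs))) - exp (- (of_real t * expo (et * thh)))) <= e"
proof (cases "thh = 0")
 case True
 thus ?thesis using `0 < e` by simp
next
 case False
 define s where "s = (%n. scl et n * thh)"
 define Ps where "Ps = expo (et * thh)"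
 define A where "A = |et * thh| powr al"
 let ?d = "d_const al"
 have t: "0 <= t" by (rule LIMSEQ_le_const[OF N]) auto
 have A: "0 <= A" by (simp add: A_def)
 have s_powr: "|s n| powr al = A / (real n * ?d)" if "0 < n" for n
  using scl_powr[OF et that] scl_pos[OF et that] et by (simp add: s_def A_def abs_mult powr_mult)
 have s_ne: "s n ~= 0" if "0 < n" for n using scl_pos[OF et that] False by (simp add: s_def)
 have s_expo: "of_real (?d * r) * expo (s n) = of_real r * (Ps / n)" if "0 < n" for n r
 proof -
  define u where "u = real n powr (- ga) * ?d powr (- ga)"
  have u: "0 < u" using that d_const_pos by (simp add: u_def)
  have "u powr al = 1 / (real n * ?d)" using scl_powr[of 1 n] that by (simp add: u_def scl_def)
  moreover have "expo (s n) = of_real (u powr al) * Ps"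
   unfolding Ps_def expo_scale[OF u, symmetric] by (simp add: s_def scl_def u_def algebra_simps)
  ultimately show ?thesis using d_const_pos by simp
 qed
 have q: "0 < q 1" "q 1 < 1" using q_bds[of 1] by auto
 define K2 where "K2 = norm Ps / q 1"
 have K2: "0 <= K2" using q by (simp add: K2_def)
 have rhPs: "norm (of_real (rh y) * (Ps / n)) <= K2 / n" if "xs <= y" "y <= 1" for y and n :: nat
 proof -
  have "rh y * norm Ps <= (1 / q 1) * norm Ps" using rh_bounds[OF that] by (intro mult_right_mono) auto
  hence "rh y * norm Ps / n <= K2 / n" by (intro divide_right_mono) (auto simp: K2_def)
  thus ?thesis using rh_bounds[OF that] by (simp add: norm_mult norm_divide)
 qed
 \<comment> \<open>Each factor has modulus at least \<open>1 - K' / n\<close>: \<open>K2\<close>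
   accounts for the main term, \<open>1\<close> for its error. Over at most
   \<open>(t + 1) * n\<close> steps the product stays above \<open>1 / R\<close>.\<close>
 define K' where "K' = K2 + 1"
 define R where "R = exp (2 * K' * (t + 1))"
 have R: "0 < R" by (simp add: R_def)
 \<comment> \<open>The comparison of products costs \<open>4 * ep\<close>, the two exceptional sets
   cost twice \<open>2 * ep\<close>, and division by the product costs the factor
   \<open>R\<close>.\<close>
 define ep where "ep = e / (8 * R)"
 have ep: "0 < ep" using `0 < e` R by (simp add: ep_def)
 define e1 where "e1 = min 1 (ep / (2 * (t + 1)))"
 have e1: "0 < e1" "e1 <= 1" "e1 <= ep / (2 * (t + 1))" using ep t by (auto simp: e1_def)
 define e2 where "e2 = e1 * ?d / (A + 1)"
 have "0 < e2" using e1 A d_const_pos by (simp add: e2_def)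
 then obtain de where de: "0 < de" "!!s y. s ~= 0 ==> |s| < de ==> xs <= y ==> y <= 1 ==>
  norm (iexp (- (s * be * wmean y)) * \<E> (step y) (%z. iexp (s * jump z)) - 1
   + of_real (?d * rh y) * expo s) <= e2 * |s| powr al" by (rule step_cf) blast
 define w1 where "w1 = osc wmean / q 1"
 define w2 where "w2 = osc rh / q 1"
 define h where "h = ep / (norm Ps + 1)"
 define l2 where "l2 = (%n. real n * h)"
 have c0: "0 < h" using ep by (simp add: h_def add_nonneg_pos)
 have s0: "s ----> 0" using tendsto_mult[OF scl_tendsto[of et] tendsto_const[of thh]] by (simp add: s_def)
 have ev: "\<forall>\<^sub>F n in sequentially. 0 < n & |s n| < de & real (N n) / n < t + 1 & K' / n < 1 / 2
  & 3 * K2\<^sup>2 / n < ep / (2 * (t + 1)) & |real (N n) / n - t| * norm Ps < ep & 6 * w1 * |s n| < ep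
  & 16 * w1\<^sup>2 * (t + 1) * (real n * (s n)\<^sup>2) / ep\<^sup>2 < ep & 6 * w2 / h < real n
  & (16 * w2\<^sup>2 * (t + 1) / h\<^sup>2) / n < ep"
 proof (intro eventually_conj)
  have inv: "(%n. c / real n) ----> 0" for c by (rule lim_const_over_n)
  show "\<forall>\<^sub>F n in sequentially. 0 < n" by (rule eventually_gt_at_top)
  show "\<forall>\<^sub>F n in sequentially. |s n| < de" using tendsto_rabs[OF s0] de by (intro order_tendstoD) auto
  show "\<forall>\<^sub>F n in sequentially. real (N n) / n < t + 1" using N by (intro order_tendstoD) auto
  show "\<forall>\<^sub>F n in sequentially. K' / real n < 1 / 2" using inv by (intro order_tendstoD) auto
  show "\<forall>\<^sub>F n in sequentially. 3 * K2\<^sup>2 / real n < ep / (2 * (t + 1))" using inv ep t by (intro order_tendstoD[OF inv]) auto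
  show "\<forall>\<^sub>F n in sequentially. (16 * w2\<^sup>2 * (t + 1) / h\<^sup>2) / real n < ep"
   using ep by (intro order_tendstoD[OF inv])
  have "(%n. |real (N n) / n - t| * norm Ps) ----> |t - t| * norm Ps" by (intro tendsto_intros N)
  thus "\<forall>\<^sub>F n in sequentially. |real (N n) / n - t| * norm Ps < ep" using ep by (intro order_tendstoD) auto
  have "(%n. 6 * w1 * |s n| ) ----> 6 * w1 * |0|" by (intro tendsto_intros s0)
  thus "\<forall>\<^sub>F n in sequentially. 6 * w1 * |s n| < ep" using ep by (intro order_tendstoD) auto
  have "(%n. 16 * w1\<^sup>2 * (t + 1) * ((real n * (scl et n)\<^sup>2) * thh\<^sup>2) / ep\<^sup>2) ----> 16 * w1\<^sup>2 * (t + 1) * (0 * thh\<^sup>2) / ep\<^sup>2"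
   using ep by (intro tendsto_intros scl_square_tendsto) auto
  hence "(%n. 16 * w1\<^sup>2 * (t + 1) * (real n * (s n)\<^sup>2) / ep\<^sup>2) ----> 0"
   by (simp add: s_def power_mult_distrib mult.assoc)
  thus "\<forall>\<^sub>F n in sequentially. 16 * w1\<^sup>2 * (t + 1) * (real n * (s n)\<^sup>2) / ep\<^sup>2 < ep" using ep by (intro order_tendstoD)
  show "\<forall>\<^sub>F n in sequentially. 6 * w2 / h < real n"
   using filterlim_real_sequentially by (simp add: filterlim_at_top_dense)
 qed
 thus ?thesis
 proof (rule eventually_mono, elim conjE, intro allI impI)
  fix n y
  assume n: "0 < n" and sn: "|s n| < de" and Nn: "real (N n) / n < t + 1" and Kn: "K' / n < 1 / 2"
   and K2n: "3 * K2\<^sup>2 / n < ep / (2 * (t + 1))" and Nt: "|real (N n) / n - t| * norm Ps < ep"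
   and w1: "6 * w1 * |s n| < ep" "16 * w1\<^sup>2 * (t + 1) * (real n * (s n)\<^sup>2) / ep\<^sup>2 < ep"
   and w2: "6 * w2 / h < real n" "(16 * w2\<^sup>2 * (t + 1) / h\<^sup>2) / n < ep" and y: "xs <= y" "y <= 1"
  \<comment> \<open>\<open>V\<close> is centred by the conditional mean of the current state,
    \<open>c\<close> by the overall mean; \<open>U\<close> is the exponential form of the expansion
    of \<open>V\<close>.\<close>
  define V where "V = (%y. iexp (- (s n * be * wmean y)) * \<E> (step y) (%z. iexp (s n * jump z)))"
  define U where "U = (%y. exp (- (of_real (rh y) * (Ps / n))))"
  define c where "c = (%y. \<E> (step y) (%z. iexp (s n * cent z)))"
  have NnR: "real (N n) <= (t + 1) * n" using Nn n by (simp add: field_simps)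
  have cV: "c = (%y. iexp ((s n * be) * (wmean y - ell)) * V y)"
  proof
   fix y
   have "(%z. iexp (s n * cent z)) = (%z. iexp (- (s n * be * ell)) * iexp (s n * jump z))"
    by (intro ext) (simp add: cent_def algebra_simps flip: exp_add)
   hence "c y = iexp (- (s n * be * ell)) * \<E> (step y) (%z. iexp (s n * jump z))"
    unfolding c_def by (simp only: integral_mult_right_zero)
   also have "iexp (- (s n * be * ell)) = iexp ((s n * be) * (wmean y - ell)) * iexp (- (s n * be * wmean y))"
    by (simp add: algebra_simps flip: exp_add)
   finally show "c y = iexp ((s n * be) * (wmean y - ell)) * V y" by (simp add: V_def mult.assoc)
  qed
  have V1: "norm (V y) <= 1" for y unfolding V_def norm_mult by (simp add: norm_exp_pmf)
  have U1: "norm (U y) <= 1" if "xs <= y" "y <= 1" for y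
   using rh_bounds[OF that] Re_expo[of "et * thh"] by (simp add: U_def Ps_def)
  have e2s: "e2 * |s n| powr al <= e1 / n"
  proof -
   have "e2 * |s n| powr al = (e1 / n) * (A / (A + 1))"
    using d_const_pos n unfolding s_powr[OF n] e2_def by (simp add: field_simps)
   also have "... <= (e1 / n) * 1" using A e1 by (intro mult_left_mono) auto
   finally show ?thesis by simp
  qed
  have V: "norm (V y - 1 + of_real (rh y) * (Ps / n)) <= e1 / n" if "xs <= y" "y <= 1" for y
   using de(2)[OF s_ne[OF n] sn that] e2s unfolding s_expo[OF n] V_def by linarith
  have VU: "norm (V y - U y) <= ep / (t + 1) / n" if y: "xs <= y" "y <= 1" for y
  proof -
   let ?z = "- (of_real (rh y) * (Ps / n))"
   have z: "norm ?z <= K2 / n" unfolding norm_minus_cancel by (rule rhPs[OF y])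
   moreover have "K2 / n <= K' / n" by (simp add: K'_def divide_right_mono)
   ultimately have "norm (U y - 1 - ?z) <= 3 * (norm ?z)\<^sup>2" unfolding U_def using Kn by (intro exp_minus_linear_le) linarith
   also have "... <= 3 * (K2 / n)\<^sup>2" using z by (intro mult_left_mono power_mono) auto
   also have "... = (3 * K2\<^sup>2 / n) / n" by (simp add: power2_eq_square)
   also have "... <= (ep / (2 * (t + 1))) / n" using K2n by (intro divide_right_mono) auto
   finally have u: "norm (U y - 1 - ?z) <= (ep / (2 * (t + 1))) / n" .
   have v: "norm (V y - 1 - ?z) <= (ep / (2 * (t + 1))) / n" using V[OF y] divide_right_mono[OF e1(3), of "real n"] by simp
   have "norm (V y - U y) <= norm (V y - 1 - ?z) + norm (U y - 1 - ?z)"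
    using norm_triangle_ineq4[of "V y - 1 - ?z" "U y - 1 - ?z"] by simp
   also have "... <= (ep / (2 * (t + 1))) / n + (ep / (2 * (t + 1))) / n" by (rule add_mono[OF v u])
   also have "... = ep / (t + 1) / n"
   proof -
    have "x / (2 * u) + x / (2 * u) = x / u" for x u :: real by (cases "u = 0") (simp_all add: field_simps)
    from this[of ep "t + 1"] show ?thesis by (simp only: add_divide_distrib[symmetric])
   qed
   finally show ?thesis .
  qed
  define r where "r = 1 - K' / n"
  have K'n: "0 <= K' / n" using K2 by (simp add: K'_def)
  have r: "0 < r" using Kn unfolding r_def by linarith
  have rc: "r <= norm (c y)" if y: "xs <= y" "y <= 1" for y
  proof -
   have "norm (c y) = norm (V y)" by (simp add: cV norm_mult)
   moreover have "1 - norm (1 - V y) <= norm (V y)" using norm_triangle_ineq2[of 1 "1 - V y"] by simp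
   moreover have "norm (1 - V y) <= norm (V y - 1 + of_real (rh y) * (Ps / n)) + norm (of_real (rh y) * (Ps / n))"
    using norm_triangle_ineq4[of "of_real (rh y) * (Ps / n)" "V y - 1 + of_real (rh y) * (Ps / n)"] by simp
   moreover have "e1 / n <= 1 / n" using e1 by (simp add: divide_right_mono)
   ultimately show ?thesis using V[OF y] rhPs[OF y, of n] by (simp add: r_def K'_def add_divide_distrib)
  qed
  have rN: "1 / r ^ N n <= R"
  proof -
   have "exp (- (2 * K' * (t + 1))) <= exp (- (2 * (K' / n)) * N n)"
   proof -
    have "K' * real (N n) <= K' * ((t + 1) * n)" using NnR K2 by (intro mult_left_mono) (auto simp: K'_def)
    hence "2 * (K' / n) * N n <= 2 * K' * (t + 1)" using n by (simp add: field_simps)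
    thus ?thesis by simp
   qed
   also have "... = exp (- (2 * (K' / n))) ^ N n" by (simp add: exp_of_nat_mult[symmetric] mult.commute)
   also have "... <= r ^ N n" unfolding r_def using Kn K'n by (intro power_mono exp_minus_2_le) auto
   finally have "exp (- (2 * K' * (t + 1))) <= r ^ N n" .
   hence "1 / r ^ N n <= 1 / exp (- (2 * K' * (t + 1)))" using r by (intro divide_left_mono) auto
   thus ?thesis unfolding R_def by (simp only: exp_minus divide_inverse mult_1_left inverse_inverse_eq)
  qed
  let ?l1 = "ep / |s n|"
  \<comment> \<open>Exceptional sets: along the path the conditional means, or the tail constants,
    deviate too much from their averages.\<close>
  define B1 where "B1 = {zs. EX m<=N n. ?l1 < |msum (%y z. wmean y - mean wmean) y (take m zs) | }"
  define B2 where "B2 = {zs. EX m<=N n. l2 n < |msum (%y z. rh y - mean rh) y (take m zs) | }"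
  have B1: "\<P> (chain (N n) y) B1 <= ep"
  proof -
   have "\<P> (chain (N n) y) B1 <= 16 * w1\<^sup>2 * N n / ?l1\<^sup>2" unfolding B1_def w1_def using w1(1) s_ne[OF n] ep
    by (intro decr_sum_deviation decr_wmean y) (auto simp: w1_def field_simps)
   also have "... <= 16 * w1\<^sup>2 * ((t + 1) * n) / ?l1\<^sup>2" using NnR by (intro divide_right_mono mult_left_mono) auto
   also have "... = 16 * w1\<^sup>2 * (t + 1) * (real n * (s n)\<^sup>2) / ep\<^sup>2" by (simp add: power_divide)
   finally show ?thesis using w1(2) by linarith
  qed
  have B2: "\<P> (chain (N n) y) B2 <= ep"
  proof -
   have "\<P> (chain (N n) y) B2 <= 16 * w2\<^sup>2 * N n / (l2 n)\<^sup>2" unfolding B2_def w2_def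
   proof (intro decr_sum_deviation decr_rh y)
    show "6 * (osc rh / q 1) <= l2 n"
     using w2(1)[unfolded pos_divide_less_eq[OF c0]] unfolding w2_def[symmetric] l2_def by (rule less_imp_le)
    show "0 < l2 n" using n c0 by (simp add: l2_def)
   qed
   also have "... <= 16 * w2\<^sup>2 * ((t + 1) * n) / (l2 n)\<^sup>2" using NnR by (intro divide_right_mono mult_left_mono) auto
   also have "... = (16 * w2\<^sup>2 * (t + 1) / h\<^sup>2) / n"
    using n c0 unfolding l2_def power_mult_distrib by (simp add: power2_eq_square field_simps)
   finally show ?thesis using w2(2) by linarith
  qed
  have "norm (\<E> (chain (N n) y) (%zs. iexp (s n * csum zs)) - exp (- (of_real t * Ps)))
   <= (4 * ep + 2 * \<P> (chain (N n) y) (B1 \<union> B2)) / r ^ N n"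
  proof (rule csum_cf_close[OF _ r y])
   show "r <= norm (\<E> (step y) (%z. iexp (s n * cent z)))" if "xs <= y" "y <= 1" for y using rc[OF that] by (simp add: c_def)
   show "norm (exp (- (of_real t * Ps))) <= 1" using t Re_expo[of "et * thh"] by (simp add: Ps_def)
   show "0 <= 4 * ep" using ep by simp
   fix zs :: "(bool \<times> nat) list" assume len: "length zs = N n" and nB: "zs \<notin> B1 \<union> B2"
   let ?m1 = "msum (%y z. wmean y - ell) y zs" and ?m2 = "msum (%y z. rh y) y zs"
   have m1: "|?m1| <= ?l1" and m2: "|msum (%y z. rh y - 1) y zs| <= l2 n"
    using nB len by (auto simp: B1_def B2_def mean_wmean mean_rh not_less dest!: spec[of _ "N n"])
   have d: "norm (cprod V y zs) <= 1 & norm (cprod U y zs) <= 1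
     & norm (cprod V y zs - cprod U y zs) <= real (length zs) * (ep / (t + 1) / n)"
    by (rule cprod_diff_le) (use V1 U1 VU y in auto)
   have 1: "norm (cprod c y zs - cprod V y zs) <= ep"
   proof -
    have "cprod c y zs - cprod V y zs = (iexp (s n * be * ?m1) - 1) * cprod V y zs"
     unfolding cV cprod_iexp by (simp add: algebra_simps)
    hence "norm (cprod c y zs - cprod V y zs) = norm (iexp (s n * be * ?m1) - 1) * norm (cprod V y zs)"
     by (simp only: norm_mult)
    also have "... <= |s n * be * ?m1| * 1" using d iexp_minus_1_le[of "s n * be * ?m1"] by (intro mult_mono) auto
    also have "... = |s n| * |be * ?m1|" by (simp add: abs_mult)
    also have "... <= |s n| * ?l1" using be_mult_le[of ?m1] m1 by (intro mult_left_mono) auto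
    also have "... = ep" using s_ne[OF n] by simp
    finally show ?thesis .
   qed
   have 2: "norm (cprod V y zs - cprod U y zs) <= ep"
   proof -
    have "real (length zs) * (ep / (t + 1) / n) <= ((t + 1) * n) * (ep / (t + 1) / n)"
     unfolding len using NnR t ep by (intro mult_right_mono) auto
    also have "... = ep" using t n by simp
    finally show ?thesis using d by linarith
   qed
   have 3: "norm (cprod U y zs - exp (- (of_real t * Ps))) <= 2 * ep"
   proof -
    have m2n: "0 <= ?m2" by (rule msum_nonneg[OF _ y]) (use rh_bounds in \<open>auto simp: less_imp_le\<close>)
    have "cprod U y zs = exp (- (of_real ?m2 * (Ps / n)))" unfolding U_def by (rule cprod_exp_mult)
    also have "norm (... - exp (- (of_real t * Ps))) <= norm (- (of_real ?m2 * (Ps / n)) - - (of_real t * Ps))"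
     using m2n t Re_expo[of "et * thh"] by (intro exp_lipschitz) (auto simp: Ps_def)
    also have "- (of_real ?m2 * (Ps / n)) - - (of_real t * Ps) = of_real (t - ?m2 / n) * Ps" by (simp add: algebra_simps)
    also have "norm (of_real (t - ?m2 / n) * Ps) = |t - ?m2 / n| * norm Ps" by (simp only: norm_mult norm_of_real)
    also have "... <= (l2 n / n + |real (N n) / n - t| ) * norm Ps"
    proof (intro mult_right_mono)
     have "?m2 = msum (%y z. rh y - 1) y zs + real (N n)" using msum_shift[of rh y zs 1] len by simp
     hence "t - ?m2 / n = - (msum (%y z. rh y - 1) y zs / n) - (real (N n) / n - t)" by (simp add: add_divide_distrib)
     moreover have "|msum (%y z. rh y - 1) y zs / n| <= l2 n / n" using m2 n by (simp add: divide_right_mono)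
     ultimately show "|t - ?m2 / n| <= l2 n / n + |real (N n) / n - t|" by linarith
    qed simp
    also have "... = (l2 n / n) * norm Ps + |real (N n) / n - t| * norm Ps" by (simp add: distrib_right)
    also have "(l2 n / n) * norm Ps <= ep"
    proof -
     have "(l2 n / n) * norm Ps = ep * (norm Ps / (norm Ps + 1))" using n by (simp add: l2_def h_def)
     also have "... <= ep * 1" using ep by (intro mult_left_mono) (auto simp: divide_le_eq add_nonneg_pos)
     finally show ?thesis by simp
    qed
    finally show ?thesis using Nt by linarith
   qed
   have "norm (cprod c y zs - exp (- (of_real t * Ps)))
     <= norm (cprod c y zs - cprod V y zs) + (norm (cprod V y zs - cprod U y zs) + norm (cprod U y zs - exp (- (of_real t * Ps))))"
    by norm
   thus "norm (cprod (%y. \<E> (step y) (%z. iexp (s n * cent z))) y zs - exp (- (of_real t * Ps))) <= 4 * ep"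
    using 1 2 3 unfolding c_def[symmetric] by linarith
  qed
  also have "... = (4 * ep + 2 * \<P> (chain (N n) y) (B1 \<union> B2)) * (1 / r ^ N n)" by simp
  also have "... <= (8 * ep) * R"
  proof (intro mult_mono rN)
   have "\<P> (chain (N n) y) (B1 \<union> B2) <= 2 * ep" using measure_Un_le[of B1 "chain (N n) y" B2] B1 B2 by simp
   thus "4 * ep + 2 * \<P> (chain (N n) y) (B1 \<union> B2) <= 8 * ep" by linarith
  qed (use ep r in auto)
  also have "... = e" using R by (simp add: ep_def)
  finally show "norm (\<E> (chain (N n) y) (%zs. iexp (thh * (scl et n * csum zs)))
   - exp (- (of_real t * expo (et * thh)))) <= e" by (simp add: s_def Ps_def mult.assoc mult.left_commute)
 qed
qed

end

section \<open>Joint weak convergence of block sums\<close>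

context sthaler
begin

lemma char_stable:
 assumes et: "0 < et" and nuu: "stable_law al et be nuu" and t: "0 <= t"
 shows "char (distr nuu borel (%x. t powr ga * x)) thh = exp (- (of_real t * expo (et * thh)))"
proof -
 interpret nuu: real_distribution nuu using nuu by (simp add: stable_law_def)
 have "char (distr nuu borel (%x. t powr ga * x)) thh = char nuu (t powr ga * thh)"
  unfolding char_def by (subst integral_distr) (auto simp: ac_simps)
 also have "... = exp (- expo (et * (t powr ga * thh)))" using nuu et by (simp add: stable_law_def stable_cf_eq)
 also have "expo (et * (t powr ga * thh)) = of_real t * expo (et * thh)"
 proof (cases "t = 0")
  case False
  have "expo (t powr ga * (et * thh)) = of_real ((t powr ga) powr al) * expo (et * thh)"
   using False t by (intro expo_scale) simp
  also have "(t powr ga) powr al = t" using t ga_pos by (simp add: powr_powr)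
  finally show ?thesis by (simp add: ac_simps)
 qed simp
 finally show ?thesis .
qed

text \<open>Uniformity in the state: Levy's theorem is applied along starting states that violate
  the bound whenever some state does.\<close>

lemma block_weak_conv:
 fixes u :: "real => real"
 assumes et: "0 < et" and nuu: "stable_law al et be nuu" and N: "(%n. real (N n) / real n) ----> t"
  and u: "!!x. isCont u x" "!!x. |u x| <= B" and e: "0 < e"
 shows "\<forall>\<^sub>F n in sequentially. ALL y. xs <= y --> y <= 1 --> |\<E> (chain (N n) y) (%zs. u (scl et n * csum zs))
   - (\<integral>x. u x \<partial>distr nuu borel (%x. t powr ga * x)) | < e"
proof -
 let ?E = "%n y. \<E> (chain (N n) y) (%zs. u (scl et n * csum zs))"
 let ?muu = "distr nuu borel (%x. t powr ga * x)"
 define bad where "bad = (%n y. xs <= y & y <= 1 & e <= |?E n y - (\<integral>x. u x \<partial>?muu) | )"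
 define y where "y = (%n. if EX y. bad n y then SOME y. bad n y else 1)"
 have y: "xs <= y n & y n <= 1" for n using someI_ex[of "bad n"] xs_bds by (auto simp: y_def bad_def)
 have t: "0 <= t" by (rule LIMSEQ_le_const[OF N]) auto
 interpret nuu: real_distribution nuu using nuu by (simp add: stable_law_def)
 define m where "m = (%n. distr (measure_pmf (chain (N n) (y n))) borel (%zs. scl et n * csum zs))"
 have "weak_conv_m m ?muu"
 proof (rule levy_continuity)
  show "real_distribution (m n)" for n
   unfolding m_def by (rule prob_space.real_distribution_distr) (auto simp: measure_pmf.prob_space_axioms)
  show "real_distribution ?muu" by (intro nuu.real_distribution_distr) simp
  fix thh :: real
  have ch: "char (m n) thh = \<E> (chain (N n) (y n)) (%zs. iexp (thh * (scl et n * csum zs)))" for n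
   unfolding m_def char_def by (subst integral_distr) auto
  show "(%n. char (m n) thh) ----> char ?muu thh" unfolding char_stable[OF et nuu t]
  proof (intro tendstoI)
   fix ep :: real assume "0 < ep"
   hence "0 < ep / 2" by simp
   from block_cf[OF et N this, of thh]
   show "\<forall>\<^sub>F n in sequentially. dist (char (m n) thh) (exp (- (of_real t * expo (et * thh)))) < ep"
   proof (rule eventually_mono)
    fix n assume "ALL y>=xs. y <= 1 --> norm (\<E> (chain (N n) y) (%zs. iexp (thh * (scl et n * csum zs)))
     - exp (- (of_real t * expo (et * thh)))) <= ep / 2"
    hence "dist (char (m n) thh) (exp (- (of_real t * expo (et * thh)))) <= ep / 2" unfolding ch dist_norm using y by blast
    thus "dist (char (m n) thh) (exp (- (of_real t * expo (et * thh)))) < ep" using `0 < ep` by linarith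
   qed
  qed
 qed
 moreover have "real_distribution (m n)" for n
  unfolding m_def by (rule prob_space.real_distribution_distr) (auto simp: measure_pmf.prob_space_axioms)
 moreover have "real_distribution ?muu" by (intro nuu.real_distribution_distr) simp
 ultimately have "(%n. integral\<^sup>L (m n) u) ----> integral\<^sup>L ?muu u"
  using u by (intro weak_conv_imp_integral_bdd_continuous_conv) auto
 moreover have "integral\<^sup>L (m n) u = ?E n (y n)" for n
  unfolding m_def using u by (subst integral_distr) (auto intro!: borel_measurable_continuous_onI continuous_at_imp_continuous_on)
 ultimately have "\<forall>\<^sub>F n in sequentially. dist (?E n (y n)) (\<integral>x. u x \<partial>?muu) < e"
  using e by (auto dest: tendstoD)
 thus ?thesis
 proof (rule eventually_mono, intro allI impI)
  fix n y' assume *: "dist (?E n (y n)) (\<integral>x. u x \<partial>?muu) < e" and "xs <= y'" "y' <= 1"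
  have nb: "\<not> bad n (y n)" using * by (simp add: bad_def dist_real_def)
  have "\<not> bad n y'"
  proof
   assume "bad n y'"
   hence "y n = (SOME y. bad n y)" "bad n (SOME y. bad n y)" by (auto simp: y_def intro: someI)
   with nb show False by simp
  qed
  thus "|?E n y' - (\<integral>x. u x \<partial>?muu) | < e" using `xs <= y'` `y' <= 1` by (simp add: bad_def not_le)
 qed
qed

end

definition llip :: "real => (real list => real) => bool" where "llip L F <-> (ALL us vs. length us = length vs -->
  |F us - F vs| <= L * (\<Sum>(u, v)\<leftarrow>zip us vs. |u - v| ))"

lemma llip_Cons: "llip L F ==> llip L (%us. F (x # us))" unfolding llip_def
proof (intro allI impI)
 fix us vs :: "real list"
 assume *: "ALL us vs. length us = length vs --> |F us - F vs| <= L * (\<Sum>(u, v)\<leftarrow>zip us vs. |u - v| )" "length us = length vs"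
 thus "|F (x # us) - F (x # vs) | <= L * (\<Sum>(u, v)\<leftarrow>zip us vs. |u - v| )"
  using *(1)[rule_format, of "x # us" "x # vs"] by simp
qed

lemma llip_head: "llip L F ==> |F (x # us) - F (x' # us) | <= L * |x - x'|"
proof -
 assume *: "llip L F"
 have "(\<Sum>(u, v)\<leftarrow>zip us us. |u - v| ) = (0 :: real)" by (induction us) auto
 thus ?thesis using *[unfolded llip_def, rule_format, of "x # us" "x' # us"] by simp
qed

lemma lipschitz_isCont:
 fixes f :: "real => real"
 assumes "!!x y. |f x - f y| <= L * |x - y|"
 shows "isCont f x"
proof -
 have "(%y. L * |y - x| ) \<midarrow>x\<rightarrow> L * |x - x|" by (intro tendsto_intros)
 hence lim: "(%y. L * |y - x| ) \<midarrow>x\<rightarrow> 0" by simp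
 have "(%y. f y - f x) \<midarrow>x\<rightarrow> 0"
  by (rule Lim_null_comparison[OF _ lim], rule always_eventually) (use assms in simp)
 thus ?thesis unfolding isCont_def by (rule LIM_zero_cancel)
qed

text \<open>Expectation over \<open>r\<close> independent coordinates with law \<open>muu\<close>,
  written as an iterated integral to match the recursion over blocks.\<close>

primrec iter_int :: "real measure => nat => (real list => real) => real" where "iter_int muu 0 F = F []"
| "iter_int muu (Suc r) F = (\<integral>x. iter_int muu r (%us. F (x # us)) \<partial>muu)"

context real_distribution
begin

text \<open>The claims support each other in the induction: continuity in the first coordinate gives
  the measurability for the next integral, and the comparison of two integrands gives the
  continuity.\<close>

lemma iter_int_bounds:
 assumes "llip L F" "!!us. |F us| <= B"
 shows "|iter_int M r F| <= B" and "!!G e. llip L G ==> (!!us. |G us| <= B) ==> (!!us. |F us - G us| <= e) ==>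
   |iter_int M r F - iter_int M r G| <= e" and "isCont (%x. iter_int M r (%us. F (x # us))) x"
proof -
 have main: "|iter_int M r F| <= B & (ALL G e. llip L G --> (ALL us. |G us| <= B) --> (ALL us. |F us - G us| <= e) -->
   |iter_int M r F - iter_int M r G| <= e)" and cont: "isCont (%x. iter_int M r (%us. F (x # us))) x"
  if "llip L F" "!!us. |F us| <= B" for F x using that
 proof (induction r arbitrary: F x)
  case (Suc r)
  have int: "integrable M (%x. iter_int M r (%us. F (x # us)))" if "llip L F" "!!us. |F us| <= B" for F
  proof (rule integrable_const_bound[where B = B])
   show "AE x in M. norm (iter_int M r (%us. F (x # us))) <= B" using Suc.IH(1)[OF llip_Cons[OF that(1)] that(2)] by simp
   show "(%x. iter_int M r (%us. F (x # us))) : borel_measurable M" using Suc.IH(2)[OF that]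
    by (intro measurable_finite_borel borel_measurable_continuous_onI continuous_at_imp_continuous_on) blast
  qed
  show 1: "|iter_int M (Suc r) F| <= B & (ALL G e. llip L G --> (ALL us. |G us| <= B) --> (ALL us. |F us - G us| <= e) -->
   |iter_int M (Suc r) F - iter_int M (Suc r) G| <= e)" if F: "llip L F" "!!us. |F us| <= B" for F
  proof (intro conjI allI impI)
   have "|\<integral>x. iter_int M r (%us. F (x # us)) \<partial>M| <= (\<integral>x. |iter_int M r (%us. F (x # us)) | \<partial>M)"
    by (rule integral_abs_bound)
   also have "... <= (\<integral>x. B \<partial>M)"
    using Suc.IH(1)[OF llip_Cons[OF F(1)] F(2)] int[OF F] by (intro integral_mono) auto
   finally show "|iter_int M (Suc r) F| <= B" by (simp add: prob_space[simplified])
   fix G e assume G: "llip L G" "ALL us. |G us| <= B" and FG: "ALL us. |F us - G us| <= e"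
   have "|iter_int M (Suc r) F - iter_int M (Suc r) G|
     = |\<integral>x. iter_int M r (%us. F (x # us)) - iter_int M r (%us. G (x # us)) \<partial>M|"
    using int[OF F] int[OF G(1)] G(2) by simp
   also have "... <= (\<integral>x. |iter_int M r (%us. F (x # us)) - iter_int M r (%us. G (x # us)) | \<partial>M)"
    by (rule integral_abs_bound)
   also have "... <= (\<integral>x. e \<partial>M)"
   proof (rule integral_mono)
    show "|iter_int M r (%us. F (x # us)) - iter_int M r (%us. G (x # us)) | <= e" for x
     using Suc.IH(1)[OF llip_Cons[OF F(1)] F(2)] llip_Cons[OF G(1)] G(2) FG by blast
   qed (use int[OF F] int[OF G(1)] G(2) in auto)
   finally show "|iter_int M (Suc r) F - iter_int M (Suc r) G| <= e" by (simp add: prob_space[simplified])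
  qed
  show "isCont (%x. iter_int M (Suc r) (%us. F (x # us))) x" if F: "llip L F" "!!us. |F us| <= B" for F x
  proof (rule lipschitz_isCont[where L = L])
   show "|iter_int M (Suc r) (%us. F (x # us)) - iter_int M (Suc r) (%us. F (y # us)) | <= L * |x - y|" for x y
    using 1[OF llip_Cons[OF F(1), of x] F(2)] llip_Cons[OF F(1), of y] F(2) llip_head[OF F(1), of x _ y] by blast
  qed
 next
  case 0
  show "isCont (%x. iter_int M 0 (%us. F (x # us))) x" if "llip L F" for F x
   using llip_head[OF that] by (intro lipschitz_isCont[where L = L]) auto
  show "|iter_int M 0 F| <= B & (ALL G e. llip L G --> (ALL us. |G us| <= B) --> (ALL us. |F us - G us| <= e) -->
   |iter_int M 0 F - iter_int M 0 G| <= e)" if "llip L F" "!!us. |F us| <= B" for F using that by auto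
 qed
 show "|iter_int M r F| <= B" using main[OF assms] by blast
 show "!!G e. llip L G ==> (!!us. |G us| <= B) ==> (!!us. |F us - G us| <= e) ==>
   |iter_int M r F - iter_int M r G| <= e" using main[OF assms] by blast
 show "isCont (%x. iter_int M r (%us. F (x # us))) x" by (rule cont[OF assms])
qed

end

context sthaler
begin

fun blocks :: "real => nat list => (bool \<times> nat) list => real list" where "blocks c [] zs = []"
| "blocks c (n # ns) zs = c * csum (take n zs) # blocks c ns (drop n zs)"

lemma expectation_chain_add:
 fixes f :: "(bool \<times> nat) list => real"
 assumes "!!zs. |f zs| <= B"
 shows "\<E> (chain (m + n) y) f = \<E> (chain m y) (%us. \<E> (chain n (foldl nxt y us)) (%vs. f (us @ vs)))"
 unfolding chain_add using assms by (simp add: exp_bind_pmf[where B = B])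

lemma expectation_chain_cong:
 fixes f g :: "(bool \<times> nat) list => real"
 assumes "!!zs. length zs = n ==> f zs = g zs"
 shows "\<E> (chain n y) f = \<E> (chain n y) g"
 by (rule integral_cong_AE) (use assms chain_len in \<open>auto simp: AE_measure_pmf_iff\<close>)

lemma expectation_pmf_diff_le:
 fixes f g h :: "'b => real"
 assumes "!!x. |f x| <= B" "!!x. |g x| <= B" "!!x. |f x - g x| <= h x" "!!x. |h x| <= B'"
 shows "|\<E> p f - \<E> p g| <= \<E> p h"
proof -
 have int: "integrable (measure_pmf p) f" "integrable (measure_pmf p) g" "integrable (measure_pmf p) h"
  using assms by (auto intro!: int_pmf_bdd)
 hence "|\<E> p f - \<E> p g| = |\<E> p (%x. f x - g x) |" by simp
 also have "... <= \<E> p (%x. |f x - g x| )" by (rule integral_abs_bound)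
 also have "... <= \<E> p h" using int assms(3) by (intro integral_mono) auto
 finally show ?thesis .
qed

text \<open>By induction on the number of blocks; the error in the inner expectation is dominated by a
  decr sequence of bounded Lipschitz functions of the value of the outer block.\<close>

lemma blocks_weak_conv:
 assumes muu: "real_distribution muu" and bw: "!!u b a K. (!!x. isCont u x) ==> (!!x. |u x| <= b) ==> K : set Ns ==> 0 < a ==>
   \<forall>\<^sub>F n in sequentially. ALL y. xs <= y --> y <= 1 -->
    |\<E> (chain (K n) y) (%zs. u (c n * csum zs)) - (\<integral>x. u x \<partial>muu) | < (a :: real)"
  and F: "llip L F" "!!us. |F us| <= B" and e: "0 < e"
 shows "\<forall>\<^sub>F n in sequentially. ALL y. xs <= y --> y <= 1 -->
  |\<E> (chain (\<Sum>N\<leftarrow>Ns. N n) y) (%zs. F (blocks (c n) (map (%N. N n) Ns) zs)) - iter_int muu (length Ns) F| < e"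
 using bw F e
proof (induction Ns arbitrary: F e)
 case Nil
 thus ?case by simp
next
 case (Cons N Ns)
 interpret muu: real_distribution muu by (rule muu)
 note F = Cons.prems(2,3) and e = Cons.prems(4)
 have bw: "\<forall>\<^sub>F n in sequentially. ALL y. xs <= y --> y <= 1 -->
    |\<E> (chain (K n) y) (%zs. u (c n * csum zs)) - (\<integral>x. u x \<partial>muu) | < a"
  if "!!x. isCont u x" "!!x. |u x| <= b" "K : set Ns" "0 < a" for u :: "real => real" and b a K
 proof (rule Cons.prems(1)[of u b K a])
  show "|u x| <= b" for x by (rule that)
 qed (use that in auto)
 have L: "0 <= L" using order_trans[OF abs_ge_zero llip_head[OF F(1), of 1 "[]" 0]] by simp
 have B: "0 <= B" using F(2)[of "[]"] by simp
 define M where "M = (%n. \<Sum>N\<leftarrow>Ns. N n)"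
 define ns where "ns = (%n. map (%N. N n) Ns)"
 define ph where "ph = (%x. iter_int muu (length Ns) (%us. F (x # us)))"
 define G where "G = (%n y x. \<E> (chain (M n) y) (%vs. F (x # blocks (c n) (ns n) vs)))"
 define D where "D = (%n y x. |G n y x - ph x| )"
 have phB: "|ph x| <= B" for x unfolding ph_def by (rule muu.iter_int_bounds(1)[OF llip_Cons[OF F(1)] F(2)])
 have phL: "|ph x - ph x'| <= L * |x - x'|" for x x' unfolding ph_def
  by (rule muu.iter_int_bounds(2)[OF llip_Cons[OF F(1)] F(2) llip_Cons[OF F(1)] F(2)]) (rule llip_head[OF F(1)])
 have phc: "isCont ph x" for x by (rule lipschitz_isCont[OF phL])
 have GB: "|G n y x| <= B" for n y x unfolding G_def real_norm_def[symmetric] by (rule norm_exp_pmf) (simp add: F(2))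
 have GL: "|G n y x - G n y x'| <= L * |x - x'|" for n y x x'
 proof -
  have "|G n y x - G n y x'| <= \<E> (chain (M n) y) (%vs. L * |x - x'| )"
   unfolding G_def by (rule expectation_pmf_diff_le[where B = B and B' = "L * |x - x'|"]) (use F L llip_head[OF F(1)] in auto)
  thus ?thesis by simp
 qed
 have DB: "0 <= D n y x" "D n y x <= 2 * B" for n y x using GB[of n y x] phB[of x] unfolding D_def by linarith+
 have DL: "D n y x <= D n y x' + 2 * L * |x - x'|" for n y x x' using GL[of n y x x'] phL[of x x'] unfolding D_def by linarith
 define I where "I = (%m::nat. {m..} \<times> {xs..1})"
 define u where "u = (%m x. SUP (n, y)\<in>I m. D n y x)"
 have I: "(m, 1) : I m" for m using xs_bds by (simp add: I_def)
 have bdd: "bdd_above ((%(n, y). D n y x) ` I m)" for m x using DB by (intro bdd_aboveI[where M = "2 * B"]) auto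
 have u_ge: "D n y x <= u m x" if "m <= n" "xs <= y" "y <= 1" for n y x m
  unfolding u_def using that cSUP_upper[OF _ bdd, of "(n, y)" m x] by (simp add: I_def)
 have u_le: "u m x <= a" if "!!n y. m <= n ==> xs <= y ==> y <= 1 ==> D n y x <= a" for m x a
  unfolding u_def using I[of m] that by (intro cSUP_least) (auto simp: I_def)
 have uB: "0 <= u m x" "u m x <= 2 * B" for m x
  using u_le[of m x "2 * B"] DB(2) order_trans[OF DB(1) u_ge[of m m 1 x]] xs_bds by auto
 have uL: "|u m x - u m x'| <= 2 * L * |x - x'|" for m x x'
 proof -
  have "u m x <= u m x' + 2 * L * |x - x'|" for x x'
   using DL[of _ _ x x'] u_ge[of m _ _ x'] by (intro u_le) (meson add_right_mono order_trans)
  from this[of x x'] this[of x' x] show ?thesis by (simp add: abs_le_iff abs_minus_commute)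
 qed
 have uc: "isCont (u m) x" for m x by (rule lipschitz_isCont[OF uL])
 have meas: "f : borel_measurable muu" if "!!x. isCont f x" for f :: "real => real"
  using that by (intro muu.measurable_finite_borel borel_measurable_continuous_onI continuous_at_imp_continuous_on) blast
 have u0: "(%m. u m x) ----> 0" for x
 proof (rule tendstoI)
  fix a :: real assume "0 < a"
  hence a: "0 < a / 2" by simp
  have "\<forall>\<^sub>F n in sequentially. ALL y. xs <= y --> y <= 1 --> D n y x < a / 2"
   unfolding D_def G_def ph_def M_def ns_def by (rule Cons.IH[OF bw llip_Cons[OF F(1)] F(2) a])
  then obtain n0 where n0: "!!n y. n0 <= n ==> xs <= y ==> y <= 1 ==> D n y x < a / 2"
   unfolding eventually_sequentially by blast
  have "u m x <= a / 2" if "n0 <= m" for m using n0 that by (intro u_le less_imp_le) (meson order_trans)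
  thus "\<forall>\<^sub>F m in sequentially. dist (u m x) 0 < a"
   using uB `0 < a` unfolding eventually_sequentially by (intro exI[of _ n0]) (force simp: dist_real_def)
 qed
 have "(%m. \<integral>x. u m x \<partial>muu) ----> (\<integral>x. 0 \<partial>muu)"
  by (rule integral_dominated_convergence[where w = "%_. 2 * B"]) (use u0 uB meas[OF uc] in auto)
 hence "\<forall>\<^sub>F m in sequentially. (\<integral>x. u m x \<partial>muu) < e / 4" using e by (intro order_tendstoD(2)) auto
 \<comment> \<open>The envelope index \<open>m\<close> is fixed before \<open>n\<close> grows, so
   that \<open>u m\<close> is a single test function for the outer block.\<close>
 then obtain m where m: "(\<integral>x. u m x \<partial>muu) < e / 4" unfolding eventually_sequentially by blast
 have e4: "0 < e / 4" using e by simp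
 have "\<forall>\<^sub>F n in sequentially. ALL y. xs <= y --> y <= 1 -->
    |\<E> (chain (N n) y) (%zs. u m (c n * csum zs)) - (\<integral>x. u m x \<partial>muu) | < e / 4"
 proof (rule Cons.prems(1)[of "u m" "2 * B" N "e / 4"])
  show "|u m x| <= 2 * B" for x using uB by simp
 qed (use uc e4 in auto)
 moreover have "\<forall>\<^sub>F n in sequentially. ALL y. xs <= y --> y <= 1 -->
    |\<E> (chain (N n) y) (%zs. ph (c n * csum zs)) - (\<integral>x. ph x \<partial>muu) | < e / 4"
 proof (rule Cons.prems(1)[of ph B N "e / 4"])
  show "|ph x| <= B" for x by (rule phB)
 qed (use phc e4 in auto)
 moreover have "\<forall>\<^sub>F n in sequentially. m <= n" by (rule eventually_ge_at_top)
 ultimately show ?case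
 proof eventually_elim
  case (elim n)
  show ?case
  proof (intro allI impI)
   fix y assume y: "xs <= y" "y <= 1"
   let ?p = "chain (N n) y"
   have "\<E> (chain (\<Sum>N\<leftarrow>N # Ns. N n) y) (%zs. F (blocks (c n) (map (%N. N n) (N # Ns)) zs))
     = \<E> ?p (%us. \<E> (chain (M n) (foldl nxt y us)) (%vs. F (blocks (c n) (N n # ns n) (us @ vs))))"
    unfolding M_def ns_def using expectation_chain_add[where B = B, OF F(2)] by simp
   also have "... = \<E> ?p (%us. G n (foldl nxt y us) (c n * csum us))" unfolding G_def by (rule expectation_chain_cong) simp
   finally have 1: "\<E> (chain (\<Sum>N\<leftarrow>N # Ns. N n) y) (%zs. F (blocks (c n) (map (%N. N n) (N # Ns)) zs))
     = \<E> ?p (%us. G n (foldl nxt y us) (c n * csum us))" .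
   have 2: "|\<E> ?p (%us. G n (foldl nxt y us) (c n * csum us))
     - \<E> ?p (%us. ph (c n * csum us)) | <= \<E> ?p (%us. u m (c n * csum us))"
   proof (rule expectation_pmf_diff_le)
    show "|G n (foldl nxt y us) (c n * csum us) - ph (c n * csum us) | <= u m (c n * csum us)" for us
     using u_ge[of m n "foldl nxt y us" "c n * csum us"] foldl_nxt_in[OF y, of us] elim(3) by (simp add: D_def)
   qed (use GB phB uB in \<open>auto simp: abs_of_nonneg\<close>)
   have "|\<E> ?p (%us. u m (c n * csum us)) - (\<integral>x. u m x \<partial>muu) | < e / 4"
    "|\<E> ?p (%us. ph (c n * csum us)) - (\<integral>x. ph x \<partial>muu) | < e / 4" using elim(1,2) y by blast+
   with 2 m have "|\<E> ?p (%us. G n (foldl nxt y us) (c n * csum us)) - (\<integral>x. ph x \<partial>muu) | < e" by linarith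
   thus "|\<E> (chain (\<Sum>N\<leftarrow>N # Ns. N n) y) (%zs. F (blocks (c n) (map (%N. N n) (N # Ns)) zs))
     - iter_int muu (length (N # Ns)) F| < e" unfolding 1 by (simp add: ph_def)
  qed
 qed
qed

end

section \<open>Cadlag functions and time changes\<close>

definition cadlag :: "(real => real) => bool" where
 "cadlag f <-> (ALL t>=0. (f \<longlongrightarrow> f t) (at_right t)) & (ALL t>0. EX l. (f \<longlongrightarrow> l) (at_left t))"

lemma cadlag_space_iff: "f : cadlag_space <-> f : extensional {0..} & cadlag f" by (auto simp: cadlag_space_def cadlag_def)

lemma cadlag_right: "cadlag f ==> 0 <= t ==> (f \<longlongrightarrow> f t) (at_right t)" by (simp add: cadlag_def)

lemma cadlag_left:
 assumes "cadlag f" "0 < t"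
 shows "(f \<longlongrightarrow> left_limit f t) (at_left t)"
proof -
 obtain l where l: "(f \<longlongrightarrow> l) (at_left t)" using assms by (auto simp: cadlag_def)
 hence "Lim (at_left t) f = l" by (intro tendsto_Lim) auto
 with l assms show ?thesis by (simp add: left_limit_def)
qed

lemma left_limit_eqI: "(f \<longlongrightarrow> l) (at_left t) ==> 0 < t ==> left_limit f t = l"
 by (auto simp: left_limit_def intro: tendsto_Lim)

text \<open>Taken on the whole line, so that inverses and compositions are of the same kind; fixing
  \<open>0\<close> preserves the half-line.\<close>

definition tchange :: "(real => real) => bool" where "tchange muu <-> strict_mono muu & surj muu & muu 0 = 0"

lemma tchange_less: "tchange muu ==> muu x < muu y <-> x < y" by (auto simp: tchange_def strict_mono_less)

lemma tchange_le: "tchange muu ==> muu x <= muu y <-> x <= y" by (auto simp: tchange_def strict_mono_less_eq)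

lemma tchange_nonneg: "tchange muu ==> 0 <= muu x <-> 0 <= x" using tchange_le[of muu 0 x] by (auto simp: tchange_def)

lemma tchange_pos: "tchange muu ==> 0 < muu x <-> 0 < x" using tchange_less[of muu 0 x] by (auto simp: tchange_def)

lemma tchange_inj: "tchange muu ==> inj muu" by (auto simp: tchange_def strict_mono_on_imp_inj_on)

lemma tchange_isCont: "tchange muu ==> isCont muu t"
proof -
 assume "tchange muu"
 hence "continuous_on UNIV muu" by (intro continuous_onI_mono) (auto simp: tchange_def strict_mono_less_eq)
 thus ?thesis by (simp add: continuous_on_eq_continuous_at)
qed

lemma tchange_inv:
 assumes "tchange muu"
 shows "tchange (inv muu)" "muu (inv muu x) = x" "inv muu (muu x) = x"
proof -
 show *: "muu (inv muu x) = x" for x using assms by (simp add: tchange_def surj_f_inv_f)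
 show **: "inv muu (muu x) = x" for x using tchange_inj[OF assms] by simp
 have "inv muu x < inv muu y" if "x < y" for x y using that * tchange_less[OF assms] by metis
 moreover have "surj (inv muu)" using ** by (metis surjI)
 moreover have "inv muu 0 = 0" using **[of 0] assms by (simp add: tchange_def)
 ultimately show "tchange (inv muu)" by (auto simp: tchange_def strict_mono_def)
qed

lemma tchange_comp:
 assumes "tchange muu" "tchange kaa"
 shows "tchange (%t. muu (kaa t))"
proof -
 have "surj (%t. muu (kaa t))" using assms unfolding tchange_def surj_def by metis
 with assms show ?thesis by (simp add: tchange_def strict_mono_def)
qed

lemma tchange_at_left: "tchange muu ==> filterlim muu (at_left (muu t)) (at_left t)"
 unfolding filterlim_at using tchange_isCont[of muu t] by (auto simp: tchange_less less_imp_neq isCont_def eventually_at_filter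
   intro: tendsto_mono[of "at_left t" "at t"] at_le)

lemma tchange_at_right: "tchange muu ==> filterlim muu (at_right (muu t)) (at_right t)"
 unfolding filterlim_at using tchange_isCont[of muu t]
 by (auto simp: tchange_less less_imp_neq[THEN not_sym] isCont_def eventually_at_filter
   intro: tendsto_mono[of "at_right t" "at t"] at_le)

lemma left_limit_tchange:
 assumes "cadlag f" "tchange muu" "0 < t"
 shows "((%t. f (muu t)) \<longlongrightarrow> left_limit f (muu t)) (at_left t)"
 by (rule filterlim_compose[OF cadlag_left tchange_at_left]) (use assms tchange_pos in auto)

lemma cadlag_tchange:
 assumes "cadlag f" "tchange muu"
 shows "cadlag (%t. f (muu t))" unfolding cadlag_def
proof (intro conjI allI impI)
 fix t :: real assume "0 <= t"
 thus "((%t. f (muu t)) \<longlongrightarrow> f (muu t)) (at_right t)"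
  using filterlim_compose[OF cadlag_right tchange_at_right[of muu t]] assms tchange_nonneg by blast
next
 fix t :: real assume "0 < t"
 thus "EX l. ((%t. f (muu t)) \<longlongrightarrow> l) (at_left t)" using left_limit_tchange[OF assms] by blast
qed

lemma left_limit_comp_tchange:
 assumes "cadlag f" "tchange muu" "0 <= t"
 shows "left_limit (%t. f (muu t)) t = left_limit f (muu t)"
proof (cases "t = 0")
 case True
 thus ?thesis using assms by (simp add: left_limit_def tchange_def)
next
 case False
 thus ?thesis using left_limit_eqI[OF left_limit_tchange] assms by auto
qed

text \<open>Compactness by bisection: near a point \<open>x\<close> the exceptional set consisting
  of \<open>x\<close> alone suffices, and when two intervals are joined the common end point is
  added.\<close>

lemma cadlag_finite_oscillation:
 assumes "cadlag f" "0 <= T" "0 < e"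
 obtains J where "finite J" "!!u v. 0 <= u ==> u <= v ==> v <= T ==> J \<inter> {u<..v} = {} ==> |f u - f v| <= e"
proof -
 define P where "P = (%a b. 0 <= a --> (EX J. finite J &
  (ALL u v. a <= u & u <= v & v <= b & J \<inter> {u<..v} = {} --> |f u - f v| <= e)))"
 have "P 0 T"
 proof (rule Bolzano[OF assms(2)])
  fix a b c assume P: "P a b" "P b c" and "a <= b" "b <= c"
  show "P a c" unfolding P_def
  proof
   assume "0 <= a"
   with P(1) obtain J where J: "finite J" "!!u v. a <= u ==> u <= v ==> v <= b ==> J \<inter> {u<..v} = {} ==> |f u - f v| <= e"
    unfolding P_def by blast
   from P(2) `a <= b` `0 <= a` obtain J' where J': "finite J'"
    "!!u v. b <= u ==> u <= v ==> v <= c ==> J' \<inter> {u<..v} = {} ==> |f u - f v| <= e"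
    unfolding P_def by (meson order_trans)
   have "|f u - f v| <= e" if "a <= u" "u <= v" "v <= c" "insert b (J \<union> J') \<inter> {u<..v} = {}" for u v
   proof -
    have "J \<inter> {u<..v} = {}" "J' \<inter> {u<..v} = {}" "v < b \<or> b <= u" using that by auto
    thus ?thesis using J(2)[of u v] J'(2)[of u v] that by auto
   qed
   with J(1) J'(1) show "EX J. finite J & (ALL u v. a <= u & u <= v & v <= c & J \<inter> {u<..v} = {} --> |f u - f v| <= e)"
    by (intro exI[of _ "insert b (J \<union> J')"]) auto
  qed
 next
  fix x assume "0 <= x" "x <= T"
  have "\<forall>\<^sub>F y in at_right x. dist (f y) (f x) < e / 2"
   using cadlag_right[OF assms(1) `0 <= x`] assms(3) by (intro tendstoD) auto
  then obtain c where c: "x < c" "!!y. x < y ==> y < c ==> dist (f y) (f x) < e / 2" by (auto simp: eventually_at_right_field)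
  obtain c' where c': "c' < x" "!!y. c' < y ==> y < x ==> 0 < x ==> dist (f y) (left_limit f x) < e / 2"
  proof (cases "0 < x")
   case True
   hence "\<forall>\<^sub>F y in at_left x. dist (f y) (left_limit f x) < e / 2"
    using cadlag_left[OF assms(1)] assms(3) by (intro tendstoD) auto
   thus ?thesis using that by (auto simp: eventually_at_left_field)
  next
   case False
   thus ?thesis using that[of "x - 1"] by auto
  qed
  show "EX d>0. ALL a b. a <= x & x <= b & b - a < d --> P a b"
  proof (intro exI[of _ "min (c - x) (x - c')"] conjI allI impI)
   show "0 < min (c - x) (x - c')" using c(1) c'(1) by auto
   fix a b assume ab: "a <= x & x <= b & b - a < min (c - x) (x - c')"
   show "P a b" unfolding P_def
   proof (intro impI exI[of _ "{x}"] conjI allI)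
    fix u v assume "0 <= a" and uv: "a <= u & u <= v & v <= b & {x} \<inter> {u<..v} = {}"
    then consider "v < x" | "x <= u" by force
    thus "|f u - f v| <= e"
    proof cases
     case 1
     hence "dist (f u) (left_limit f x) < e / 2" "dist (f v) (left_limit f x) < e / 2"
     using c'(2)[of u] c'(2)[of v] uv ab `0 <= a` by auto
     thus ?thesis unfolding dist_real_def by linarith
    next
     case 2
     have near: "dist (f w) (f x) < e / 2" if "x <= w" "w < c" for w using c(2)[of w] that assms(3) by (cases "w = x") auto
     have "dist (f u) (f x) < e / 2" "dist (f v) (f x) < e / 2" using near[of u] near[of v] uv ab 2 by auto
     thus ?thesis unfolding dist_real_def by linarith
    qed
   qed simp
  qed
 qed
 thus ?thesis unfolding P_def using that by auto
qed

text \<open>A jump time belongs to one of the finite exceptional sets for the oscillations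
  \<open>1 / (n + 1)\<close>; outside all of them the jump has size \<open>0\<close>.\<close>

lemma cadlag_jumps_countable:
 assumes "cadlag f" "0 <= T"
 shows "countable {t : {0<..T}. left_limit f t ~= f t}"
proof -
 have "EX J. finite J & (ALL u v. 0 <= u --> u <= v --> v <= T --> J \<inter> {u<..v} = {} -->
   |f u - f v| <= 1 / real (Suc n))" for n using cadlag_finite_oscillation[OF assms, of "1 / real (Suc n)"]
  by (metis of_nat_0_less_iff zero_less_Suc zero_less_divide_1_iff)
 then obtain J where J: "!!n. finite (J n)" "!!n u v. 0 <= u ==> u <= v ==> v <= T ==>
   J n \<inter> {u<..v} = {} ==> |f u - f v| <= 1 / real (Suc n)" by metis
 have "t : (\<Union>n. J n)" if t: "0 < t" "t <= T" "left_limit f t ~= f t" for t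
 proof (rule ccontr)
  assume "t \<notin> (\<Union>n. J n)"
  have "|left_limit f t - f t| <= 1 / real (Suc n)" for n
  proof (rule tendsto_upperbound)
   show "((%u. |f u - f t| ) \<longlongrightarrow> |left_limit f t - f t| ) (at_left t)"
    by (intro tendsto_intros cadlag_left assms t)
   have "\<forall>\<^sub>F u in at_left t. ALL s:J n. s < t --> s < u"
   proof (intro eventually_ball_finite J(1) ballI)
    fix s show "\<forall>\<^sub>F u in at_left t. s < t --> s < u"
    proof (cases "s < t")
     case True
     thus ?thesis by (intro eventually_mono[OF eventually_at_left_real[OF True]]) auto
    qed simp
   qed
   moreover have "\<forall>\<^sub>F u in at_left t. 0 < u & u < t"
    using eventually_at_left_real[OF t(1)] by (rule eventually_mono) auto
   ultimately show "\<forall>\<^sub>F u in at_left t. |f u - f t| <= 1 / real (Suc n)"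
   proof eventually_elim
    case (elim u)
    hence "J n \<inter> {u<..t} = {}" using `t \<notin> (\<Union>n. J n)` by force
    thus ?case using J(2)[of u t n] elim t by auto
   qed
  qed auto
  hence "|left_limit f t - f t| <= 0" by (intro LIMSEQ_le_const[OF LIMSEQ_inverse_real_of_nat]) (auto simp: inverse_eq_divide)
  with t show False by simp
 qed
 hence "{t : {0<..T}. left_limit f t ~= f t} \<subseteq> (\<Union>n. J n)" by auto
 thus ?thesis using J(1) by (meson countable_UN countable_finite countable_subset countableI_type)
qed

section \<open>Parametrisations of completed graphs\<close>

lemma cvx_comb_dist:
 fixes x y z :: real
 assumes "|x - z| <= e" "|y - z| <= e" "0 <= c" "c <= 1"
 shows "| (1 - c) * x + c * y - z| <= e"
proof -
 have "(1 - c) * x + c * y - z = (1 - c) * (x - z) + c * (y - z)" by (simp add: algebra_simps)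
 also have "|... | <= (1 - c) * |x - z| + c * |y - z|"
  using assms by (intro order_trans[OF abs_triangle_ineq]) (simp add: abs_mult)
 also have "... <= (1 - c) * e + c * e" using assms by (intro add_mono mult_left_mono) auto
 finally show ?thesis by (simp add: algebra_simps)
qed

lemma cadlag_near_right:
 assumes "cadlag f" "0 <= t" "0 < e"
 obtains d where "0 < d" "!!x. t < x ==> x < t + d ==> |f x - f t| <= e & |left_limit f x - f t| <= e"
proof -
 have "\<forall>\<^sub>F y in at_right t. dist (f y) (f t) < e" using cadlag_right[OF assms(1,2)] assms(3) by (rule tendstoD)
 then obtain c where c: "t < c" "!!y. t < y ==> y < c ==> |f y - f t| < e"
  by (auto simp: eventually_at_right_field dist_real_def)
 have "|left_limit f x - f t| <= e" if "t < x" "x < c" for x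
 proof (rule tendsto_upperbound)
  show "((%u. |f u - f t| ) \<longlongrightarrow> |left_limit f x - f t| ) (at_left x)"
   using assms that by (intro tendsto_intros cadlag_left) auto
  show "\<forall>\<^sub>F u in at_left x. |f u - f t| <= e" using eventually_at_left_real[OF that(1)]
   by eventually_elim (use c(2) that in force)
 qed simp
 thus ?thesis using that[of "c - t"] c less_imp_le by auto
qed

lemma cadlag_near_left:
 assumes "cadlag f" "0 < t" "0 < e"
 obtains d where "0 < d" "!!x. t - d < x ==> x < t ==> 0 < x ==>
  |f x - left_limit f t| <= e & |left_limit f x - left_limit f t| <= e"
proof -
 have "\<forall>\<^sub>F y in at_left t. dist (f y) (left_limit f t) < e"
  using cadlag_left[OF assms(1,2)] assms(3) by (rule tendstoD)
 then obtain c where c: "c < t" "!!y. c < y ==> y < t ==> |f y - left_limit f t| < e"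
  by (auto simp: eventually_at_left_field dist_real_def)
 have "|left_limit f x - left_limit f t| <= e" if "c < x" "x < t" "0 < x" for x
 proof (rule tendsto_upperbound)
  show "((%u. |f u - left_limit f t| ) \<longlongrightarrow> |left_limit f x - left_limit f t| ) (at_left x)"
   using assms that by (intro tendsto_intros cadlag_left) auto
  show "\<forall>\<^sub>F u in at_left x. |f u - left_limit f t| <= e" using eventually_at_left_real[OF that(1)]
   by eventually_elim (use c(2) that in force)
 qed simp
 thus ?thesis using that[of "t - c"] c less_imp_le by auto
qed

text \<open>\<open>ta\<close> is the time shown and \<open>thh\<close> the position within a pause;
  at each time of \<open>J\<close> the clock pauses while \<open>thh\<close> takes all values in
  \<open>[0, 1]\<close>. The last clause concerns every function with jumps in \<open>J\<close>, so
  that one clock can serve two graphs.\<close>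

definition is_clock :: "real => real set => (real => real) => (real => real) => bool" where "is_clock S J ta thh <->
  (ALL u:{0..1}. ta u : {0..S} & thh u : {0..1}) & (ALL t:{0..S}. EX u:{0..1}. ta u = t) &
  (ALL t:J \<inter> {0<..S}. ALL c:{0..1}. EX u:{0..1}. ta u = t & thh u = c) &
  (ALL u u'. 0 <= u & u <= u' & u' <= 1 --> ta u < ta u' \<or> ta u = ta u' & thh u <= thh u') & continuous_on {0..1} ta &
  (ALL f. cadlag f & {t : {0<..S}. left_limit f t ~= f t} \<subseteq> J -->
   continuous_on {0..1} (%u. (1 - thh u) * left_limit f (ta u) + thh u * f (ta u)))"

text \<open>Time is stretched by the distribution function of a probability measure with atoms at
  the points of \<open>J\<close>: \<open>T\<close> is the generalised inverse of
  \<open>t + cdf nuu t\<close>, pausing at an atom for the length of its mass, while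
  \<open>Th\<close> runs from \<open>0\<close> to \<open>1\<close>.\<close>

lemma clock_exists:
 fixes S :: real
 assumes S: "0 < S" and J: "countable J"
 shows "EX ta thh. is_clock S J ta thh"
proof -
 \<comment> \<open>\<open>S\<close> is added to have a nonempty set, which can be
   enumerated.\<close>
 define J' where "J' = insert S (J \<inter> {0<..S})"
 define s where "s = from_nat_into J'"
 have s: "range s = J'" unfolding s_def by (rule range_from_nat_into) (auto simp: J'_def J)
 \<comment> \<open>The geometric law charges every index, so every point of \<open>J'\<close> is an
   atom.\<close>
 define nuu where "nuu = distr (measure_pmf (geometric_pmf (1/2))) borel s"
 interpret nu: real_distribution nuu
  unfolding nuu_def by (intro prob_space.real_distribution_distr measure_pmf.prob_space_axioms) simp
 have meas: "measure nuu A = \<P> (geometric_pmf (1/2)) (s -` A)" if "A : sets borel" for A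
  unfolding nuu_def using that by (subst measure_distr) auto
 have atom: "0 < measure nuu {t} <-> t : J'" for t
 proof
  assume "0 < measure nuu {t}"
  hence "s -` {t} ~= {}" using meas[of "{t}"] by force
  thus "t : J'" using s by blast
 next
  assume "t : J'"
  then obtain n where "s n = t" using s by blast
  hence "pmf (geometric_pmf (1/2)) n <= measure nuu {t}" unfolding meas[OF borel_singleton[OF sets.empty_sets]]
   by (subst pmf.rep_eq) (auto intro!: measure_pmf.finite_measure_mono)
  moreover have "0 < pmf (geometric_pmf (1/2)) n" by simp
  ultimately show "0 < measure nuu {t}" by linarith
 qed
 define A where "A = (%t. t + cdf nuu t)"
 define B where "B = (%t. t + measure nuu {..<t})"
 have AB: "A t = B t + measure nuu {t}" for t
 proof -
  have "measure nuu {..t} = measure nuu {..<t} + measure nuu {t}"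
   by (subst nu.finite_measure_Union[symmetric]) (auto intro!: arg_cong[of _ _ "measure nuu"])
  thus ?thesis by (simp add: A_def B_def cdf_def)
 qed
 have BA: "B t' - A t >= t' - t" if "t < t'" for t t'
  unfolding A_def B_def cdf_def using that by (auto intro!: nu.finite_measure_mono)
 have Bmono: "t <= t' ==> B t <= B t'" for t t' unfolding B_def by (auto intro!: add_mono nu.finite_measure_mono)
 have BleA: "B t <= A t" for t using AB[of t] by simp
 have sn: "0 < s n" "s n <= S" for n
 proof -
  have "s n : J'" using s by blast
  thus "0 < s n" "s n <= S" using S by (auto simp: J'_def)
 qed
 have B0: "B 0 = 0"
 proof -
  have "\<not> s n < 0" for n using sn(1)[of n] by simp
  hence "s -` {..<0} = {}" by auto
  thus ?thesis by (simp add: B_def meas)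
 qed
 have AS: "A S = S + 1"
 proof -
  have "s -` {..S} = UNIV" using sn(2) by auto
  thus ?thesis by (simp add: A_def cdf_def meas)
 qed
 have ex: "EX t. t : {0..S} & B t <= v & v <= A t" if v: "0 <= v" "v <= S + 1" for v
 proof -
  \<comment> \<open>The time at which the stretched clock reaches \<open>v\<close>, found as a
    supremum; left limits and right continuity of the distribution function give the two
    inequalities.\<close>
  define X where "X = {t : {0..S}. B t <= v}"
  define t where "t = Sup X"
  have X: "0 : X" "bdd_above X" using S v by (auto simp: X_def B0)
  have t: "0 <= t" "t <= S" unfolding t_def using X by (auto intro!: cSup_upper cSup_least simp: X_def)
  have "B t <= v"
  proof (cases "t : X")
   case False
   have below: "A x <= v" if x: "x < t" for x
   proof -
    obtain y where "y : X" "x < y" using x X less_cSup_iff[of X x] by (auto simp: t_def)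
    thus ?thesis using BA[of x y] by (auto simp: X_def)
   qed
   have "(A \<longlongrightarrow> B t) (at_left t)" unfolding A_def B_def by (intro tendsto_intros nu.cdf_at_left)
   thus ?thesis by (rule tendsto_upperbound) (auto simp: eventually_at_left_field below intro!: exI[of _ "t - 1"])
  qed (simp add: X_def)
  moreover have "v <= A t"
  proof (cases "t = S")
   case False
   have above: "v <= A x" if x: "t < x" "x < S" for x
   proof -
    have "x \<notin> X" using x X cSup_upper[of x X] by (auto simp: t_def)
    thus ?thesis using x t BleA[of x] by (auto simp: X_def)
   qed
   have "(A \<longlongrightarrow> A t) (at_right t)" unfolding A_def using nu.cdf_is_right_cont[of t]
    by (intro tendsto_intros) (auto simp: continuous_within)
   thus ?thesis by (rule tendsto_lowerbound)
     (use False t above in \<open>auto simp: eventually_at_right_field intro!: exI[of _ S]\<close>)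
  qed (use AS v in simp)
  ultimately show ?thesis using t by auto
 qed
 define T where "T = (%v. SOME t. t : {0..S} & B t <= v & v <= A t)"
 define Th where "Th = (%v. (v - B (T v)) / measure nuu {T v})"
 have T: "T v : {0..S}" "B (T v) <= v" "v <= A (T v)" if "0 <= v" "v <= S + 1" for v
  using someI_ex[OF ex[OF that]] unfolding T_def by auto
 have T_eqI: "T v = t" if "t : {0..S}" "B t <= v" "v <= A t" "0 <= v" "v <= S + 1" for v t
  using T[of v] that BA[of t "T v"] BA[of "T v" t] by (cases t "T v" rule: linorder_cases) auto
 have Thmult: "Th v * measure nuu {T v} = v - B (T v)" if "0 <= v" "v <= S + 1" for v
  using T[OF that] AB[of "T v"] by (cases "measure nuu {T v} = 0") (auto simp: Th_def)
 have Th: "0 <= Th v" "Th v <= 1" if "0 <= v" "v <= S + 1" for v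
  using T[OF that] AB[of "T v"] by (auto simp: Th_def divide_le_eq_1 zero_less_measure_iff)
 have Tmono: "T v < T v' \<or> T v = T v' & Th v <= Th v'" if "0 <= v" "v <= v'" "v' <= S + 1" for v v'
 proof (cases "T v" "T v'" rule: linorder_cases)
  case greater
  thus ?thesis using T[of v] T[of v'] that BA[of "T v'" "T v"] by auto
 qed (use that in \<open>auto simp: Th_def intro!: divide_right_mono\<close>)
 have Tlip: "T v' - T v <= v' - v" if "0 <= v" "v <= v'" "v' <= S + 1" for v v'
  using T[of v] T[of v'] that BA[of "T v" "T v'"] by (cases "T v < T v'") auto
 have Tdist: "|T v' - T v| <= |v' - v|" if "0 <= v" "v <= S + 1" "0 <= v'" "v' <= S + 1" for v v'
  using Tlip[of v v'] Tlip[of v' v] Tmono[of v v'] Tmono[of v' v] that by (cases "v <= v'") auto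
 have contT: "continuous_on {0..S + 1} T" unfolding continuous_on_iff
 proof (intro ballI allI impI)
  fix x e :: real assume "x : {0..S + 1}" "0 < e"
  thus "EX d>0. ALL x':{0..S + 1}. dist x' x < d --> dist (T x') (T x) < e"
   using Tdist[of x] by (intro exI[of _ e]) (force simp: dist_real_def)
 qed
 have contP: "continuous_on {0..S + 1} (%v. (1 - Th v) * left_limit f (T v) + Th v * f (T v))"
  if f: "cadlag f" "{t : {0<..S}. left_limit f t ~= f t} \<subseteq> J" for f unfolding continuous_on_iff
 proof (intro ballI allI impI)
  fix v e :: real assume v': "v : {0..S + 1}" and "0 < e"
  hence v: "0 <= v" "v <= S + 1" by auto
  let ?P = "%v. (1 - Th v) * left_limit f (T v) + Th v * f (T v)"
  define t l r where "t = T v" and "l = left_limit f t" and "r = f t"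
  note [simp] = t_def[symmetric]
  have t: "0 <= t" "t <= S" using T[OF v] by auto
  define m where "m = measure nuu {t}"
  \<comment> \<open>Slope of the space component during the pause at \<open>t\<close>. Without an
    atom there is no jump, and both sides of \<open>K * m = |r - l|\<close> vanish.\<close>
  define K where "K = |r - l| / m"
  have K: "K * m = |r - l|" "0 <= K"
  proof -
   have "r = l" if "m = 0"
   proof (cases "t = 0")
    case False
    have "t \<notin> J'" using that atom[of t] by (simp add: m_def)
    hence "t \<notin> J" using t False by (auto simp: J'_def)
    hence "t \<notin> {t : {0<..S}. left_limit f t ~= f t}" using f(2) by blast
    thus ?thesis using t False by (auto simp: r_def l_def)
   qed (simp add: r_def l_def left_limit_def)
   thus "K * m = |r - l|" "0 <= K" by (auto simp: K_def m_def)
  qed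
  obtain d1 where d1: "0 < d1" "!!x. t < x ==> x < t + d1 ==> |f x - r| <= e / 2 & |left_limit f x - r| <= e / 2"
   using cadlag_near_right[OF f(1) t(1), of "e / 2"] `0 < e` unfolding r_def by auto
  obtain d2 where d2: "0 < d2" "!!x. t - d2 < x ==> x < t ==> 0 <= x ==> |f x - l| <= e / 2 & |left_limit f x - l| <= e / 2"
  proof (cases "t = 0")
   case False
   then obtain d where d: "0 < d" "!!x. t - d < x ==> x < t ==> 0 < x ==> |f x - l| <= e / 2 & |left_limit f x - l| <= e / 2"
    using cadlag_near_left[OF f(1), of t "e / 2"] `0 < e` t unfolding l_def by auto
   show ?thesis by (rule that[of "min d t"]) (use d t False in auto)
  qed (use that[of 1] in auto)
  define d where "d = Min {d1, d2, e / (2 * (K + 1))}"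
  have d: "0 < d" "d <= d1" "d <= d2" "d <= e / (2 * (K + 1))" using d1 d2 `0 < e` K(2) by (auto simp: d_def)
  have Kd: "K * x < e / 2" if "x < d" "0 <= x" for x
  proof -
   have "K * x <= (K + 1) * x" using that by (simp add: algebra_simps)
   also have "... < (K + 1) * (e / (2 * (K + 1)))" using K(2) that d by (intro mult_strict_left_mono) auto
   also have "... = e / 2" using K(2) by (simp add: field_simps)
   finally show ?thesis .
  qed
  have Pl: "?P v - l = Th v * (r - l)" and Pr: "?P v - r = (Th v - 1) * (r - l)" by (simp_all add: l_def r_def algebra_simps)
  have Thv: "Th v * m = v - B t" using Thmult[OF v] by (simp add: m_def)
  have "dist (?P w) (?P v) < e" if "w : {0..S + 1}" "dist w v < d" for w
  proof -
   have w: "0 <= w" "w <= S + 1" "|w - v| < d" using that by (auto simp: dist_real_def)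
   have Tw: "|T w - t| < d" "0 <= T w" using Tdist[of v w] v w T[of w] by auto
   have KK: "K * |w - v| < e / 2" using Kd w by simp
   \<comment> \<open>Within the pause the component is affine with slope \<open>K\<close>. If the
     time has moved on, the rest of the pause is at most \<open>|w - v|\<close>, so the value at
     \<open>v\<close> is already near \<open>r\<close>; the third case is symmetric with
     \<open>l\<close>.\<close>
   consider "T w = t" | "t < T w" | "T w < t" by linarith
   hence "|?P w - ?P v| < e"
   proof cases
    case 1
    have "Th w * m = w - B t" using Thmult[of w] w 1 by (simp add: m_def)
    have "?P w - ?P v = (Th w - Th v) * (r - l)" by (simp add: 1 l_def r_def algebra_simps)
    hence "|?P w - ?P v| = |Th w - Th v| * (K * m)" by (simp add: abs_mult K)
    also have "... = K * | (Th w - Th v) * m|" by (simp add: abs_mult m_def)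
    also have "(Th w - Th v) * m = w - v" using `Th w * m = w - B t` Thv by (simp add: algebra_simps)
    finally show ?thesis using KK `0 < e` by linarith
   next
    case 2
    have "|?P w - r| <= e / 2" using d1(2)[of "T w"] 2 Tw d Th[of w] w by (intro cvx_comb_dist) auto
    moreover have "|?P v - r| < e / 2"
    proof -
     have "|?P v - r| = (1 - Th v) * (K * m)" using Th[OF v] unfolding Pr K(1) by (simp add: abs_mult)
     also have "... = K * (m - Th v * m)" by (simp add: algebra_simps)
     also have "... <= K * |w - v|" using BA[of t "T w"] 2 T[of w] w K(2) AB[of t] unfolding Thv
     by (intro mult_left_mono) (auto simp: m_def)
     finally show ?thesis using KK by linarith
    qed
    ultimately show ?thesis by linarith
   next
    case 3
    have "|?P w - l| <= e / 2" using d2(2)[of "T w"] 3 Tw d Th[of w] w by (intro cvx_comb_dist) auto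
    moreover have "|?P v - l| < e / 2"
    proof -
     have "|?P v - l| = Th v * (K * m)" using Th[OF v] unfolding Pl K(1) by (simp add: abs_mult)
     also have "... = K * (Th v * m)" by (simp add: algebra_simps)
     also have "... <= K * |w - v|" using BA[of "T w" t] 3 T[of w] w K(2) unfolding Thv by (intro mult_left_mono) auto
     finally show ?thesis using KK by linarith
    qed
    ultimately show ?thesis by linarith
   qed
   thus ?thesis by (simp add: dist_real_def)
  qed
  thus "EX d>0. ALL w:{0..S + 1}. dist w v < d --> dist (?P w) (?P v) < e" using d(1) by blast
 qed
 have rng: "0 <= (S + 1) * u & (S + 1) * u <= S + 1" if "u : {0..1}" for u using that S by (auto intro: mult_left_le)
 have scale: "EX u:{0..1}. (S + 1) * u = v" if "0 <= v" "v <= S + 1" for v using that S by (intro bexI[of _ "v / (S + 1)"]) auto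
 have cont: "continuous_on {0..1} (%u. F ((S + 1) * u))" if "continuous_on {0..S + 1} F" for F :: "real => real"
  by (rule continuous_on_compose2[OF that]) (auto intro!: continuous_intros simp: rng)
 have "is_clock S J (%u. T ((S + 1) * u)) (%u. Th ((S + 1) * u))" unfolding is_clock_def
 proof (intro conjI[rotated] ballI allI impI; (elim conjE)?)
  fix u :: real assume "u : {0..1}"
  thus "T ((S + 1) * u) : {0..S}" "Th ((S + 1) * u) : {0..1}" using rng[of u] T(1) Th by auto
 next
  fix t assume t: "t : {0..S}"
  have v: "0 <= A t" "A t <= S + 1" using t nu.prob_le_1[of "{..t}"] by (auto simp: A_def cdf_def intro: add_mono)
  then obtain u where "u : {0..1}" "(S + 1) * u = A t" using scale by blast
  moreover have "T (A t) = t" using T_eqI[of t "A t"] t v BleA by auto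
  ultimately show "EX u:{0..1}. T ((S + 1) * u) = t" by (intro bexI[of _ u]) auto
 next
  fix t c :: real assume t: "t : J \<inter> {0<..S}" and c: "c : {0..1}"
  define v where "v = B t + c * measure nuu {t}"
  have m: "0 < measure nuu {t}" using t by (subst atom) (auto simp: J'_def)
  have B: "B t <= v" "v <= A t" unfolding AB using c m by (auto simp: v_def mult_left_le_one_le)
  have v: "0 <= v" "v <= S + 1"
  proof -
   show "0 <= v" using B(1) t by (auto simp: B_def intro: order_trans[rotated])
   have "A t <= S + 1" using t nu.prob_le_1[of "{..t}"] by (auto simp: A_def cdf_def intro: add_mono)
   thus "v <= S + 1" using B(2) by simp
  qed
  have "T v = t" by (rule T_eqI) (use t B v in auto)
  moreover from this have "Th v = c" using m by (simp add: Th_def v_def)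
  moreover obtain u where "u : {0..1}" "(S + 1) * u = v" using scale v by blast
  ultimately show "EX u:{0..1}. T ((S + 1) * u) = t & Th ((S + 1) * u) = c" by (intro bexI[of _ u]) auto
 next
  fix u u' :: real assume "0 <= u" "u <= u'" "u' <= 1"
  thus "T ((S + 1) * u) < T ((S + 1) * u') \<or> T ((S + 1) * u) = T ((S + 1) * u') & Th ((S + 1) * u) <= Th ((S + 1) * u')"
   using S rng[of u'] by (intro Tmono) (auto intro: mult_left_mono)
 qed (intro cont contT contP; assumption)+
 thus ?thesis by blast
qed

text \<open>The clock runs for \<open>g\<close> composed with \<open>muu\<close>; applying
  \<open>muu\<close> to its time component yields the graph of \<open>g\<close> itself.\<close>

lemma parametrisation_of_clock:
 fixes ta thh :: "real => real"
 assumes S: "0 < S" and g: "cadlag g" and muu: "tchange muu" "muu S = S" and clock: "is_clock S J ta thh"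
  and jumps: "{t : {0<..S}. left_limit (%t. g (muu t)) t ~= g (muu t)} \<subseteq> J"
 shows "(%u. (muu (ta u), (1 - thh u) * left_limit (%t. g (muu t)) (ta u) + thh u * g (muu (ta u))))
  : parametrisations S g" (is "?p : _")
proof -
 let ?f = "%t. g (muu t)"
 have tathh: "!!u. u : {0..1} ==> ta u : {0..S} & thh u : {0..1}" and surj1: "!!t. t : {0..S} ==> EX u:{0..1}. ta u = t"
  and surj2: "!!t c. t : J \<inter> {0<..S} ==> c : {0..1} ==> EX u:{0..1}. ta u = t & thh u = c"
  and mono: "!!u u'. 0 <= u ==> u <= u' ==> u' <= 1 ==> ta u < ta u' \<or> ta u = ta u' & thh u <= thh u'"
  using clock unfolding is_clock_def by simp_all
 have cont: "continuous_on {0..1} ta" "continuous_on {0..1} (%u. (1 - thh u) * left_limit ?f (ta u) + thh u * ?f (ta u))"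
  using clock cadlag_tchange[OF g muu(1)] jumps unfolding is_clock_def by blast+
 have ll: "left_limit ?f t = left_limit g (muu t)" if "0 <= t" for t using left_limit_comp_tchange[OF g muu(1) that] .
 have muuS: "muu t : {0..S} <-> t : {0..S}" for t
  using tchange_nonneg[OF muu(1), of t] tchange_le[OF muu(1), of t S] muu(2) by auto
 have "continuous_on UNIV muu" by (simp add: continuous_on_eq_continuous_at tchange_isCont[OF muu(1)])
 hence "continuous_on {0..1} (%u. muu (ta u))" by (rule continuous_on_compose2[OF _ cont(1)]) simp
 hence "continuous_on {0..1} ?p" using cont(2) by (rule continuous_on_Pair)
 moreover have "?p ` {0..1} = completed_graph S g"
 proof (intro equalityI subsetI)
  fix z assume "z : ?p ` {0..1}"
  then obtain u where u: "u : {0..1}" "z = ?p u" by blast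
  have "ta u : {0..S}" "thh u : {0..1}" using tathh[OF u(1)] by auto
  moreover from this have "muu (ta u) : {0..S}" using muuS by blast
  ultimately show "z : completed_graph S g" unfolding completed_graph_def u(2) by (auto simp: ll intro!: bexI[of _ "1 - thh u"])
 next
  fix z assume "z : completed_graph S g"
  then obtain t x c where z: "z = (t, x)" "t : {0..S}" "c : {0..1}" "x = c * left_limit g t + (1 - c) * g t"
   unfolding completed_graph_def by auto
  define t0 where "t0 = inv muu t"
  have t0: "muu t0 = t" unfolding t0_def using tchange_inv[OF muu(1)] by blast
  have t0S: "t0 : {0..S}" using muuS[of t0] z t0 by simp
  show "z : ?p ` {0..1}"
  proof (cases "t0 : J \<inter> {0<..S}")
   case True
   then obtain u where "u : {0..1}" "ta u = t0" "thh u = 1 - c" using surj2[of t0 "1 - c"] z by auto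
   thus ?thesis using z t0 t0S by (intro image_eqI[of _ _ u]) (auto simp: ll)
  next
   case False
   have "left_limit ?f t0 = g t"
   proof (cases "t0 = 0")
    case False
    hence "t0 \<notin> J" "t0 : {0<..S}" using `t0 \<notin> J \<inter> {0<..S}` t0S by auto
    hence "left_limit ?f t0 = ?f t0" using jumps by blast
    thus ?thesis using t0 by simp
   qed (use t0 in \<open>simp add: left_limit_def\<close>)
   hence eq: "left_limit g t = g t" using ll[of t0] t0S t0 by simp
   obtain u where "u : {0..1}" "ta u = t0" using surj1[OF t0S] by blast
   thus ?thesis using z t0 t0S by (intro image_eqI[of _ _ u]) (auto simp: ll eq algebra_simps)
  qed
 qed
 moreover have "graph_le g (?p s) (?p s')" if "s : {0..1}" "s' : {0..1}" "s <= s'" for s s'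
 proof -
  have pos: "0 <= ta s" "thh s : {0..1}" "thh s' : {0..1}" using tathh that by auto
  have "ta s < ta s' \<or> ta s = ta s' & thh s <= thh s'" using mono[of s s'] that by auto
  then consider "ta s < ta s'" | "ta s = ta s'" "thh s <= thh s'" by blast
  thus ?thesis
  proof cases
   case 1
   thus ?thesis by (simp add: graph_le_def tchange_less[OF muu(1)])
  next
   case 2
   let ?l = "left_limit g (muu (ta s))" and ?r = "g (muu (ta s))"
   have "?l - ((1 - c) * ?l + c * ?r) = c * (?l - ?r)" for c by (simp add: algebra_simps)
   thus ?thesis using 2 pos by (auto simp: graph_le_def ll abs_mult intro: mult_right_mono)
  qed
 qed
 ultimately show ?thesis unfolding parametrisations_def by blast
qed

text \<open>One clock that pauses at the jumps of both functions parametrises both graphs, so the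
  two space components are convex combinations with the same weights.\<close>

lemma M1_dist_le:
 assumes S: "0 < S" and f: "cadlag f" and g: "cadlag g" and muu: "tchange muu" "muu S = S"
  and e: "!!t. t : {0..S} ==> |muu t - t| <= e" "!!t. t : {0..S} ==> |f t - g (muu t) | <= e"
 shows "M1_dist S f g <= e" and "0 <= M1_dist S f g"
proof -
 let ?g = "%t. g (muu t)"
 have g': "cadlag ?g" by (rule cadlag_tchange[OF g muu(1)])
 define J where "J = {t : {0<..S}. left_limit f t ~= f t} \<union> {t : {0<..S}. left_limit ?g t ~= ?g t}"
 have J: "countable J" unfolding J_def using cadlag_jumps_countable[of _ S] f g' S by (intro countable_Un) auto
 obtain ta thh where clock: "is_clock S J ta thh" using clock_exists[OF S J] by blast
 have c: "!!u. u : {0..1} ==> ta u : {0..S} & thh u : {0..1}" using clock by (simp add: is_clock_def)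
 define x where "x = (%f u. (1 - thh u) * left_limit f (ta u) + thh u * f (ta u))"
 have p: "(%u. (ta u, x f u)) : parametrisations S f" unfolding x_def
  by (rule parametrisation_of_clock[OF S f _ _ clock, where muu = "%t. t"]) (auto simp: J_def tchange_def strict_mono_def)
 have q: "(%u. (muu (ta u), x ?g u)) : parametrisations S g" unfolding x_def
  by (rule parametrisation_of_clock[OF S g muu clock]) (auto simp: J_def)
 let ?v = "%(p :: real => real \<times> real, q :: real => real \<times> real).
  max (SUP s\<in>{0..1}. |fst (p s) - fst (q s) | ) (SUP s\<in>{0..1}. |snd (p s) - snd (q s) | )"
 have v0: "0 <= ?v z" if z: "z : parametrisations S f \<times> parametrisations S g" for z
 proof -
  obtain p q where pq: "z = (p, q)" by force
  have cont: "continuous_on {0..1} p" "continuous_on {0..1} q" using z by (auto simp: parametrisations_def pq)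
  have "compact ((%s. |fst (p s) - fst (q s) | ) ` {0..1})"
   using cont by (intro compact_continuous_image continuous_intros) auto
  hence "bdd_above ((%s. |fst (p s) - fst (q s) | ) ` {0..1})" by (intro bounded_imp_bdd_above compact_imp_bounded)
  hence "|fst (p 0) - fst (q 0) | <= (SUP s\<in>{0..1}. |fst (p s) - fst (q s) | )" by (intro cSUP_upper) auto
  thus ?thesis by (auto simp: pq)
 qed
 have "|x f u - x ?g u| <= e" if u: "u : {0..1}" for u
 proof -
  have tathh: "ta u : {0..S}" "thh u : {0..1}" using c[OF u] by auto
  have "|left_limit f (ta u) - left_limit ?g (ta u) | <= e"
  proof (cases "ta u = 0")
   case False
   hence pos: "0 < ta u" using tathh by auto
   show ?thesis
   proof (rule tendsto_upperbound)
    show "((%t. |f t - ?g t| ) \<longlongrightarrow> |left_limit f (ta u) - left_limit ?g (ta u) | ) (at_left (ta u))"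
     using pos by (intro tendsto_intros cadlag_left f g')
    show "\<forall>\<^sub>F t in at_left (ta u). |f t - ?g t| <= e"
     using eventually_at_left_real[OF pos] by eventually_elim (use e(2) tathh in auto)
   qed simp
  qed (use e(2) S in \<open>simp add: left_limit_def\<close>)
  moreover have "|f (ta u) - ?g (ta u) | <= e" using e(2) tathh by blast
  ultimately have "| (1 - thh u) * (left_limit f (ta u) - left_limit ?g (ta u)) + thh u * (f (ta u) - ?g (ta u)) - 0| <= e"
   using tathh by (intro cvx_comb_dist) auto
  thus ?thesis by (simp add: x_def algebra_simps)
 qed
 hence "?v (%u. (ta u, x f u), %u. (muu (ta u), x ?g u)) <= e" using c e(1) by (auto intro!: cSUP_least simp: abs_minus_commute)
 moreover have "M1_dist S f g <= ?v (%u. (ta u, x f u), %u. (muu (ta u), x ?g u))"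
  unfolding M1_dist_def by (rule cINF_lower) (use v0 p q in \<open>auto intro!: bdd_belowI2[of _ 0]\<close>)
 ultimately show "M1_dist S f g <= e" by linarith
 show "0 <= M1_dist S f g" unfolding M1_dist_def by (rule cINF_greatest) (use v0 p q in auto)
qed

section \<open>A metric of Skorohod J1 type on the half-line\<close>

definition closep :: "real => (real => real) => (real => real) => bool" where
 "closep e f g <-> (EX muu. tchange muu & (ALL t. |muu t - t| <= e) &
  (ALL t>=0. min t (muu t) <= 1 / e --> |f t - g (muu t) | <= e))"

text \<open>The inserted \<open>1\<close> makes the set nonempty and caps the distance at
  \<open>1\<close>, the range in which the horizons \<open>1 / e\<close> combine in the triangle
  inequality.\<close>

definition pdist :: "(real => real) => (real => real) => real" where "pdist f g = Inf (insert 1 {e. 0 < e & closep e f g})"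

lemma pdist_bdd: "bdd_below (insert 1 {e. 0 < e & closep e f g})" by (auto intro!: bdd_belowI[of _ 0])

lemma pdist_nonneg: "0 <= pdist f g" unfolding pdist_def by (rule cInf_greatest) auto

lemma pdist_leI: "0 < e ==> closep e f g ==> pdist f g <= e" unfolding pdist_def by (rule cInf_lower[OF _ pdist_bdd]) simp

lemma pdist_le_1: "pdist f g <= 1" unfolding pdist_def by (rule cInf_lower[OF _ pdist_bdd]) simp

lemma path_distD:
 assumes "pdist f g < e" "e <= 1"
 shows "closep e f g"
proof -
 obtain e' where "e' : insert 1 {e. 0 < e & closep e f g}" "e' < e"
  using assms(1) unfolding pdist_def by (subst (asm) cInf_less_iff[OF _ pdist_bdd]) auto
 hence e': "0 < e'" "e' < e" "closep e' f g" using assms(2) by auto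
 hence "1 / e <= 1 / e'" by (simp add: frac_le)
 thus ?thesis using e' unfolding closep_def by (meson less_imp_le order_trans)
qed

lemma closep_uniform:
 assumes "0 < e" "!!t. 0 <= t ==> |f t - g t| <= e"
 shows "closep e f g" unfolding closep_def using assms by (intro exI[of _ "%t. t"]) (auto simp: tchange_def strict_mono_def)

lemma pdist_uniform:
 assumes "0 <= e" "!!t. 0 <= t ==> |f t - g t| <= e"
 shows "pdist f g <= e"
proof (rule field_le_epsilon)
 fix d :: real assume "0 < d"
 thus "pdist f g <= e + d" by (intro pdist_leI closep_uniform) (use assms in \<open>auto intro: add_increasing2\<close>)
qed

lemma pdist_refl [simp]: "pdist f f = 0" using pdist_uniform[of 0 f f] pdist_nonneg[of f f] by simp

text \<open>Inverts the time change; the horizon condition is stated with the minimum of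
  \<open>t\<close> and \<open>muu t\<close> to be invariant under this.\<close>

lemma closep_sym: "closep e f g ==> closep e g f"
proof -
 assume "closep e f g"
 then obtain muu where muu: "tchange muu" "!!t. |muu t - t| <= e"
  "!!t. t >= 0 ==> min t (muu t) <= 1 / e ==> |f t - g (muu t) | <= e" unfolding closep_def by blast
 note inv = tchange_inv[OF muu(1)]
 show ?thesis unfolding closep_def
 proof (intro exI[of _ "inv muu"] conjI allI impI)
  show "|inv muu t - t| <= e" for t using muu(2)[of "inv muu t"] inv(2)[of t] by (simp add: abs_minus_commute)
  show "|g t - f (inv muu t) | <= e" if "0 <= t" "min t (inv muu t) <= 1 / e" for t
   using muu(3)[of "inv muu t"] inv(2)[of t] tchange_nonneg[OF inv(1), of t] that by (simp add: abs_minus_commute min.commute)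
 qed (rule inv(1))
qed

lemma pdist_sym: "pdist f g = pdist g f" unfolding pdist_def using closep_sym by metis

lemma closep_trans:
 assumes "closep a f g" "closep b g h" "0 < a" "0 < b" "a + b <= 1"
 shows "closep (a + b) f h"
proof -
 obtain muu where muu: "tchange muu" "!!t. |muu t - t| <= a"
  "!!t. t >= 0 ==> min t (muu t) <= 1 / a ==> |f t - g (muu t) | <= a" using assms(1) unfolding closep_def by blast
 obtain kaa where kaa: "tchange kaa" "!!t. |kaa t - t| <= b"
  "!!t. t >= 0 ==> min t (kaa t) <= 1 / b ==> |g t - h (kaa t) | <= b" using assms(2) unfolding closep_def by blast
 \<comment> \<open>The horizon shrinks from \<open>1 / y\<close> to \<open>1 / (x + y)\<close> by at
   least \<open>x\<close>, which leaves room for times moved by \<open>x\<close>.\<close>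
 have aux: "1 / (x + y) + x <= 1 / y" if "0 < x" "0 < y" "x + y <= 1" for x y :: real
 proof -
  have "1 / y - 1 / (x + y) = x / (y * (x + y))" using that by (simp add: field_simps)
  also have "... >= x / 1" using that by (intro divide_left_mono mult_le_one mult_pos_pos) auto
  finally show ?thesis by simp
 qed
 show ?thesis unfolding closep_def
 proof (intro exI[of _ "%t. kaa (muu t)"] conjI allI impI)
  show "tchange (%t. kaa (muu t))" by (rule tchange_comp[OF kaa(1) muu(1)])
  show "|kaa (muu t) - t| <= a + b" for t using muu(2)[of t] kaa(2)[of "muu t"] by linarith
  fix t :: real assume t: "0 <= t" "min t (kaa (muu t)) <= 1 / (a + b)"
  have "1 / (a + b) <= 1 / a" "1 / (a + b) <= 1 / b" using assms by (auto intro!: frac_le)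
  hence "min t (muu t) <= 1 / a" "min (muu t) (kaa (muu t)) <= 1 / b"
   using t aux[of a b] aux[of b a] assms muu(2)[of t] kaa(2)[of "muu t"] by (auto simp: min_le_iff_disj add.commute)
  thus "|f t - h (kaa (muu t)) | <= a + b"
   using muu(3)[OF t(1)] kaa(3)[of "muu t"] tchange_nonneg[OF muu(1), of t] t by linarith
 qed
qed

lemma pdist_triangle: "pdist f h <= pdist f g + pdist g h"
proof (rule field_le_epsilon)
 fix d :: real assume "0 < d"
 define a b where "a = pdist f g + d / 2" and "b = pdist g h + d / 2"
 have ab: "0 < a" "0 < b" using `0 < d` pdist_nonneg[of f g] pdist_nonneg[of g h] by (auto simp: a_def b_def)
 show "pdist f h <= pdist f g + pdist g h + d"
 proof (cases "a + b <= 1")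
  case True
  hence "closep (a + b) f h" using ab `0 < d` by (intro closep_trans[where g = g] path_distD) (auto simp: a_def b_def)
  thus ?thesis using pdist_leI[of "a + b" f h] ab by (simp add: a_def b_def)
 next
  case False
  thus ?thesis using pdist_le_1[of f h] by (simp add: a_def b_def)
 qed
qed

text \<open>The time change from \<open>pdist\<close> need not fix \<open>S\<close>. It is replaced
  by a linear one on a short interval before \<open>S\<close>, where continuity of \<open>f\<close>
  at \<open>S\<close> makes this harmless, and \<open>M1_dist_le\<close> applies.\<close>

lemma pdist_imp_M1_converges:
 assumes F: "!!n. cadlag (F n)" and f: "cadlag f" and lim: "(%n. pdist (F n) f) ----> 0"
 shows "M1_converges F f" unfolding M1_converges_def
proof (intro allI impI)
 fix S :: real assume S: "0 < S" "isCont f S"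
 show "(%n. M1_dist S (F n) f) ----> 0"
 proof (rule LIMSEQ_I)
  fix r :: real assume "0 < r"
  define e where "e = r / 2"
  have "0 < e" using `0 < r` by (simp add: e_def)
  obtain c where c: "0 < c" "!!t. |t - S| < c ==> |f t - f S| < e / 4"
   using S(2)[unfolded continuous_at_eps_delta, rule_format, of "e / 4"] `0 < e` by (auto simp: dist_real_def)
  \<comment> \<open>Length of the interval before \<open>S\<close> on which the time change is
    modified.\<close>
  define y where "y = Min {c / 3, S / 2, e / 4}"
  have y: "0 < y" "3 * y <= c" "2 * y <= S" "4 * y <= e" using c(1) S(1) `0 < e` by (auto simp: y_def)
  define d where "d = Min {y / 2, e / 4, 1 / (S + 1), 1}"
  have d: "0 < d" "2 * d <= y" "4 * d <= e" "d <= 1 / (S + 1)" "d <= 1" using y S `0 < e` by (auto simp: d_def min_le_iff_disj)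
  have Sd: "S <= 1 / d" using d(1,4) S(1) by (simp add: field_simps)
  have "\<forall>\<^sub>F n in sequentially. pdist (F n) f < d" using lim d(1) by (rule order_tendstoD)
  moreover have "norm (M1_dist S (F n) f - 0) < r" if n: "pdist (F n) f < d" for n
  proof -
   obtain kaa where kaa: "tchange kaa" "!!t. |kaa t - t| <= d"
    "!!t. t >= 0 ==> min t (kaa t) <= 1 / d ==> |F n t - f (kaa t) | <= d"
    using path_distD[OF n d(5)] unfolding closep_def by blast
   define a where "a = S - y"
   have a: "0 < a" "a < S" "kaa a < S" using y kaa(2)[of a] d by (auto simp: a_def)
   define k where "k = (S - kaa a) / y"
   have k: "0 < k" "k * y = S - kaa a" using a y by (auto simp: k_def)
   define muu where "muu = (%t. if t <= a then kaa t else if t <= S then kaa a + k * (t - a) else t)"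
   have ka: "k * (S - a) = S - kaa a" using k by (simp add: a_def)
   have low: "muu t = kaa t" if "t <= a" for t using that by (simp add: muu_def)
   have mid: "muu t = kaa a + k * (t - a)" "kaa a < muu t" "muu t <= S" if "a < t" "t <= S" for t
   proof -
    show "muu t = kaa a + k * (t - a)" using that by (simp add: muu_def)
    moreover have "0 < k * (t - a)" "k * (t - a) <= k * (S - a)" using k that by (auto intro!: mult_left_mono)
    ultimately show "kaa a < muu t" "muu t <= S" using ka by auto
   qed
   have high: "muu t = t" if "S <= t" for t using that a ka by (cases "t = S") (auto simp: muu_def)
   have "muu x < muu x'" if "x < x'" for x x'
   proof -
    consider "x' <= a" | "x <= a" "a < x'" "x' <= S" | "x <= a" "S < x'"
     | "a < x" "x' <= S" | "a < x" "x <= S" "S < x'" | "S < x" using that by linarith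
    thus ?thesis
    proof cases
     case 2
     thus ?thesis using mid(2)[of x'] low[of x] tchange_le[OF kaa(1), of x a] by simp
    next
     case 3
     thus ?thesis using high[of x'] low[of x] tchange_le[OF kaa(1), of x a] a by simp
    next
     case 4
     thus ?thesis using mid(1)[of x] mid(1)[of x'] k(1) that by simp
    next
     case 5
     thus ?thesis using mid(3)[of x] high[of x'] by simp
    qed (use that a in \<open>auto simp: low high tchange_less[OF kaa(1)]\<close>)
   qed
   moreover have "EX t. muu t = v" for v
   proof -
    consider "v <= kaa a" | "kaa a < v" "v < S" | "S <= v" by linarith
    thus ?thesis
    proof cases
     case 1
     hence "inv kaa v <= a" using tchange_inv[OF kaa(1)] tchange_le[OF kaa(1), of "inv kaa v" a] by simp
     thus ?thesis using low tchange_inv[OF kaa(1)] by (intro exI[of _ "inv kaa v"]) simp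
    next
     case 2
     have "k * ((v - kaa a) / k) < k * (S - a)" using ka 2 k(1) by simp
     hence "(v - kaa a) / k < S - a" using k(1) by (subst (asm) mult_less_cancel_left_pos) auto
     thus ?thesis using k 2 mid(1)[of "a + (v - kaa a) / k"] by (intro exI[of _ "a + (v - kaa a) / k"]) auto
    qed (use high in blast)
   qed
   ultimately have muu: "tchange muu" using low[of 0] a kaa(1) by (auto simp: tchange_def strict_mono_def surj_def) metis
   have near: "|muu t - t| <= e & |F n t - f (muu t) | <= e" if t: "t : {0..S}" for t
   proof (cases "t <= a")
    case True
    have "|F n t - f (kaa t) | <= d" using kaa(3)[of t] t Sd by auto
    thus ?thesis using kaa(2)[of t] d low[OF True] by auto
   next
    case False
    have "|F n t - f (kaa t) | <= d" using kaa(3)[of t] t Sd by auto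
    moreover have "|f (kaa t) - f S| < e / 4" using False t kaa(2)[of t] y d by (intro c(2)) (auto simp: a_def)
    moreover have "|f (muu t) - f S| < e / 4" using False t mid(2,3)[of t] kaa(2)[of a] y d by (intro c(2)) (auto simp: a_def)
    moreover have "|muu t - t| <= e" using False t mid(2,3)[of t] kaa(2)[of a] y d by (auto simp: a_def)
    ultimately show ?thesis using d by linarith
   qed
   have "M1_dist S (F n) f <= e" "0 <= M1_dist S (F n) f" using M1_dist_le[OF S(1) F f muu high, where e = e] near by auto
   thus ?thesis using `0 < r` by (simp add: e_def)
  qed
  ultimately show "EX no. ALL n>=no. norm (M1_dist S (F n) f - 0) < r" unfolding eventually_sequentially by blast
 qed
qed

section \<open>Approximation by step paths\<close>

lemma cadlag_cong:
 assumes "!!t. 0 <= t ==> f t = g t"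
 shows "cadlag f <-> cadlag g"
proof -
 have "(f \<longlongrightarrow> l) (at_right t) <-> (g \<longlongrightarrow> l) (at_right t)" if "0 <= t" for t l
  by (rule tendsto_cong) (use that assms in \<open>auto simp: eventually_at_filter\<close>)
 moreover have "(f \<longlongrightarrow> l) (at_left t) <-> (g \<longlongrightarrow> l) (at_left t)" if "0 < t" for t l
  by (rule tendsto_cong, rule eventually_mono[OF eventually_at_left_real[OF that]]) (use assms in auto)
 ultimately show ?thesis using assms by (auto simp: cadlag_def)
qed

lemma cadlag_floor:
 fixes v :: "nat => real"
 assumes "0 <= r"
 shows "cadlag (%t. v (nat \<lfloor>r * t\<rfloor>))" unfolding cadlag_def
proof (intro conjI allI impI)
 fix t :: real assume "0 <= t"
 have "((%x. r * x) \<longlongrightarrow> r * t) (at_right t)" by (intro tendsto_intros)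
 hence "\<forall>\<^sub>F x in at_right t. r * x < of_int \<lfloor>r * t\<rfloor> + 1" by (rule order_tendstoD) linarith
 hence "\<forall>\<^sub>F x in at_right t. v (nat \<lfloor>r * x\<rfloor>) = v (nat \<lfloor>r * t\<rfloor>)"
 proof (rule eventually_mp[rotated])
  have "\<lfloor>r * x\<rfloor> = \<lfloor>r * t\<rfloor>" if "t < x" "r * x < of_int \<lfloor>r * t\<rfloor> + 1" for x
  proof -
   have "r * t <= r * x" using that assms by (intro mult_left_mono) auto
   thus ?thesis using that by (intro floor_unique) linarith+
  qed
  thus "\<forall>\<^sub>F x in at_right t. r * x < of_int \<lfloor>r * t\<rfloor> + 1 --> v (nat \<lfloor>r * x\<rfloor>) = v (nat \<lfloor>r * t\<rfloor>)"
   by (auto simp: eventually_at_right_field intro!: exI[of _ "t + 1"])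
 qed
 thus "((%t. v (nat \<lfloor>r * t\<rfloor>)) \<longlongrightarrow> v (nat \<lfloor>r * t\<rfloor>)) (at_right t)"
  by (rule tendsto_eventually)
next
 fix t :: real assume "0 < t"
 show "EX l. ((%t. v (nat \<lfloor>r * t\<rfloor>)) \<longlongrightarrow> l) (at_left t)"
 proof (cases "r = 0")
  case False
  define m where "m = \<lceil>r * t\<rceil> - 1"
  have "((%x. r * x) \<longlongrightarrow> r * t) (at_left t)" by (intro tendsto_intros)
  hence "\<forall>\<^sub>F x in at_left t. of_int m < r * x" by (rule order_tendstoD) (simp add: m_def, linarith)
  hence "\<forall>\<^sub>F x in at_left t. v (nat \<lfloor>r * x\<rfloor>) = v (nat m)"
  proof (rule eventually_mp[rotated])
   have "\<lfloor>r * x\<rfloor> = m" if "x < t" "of_int m < r * x" for x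
   proof -
    have "r * x < r * t" using that assms False by (intro mult_strict_left_mono) auto
    thus ?thesis using that unfolding m_def by (intro floor_unique) linarith+
   qed
   thus "\<forall>\<^sub>F x in at_left t. of_int m < r * x --> v (nat \<lfloor>r * x\<rfloor>) = v (nat m)"
    by (auto simp: eventually_at_left_field intro!: exI[of _ "t - 1"])
  qed
  thus ?thesis by (blast intro: tendsto_eventually)
 qed auto
qed

lemma cadlag_add: "cadlag f ==> cadlag g ==> cadlag (%t. f t + g t)" unfolding cadlag_def by (blast intro: tendsto_add)

lemma cadlag_cmult: "cadlag f ==> cadlag (%t. c * f t)" unfolding cadlag_def by (blast intro: tendsto_mult_left)

lemma cadlag_linear: "cadlag (%t. c * t)" unfolding cadlag_def by (auto intro!: tendsto_intros exI)

text \<open>Mesh \<open>1 / k\<close>, frozen from time \<open>k\<close> on, so that the path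
  depends on finitely many values.\<close>

definition spath :: "nat => (nat => real) => real => real" where
 "spath k v = (\<lambda>t\<in>{0..}. v (min (nat \<lfloor>real k * t\<rfloor>) (k * k)))"

lemma spath_cadlag_space [simp, intro]: "spath k v : cadlag_space" unfolding cadlag_space_iff
proof
 have "cadlag (%t. v (min (nat \<lfloor>real k * t\<rfloor>) (k * k)))"
  using cadlag_floor[of "real k" "%i. v (min i (k * k))"] by simp
 thus "cadlag (spath k v)" by (rule cadlag_cong[THEN iffD1, rotated]) (simp add: spath_def)
qed (simp add: spath_def)

lemma pdist_spath_le:
 assumes "0 <= e" "!!i. i <= k * k ==> |v i - w i| <= e"
 shows "pdist (spath k v) (spath k w) <= e" using assms by (intro pdist_uniform) (auto simp: spath_def)

text \<open>The point \<open>s (Suc i)\<close> may lie anywhere in the cell that ends at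
  \<open>(i + 1) / k\<close>. The time change maps cell \<open>i\<close> linearly onto the interval
  from \<open>s i\<close> to \<open>s (Suc i)\<close> and moves times by at most
  \<open>1 / k\<close>.\<close>

lemma pdist_spath:
 fixes s :: "nat => real"
 assumes k: "0 < k" "1 / real k <= e" "1 / e + e <= real k"
  and s: "s 0 = 0" "!!i. real i / k < s (Suc i)" "!!i. s (Suc i) <= real (Suc i) / k"
  and near: "!!i t. s i <= t ==> t < s (Suc i) ==> t <= 1 / e + e ==> |f t - v i| <= e"
 shows "pdist f (spath k v) <= e"
proof -
 have "0 < 1 / real k" using k by simp
 with k(2) have e: "0 < e" by linarith
 have s_le: "s i <= real i / k" for i using s by (cases i) auto
 have s_less: "s i < s (Suc i)" for i using s_le[of i] s(2)[of i] by linarith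
 have s_mono: "s i <= s j" if "i <= j" for i j using that s_less by (meson less_imp_le lift_Suc_mono_le)
 define kaa where "kaa = (%u :: real. if u < 0 then u else
  (let i = nat \<lfloor>k * u\<rfloor> in s i + (k * u - i) * (s (Suc i) - s i)))"
 have kaa_eq: "kaa u = s i + (k * u - i) * (s (Suc i) - s i)" if "real i <= k * u" "k * u < real i + 1" for i and u :: real
 proof -
  have "\<lfloor>k * u\<rfloor> = int i" using that by (intro floor_unique) auto
  hence "nat \<lfloor>k * u\<rfloor> = i" by simp
  moreover have "0 <= u" 
  proof -
   have "0 <= k * u" using that by linarith
   thus ?thesis using k(1) by (simp add: zero_le_mult_iff)
  qed
  ultimately show ?thesis by (simp add: kaa_def Let_def)
 qed
 have idx: "EX i. real i <= k * u & k * u < real i + 1" if "0 <= u" for u :: real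
 proof -
  have "real (nat \<lfloor>k * u\<rfloor>) = of_int \<lfloor>k * u\<rfloor>" using that by simp
  thus ?thesis by (intro exI[of _ "nat \<lfloor>k * u\<rfloor>"]) linarith
 qed
 have kaa_cell: "s i <= kaa u" "kaa u < s (Suc i)" if u: "real i <= k * u" "k * u < real i + 1" for i and u :: real
 proof -
  have "0 <= (k * u - i) * (s (Suc i) - s i)" using u s_less[of i] by (intro mult_nonneg_nonneg) auto
  thus "s i <= kaa u" using kaa_eq[OF u] by simp
  have "(k * u - i) * (s (Suc i) - s i) < 1 * (s (Suc i) - s i)" using u s_less[of i] by (intro mult_strict_right_mono) auto
  thus "kaa u < s (Suc i)" using kaa_eq[OF u] by simp
 qed
 have kaa_dist: "|kaa u - u| <= 1 / k" for u
 proof (cases "0 <= u")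
  case True
  then obtain i where i: "real i <= k * u" "k * u < real i + 1" using idx by blast
  define a b where "a = s i - real i / k" and "b = s (Suc i) - real (Suc i) / k"
  have "0 <= a + 1 / k"
  proof (cases i)
   case (Suc j)
   hence "a + 1 / k = s (Suc j) - real j / k" by (simp add: a_def add_divide_distrib)
   thus ?thesis using s(2)[of j] by simp
  qed (simp add: a_def s(1))
  moreover have "a <= 0" using s_le[of i] by (simp add: a_def)
  moreover have "0 <= b + 1 / k" "b <= 0" using s(2)[of i] s(3)[of i] k(1) by (auto simp: b_def field_simps)
  ultimately have "|a - 0| <= 1 / k" "|b - 0| <= 1 / k" by auto
  hence "| (1 - (k * u - i)) * a + (k * u - i) * b - 0| <= 1 / k" using i by (intro cvx_comb_dist) auto
  moreover have "kaa u - u = (1 - (k * u - i)) * a + (k * u - i) * b"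
   unfolding kaa_eq[OF i] a_def b_def using k(1) by (simp add: field_simps)
  ultimately show ?thesis by simp
 qed (simp add: kaa_def)
 have "kaa u < kaa u'" if "u < u'" for u u'
 proof (cases "0 <= u")
  case True
  obtain i where i: "real i <= k * u" "k * u < real i + 1" using idx True by blast
  obtain j where j: "real j <= k * u'" "k * u' < real j + 1" using idx[of u'] True `u < u'` by auto
  have lt: "k * u < k * u'" using `u < u'` k(1) by simp
  hence "i <= j" using i j by linarith
  show ?thesis
  proof (cases "i = j")
   case True
   thus ?thesis using kaa_eq[OF i] kaa_eq[OF j] lt s_less[of i] by simp
  next
   case False
   hence "s (Suc i) <= s j" using `i <= j` by (intro s_mono) auto
   thus ?thesis using kaa_cell[OF i] kaa_cell[OF j] by simp
  qed
 next
  case False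
  show ?thesis
  proof (cases "0 <= u'")
   case True
   obtain j where j: "real j <= k * u'" "k * u' < real j + 1" using idx[OF True] by blast
   have "0 <= s j" using s_mono[of 0 j] s(1) by simp
   thus ?thesis using kaa_cell[OF j] False by (simp add: kaa_def)
  qed (use that False in \<open>simp add: kaa_def\<close>)
 qed
 moreover have "EX u. kaa u = x" for x
 proof (cases "0 <= x")
  case True
  have "EX i. x < s (Suc i)"
  proof -
   obtain n :: nat where "x * k < n" using reals_Archimedean2 by blast
   hence "x < real n / k" using k(1) by (simp add: field_simps)
   thus ?thesis using s(2)[of n] by (auto intro!: exI[of _ n])
  qed
  then obtain i where i: "x < s (Suc i)" "!!j. j < i ==> \<not> x < s (Suc j)"
   using exists_least_iff[of "%i. x < s (Suc i)"] by blast
  have "s i <= x" using i(2)[of "i - 1"] True s(1) by (cases i) auto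
  define c where "c = (x - s i) / (s (Suc i) - s i)"
  have c: "0 <= c" "c < 1" "c * (s (Suc i) - s i) = x - s i"
   using s_less[of i] `s i <= x` i(1) by (auto simp: c_def field_simps)
  have "real i <= k * ((i + c) / k)" "k * ((i + c) / k) < real i + 1" using c k(1) by auto
  from kaa_eq[OF this] have "kaa ((i + c) / k) = x" using c k(1) by simp
  thus ?thesis by blast
 qed (auto simp: kaa_def intro!: exI[of _ x])
 moreover have "kaa 0 = 0" using kaa_eq[of 0 0] s(1) by simp
 ultimately have kaa: "tchange kaa" by (auto simp: tchange_def strict_mono_def surj_def) metis
 have "closep e (spath k v) f" unfolding closep_def
 proof (intro exI[of _ kaa] conjI allI impI kaa)
  show "|kaa u - u| <= e" for u using kaa_dist[of u] k(2) by linarith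
  fix u assume u: "0 <= u" "min u (kaa u) <= 1 / e"
  obtain i where i: "real i <= k * u" "k * u < real i + 1" using idx[OF u(1)] by blast
  have "u <= 1 / e + e" "kaa u <= 1 / e + e" using u kaa_dist[of u] k(2) e by (auto simp: min_le_iff_disj)
  hence "u <= k" using k(3) by linarith
  hence "k * u <= real (k * k)" by (simp add: mult_left_mono)
  hence "i <= k * k" using i(1) by linarith
  moreover have "\<lfloor>k * u\<rfloor> = int i" using i by (intro floor_unique) auto
  ultimately have "spath k v u = v i" using u(1) by (simp add: spath_def)
  thus "|spath k v u - f (kaa u) | <= e" using near[OF kaa_cell[OF i] `kaa u <= 1 / e + e`] by (simp add: abs_minus_commute)
 qed
 thus ?thesis using pdist_leI[OF e] pdist_sym by metis
qed

lemma finite_separated: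
 fixes J :: "real set"
 assumes "finite J"
 obtains d where "0 < d" "!!x y. x : J ==> y : J ==> |x - y| < d ==> x = y"
proof -
 define D where "D = (%(x, y). |x - y| ) ` {z : J \<times> J. fst z ~= snd z}"
 have D: "finite (insert 1 D)" "ALL d:insert 1 D. 0 < d" using assms by (auto simp: D_def)
 show ?thesis
 proof (rule that[of "Min (insert 1 D)"])
  show "0 < Min (insert 1 D)" using D by (subst Min_gr_iff) auto
  fix x y assume xy: "x : J" "y : J" "|x - y| < Min (insert 1 D)"
  show "x = y"
  proof (rule ccontr)
   assume "x ~= y"
   hence "|x - y| : D" using xy by (force simp: D_def)
   hence "Min (insert 1 D) <= |x - y|" using D by (intro Min_le) auto
   with xy show False by simp
  qed
 qed
qed

text \<open>The points \<open>s\<close> are moved to the exceptional points of the oscillation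
  lemma; a mesh finer than their separation leaves at most one of them in a cell.\<close>

lemma spath_converges:
 assumes f: "cadlag f"
 shows "(%k. pdist f (spath k (%i. f (real i / k)))) ----> 0"
proof (rule LIMSEQ_I)
 fix r :: real assume "0 < r"
 define e where "e = min (r / 2) 1"
 have e: "0 < e" "e < r" using `0 < r` by (auto simp: e_def)
 define T where "T = 1 / e + e + 1"
 have T: "0 <= T" using e by (simp add: T_def)
 obtain J where J: "finite J" "!!u v. 0 <= u ==> u <= v ==> v <= T ==> J \<inter> {u<..v} = {} ==> |f u - f v| <= e"
  using cadlag_finite_oscillation[OF f T e(1)] by metis
 obtain d where d: "0 < d" "!!x y. x : J ==> y : J ==> |x - y| < d ==> x = y" using finite_separated[OF J(1)] by blast
 have le: "pdist f (spath k (%i. f (real i / k))) <= e"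
  if k: "0 < k" "1 / real k <= e" "1 / real k < d" "1 / e + e <= real k" for k
 proof -
  define P where "P = (%i j. j : J & real i / k < j & j <= real (Suc i) / k)"
  define s where "s = (%i. case i of 0 => 0 | Suc i => if EX j. P i j then SOME j. P i j else real (Suc i) / k)"
  have Suc_k: "real (Suc i) / k = real i / k + 1 / k" for i by (simp add: add_divide_distrib)
  have PI: "P i (s (Suc i))" if "P i j" for i j using that by (auto simp: s_def intro: someI)
  have uniq: "j = s (Suc i)" if "P i j" for i j
   by (rule d(2)) (use that PI[OF that] k(3) Suc_k[of i] in \<open>auto simp: P_def\<close>)
  have s1: "real i / k < s (Suc i)" "s (Suc i) <= real (Suc i) / k" for i
   using PI[of i] k(1) by (cases "EX j. P i j"; auto simp: P_def s_def divide_strict_right_mono)+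
  show ?thesis
  proof (rule pdist_spath[OF k(1,2,4), of s])
   fix i t assume t: "s i <= t" "t < s (Suc i)" "t <= 1 / e + e"
   have si: "s i <= real i / k" using s1[of "i - 1"] by (cases i) (auto simp: s_def)
   have "1 / real k <= 1" using k(1) by (simp add: field_simps)
   have ik: "real i / k <= s i + 1 / k" using s1[of "i - 1"] Suc_k[of "i - 1"] by (cases i) (auto simp: s_def)
   have s0: "0 <= s i"
   proof (cases i)
    case (Suc i')
    have "0 <= real i' / k" by simp
    thus ?thesis using s1(1)[of i'] unfolding Suc by linarith
   qed (simp add: s_def)
   \<comment> \<open>An exceptional point between \<open>t\<close> and \<open>i / k\<close> would
     have to be \<open>s i\<close> or \<open>s (Suc i)\<close>, but it lies strictly between these
     two.\<close>
   define u v where "u = min t (real i / k)" and "v = max t (real i / k)"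
   have uv: "s i <= u" "u <= v" "v < s (Suc i)" "v <= T"
    using t si s1[of i] ik `1 / real k <= 1` by (auto simp: u_def v_def T_def)
   have "J \<inter> {u<..v} = {}"
   proof (rule ccontr)
    assume "J \<inter> {u<..v} ~= {}"
    then obtain j where "j : J" "u < j" "j <= v" by auto
    hence j: "j : J" "s i < j" "j < s (Suc i)" using uv by linarith+
    show False
    proof (cases "j <= real i / k")
     case True
     show False
     proof (cases i)
     case 0
     thus False using True j by (simp add: s_def)
     next
     case (Suc i')
     hence "P i' j" using j True s1(1)[of i'] by (auto simp: P_def)
     thus False using uniq j Suc by auto
     qed
    next
     case False
     hence "P i j" using j s1(2)[of i] by (auto simp: P_def)
     thus False using uniq j by auto
    qed
   qed
   hence "|f u - f v| <= e" using J(2)[of u v] uv s0 by auto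
   thus "|f t - f (real i / k) | <= e" by (auto simp: u_def v_def min_def max_def abs_minus_commute split: if_splits)
  qed (use s1 in \<open>auto simp: s_def\<close>)
 qed
 have "\<forall>\<^sub>F k in sequentially. 0 < k & 1 / real k <= e & 1 / real k < d & 1 / e + e <= real k"
 proof (intro eventually_conj)
  have lim: "(%k. 1 / real k) ----> 0" by (rule lim_1_over_n)
  show "\<forall>\<^sub>F k in sequentially. 1 / real k < d" using lim d(1) by (rule order_tendstoD)
  show "\<forall>\<^sub>F k in sequentially. 1 / real k <= e"
   using order_tendstoD(2)[OF lim e(1)] by (rule eventually_mono) simp
  show "\<forall>\<^sub>F k in sequentially. 1 / e + e <= real k"
   using filterlim_real_sequentially by (simp add: filterlim_at_top)
 qed (rule eventually_gt_at_top)
 hence "\<forall>\<^sub>F k in sequentially. norm (pdist f (spath k (%i. f (real i / k))) - 0) < r"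
 proof eventually_elim
  case (elim k)
  thus ?case using le[of k] e pdist_nonneg by simp
 qed
 thus "EX no. ALL k>=no. norm (pdist f (spath k (%i. f (real i / k))) - 0) < r" unfolding eventually_sequentially .
qed

section \<open>Lipschitz functionals: measurability and weak convergence\<close>

lemma measurable_map_list:
 fixes g :: "'i => 'a => 'c :: countable"
 assumes "!!i. i : set is ==> g i : measurable M (count_space UNIV)"
 shows "(%om. map (%i. g i om) is) : measurable M (count_space UNIV)" using assms
proof (induction "is")
 case (Cons i "is")
 have IH: "(%om. map (%i. g i om) is) : measurable M (count_space UNIV)" using Cons by simp
 have "(%om. (%a om. a # map (%i. g i om) is) (g i om) om) : measurable M (count_space UNIV)"
 proof (rule measurable_compose_countable[where g = "g i"])
  show "g i : measurable M (count_space UNIV)" using Cons by simp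
  show "(%om. a # map (%i. g i om) is) : measurable M (count_space UNIV)" for a by (rule measurable_compose[OF IH]) simp
 qed
 thus ?case by simp
qed simp

definition plip :: "real => ((real => real) => real) => bool" where "plip L G <-> 0 <= L &
  (ALL f:cadlag_space. ALL g:cadlag_space. |G f - G g| <= L * pdist f g)"

lemma path_lipschitzD: "plip L G ==> f : cadlag_space ==> g : cadlag_space ==> |G f - G g| <= L * pdist f g"
 by (simp add: plip_def)

lemma plip_tendsto:
 assumes "plip L G" "!!n. F n : cadlag_space" "f : cadlag_space" "(%n. pdist f (F n)) ----> 0"
 shows "(%n. G (F n)) ----> G f"
proof (rule LIMSEQ_I)
 have "(%n. L * pdist f (F n)) ----> L * 0" by (intro tendsto_intros assms)
 fix r :: real assume "0 < r"
 with `(%n. L * pdist f (F n)) ----> L * 0`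
 have "\<forall>\<^sub>F n in sequentially. L * pdist f (F n) < r" by (intro order_tendstoD) auto
 hence "\<forall>\<^sub>F n in sequentially. norm (G (F n) - G f) < r"
 proof eventually_elim
  case (elim n)
  thus ?case using path_lipschitzD[OF assms(1,3,2), of n] by (simp add: abs_minus_commute)
 qed
 thus "EX no. ALL n>=no. norm (G (F n) - G f) < r" unfolding eventually_sequentially .
qed

text \<open>Rounding the values makes the path a function of a list of integers, which has countably
  many values, so any functional of it is measurable.\<close>

definition qpath :: "nat => (real => real) => real => real" where
 "qpath k f = spath k (%i. of_int \<lfloor>real k * f (real i / k)\<rfloor> / k)"

lemma qpath_cadlag_space: "qpath k f : cadlag_space" by (simp add: qpath_def)

lemma qpath_converges:
 assumes "cadlag f"
 shows "(%k. pdist f (qpath k f)) ----> 0"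
proof (rule tendsto_sandwich[where f = "%_. 0"])
 let ?g = "%k. pdist f (spath k (%i. f (real i / k)))"
 show "(%k. ?g k + 1 / real k) ----> 0" using tendsto_add[OF spath_converges[OF assms] lim_1_over_n] by simp
 have "pdist (spath k (%i. f (real i / k))) (qpath k f) <= 1 / real k" if "0 < k" for k unfolding qpath_def
 proof (rule pdist_spath_le)
  fix i assume "i <= k * k"
  show "|f (real i / k) - of_int \<lfloor>real k * f (real i / k)\<rfloor> / k| <= 1 / real k"
  proof -
   let ?x = "f (real i / k)"
   have "?x - of_int \<lfloor>real k * ?x\<rfloor> / k = (k * ?x - of_int \<lfloor>real k * ?x\<rfloor>) / k"
    using that by (simp add: field_simps)
   moreover have "|k * ?x - of_int \<lfloor>real k * ?x\<rfloor> | <= 1" by linarith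
   ultimately show ?thesis by (simp add: divide_right_mono)
  qed
 qed simp
 thus "\<forall>\<^sub>F k in sequentially. pdist f (qpath k f) <= ?g k + 1 / real k"
  by (intro eventually_mono[OF eventually_gt_at_top[of 0]] order_trans[OF pdist_triangle add_left_mono])
qed (auto simp: pdist_nonneg)

definition cmeas :: "'a measure => ('a => real => real) => bool" where "cmeas M X <-> (ALL om:space M. X om : cadlag_space) &
  (ALL t>=0. (%om. X om t) : borel_measurable M)"

lemma measurable_qpath:
 fixes G :: "(real => real) => real"
 assumes "cmeas M X"
 shows "(%om. G (qpath k (X om))) : borel_measurable M"
proof -
 have [measurable]: "(%om. X om t) : borel_measurable M" if "0 <= t" for t using assms that by (auto simp: cmeas_def)
 define z where "z = (%om. map (%i. \<lfloor>real k * X om (real i / k)\<rfloor>) [0..<Suc (k * k)])"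
 have z: "z : measurable M (count_space UNIV)" unfolding z_def by (intro measurable_map_list) measurable
 have eq: "qpath k (X om) = spath k (%i. of_int (z om ! i) / k)" for om unfolding qpath_def spath_def z_def
  by (auto intro!: restrict_ext simp del: upt_Suc)
 show ?thesis unfolding eq by (rule measurable_compose[OF z]) simp
qed

text \<open>A pointwise limit of the functional along rounded step paths.\<close>

lemma plip_measurable:
 assumes "plip L G" "cmeas M X"
 shows "(%om. G (X om)) : borel_measurable M"
proof (rule borel_measurable_LIMSEQ_real)
 show "(%om. G (qpath k (X om))) : borel_measurable M" for k by (rule measurable_qpath[OF assms(2)])
 fix om assume "om : space M"
 hence X: "X om : cadlag_space" using assms(2) by (simp add: cmeas_def)
 thus "(%k. G (qpath k (X om))) ----> G (X om)" by (intro plip_tendsto[OF assms(1)] qpath_converges qpath_cadlag_space)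
   (auto simp: cadlag_space_iff)
qed

text \<open>The inserted \<open>1\<close> gives a value for the empty set as well.\<close>

definition dset :: "(real => real) set => (real => real) => real" where "dset C f = Inf (insert 1 (pdist f ` C))"

lemma dset_bdd: "bdd_below (insert 1 (pdist f ` C))" using pdist_nonneg by (auto intro!: bdd_belowI[of _ 0])

lemma dset_nonneg: "0 <= dset C f" unfolding dset_def using pdist_nonneg by (intro cInf_greatest) auto

lemma plip_dset: "plip 1 (dset C)"
proof -
 have "dset C f <= dset C g + pdist f g" for f g
 proof -
  have "dset C f - pdist f g <= dset C g" unfolding dset_def[of C g]
  proof (rule cInf_greatest)
   fix x assume "x : insert 1 (pdist g ` C)"
   then consider "x = 1" | h where "h : C" "x = pdist g h" by auto
   thus "dset C f - pdist f g <= x"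
   proof cases
    case 1
    thus ?thesis using cInf_lower[OF _ dset_bdd, of 1 f C] pdist_nonneg[of f g] by (simp add: dset_def)
   next
    case 2
    thus ?thesis using cInf_lower[OF _ dset_bdd, of "pdist f h" f C] pdist_triangle[of f h g] by (simp add: dset_def)
   qed
  qed simp
  thus ?thesis by simp
 qed
 from this this show ?thesis unfolding plip_def
  by (auto simp: abs_le_iff algebra_simps pdist_sym) (metis add.commute pdist_sym)+
qed

text \<open>The bridge between the topologies: convergence in \<open>pdist\<close> implies M1
  convergence, and M1-open sets are sequentially open.\<close>

lemma pdist_openin:
 assumes U: "openin M1_topology U" and f: "f : U" and F: "!!n. F n : cadlag_space" "(%n. pdist f (F n)) ----> 0"
 shows "\<forall>\<^sub>F n in sequentially. F n : U"
proof -
 have "f : cadlag_space" using U f by (auto simp: openin_M1_topology)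
 hence "M1_converges F f" using F by (intro pdist_imp_M1_converges) (auto simp: cadlag_space_iff pdist_sym)
 thus ?thesis using U f F(1) unfolding openin_M1_topology by blast
qed

text \<open>By \<open>pdist_openin\<close> no sequence in the complement approaches a point of
  \<open>U\<close>. Membership in \<open>U\<close> thus becomes a condition on a Lipschitz
  functional.\<close>

lemma open_dist_to_complement:
 assumes U: "openin M1_topology U"
 shows "U = {f : cadlag_space. 0 < dset (cadlag_space - U) f}"
proof (intro equalityI subsetI)
 fix f assume f: "f : U"
 hence fD: "f : cadlag_space" using U by (auto simp: openin_M1_topology)
 have "dset (cadlag_space - U) f ~= 0"
 proof
  assume 0: "dset (cadlag_space - U) f = 0"
  have "EX g:cadlag_space - U. pdist f g < 1 / real (Suc n)" for n
  proof -
   have "Inf (insert 1 (pdist f ` (cadlag_space - U))) < 1 / real (Suc n)" using 0 by (simp add: dset_def)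
   thus ?thesis unfolding cInf_less_iff[OF insert_not_empty dset_bdd] by (auto simp: field_simps)
  qed
  then obtain F where F: "!!n. F n : cadlag_space - U" "!!n. pdist f (F n) < 1 / real (Suc n)" by metis
  have "(%n. pdist f (F n)) ----> 0" by (rule tendsto_sandwich[OF _ _ tendsto_const LIMSEQ_inverse_real_of_nat])
    (use F(2) in \<open>auto simp: pdist_nonneg inverse_eq_divide intro!: always_eventually less_imp_le\<close>)
  hence "\<forall>\<^sub>F n in sequentially. F n : U" using F(1) by (intro pdist_openin[OF U f]) auto
  thus False using F(1) by (auto simp: eventually_sequentially)
 qed
 thus "f : {f : cadlag_space. 0 < dset (cadlag_space - U) f}" using fD dset_nonneg[of "cadlag_space - U" f] by auto
next
 fix f assume f: "f : {f : cadlag_space. 0 < dset (cadlag_space - U) f}"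
 show "f : U"
 proof (rule ccontr)
  assume "f \<notin> U"
  hence "pdist f f : insert 1 (pdist f ` (cadlag_space - U))" using f by blast
  hence "dset (cadlag_space - U) f <= 0" unfolding dset_def using cInf_lower[OF _ dset_bdd] by fastforce
  with f show False by simp
 qed
qed

lemma space_borel_of [simp]: "space (borel_of X) = topspace X" unfolding borel_of_def by (simp add: space_measure_of_conv)

lemma sets_borel_of: "sets (borel_of X) = sigma_sets (topspace X) {U. openin X U}"
 unfolding borel_of_def by (rule sets_measure_of) (use openin_subset in blast)

text \<open>An open set is a level set of the Lipschitz functional \<open>dset\<close>, so
  measurability of the coordinates suffices.\<close>

lemma cmeas_imp_borel:
 assumes X: "cmeas M X"
 shows "X : measurable M (borel_of M1_topology)"
proof (rule measurable_sigma_sets[OF sets_borel_of])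
 show "{U. openin M1_topology U} \<subseteq> Pow (topspace M1_topology)" using openin_subset by blast
 show "X : space M \<rightarrow> topspace M1_topology" using X by (auto simp: cmeas_def)
 fix U assume "U : {U. openin M1_topology U}"
 hence U: "openin M1_topology U" by simp
 have "X -` U \<inter> space M = {om : space M. 0 < dset (cadlag_space - U) (X om)}"
  by (subst open_dist_to_complement[OF U]) (use X in \<open>auto simp: cmeas_def\<close>)
 also have "... : sets M" using plip_measurable[OF plip_dset X] by measurable
 finally show "X -` U \<inter> space M : sets M" .
qed

lemma continuous_map_borel_measurable:
 assumes "continuous_map X euclideanreal ph"
 shows "ph : borel_measurable (borel_of X)"
proof (rule borel_measurableI)
 fix S :: "real set" assume "open S"
 hence "openin X {x : topspace X. ph x : S}" using assms by (simp add: continuous_map_def)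
 moreover have "ph -` S \<inter> space (borel_of X) = {x : topspace X. ph x : S}" by auto
 ultimately show "ph -` S \<inter> space (borel_of X) : sets (borel_of X)" by (simp add: sets_borel_of sigma_sets.Basic)
qed

text \<open>Lipschitz regularisation from below: for bounded \<open>ph\<close> and
  \<open>L >= 0\<close> the largest \<open>L\<close>-Lipschitz minorant on the space with respect to
  \<open>pdist\<close>.\<close>

definition infconv :: "real => ((real => real) => real) => (real => real) => real" where
 "infconv L ph f = (INF g\<in>cadlag_space. ph g + L * pdist f g)"

lemma cadlag_space_nonempty: "cadlag_space ~= {}" using spath_cadlag_space by blast

context
 fixes ph :: "(real => real) => real" and B :: real
 assumes ph: "!!f. f : cadlag_space ==> |ph f| <= B"
begin

lemma infconv_bdd: "0 <= L ==> bdd_below ((%g. ph g + L * pdist f g) ` cadlag_space)"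
proof (rule bdd_belowI2)
 fix g assume "0 <= L" "g : cadlag_space"
 thus "- B <= ph g + L * pdist f g" using ph[of g] mult_nonneg_nonneg[OF `0 <= L` pdist_nonneg[of f g]] by linarith
qed

lemma infconv_ge: "0 <= L ==> - B <= infconv L ph f" unfolding infconv_def
proof (rule cINF_greatest[OF cadlag_space_nonempty])
 fix g assume "0 <= L" "g : cadlag_space"
 thus "- B <= ph g + L * pdist f g" using ph[of g] mult_nonneg_nonneg[OF `0 <= L` pdist_nonneg[of f g]] by linarith
qed

lemma infconv_le: "0 <= L ==> f : cadlag_space ==> infconv L ph f <= ph f"
 unfolding infconv_def using cINF_lower[OF infconv_bdd, of L f f] by simp

lemma infconv_abs_le: "0 <= L ==> f : cadlag_space ==> |infconv L ph f| <= B"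
 using infconv_le[of L f] infconv_ge[of L f] ph[of f] by auto

lemma plip_infconv:
 assumes L: "0 <= L"
 shows "plip L (infconv L ph)"
proof -
 have "infconv L ph f <= infconv L ph g + L * pdist f g" for f g
 proof -
  have "infconv L ph f - L * pdist f g <= infconv L ph g" unfolding infconv_def[of L ph g]
  proof (rule cINF_greatest[OF cadlag_space_nonempty])
   fix h assume h: "h : cadlag_space"
   have "L * pdist f h <= L * (pdist f g + pdist g h)" by (intro mult_left_mono pdist_triangle L)
   thus "infconv L ph f - L * pdist f g <= ph h + L * pdist g h" using cINF_lower[OF infconv_bdd[OF L] h, of f]
    by (simp add: infconv_def algebra_simps)
  qed
  thus ?thesis by simp
 qed
 hence "|infconv L ph f - infconv L ph g| <= L * pdist f g" for f g
  by (simp add: abs_le_iff diff_le_eq) (metis add.commute pdist_sym)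
 thus ?thesis using L by (simp add: plip_def)
qed

text \<open>Near-minimisers are within \<open>2 * B / n\<close> of \<open>f\<close>, so M1
  continuity, through \<open>pdist_openin\<close>, keeps \<open>ph\<close> from dropping by
  \<open>e / 2\<close> there.\<close>

lemma infconv_tendsto:
 assumes cont: "continuous_map M1_topology euclideanreal ph" and f: "f : cadlag_space"
 shows "(%n. infconv (real n) ph f) ----> ph f"
proof (rule ccontr)
 assume "\<not> ?thesis"
 then obtain e where e: "0 < e" "\<exists>\<^sub>F n in sequentially. e <= |infconv (real n) ph f - ph f|"
  unfolding tendsto_iff by (auto simp: frequently_def dist_real_def not_less not_le)
 \<comment> \<open>For the other \<open>n\<close> the choice \<open>g = f\<close> keeps
   \<open>G\<close> a full sequence that converges to \<open>f\<close>.\<close>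
 have "EX g:cadlag_space. (e <= |infconv (real n) ph f - ph f| --> ph g + n * pdist f g < ph f - e / 2)
  & (\<not> e <= |infconv (real n) ph f - ph f| --> g = f)" for n
 proof (cases "e <= |infconv (real n) ph f - ph f|")
  case True
  hence "(INF g\<in>cadlag_space. ph g + n * pdist f g) < ph f - e / 2"
   using infconv_le[of n f] f e(1) by (auto simp: infconv_def)
  thus ?thesis using True by (subst (asm) cInf_less_iff) (auto intro!: infconv_bdd simp: cadlag_space_nonempty)
 qed (use f in auto)
 then obtain G where G: "!!n. G n : cadlag_space"
  "!!n. e <= |infconv (real n) ph f - ph f| ==> ph (G n) + n * pdist f (G n) < ph f - e / 2"
  "!!n. \<not> e <= |infconv (real n) ph f - ph f| ==> G n = f" by metis
 have dist: "pdist f (G n) <= 2 * B / n" if "0 < n" for n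
 proof (cases "e <= |infconv (real n) ph f - ph f|")
  case True
  hence "n * pdist f (G n) <= 2 * B" using G(2)[of n] ph[OF G(1)[of n]] ph[OF f] e(1) by linarith
  thus ?thesis using that by (simp add: field_simps)
 next
  case False
  thus ?thesis using G(3)[of n] ph[OF f] by simp
 qed
 have "(%n. pdist f (G n)) ----> 0"
 proof (rule tendsto_sandwich[OF _ _ tendsto_const])
  show "(%n. 2 * B / real n) ----> 0" by (rule lim_const_over_n)
  show "\<forall>\<^sub>F n in sequentially. pdist f (G n) <= 2 * B / real n"
   using eventually_gt_at_top[of 0] by eventually_elim (rule dist)
 qed (simp add: pdist_nonneg)
 moreover have "openin M1_topology {g : topspace M1_topology. ph g : {ph f - e / 2 <..}}"
  using cont unfolding continuous_map_def by (simp del: greaterThan_iff)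
 ultimately have "\<forall>\<^sub>F n in sequentially. G n : {g : topspace M1_topology. ph g : {ph f - e / 2 <..}}"
  using G(1) f e(1) by (intro pdist_openin[where f = f]) auto
 with e(2) have "\<exists>\<^sub>F n in sequentially. G n : {g : topspace M1_topology. ph g : {ph f - e / 2 <..}}
   & e <= |infconv (real n) ph f - ph f|" by (rule frequently_eventually_conj)
 then obtain n where n: "ph f - e / 2 < ph (G n)" "e <= |infconv (real n) ph f - ph f|" by (auto dest!: frequently_ex)
 have "0 <= real n * pdist f (G n)" by (simp add: pdist_nonneg)
 thus False using G(2)[OF n(2)] n(1) by linarith
qed

end

definition lwconv :: "'a measure => (nat => 'a => real => real) => 'b measure => ('b => real => real) => bool" where
 "lwconv M Z N W <-> (ALL G L B. plip L G & (ALL f:cadlag_space. |G f| <= B) -->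
  (%n. \<integral>om. G (Z n om) \<partial>M) ----> (\<integral>om. G (W om) \<partial>N))"

text \<open>Regularisation from below gives the lower bound for a continuous function; the upper
  bound is the lower bound for its negative.\<close>

lemma lwconv_imp_converges_weakly:
 assumes M: "prob_space M" and N: "prob_space N" and Z: "!!n. cmeas M (Z n)" and W: "cmeas N W" and conv: "lwconv M Z N W"
 shows "converges_weakly M1_topology M Z N W"
proof -
 interpret M: prob_space M by fact
 interpret N: prob_space N by fact
 have Zc: "Z n om : cadlag_space" if "om : space M" for n om using Z that by (auto simp: cmeas_def)
 have Wc: "W om : cadlag_space" if "om : space N" for om using W that by (auto simp: cmeas_def)
 have lower: "\<forall>\<^sub>F n in sequentially. a < (\<integral>om. ph (Z n om) \<partial>M)"
  if ph: "continuous_map M1_topology euclideanreal ph" "!!f. f : cadlag_space ==> |ph f| <= B"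
   and a: "a < (\<integral>om. ph (W om) \<partial>N)" for ph :: "(real => real) => real" and B a
 proof -
  note B = infconv_abs_le[OF ph(2)]
  have phm: "(%om. ph (X om)) : borel_measurable M'" if "cmeas M' X" for M' X
   using measurable_compose[OF cmeas_imp_borel continuous_map_borel_measurable[OF ph(1)]] that by blast
  have m: "(%om. infconv (real k) ph (X om)) : borel_measurable M'" if "cmeas M' X" for M' X k
   by (rule plip_measurable[OF plip_infconv[OF ph(2)] that]) auto
  have "(%k. \<integral>om. infconv (real k) ph (W om) \<partial>N) ----> (\<integral>om. ph (W om) \<partial>N)"
   by (rule integral_dominated_convergence[where w = "%_. B"])
    (use B infconv_tendsto[OF ph(2,1)] in \<open>simp_all add: phm m W Wc\<close>)
  hence "\<forall>\<^sub>F k in sequentially. a < (\<integral>om. infconv (real k) ph (W om) \<partial>N)"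
   using a by (rule order_tendstoD)
  then obtain k where k: "a < (\<integral>om. infconv (real k) ph (W om) \<partial>N)" by (auto simp: eventually_sequentially)
  have "(%n. \<integral>om. infconv (real k) ph (Z n om) \<partial>M) ---->
    (\<integral>om. infconv (real k) ph (W om) \<partial>N)" by (rule conv[unfolded lwconv_def, rule_format,
     where L = "real k" and B = B]) (use plip_infconv[OF ph(2), where L = "real k"] B[where L = "real k"] in simp)
  hence "\<forall>\<^sub>F n in sequentially. a < (\<integral>om. infconv (real k) ph (Z n om) \<partial>M)"
   using k by (rule order_tendstoD)
  thus ?thesis
  proof eventually_elim
   case (elim n)
   also have "(\<integral>om. infconv (real k) ph (Z n om) \<partial>M) <= (\<integral>om. ph (Z n om) \<partial>M)"
   proof (rule integral_mono)
    show "integrable M (%om. infconv (real k) ph (Z n om))"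
     by (rule M.integrable_const_bound[where B = B]) (use B Zc in \<open>auto intro!: m Z\<close>)
    show "integrable M (%om. ph (Z n om))"
     by (rule M.integrable_const_bound[where B = B]) (use ph(2) Zc in \<open>auto intro!: phm Z\<close>)
    show "infconv (real k) ph (Z n om) <= ph (Z n om)" if "om : space M" for om
     by (rule infconv_le[OF ph(2)]) (use Zc[OF that] in auto)
   qed
   finally show ?case .
  qed
 qed
 have "(%n. \<integral>om. ph (Z n om) \<partial>M) ----> (\<integral>om. ph (W om) \<partial>N)"
  if ph: "continuous_map M1_topology euclideanreal ph" "bounded (ph ` topspace M1_topology)" for ph :: "(real => real) => real"
 proof (rule order_tendstoI)
  obtain B where B: "!!f. f : cadlag_space ==> |ph f| <= B" using ph(2) by (auto simp: bounded_iff)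
  show "\<forall>\<^sub>F n in sequentially. a < (\<integral>om. ph (Z n om) \<partial>M)" if "a < (\<integral>om. ph (W om) \<partial>N)" for a
   by (rule lower[OF ph(1) B that])
  fix a assume a: "(\<integral>om. ph (W om) \<partial>N) < a"
  have "continuous_map M1_topology euclideanreal (%f. - ph f)" using ph(1) by (intro continuous_map_minus)
  hence "\<forall>\<^sub>F n in sequentially. - a < (\<integral>om. - ph (Z n om) \<partial>M)"
   by (rule lower) (use B a in auto)
  thus "\<forall>\<^sub>F n in sequentially. (\<integral>om. ph (Z n om) \<partial>M) < a" by simp
 qed
 thus ?thesis unfolding converges_weakly_def using Z W by (auto intro: cmeas_imp_borel)
qed

text \<open>Two limits of one sequence agree on bounded Lipschitz functionals. The indicator of an
  open set is a limit of such functionals, and open sets are a generator stable under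
  intersection.\<close>

lemma lwconv_unique:
 assumes N: "prob_space N" and N': "prob_space N'" and W: "cmeas N W" and W': "cmeas N' W'"
  and conv: "lwconv M Z N W" "lwconv M Z N' W'"
 shows "equal_in_law M1_topology N W N' W'"
proof -
 interpret N: prob_space N by fact
 interpret N': prob_space N' by fact
 note Wm = cmeas_imp_borel[OF W] and Wm' = cmeas_imp_borel[OF W']
 have Wc: "W om : cadlag_space" if "om : space N" for om using W that by (auto simp: cmeas_def)
 have Wc': "W' om : cadlag_space" if "om : space N'" for om using W' that by (auto simp: cmeas_def)
 have lip: "(\<integral>om. G (W om) \<partial>N) = (\<integral>om. G (W' om) \<partial>N')"
  if "plip L G" "!!f. f : cadlag_space ==> |G f| <= B" for G L B
  using conv that unfolding lwconv_def by (blast intro: LIMSEQ_unique)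
 have open_eq: "measure N (W -` U \<inter> space N) = measure N' (W' -` U \<inter> space N')" if U: "openin M1_topology U" for U
 proof -
  define rh where "rh = dset (cadlag_space - U)"
  have rh: "plip 1 rh" "!!f. 0 <= rh f" unfolding rh_def by (simp_all add: plip_dset dset_nonneg)
  have Uiff: "f : U <-> 0 < rh f" if "f : cadlag_space" for f using that open_dist_to_complement[OF U] unfolding rh_def by blast
  define G where "G = (%k f. min 1 (real k * rh f))"
  have G: "plip (real k) (G k)" for k
  proof -
   have "|G k f - G k g| <= real k * pdist f g" if "f : cadlag_space" "g : cadlag_space" for f g
   proof -
    have "|G k f - G k g| <= |real k * rh f - real k * rh g|" by (auto simp: G_def)
    also have "... = real k * |rh f - rh g|" by (simp add: abs_mult right_diff_distrib[symmetric])
    also have "... <= real k * pdist f g" using path_lipschitzD[OF rh(1) that] by (intro mult_left_mono) auto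
    finally show ?thesis .
   qed
   thus ?thesis by (simp add: plip_def)
  qed
  have Glim: "(%k. G k f) ----> indicator U f" if f: "f : cadlag_space" for f
  proof (cases "f : U")
   case True
   hence pos: "0 < rh f" using Uiff[OF f] by simp
   obtain k0 :: nat where "1 / rh f < k0" using reals_Archimedean2 by blast
   hence "1 <= real k * rh f" if "k0 <= k" for k
   proof -
    have "1 / rh f <= real k" using `1 / rh f < k0` that by linarith
    thus ?thesis using pos by (simp add: field_simps)
   qed
   hence "\<forall>\<^sub>F k in sequentially. G k f = 1" unfolding eventually_sequentially G_def by (intro exI[of _ k0]) auto
   thus ?thesis using True by (auto intro: tendsto_eventually)
  next
   case False
   hence "rh f = 0" using Uiff[OF f] rh(2)[of f] by simp
   thus ?thesis using False by (simp add: G_def)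
  qed
  have Gb: "|G k f| <= 1" for k f using rh(2)[of f] by (auto simp: G_def)
  have limit: "(%k. \<integral>om. G k (X om) \<partial>P) ----> measure P (X -` U \<inter> space P)"
   if P: "prob_space P" and X: "cmeas P X" for P :: "'z measure" and X
  proof -
   interpret P: prob_space P by fact
   have "X -` U \<inter> space P : sets P" using cmeas_imp_borel[OF X] U by (auto simp: sets_borel_of intro!: measurable_sets)
   have "(%k. \<integral>om. G k (X om) \<partial>P) ----> (\<integral>om. indicator (X -` U \<inter> space P) om \<partial>P)"
   proof (rule integral_dominated_convergence[where w = "%_. 1"])
    show "AE om in P. (%k. G k (X om)) ----> indicator (X -` U \<inter> space P) om"
    proof (rule AE_I2)
     fix om assume "om : space P"
     thus "(%k. G k (X om)) ----> indicator (X -` U \<inter> space P) om"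
     using Glim[of "X om"] X by (auto simp: cmeas_def indicator_def)
    qed
   qed (use Gb \<open>X -` U \<inter> space P : sets P\<close> in \<open>auto intro!: plip_measurable[OF G X]\<close>)
   thus ?thesis by simp
  qed
  have "(\<integral>om. G k (W om) \<partial>N) = (\<integral>om. G k (W' om) \<partial>N')" for k by (rule lip[OF G]) (rule Gb)
  thus ?thesis using limit[OF N W] limit[OF N' W'] by (simp add: LIMSEQ_unique)
 qed
 have "distr N (borel_of M1_topology) W = distr N' (borel_of M1_topology) W'"
 proof (rule measure_eqI_generator_eq[where A = "%_. cadlag_space"])
  show "Int_stable {U. openin M1_topology U}" by (auto simp: Int_stable_def)
  show "{U. openin M1_topology U} \<subseteq> Pow cadlag_space" using openin_subset[of M1_topology] by auto
  show "sets (distr N (borel_of M1_topology) W) = sigma_sets cadlag_space {U. openin M1_topology U}"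
   "sets (distr N' (borel_of M1_topology) W') = sigma_sets cadlag_space {U. openin M1_topology U}"
   by (simp_all add: sets_borel_of)
  show "range (%_. cadlag_space) \<subseteq> {U. openin M1_topology U}" using openin_topspace[of M1_topology] by auto
  fix U assume "U : {U. openin M1_topology U}"
  hence U: "openin M1_topology U" "U : sets (borel_of M1_topology)" by (auto simp: sets_borel_of)
  show "emeasure (distr N (borel_of M1_topology) W) U = emeasure (distr N' (borel_of M1_topology) W') U"
   using open_eq[OF U(1)] U(2) Wm Wm' by (simp add: emeasure_distr N.emeasure_eq_measure N'.emeasure_eq_measure)
 next
  show "emeasure (distr N (borel_of M1_topology) W) cadlag_space ~= \<infinity>" for i :: nat
   using N.prob_space_distr[OF Wm] by (simp add: prob_space.emeasure_le_1 prob_space_imp_subprob_space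
     finite_measure.emeasure_finite[OF prob_space.finite_measure])
 qed auto
 thus ?thesis unfolding equal_in_law_def using Wm Wm' by blast
qed

section \<open>The given walk as a reversed chain\<close>

context sthaler
begin

definition sprob :: "bool => real" where "sprob s = (if s then b else 1 - b)"

lemma sprob_nonneg [simp]: "0 <= sprob s" using b_bounds by (simp add: sprob_def)

lemma prod_sprob_nonneg: "0 <= (\<Prod>z\<leftarrow>zs. sprob (fst z))" by (induction zs) auto

lemma pmf_chain_Cons:
 assumes "xs <= y"
 shows "pmf (chain (Suc n) y) (z # zs) = sprob (fst z) * mass (snd z) y * pmf (chain n (nxt y z)) zs"
proof -
 have "{ws. z' # ws : {z # zs}} = (if z' = z then {zs} else {})" for z' by auto
 hence "pmf (chain (Suc n) y) (z # zs) = \<E> (step y) (%z'. if z' = z then pmf (chain n (nxt y z)) zs else 0)"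
  unfolding pmf.rep_eq prob_chain_Suc by (auto intro!: Bochner_Integration.integral_cong)
 also have "... = pmf (step y) z * pmf (chain n (nxt y z)) zs" by (subst integral_measure_pmf[of "{z}"]) (auto split: if_splits)
 also have "pmf (step y) z = sprob (fst z) * mass (snd z) y"
  using b_bounds unfolding step_def by (cases z) (simp add: pmf_pair pmf_wait[OF assms] sprob_def)
 finally show ?thesis .
qed

lemma pmf_chain:
 assumes "xs <= y" "y <= 1" "length zs = n"
 shows "ennreal (pmf (chain n y) zs) = ennreal (\<Prod>z\<leftarrow>zs. sprob (fst z)) * path_prob (map snd zs) y" using assms
proof (induction zs arbitrary: n y)
 case (Cons z zs)
 then obtain m where m: "n = Suc m" "length zs = m" by auto
 have "0 <= mass (snd z) y" using Cons.prems xs_bds by (intro mass_ge0) auto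
 moreover have "0 <= (\<Prod>z\<leftarrow>zs. sprob (fst z))" by (rule prod_sprob_nonneg)
 ultimately show ?case using Cons.IH[of "nxt y z" m] nxt_in[OF Cons.prems(1,2), of z] m
  unfolding m(1) pmf_chain_Cons[OF Cons.prems(1)] by (simp add: ennreal_mult ennreal_mult' mult_ac nxt_def)
qed (simp add: measure_return_pmf pmf.rep_eq)

end

locale signed_walk = sthaler + prob_space M for M :: "'a measure" +
 fixes y0 :: "'a => real" and de :: "nat => 'a => real"
 assumes y0_measurable: "y0 : measurable M mu" and distr_y0: "distr M mu y0 = mu" and de_indep: "indep_vars (%_. borel) de UNIV"
  and de_plus: "prob {om : space M. de j om = 1} = b" and de_minus: "prob {om : space M. de j om = -1} = 1 - b"
  and de_ta_indep: "indep_var (Pi\<^sub>M UNIV (%_. borel)) (%om j. de j om)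
   (Pi\<^sub>M UNIV (%_. borel)) (%om j. real (return_time ga j (y0 om)))"
begin

lemma de_measurable [measurable]: "de j : borel_measurable M" using de_indep by (simp add: indep_vars_def)

lemma ta_measurable [measurable]: "(%om. return_time ga j (y0 om)) : measurable M (count_space UNIV)"
proof -
 have "(%om j. real (return_time ga j (y0 om))) : measurable M (Pi\<^sub>M UNIV (%_. borel))"
  using de_ta_indep by (rule indep_var_rv2)
 from measurable_compose[OF this measurable_component_singleton[of j]]
 have "(%om. real (return_time ga j (y0 om))) : borel_measurable M" by simp
 hence "(%om. nat \<lfloor>real (return_time ga j (y0 om))\<rfloor>) : measurable M (count_space UNIV)" by measurable
 thus ?thesis by simp
qed

text \<open>Subtracting \<open>1\<close> matches the shifted waiting times of \<open>chain\<close>;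
  any sign other than \<open>1\<close> is recorded as \<open>False\<close>.\<close>

definition walk :: "nat => 'a => (bool \<times> nat) list" where
 "walk N om = map (%j. (de j om = 1, return_time ga j (y0 om) - 1)) [0..<N]"

lemma walk_measurable [measurable]: "walk N : measurable M (count_space UNIV)"
 unfolding walk_def[abs_def] by (intro measurable_map_list) measurable

text \<open>Stronger than equality of \<open>walk\<close> with \<open>zs\<close>: signs other than
  \<open>1\<close> and \<open>- 1\<close> and the return time \<open>0\<close>, which
  \<open>walk\<close> cannot see, are ruled out.\<close>

definition wevent :: "(bool \<times> nat) list => 'a set" where
 "wevent zs = {om : space M. ALL j<length zs. de j om = (if fst (zs ! j) then 1 else - 1) &
  return_time ga j (y0 om) = Suc (snd (zs ! j))}"

lemma wevent_measurable [measurable]: "wevent zs : sets M" unfolding wevent_def by measurable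

lemma walk_eq: "om : wevent zs ==> walk (length zs) om = zs"
 by (intro nth_equalityI) (auto simp: walk_def wevent_def prod_eq_iff)

lemma prod_list_nth: "(\<Prod>z\<leftarrow>zs. f z) = (\<Prod>j<length zs. f (zs ! j))"
 by (simp add: prod.list_conv_set_nth lessThan_atLeast0)

lemma prob_signs:
 "prob {om : space M. ALL j<length zs. de j om = (if fst (zs ! j) then 1 else - 1)} = (\<Prod>z\<leftarrow>zs. sprob (fst z))"
proof (cases "zs = []")
 case False
 let ?A = "%j. {if fst (zs ! j) then 1 else - 1 :: real}"
 have "{om : space M. ALL j<length zs. de j om = (if fst (zs ! j) then 1 else - 1)} = (\<Inter>j\<in>{..<length zs}. de j -` ?A j \<inter> space M)"
  using False by auto
 also have "prob ... = (\<Prod>j<length zs. prob (de j -` ?A j \<inter> space M))"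
  using False by (intro indep_varsD[OF de_indep]) auto
 also have "... = (\<Prod>j<length zs. sprob (fst (zs ! j)))"
 proof (intro prod.cong refl)
  fix j
  have "de j -` ?A j \<inter> space M = {om : space M. de j om = (if fst (zs ! j) then 1 else - 1)}" by auto
  thus "prob (de j -` ?A j \<inter> space M) = sprob (fst (zs ! j))" using de_plus[of j] de_minus[of j] by (simp add: sprob_def)
 qed
 finally show ?thesis by (simp add: prod_list_nth)
qed (simp add: prob_space)

text \<open>Independence splits off the signs; the return times form a cylinder for
  \<open>y0\<close>, whose measure is given by the reversed chain, whence
  \<open>rev zs\<close>.\<close>

lemma emeasure_wevent:
 assumes "length zs = N"
 shows "emeasure M (wevent zs) = (\<integral>\<^sup>+y. ennreal (pmf (chain N y) (rev zs)) \<partial>mu)"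
proof -
 let ?\<Pi> = "Pi\<^sub>M UNIV (%_::nat. borel :: real measure)"
 let ?A = "{f. ALL j<length zs. f j = (if fst (zs ! j) then 1 else - 1 :: real)}"
  and ?B = "{f. ALL j<length zs. f j = real (Suc (snd (zs ! j)))}"
 have "{f : space ?\<Pi>. ALL j<length zs. f j = c j} : sets ?\<Pi>" for c by measurable
 hence sets: "?A : sets ?\<Pi>" "?B : sets ?\<Pi>" by (simp_all add: space_PiM)
 have "prob (wevent zs) = prob ((%om. (%j. de j om, %j. real (return_time ga j (y0 om)))) -` (?A \<times> ?B) \<inter> space M)"
  by (rule arg_cong[where f = prob]) (auto simp: wevent_def simp del: of_nat_Suc)
 also have "... = prob ((%om j. de j om) -` ?A \<inter> space M) * prob ((%om j. real (return_time ga j (y0 om))) -` ?B \<inter> space M)"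
  by (rule indep_varD[OF de_ta_indep sets])
 also have "(%om j. de j om) -` ?A \<inter> space M = {om : space M. ALL j<length zs. de j om = (if fst (zs ! j) then 1 else - 1)}" by auto
 also have "prob ... = (\<Prod>z\<leftarrow>zs. sprob (fst z))" by (rule prob_signs)
 also have "(%om j. real (return_time ga j (y0 om))) -` ?B \<inter> space M = y0 -` (rcyl (map snd zs) \<inter> space mu) \<inter> space M"
  using measurable_space[OF y0_measurable] by (auto simp: rcyl_def simp del: of_nat_Suc)
 finally have "emeasure M (wevent zs) = ennreal (\<Prod>z\<leftarrow>zs. sprob (fst z)) * emeasure M (y0 -` (rcyl (map snd zs) \<inter> space mu) \<inter> space M)"
  by (simp add: emeasure_eq_measure ennreal_mult' prod_sprob_nonneg)
 also have "emeasure M (y0 -` (rcyl (map snd zs) \<inter> space mu) \<inter> space M) = emeasure (distr M mu y0) (rcyl (map snd zs) \<inter> space mu)"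
 proof (rule emeasure_distr[symmetric, OF y0_measurable])
  show "rcyl (map snd zs) \<inter> space mu : sets mu"
   unfolding sets_mu sets_restrict_space by (auto intro!: image_eqI[of _ _ "rcyl (map snd zs)"])
 qed
 also have "... = (\<integral>\<^sup>+y. path_prob (rev (map snd zs)) y \<partial>mu)" by (simp only: distr_y0 emeasure_rcyl)
 also have "ennreal (\<Prod>z\<leftarrow>zs. sprob (fst z)) * ... = (\<integral>\<^sup>+y. ennreal (\<Prod>z\<leftarrow>rev zs. sprob (fst z)) * path_prob (map snd (rev zs)) y \<partial>mu)"
 proof -
  have "(\<Prod>z\<leftarrow>rev zs. sprob (fst z)) = (\<Prod>z\<leftarrow>zs. sprob (fst z))"
   unfolding rev_map[symmetric] by (rule prod_list.rev)
  thus ?thesis by (simp add: nn_integral_cmult rev_map)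
 qed
 also have "... = (\<integral>\<^sup>+y. ennreal (pmf (chain N y) (rev zs)) \<partial>mu)"
  using assms by (intro nn_integral_cong pmf_chain[symmetric]) auto
 finally show ?thesis .
qed

lemma nn_integral_wevent:
 "(\<integral>\<^sup>+zs. f zs * emeasure M (if length zs = N then wevent zs else {}) \<partial>count_space UNIV)
  = (\<integral>\<^sup>+y. \<integral>\<^sup>+zs. f (rev zs) \<partial>measure_pmf (chain N y) \<partial>mu)"
proof -
 interpret C: sigma_finite_measure "count_space UNIV :: (bool \<times> nat) list measure"
  by (rule sigma_finite_measure_count_space_countable) simp
 interpret P: pair_sigma_finite "count_space UNIV :: (bool \<times> nat) list measure" mu ..
 \<comment> \<open>The point probability in explicit form, visibly measurable in
   \<open>y\<close>.\<close>
 define h where "h = (%zs y. if length zs = N then ennreal (\<Prod>z\<leftarrow>rev zs. sprob (fst z)) * path_prob (map snd (rev zs)) y else 0)"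
 have h: "h zs y = ennreal (pmf (chain N y) (rev zs))" if "y : space mu" for zs y
 proof (cases "length zs = N")
  case False
  hence "rev zs \<notin> set_pmf (chain N y)" using chain_len[of "rev zs" N y] by auto
  thus ?thesis using False by (simp add: h_def set_pmf_iff)
 next
  case True
  thus ?thesis using pmf_chain[of y "rev zs" N] that by (simp add: h_def)
 qed
 have [measurable]: "h zs : borel_measurable mu" for zs unfolding h_def by (cases "length zs = N") auto
 have "(\<integral>\<^sup>+zs. f zs * emeasure M (if length zs = N then wevent zs else {}) \<partial>count_space UNIV)
   = (\<integral>\<^sup>+zs. \<integral>\<^sup>+y. f zs * h zs y \<partial>mu \<partial>count_space UNIV)"
 proof (rule nn_integral_cong)
  fix zs :: "(bool \<times> nat) list"
  have "emeasure M (if length zs = N then wevent zs else {}) = (\<integral>\<^sup>+y. h zs y \<partial>mu)"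
  proof (cases "length zs = N")
   case True
   thus ?thesis using h by (simp add: emeasure_wevent cong: nn_integral_cong_simp)
  qed (simp add: h_def)
  thus "f zs * emeasure M (if length zs = N then wevent zs else {}) = (\<integral>\<^sup>+y. f zs * h zs y \<partial>mu)"
   by (simp add: nn_integral_cmult)
 qed
 also have "... = (\<integral>\<^sup>+y. \<integral>\<^sup>+zs. f zs * h zs y \<partial>count_space UNIV \<partial>mu)"
 proof (rule P.Fubini'[symmetric])
  show "(%(zs, y). f zs * h zs y) : borel_measurable (count_space UNIV \<Otimes>\<^sub>M mu)"
   by (rule measurable_pair_measure_countable1) auto
 qed
 also have "... = (\<integral>\<^sup>+y. \<integral>\<^sup>+zs. f (rev zs) \<partial>measure_pmf (chain N y) \<partial>mu)"
 proof (rule nn_integral_cong)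
  fix y assume y: "y : space mu"
  have "(\<integral>\<^sup>+zs. f zs * h zs y \<partial>count_space UNIV) = (\<integral>\<^sup>+zs. f (rev (rev zs)) * ennreal (pmf (chain N y) (rev zs)) \<partial>count_space UNIV)"
   by (simp add: h[OF y])
  also have "... = (\<integral>\<^sup>+zs. f (rev zs) * ennreal (pmf (chain N y) zs) \<partial>count_space UNIV)"
   by (rule nn_integral_bij_count_space[where g = rev]) (auto intro!: bij_betwI[where g = rev])
  finally show "(\<integral>\<^sup>+zs. f zs * h zs y \<partial>count_space UNIV) = (\<integral>\<^sup>+zs. f (rev zs) \<partial>measure_pmf (chain N y))"
   by (simp add: nn_integral_measure_pmf mult.commute)
 qed
 finally show ?thesis .
qed

text \<open>The disjoint events for lists of length \<open>N\<close> have total mass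
  \<open>1\<close>, by \<open>nn_integral_wevent\<close> with the constant function
  \<open>1\<close>.\<close>

lemma AE_wevent: "AE om in M. om : wevent (walk N om)"
proof -
 let ?U = "\<Union>zs. if length zs = N then wevent zs else {}"
 have [measurable]: "?U : sets M" by (intro sets.countable_UN') auto
 have "disjoint_family (%zs. if length zs = N then wevent zs else {})" unfolding disjoint_family_on_def
 proof (intro ballI impI)
  fix us vs :: "(bool \<times> nat) list" assume "us ~= vs"
  hence "om : wevent us ==> om : wevent vs ==> length us ~= length vs" for om using walk_eq[of om us] walk_eq[of om vs] by auto
  thus "(if length us = N then wevent us else {}) \<inter> (if length vs = N then wevent vs else {}) = {}"
   by (auto split: if_splits)
 qed
 hence "emeasure M ?U = (\<integral>\<^sup>+zs. 1 * emeasure M (if length zs = N then wevent zs else {}) \<partial>count_space UNIV)"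
  by (subst emeasure_UN_countable) auto
 also have "... = 1" unfolding nn_integral_wevent using mu.emeasure_space_1 by simp
 finally have "prob ?U = 1" by (simp add: emeasure_eq_measure)
 hence "AE om in M. om : ?U" by (rule AE_prob_1)
 thus ?thesis
 proof (rule AE_mp, intro AE_I2 impI)
  fix om assume "om : ?U"
  then obtain zs where "length zs = N" "om : wevent zs" by (auto split: if_splits)
  thus "om : wevent (walk N om)" using walk_eq[of om zs] by simp
 qed
qed

lemma nn_integral_walk:
 "(\<integral>\<^sup>+om. f (walk N om) \<partial>M) = (\<integral>\<^sup>+y. \<integral>\<^sup>+zs. f (rev zs) \<partial>measure_pmf (chain N y) \<partial>mu)"
proof -
 interpret C: sigma_finite_measure "count_space UNIV :: (bool \<times> nat) list measure"
  by (rule sigma_finite_measure_count_space_countable) simp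
 interpret P: pair_sigma_finite "count_space UNIV :: (bool \<times> nat) list measure" M ..
 let ?V = "%zs. if length zs = N then wevent zs else {}"
 have "(\<integral>\<^sup>+om. f (walk N om) \<partial>M) = (\<integral>\<^sup>+om. \<integral>\<^sup>+zs. f zs * indicator (?V zs) om \<partial>count_space UNIV \<partial>M)"
 proof (rule nn_integral_cong_AE)
  show "AE om in M. f (walk N om) = (\<integral>\<^sup>+zs. f zs * indicator (?V zs) om \<partial>count_space UNIV)"
   using AE_wevent[of N]
  proof (rule AE_mp, intro AE_I2 impI)
   fix om assume "om : wevent (walk N om)"
   hence "om : ?V zs <-> zs = walk N om" for zs using walk_eq[of om zs] by (auto simp: walk_def)
   hence "(\<integral>\<^sup>+zs. f zs * indicator (?V zs) om \<partial>count_space UNIV)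
     = (\<integral>\<^sup>+zs. f (walk N om) * indicator {walk N om} zs \<partial>count_space UNIV)"
    by (intro nn_integral_cong) (auto simp: indicator_def)
   thus "f (walk N om) = (\<integral>\<^sup>+zs. f zs * indicator (?V zs) om \<partial>count_space UNIV)"
    by (simp add: nn_integral_cmult_indicator)
  qed
 qed
 also have "... = (\<integral>\<^sup>+zs. \<integral>\<^sup>+om. f zs * indicator (?V zs) om \<partial>M \<partial>count_space UNIV)"
 proof (rule P.Fubini')
  show "(%(zs, om). f zs * indicator (?V zs) om) : borel_measurable (count_space UNIV \<Otimes>\<^sub>M M)"
   by (rule measurable_pair_measure_countable1) auto
 qed
 also have "... = (\<integral>\<^sup>+zs. f zs * emeasure M (?V zs) \<partial>count_space UNIV)"
  by (intro nn_integral_cong nn_integral_cmult_indicator) auto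
 finally show ?thesis by (simp only: nn_integral_wevent)
qed

text \<open>The walk is the reversed chain read backwards and mixed over its starting state, so
  bounds uniform in this state carry over.\<close>

lemma expectation_walk_bounds:
 fixes f :: "(bool \<times> nat) list => real"
 assumes f: "!!zs. |f zs| <= B" and le: "!!y. xs <= y ==> y <= 1 ==> |\<E> (chain N y) (%zs. f (rev zs)) - a| <= e"
 shows "|expectation (%om. f (walk N om)) - a| <= e"
proof -
 have fm [measurable]: "(%om. f (walk N om)) : borel_measurable M" by measurable
 have int: "integrable M (%om. f (walk N om))" by (rule integrable_const_bound[where B = B]) (use f in auto)
 have one: "expectation (%om. g (walk N om)) <= u"
  if g: "!!zs. |g zs| <= B" and u: "!!y. xs <= y ==> y <= 1 ==> \<E> (chain N y) (%zs. g (rev zs)) <= u"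
  for g :: "(bool \<times> nat) list => real" and u
 proof -
  have ig: "integrable M (%om. g (walk N om))" by (rule integrable_const_bound[where B = B]) (use g in auto)
  have gB: "0 <= g zs + B" for zs using g[of zs] by linarith
  have uB: "0 <= u + B"
  proof -
   have "|\<E> (chain N 1) (%zs. g (rev zs)) | <= B" unfolding real_norm_def[symmetric] by (rule norm_exp_pmf) (simp add: g)
   thus ?thesis using u[of 1] xs_bds by linarith
  qed
  have "ennreal (expectation (%om. g (walk N om) + B)) = (\<integral>\<^sup>+om. ennreal (g (walk N om) + B) \<partial>M)"
   using ig gB by (intro nn_integral_eq_integral[symmetric]) auto
  also have "... = (\<integral>\<^sup>+y. \<integral>\<^sup>+zs. ennreal (g (rev zs) + B) \<partial>measure_pmf (chain N y) \<partial>mu)"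
   by (rule nn_integral_walk)
  also have "... <= (\<integral>\<^sup>+y. ennreal (u + B) \<partial>mu)"
  proof (rule nn_integral_mono)
   fix y assume "y : space mu"
   hence y: "xs <= y" "y <= 1" by auto
   have i: "integrable (measure_pmf (chain N y)) (%zs. g (rev zs))" by (rule int_pmf_bdd[where B = B]) (simp add: g)
   hence "(\<integral>\<^sup>+zs. ennreal (g (rev zs) + B) \<partial>measure_pmf (chain N y)) = ennreal (\<E> (chain N y) (%zs. g (rev zs) + B))"
    using gB by (intro nn_integral_eq_integral) auto
   also have "... <= ennreal (u + B)" using u[OF y] i by (intro ennreal_leI) simp
   finally show "(\<integral>\<^sup>+zs. ennreal (g (rev zs) + B) \<partial>measure_pmf (chain N y)) <= ennreal (u + B)" .
  qed
  also have "... = ennreal (u + B)" using mu.emeasure_space_1 by simp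
  finally have "expectation (%om. g (walk N om) + B) <= u + B" using uB by (simp add: ennreal_le_iff)
  thus ?thesis using ig by (simp add: prob_space)
 qed
 have "expectation (%om. f (walk N om)) <= a + e"
 proof (rule one[OF f])
  show "\<E> (chain N y) (%zs. f (rev zs)) <= a + e" if "xs <= y" "y <= 1" for y using le[OF that] by (simp add: abs_le_iff)
 qed
 moreover have "expectation (%om. - f (walk N om)) <= e - a"
 proof (rule one)
  show "\<E> (chain N y) (%zs. - f (rev zs)) <= e - a" if "xs <= y" "y <= 1" for y using le[OF that] by (simp add: abs_le_iff)
 qed (simp add: f)
 ultimately show ?thesis by (simp add: abs_le_iff)
qed

end

section \<open>Blocks on a time grid\<close>

context sthaler
begin

text \<open>Number of steps of the walk up to time \<open>i / k\<close>.\<close>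

definition grid :: "nat => nat => nat => nat" where "grid n k i = n * i div k"

definition block :: "nat => nat => nat => (bool \<times> nat) list => (bool \<times> nat) list" where
 "block n k i zs = take (grid n k (Suc i) - grid n k i) (drop (grid n k i) zs)"

lemma grid_mono: "i <= j ==> grid n k i <= grid n k j" by (simp add: grid_def div_le_mono)

lemma grid_0 [simp]: "grid n k 0 = 0" by (simp add: grid_def)

lemma grid_last: "0 < k ==> grid n k (k * k) = n * k" by (simp add: grid_def)

lemma grid_less: "0 < k ==> k <= n ==> grid n k i < grid n k (Suc i)"
proof -
 assume k: "0 < k" "k <= n"
 have "grid n k i + 1 = (n * i + k) div k" using k by (simp add: grid_def)
 also have "(n * i + k) div k <= n * Suc i div k" by (rule div_le_mono) (use k in simp)
 also have "... = grid n k (Suc i)" by (simp add: grid_def)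
 finally show ?thesis by simp
qed

lemma grid_bounds:
 assumes "0 < k"
 shows "real (grid n k i) <= real n * (real i / k)" "real n * (real i / k) < real (grid n k i) + 1"
proof -
 have "n * i div k * k <= n * i" "n * i < (n * i div k + 1) * k"
  using assms by (simp_all add: div_times_less_eq_dividend dividend_less_div_times)
 hence "real (n * i div k * k) <= real (n * i)" "real (n * i) < real ((n * i div k + 1) * k)"
  by (simp_all only: of_nat_le_iff of_nat_less_iff)
 thus "real (grid n k i) <= real n * (real i / k)" "real n * (real i / k) < real (grid n k i) + 1"
  using assms by (simp_all add: grid_def field_simps)
qed

lemma csum_rev: "csum (rev zs) = csum zs" by (simp add: csum_def rev_map[symmetric])

lemma csum_take_eq: "m <= length zs ==> csum (take m zs) = (\<Sum>j<m. jump (zs ! j)) - real m * (be * ell)"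
proof (induction m)
 case (Suc m)
 thus ?case by (simp add: take_Suc_conv_app_nth cent_def algebra_simps)
qed simp

lemma split1_block:
 assumes k: "0 < k" "k <= n" and i: "i < k * k" and len: "length zs = n * k" and "0 <= l"
  and split: "split1 l (rev (block n k i zs))"
 obtains p where "grid n k i < p" "p <= grid n k (Suc i)"
  "!!x. grid n k i <= x ==> x < p ==> |csum (take x zs) - csum (take (grid n k i) zs) | <= l"
  "!!x. p <= x ==> x <= grid n k (Suc i) ==> |csum (take x zs) - csum (take (grid n k (Suc i)) zs) | <= l"
proof -
 let ?g = "grid n k i" and ?h = "grid n k (Suc i)" and ?b = "block n k i zs"
 have gh: "?g < ?h" by (rule grid_less[OF k])
 have hl: "?h <= length zs" using grid_mono[of "Suc i" "k * k" n k] i grid_last[of k n] k len by simp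
 have lb: "length ?b = ?h - ?g" using hl by (simp add: block_def)
 have S: "csum (take (?g + m) zs) = csum (take ?g zs) + csum (take m ?b)" if "m <= ?h - ?g" for m
  using that by (simp add: take_add block_def)
 have drop_b: "csum (drop m ?b) = csum (take ?h zs) - csum (take (?g + m) zs)" if "m <= ?h - ?g" for m
 proof -
  have "csum ?b = csum (take m ?b) + csum (drop m ?b)" by (metis append_take_drop_id csum_simps(3))
  thus ?thesis using S[OF that] S[of "?h - ?g"] gh lb by simp
 qed
 from split obtain p' where p': "p' <= length (rev ?b)" "!!j. j < p' ==> |csum (take j (rev ?b)) | <= l"
  "!!j. p' <= j ==> |csum (drop j (rev ?b)) | <= l" unfolding split1_def by blast
 have p'l: "p' <= ?h - ?g" using p'(1) lb by simp
 \<comment> \<open>The block was read backwards, so the split counts from its end; the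
   \<open>+ 1\<close> exchanges strict and weak inequality, and the minimum covers
   \<open>p' = 0\<close>.\<close>
 show ?thesis
 proof (rule that[of "min ?h (?h - p' + 1)"])
  show "?g < min ?h (?h - p' + 1)" using gh p'l by simp
  show "min ?h (?h - p' + 1) <= ?h" by simp
  fix x
  {
   assume x: "?g <= x" "x < min ?h (?h - p' + 1)"
   hence "x < ?h" "x < ?h - p' + 1" by auto
   hence "p' <= ?h - x" using p'l by arith
   from p'(3)[OF this] have "|csum (take (x - ?g) ?b) | <= l" using x lb by (simp add: drop_rev csum_rev)
   thus "|csum (take x zs) - csum (take ?g zs) | <= l" using S[of "x - ?g"] x `x < ?h` by simp
  next
   assume x: "min ?h (?h - p' + 1) <= x" "x <= ?h"
   show "|csum (take x zs) - csum (take ?h zs) | <= l"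
   proof (cases "x = ?h")
    case False
    hence "?h - x < p'" "?g <= x" using x p'l by auto
    from p'(2)[OF this(1)] have "|csum (drop (x - ?g) ?b) | <= l" using x lb `?g <= x` by (simp add: take_rev csum_rev)
    thus ?thesis using drop_b[of "x - ?g"] x `?g <= x` by (simp add: abs_minus_commute)
   qed (use `0 <= l` in simp)
  }
 qed
qed

text \<open>The splits of the blocks provide the free points of \<open>pdist_spath\<close>. Half of
  \<open>e\<close> pays for the fluctuation inside a block, half for the fractional part of
  \<open>n * t\<close> in the centring.\<close>

lemma pdist_walk_spath:
 fixes x :: "nat => real"
 assumes k: "0 < k" "1 / real k <= e" "1 / e + e < real k" and n: "k <= n" and len: "length zs = n * k"
  and c: "0 < c" "c * |be * ell| <= e / 2" and x: "!!j. j < n * k ==> x j = jump (zs ! j)"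
  and good: "!!i. real i / k <= 1 / e + e ==> split1 (e / (2 * c)) (rev (block n k i zs))"
 shows "pdist (\<lambda>t\<in>{0..}. c * ((\<Sum>j<nat \<lfloor>real n * t\<rfloor>. x j) - real n * t * be * ell))
  (spath k (%i. c * csum (take (grid n k i) zs))) <= e"
proof -
 define T where "T = 1 / e + e"
 have "0 < 1 / real k" using k by simp
 hence e: "0 < e" using k(2) by linarith
 have n0: "0 < real n" using k n by simp
 let ?g = "grid n k" and ?S = "%x. csum (take x zs)" and ?l = "e / (2 * c)"
 have l: "0 <= ?l" using e c by simp
 have iT: "i < k * k" if "real i / k <= T" for i
 proof -
  have "real i / k < real k" using that k(3) by (simp add: T_def)
  hence "real i < real (k * k)" using k(1) by (simp add: field_simps)
  thus ?thesis by (simp only: of_nat_less_iff)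
 qed
 have "ALL i. EX p. real i / k <= T --> ?g i < p & p <= ?g (Suc i) &
   (ALL x. ?g i <= x --> x < p --> |?S x - ?S (?g i) | <= ?l) &
   (ALL x. p <= x --> x <= ?g (Suc i) --> |?S x - ?S (?g (Suc i)) | <= ?l)" (is "ALL i. EX p. ?Q i p")
 proof
  fix i
  show "EX p. ?Q i p"
 proof (cases "real i / k <= T")
  case True
  show ?thesis by (rule split1_block[OF k(1) n iT[OF True] len l good[OF True[unfolded T_def]]]) blast
 qed simp
 qed
 from choice[OF this] obtain p where "ALL i. ?Q i (p i)" by blast
 hence p: "!!i. real i / k <= T ==> ?g i < p i" "!!i. real i / k <= T ==> p i <= ?g (Suc i)"
  "!!i x. real i / k <= T ==> ?g i <= x ==> x < p i ==> |?S x - ?S (?g i) | <= ?l"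
  "!!i x. real i / k <= T ==> p i <= x ==> x <= ?g (Suc i) ==> |?S x - ?S (?g (Suc i)) | <= ?l" by blast+
 \<comment> \<open>Splits are used for the blocks that start up to time \<open>T\<close>; later
   cells keep their grid points.\<close>
 define s where "s = (%i. case i of 0 => 0 | Suc i => if real i / k <= T then real (p i) / n else real (Suc i) / k)"
 have s_Suc: "s (Suc i) = (if real i / k <= T then real (p i) / n else real (Suc i) / k)" for i by (simp add: s_def)
 have s1: "real i / k < s (Suc i)" for i
 proof (cases "real i / k <= T")
  case True
  have "real n * (real i / k) < real (p i)" using grid_bounds(2)[OF k(1), of n i] p(1)[OF True] by linarith
  thus ?thesis using n0 True by (simp add: s_Suc field_simps)
 qed (use k(1) in \<open>simp add: s_Suc divide_strict_right_mono\<close>)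
 have s2: "s (Suc i) <= real (Suc i) / k" for i
 proof (cases "real i / k <= T")
  case True
  have "real (p i) <= real n * (real (Suc i) / k)" using grid_bounds(1)[OF k(1), of n "Suc i"] p(2)[OF True] by linarith
  thus ?thesis using n0 True by (simp add: s_Suc field_simps)
 qed (simp add: s_Suc)
 show ?thesis
 proof (rule pdist_spath[OF k(1,2) _ _ s1 s2])
  show "1 / e + e <= real k" using k(3) by simp
  show "s 0 = 0" by (simp add: s_def)
  fix i t assume t: "s i <= t" "t < s (Suc i)" "t <= 1 / e + e"
  have s0: "0 <= s i"
  proof (cases i)
   case (Suc i')
   have "0 <= real i' / k" by simp
   thus ?thesis using s1[of i'] unfolding Suc by linarith
  qed (simp add: s_def)
  have t0: "0 <= t" using t s0 by linarith
  have tT: "t <= T" using t by (simp add: T_def)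
  define m where "m = nat \<lfloor>real n * t\<rfloor>"
  have m: "real m <= real n * t" "real n * t < real m + 1" using t0 n0 unfolding m_def by (simp_all add: of_nat_nat)
  have main: "|?S m - ?S (?g i) | <= ?l"
  proof (cases "real i / k <= t")
   case True
   hence iT': "real i / k <= T" using tT by linarith
   have "real n * (real i / k) <= real n * t" using True n0 by (intro mult_left_mono) auto
   hence "real (?g i) < real m + 1" using grid_bounds(1)[OF k(1), of n i] m by linarith
   hence "?g i <= m" by linarith
   moreover have "m < p i"
   proof -
    have "real n * t < real (p i)" using t(2) iT' n0 by (simp add: s_Suc field_simps)
    thus ?thesis using m by linarith
   qed
   ultimately show ?thesis using p(3)[OF iT'] by blast
  next
   case False
   then obtain i' where i': "i = Suc i'" using t0 by (cases i) auto
   have iT': "real i' / k <= T" using s1[of i'] t(1) tT unfolding i' by linarith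
   have "p i' <= m"
   proof -
    have "real (p i') / n <= t" using t(1) iT' unfolding i' by (simp add: s_Suc)
    hence "real (p i') <= real n * t" using n0 by (simp add: field_simps)
    thus ?thesis using m by linarith
   qed
   moreover have "m <= ?g (Suc i')"
   proof -
    have "real n * t < real n * (real i / k)" using False n0 by (intro mult_strict_left_mono) auto
    hence "real m < real (?g i) + 1" using grid_bounds(2)[OF k(1), of n i] m by linarith
    thus ?thesis unfolding i' by linarith
   qed
   ultimately show ?thesis using p(4)[OF iT'] unfolding i' by blast
  qed
  have mk: "m <= n * k"
  proof -
   have "real n * t <= real n * real k" using t(3) k(3) n0 by (intro mult_left_mono) auto
   hence "real m <= real (n * k)" using m by simp
   thus ?thesis by (simp only: of_nat_le_iff)
  qed
  have "(\<Sum>j<m. x j) = (\<Sum>j<m. jump (zs ! j))" using x mk by (intro sum.cong) auto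
  also have "... = ?S m + real m * (be * ell)" using csum_take_eq[of m zs] mk len by simp
  finally have "c * ((\<Sum>j<m. x j) - real n * t * be * ell) - c * ?S (?g i)
    = c * (?S m - ?S (?g i)) - (real n * t - real m) * (c * (be * ell))" by (simp add: algebra_simps)
  also have "|... | <= |c * (?S m - ?S (?g i)) | + | (real n * t - real m) * (c * (be * ell)) |" by (rule abs_triangle_ineq4)
  also have "... <= c * ?l + 1 * (c * |be * ell| )"
  proof (intro add_mono)
   show "|c * (?S m - ?S (?g i)) | <= c * ?l" unfolding abs_mult using main c by (intro mult_mono) auto
   show "| (real n * t - real m) * (c * (be * ell)) | <= 1 * (c * |be * ell| )"
    unfolding abs_mult[of "real n * t - real m"] using m c by (intro mult_mono) (auto simp: abs_mult)
  qed
  also have "... <= e" using c by simp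
  finally show "| (\<lambda>t\<in>{0..}. c * ((\<Sum>j<nat \<lfloor>real n * t\<rfloor>. x j) - real n * t * be * ell)) t - c * ?S (?g i) | <= e"
   using t0 by (simp add: m_def)
 qed
qed

text \<open>In reversed order, as the chain meets the blocks.\<close>

definition blens :: "nat => nat => nat list" where "blens n k = map (%i. grid n k (Suc i) - grid n k i) (rev [0..<k * k])"

lemma sum_list_blocks: "length zs = sum_list ns ==> sum_list (blocks c ns zs) = c * csum zs"
proof (induction ns arbitrary: zs)
 case (Cons n ns)
 have "csum zs = csum (take n zs) + csum (drop n zs)" by (metis append_take_drop_id csum_simps(3))
 thus ?case using Cons by (simp add: distrib_left)
qed (simp add: csum_def)

lemma drop_blocks: "drop m (blocks c ns zs) = blocks c (drop m ns) (drop (sum_list (take m ns)) zs)"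
 by (induction ns arbitrary: m zs) (auto simp: drop_Cons take_Cons add.commute split: nat.split)

lemma sum_blens: "m <= k * k ==> sum_list (take m (blens n k)) = grid n k (k * k) - grid n k (k * k - m)"
proof (induction m)
 case (Suc m)
 define j where "j = k * k - Suc m"
 have j: "k * k - m = Suc j" using Suc.prems by (simp add: j_def)
 have "blens n k ! m = grid n k (Suc j) - grid n k j" using Suc.prems j by (simp add: blens_def rev_nth j_def)
 moreover have "length (blens n k) = k * k" by (simp add: blens_def)
 ultimately have "sum_list (take (Suc m) (blens n k)) = (grid n k (k * k) - grid n k (Suc j)) + (grid n k (Suc j) - grid n k j)"
  using Suc j by (simp add: take_Suc_conv_app_nth)
 also have "... = grid n k (k * k) - grid n k j" using grid_mono[of j "Suc j" n k] grid_mono[of "Suc j" "k * k" n k] j by simp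
 finally show ?case by (simp add: j_def)
qed simp

text \<open>A partial sum in forward time is a sum over the last blocks of the reversed
  list.\<close>

lemma csum_take_rev_blocks:
 assumes "0 < k" "i <= k * k" "length zs = n * k"
 shows "c * csum (take (grid n k i) (rev zs)) = sum_list (drop (k * k - i) (blocks c (blens n k) zs))"
proof -
 let ?ns = "blens n k"
 have tot: "sum_list ?ns = n * k" using sum_blens[of "k * k" k n] grid_last[OF assms(1), of n] by (simp add: blens_def)
 have t: "sum_list (take (k * k - i) ?ns) = n * k - grid n k i"
  using sum_blens[of "k * k - i" k n] assms grid_last[OF assms(1), of n] by simp
 have le: "grid n k i <= n * k" using grid_mono[OF assms(2), of n k] grid_last[OF assms(1), of n] by simp
 have "sum_list ?ns = sum_list (take (k * k - i) ?ns) + sum_list (drop (k * k - i) ?ns)"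
  by (metis append_take_drop_id sum_list_append)
 hence d: "sum_list (drop (k * k - i) ?ns) = grid n k i" using tot t le by simp
 have "sum_list (drop (k * k - i) (blocks c ?ns zs)) = c * csum (drop (n * k - grid n k i) zs)"
  unfolding drop_blocks t by (rule sum_list_blocks) (use d assms(3) le in simp)
 thus ?thesis using assms(3) by (simp add: take_rev csum_rev)
qed

end

section \<open>Independent increments, and the limit process sampled on the grid\<close>

lemma llip_nonneg: "llip L F ==> 0 <= L" using order_trans[OF abs_ge_zero llip_head[of L F 1 "[]" 0]] by simp

text \<open>Rounding to multiples of \<open>1 / m\<close> leaves countably many lists; the Lipschitz
  bound controls the error.\<close>

lemma llip_measurable:
 assumes F: "llip L F" and g: "!!i. i : set is ==> g i : borel_measurable M"
 shows "(%om. F (map (%i. g i om) is)) : borel_measurable M"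
proof -
 define z where "z = (%m om. map (%i. \<lfloor>real m * g i om\<rfloor>) is)"
 show ?thesis
 proof (rule borel_measurable_LIMSEQ_real[where u = "%m om. F (map (%u. of_int u / real m) (z m om))"])
 show "(%om. F (map (%u. of_int u / real m) (z m om))) : borel_measurable M" for m
 proof (rule measurable_compose[of "z m"])
  show "z m : measurable M (count_space UNIV)" unfolding z_def using g by (intro measurable_map_list) measurable
 qed simp
 fix om assume "om : space M"
 have bound: "|F (map (%u. of_int u / real m) (z m om)) - F (map (%i. g i om) is) | <= L * (length is * (1 / m))" if "0 < m" for m :: nat
 proof -
  have "|F (map (%u. of_int u / real m) (z m om)) - F (map (%i. g i om) is) |
    <= L * (\<Sum>(u, v)\<leftarrow>zip (map (%u. of_int u / real m) (z m om)) (map (%i. g i om) is). |u - v| )"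
   using F unfolding llip_def by (simp add: z_def)
  also have "(\<Sum>(u, v)\<leftarrow>zip (map (%u. of_int u / real m) (z m om)) (map (%i. g i om) is). |u - v| ) <= length is * (1 / m)"
   unfolding z_def
  proof (induction "is")
   case (Cons i "is")
   have "|of_int \<lfloor>real m * g i om\<rfloor> / real m - g i om| = |of_int \<lfloor>real m * g i om\<rfloor> - real m * g i om| / real m"
    using that by (simp add: field_simps)
   also have "... <= 1 / real m" by (intro divide_right_mono) linarith+
   finally show ?case using Cons by (simp add: distrib_right add_divide_distrib)
  qed simp
  finally show ?thesis using llip_nonneg[OF F] by (simp add: mult_left_mono)
 qed
 have "(%m. L * (length is * (1 / real m))) ----> L * (real (length is) * 0)" by (intro tendsto_intros lim_1_over_n)
 hence lim: "(%m. L * (length is * (1 / real m))) ----> 0" by simp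
 have "(%m. F (map (%u. of_int u / real m) (z m om)) - F (map (%i. g i om) is)) ----> 0"
 proof (rule Lim_null_comparison[OF _ lim])
  show "\<forall>\<^sub>F m in sequentially. norm (F (map (%u. of_int u / real m) (z m om)) - F (map (%i. g i om) is)) <= L * (length is * (1 / real m))"
   unfolding real_norm_def by (rule eventually_at_top_linorderI[of 1], rule bound) simp
 qed
 thus "(%m. F (map (%u. of_int u / real m) (z m om))) ----> F (map (%i. g i om) is)" by (rule LIM_zero_cancel)
 qed
qed

text \<open>The induction splits off the last variable, which is independent of the others jointly;
  the list is reversed so that this variable stands first.\<close>

lemma (in prob_space) iter_int_indep:
 fixes X :: "nat => 'a => real"
 assumes ind: "indep_vars (%_. borel) X {..<r}" and law: "!!j. j < r ==> distr M borel (X j) = muu"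
  and F: "llip L F" "!!us. |F us| <= B"
 shows "iter_int muu r F = expectation (%om. F (map (%j. X j om) (rev [0..<r])))" using assms
proof (induction r arbitrary: F)
 case 0
 thus ?case by (simp add: prob_space)
next
 case (Suc r)
 note F = Suc.prems(3,4)
 let ?P = "Pi\<^sub>M {..<r} (%_. borel :: real measure)" and ?Q = "Pi\<^sub>M {r} (%_. borel :: real measure)"
 let ?Y = "%om. \<lambda>i\<in>{..<r}. X i om" and ?Z = "%om. \<lambda>i\<in>{r}. X i om"
 have rv: "X j : borel_measurable M" if "j < Suc r" for j using Suc.prems(1) that by (auto simp: indep_vars_def)
 have iv: "indep_var ?Q ?Z ?P ?Y" by (rule indep_var_restrict[OF Suc.prems(1)]) auto
 have ind': "indep_vars (%_. borel) X {..<r}" by (rule indep_vars_subset[OF Suc.prems(1)]) auto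
 define ph where "ph = (%x. iter_int muu r (%us. F (x # us)))"
 have ph: "ph x = expectation (%om. F (x # map (%j. X j om) (rev [0..<r])))" for x
  unfolding ph_def using Suc.prems(2) by (intro Suc.IH[OF ind' _ llip_Cons[OF F(1)] F(2)]) auto
 have muu: "muu = distr M borel (X r)" using Suc.prems(2)[of r] by simp
 interpret muu: real_distribution muu unfolding muu by (rule real_distribution_distr) (simp add: rv)
 have phm: "ph : borel_measurable borel" unfolding ph_def using muu.iter_int_bounds(3)[OF F]
  by (intro borel_measurable_continuous_onI continuous_at_imp_continuous_on) blast
 \<comment> \<open>A function of the pair of the last variable and all others, to which the product
   law and Fubini apply.\<close>
 define H where "H = (%(f, g). F (f r # map g (rev [0..<r])))"
 have H_eq: "H (?Z om, ?Y om) = F (map (%j. X j om) (rev [0..<Suc r]))" for om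
  by (auto simp: H_def intro!: arg_cong[where f = F])
 have Hm: "H : borel_measurable (?Q \<Otimes>\<^sub>M ?P)"
 proof -
  have "(%p. F (map (%i. (if i = r then fst p i else snd p i)) (r # rev [0..<r]))) : borel_measurable (?Q \<Otimes>\<^sub>M ?P)"
  proof (rule llip_measurable[OF F(1)])
   fix i assume "i : set (r # rev [0..<r])"
   then consider "i = r" | "i < r" by auto
   thus "(%p. if i = r then fst p i else snd p i) : borel_measurable (?Q \<Otimes>\<^sub>M ?P)"
   proof cases
    case 1
    have "(%p. fst p r) : borel_measurable (?Q \<Otimes>\<^sub>M ?P)"
     by (intro measurable_compose[OF measurable_fst measurable_component_singleton]) auto
    thus ?thesis using 1 by simp
   next
    case 2
    hence "(%p. snd p i) : borel_measurable (?Q \<Otimes>\<^sub>M ?P)"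
     by (intro measurable_compose[OF measurable_snd measurable_component_singleton]) auto
    thus ?thesis using 2 by simp
   qed
  qed
  moreover have "(%p. F (map (%i. (if i = r then fst p i else snd p i)) (r # rev [0..<r]))) = H"
   by (auto simp: H_def fun_eq_iff intro!: arg_cong[where f = F])
  ultimately show ?thesis by simp
 qed
 have Ym: "?Y : measurable M ?P" using rv by (intro measurable_restrict) auto
 have Zm: "?Z : measurable M ?Q" using rv by (intro measurable_restrict) auto
 interpret Z: prob_space "distr M ?Q ?Z" by (rule prob_space_distr[OF Zm])
 interpret Y: prob_space "distr M ?P ?Y" by (rule prob_space_distr[OF Ym])
 interpret ZY: pair_prob_space "distr M ?Q ?Z" "distr M ?P ?Y" ..
 have "expectation (%om. F (map (%j. X j om) (rev [0..<Suc r]))) = expectation (%om. H (?Z om, ?Y om))" by (simp only: H_eq)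
 also have "... = (\<integral>p. H p \<partial>distr M (?Q \<Otimes>\<^sub>M ?P) (%om. (?Z om, ?Y om)))"
  using Zm Ym Hm by (intro integral_distr[symmetric] measurable_Pair)
 also have "distr M (?Q \<Otimes>\<^sub>M ?P) (%om. (?Z om, ?Y om)) = distr M ?Q ?Z \<Otimes>\<^sub>M distr M ?P ?Y"
  using iv unfolding indep_var_distribution_eq by simp
 also have "(\<integral>p. H p \<partial>(distr M ?Q ?Z \<Otimes>\<^sub>M distr M ?P ?Y)) = (\<integral>f. \<integral>g. H (f, g) \<partial>distr M ?P ?Y \<partial>distr M ?Q ?Z)"
 proof (rule ZY.integral_fst'[symmetric])
  show "integrable (distr M ?Q ?Z \<Otimes>\<^sub>M distr M ?P ?Y) H"
  proof (rule ZY.integrable_const_bound[where B = B])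
   have "sets (distr M ?Q ?Z \<Otimes>\<^sub>M distr M ?P ?Y) = sets (?Q \<Otimes>\<^sub>M ?P)"
    by (intro sets_pair_measure_cong) auto
   thus "H : borel_measurable (distr M ?Q ?Z \<Otimes>\<^sub>M distr M ?P ?Y)" using Hm by (simp cong: measurable_cong_sets)
  qed (use F(2) in \<open>auto simp: H_def split: prod.split\<close>)
 qed
 also have "... = (\<integral>f. ph (f r) \<partial>distr M ?Q ?Z)"
 proof (intro Bochner_Integration.integral_cong refl)
  fix f assume "f : space (distr M ?Q ?Z)"
  hence "(%g. H (f, g)) : borel_measurable ?P" by (intro measurable_Pair2[OF Hm]) simp
  hence "(\<integral>g. H (f, g) \<partial>distr M ?P ?Y) = expectation (%om. H (f, ?Y om))" by (rule integral_distr[OF Ym])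
  also have "(%om. H (f, ?Y om)) = (%om. F (f r # map (%j. X j om) (rev [0..<r])))"
   by (auto simp: H_def fun_eq_iff intro!: arg_cong[where f = F])
  finally show "(\<integral>g. H (f, g) \<partial>distr M ?P ?Y) = ph (f r)" by (simp only: ph)
 qed
 also have "... = expectation (%om. ph (?Z om r))"
 proof (rule integral_distr[OF Zm])
  have "(%f. f r) : borel_measurable ?Q" by simp
  from measurable_compose[OF this phm] show "(%f. ph (f r)) : borel_measurable ?Q" .
 qed
 also have "... = (\<integral>x. ph x \<partial>muu)" unfolding muu using rv phm by (subst integral_distr) auto
 also have "... = iter_int muu (Suc r) F" by (simp add: ph_def)
 finally show ?case by simp
qed

context sthaler
begin

lemma rev_block_rev:
 assumes "length zs = n * k" "grid n k (Suc i) <= n * k"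
 shows "rev (block n k i (rev zs)) = take (grid n k (Suc i) - grid n k i) (drop (n * k - grid n k (Suc i)) zs)"
proof -
 have "grid n k i <= grid n k (Suc i)" by (intro grid_mono) simp
 thus ?thesis using assms 
  by (auto simp: block_def drop_rev take_rev drop_take min_def intro!: arg_cong[where f = "%m. drop m zs"])
qed

text \<open>In reversed time the block is a segment in the middle of the chain, and
  \<open>rev\<close> undoes the reversal of the walk.\<close>

lemma prob_no_split1_block:
 assumes p: "!!y. xs <= y ==> y <= 1 ==> \<P> (chain (grid n k (Suc i) - grid n k i) y) {zs. \<not> split1 l zs} <= p"
  and k: "0 < k" and i: "i < k * k" and y: "xs <= y" "y <= 1"
 shows "\<P> (chain (n * k) y) {zs. \<not> split1 l (rev (block n k i (rev zs)))} <= p"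
proof -
 let ?g = "grid n k i" and ?h = "grid n k (Suc i)"
 have gh: "?g <= ?h" by (intro grid_mono) simp
 have hl: "?h <= n * k" using grid_mono[of "Suc i" "k * k" n k] i grid_last[OF k, of n] by simp
 have eq: "n * k = (n * k - ?h) + ((?h - ?g) + ?g)" using gh hl by simp
 have "\<P> (chain (n * k) y) {zs. \<not> split1 l (rev (block n k i (rev zs)))}
   <= \<P> (chain (n * k) y) {zs. take (?h - ?g) (drop (n * k - ?h) zs) : {zs. \<not> split1 l zs}}"
  by (rule prob_chain_mono) (use rev_block_rev[OF _ hl] in auto)
 also have "... <= p" using prob_chain_segment[OF p y, of "n * k - ?h" ?g] eq by simp
 finally show ?thesis .
qed

lemma grid_tendsto:
 assumes "0 < k"
 shows "(%n. real (grid n k i) / real n) ----> real i / k"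
proof (rule tendsto_sandwich[where f = "%n::nat. real i / k - 1 / n" and h = "%n. real i / k"])
 have "(%n. real i / k - 1 / real n) ----> real i / k - 0" by (intro tendsto_intros lim_1_over_n)
 thus "(%n. real i / k - 1 / real n) ----> real i / k" by simp
 have "real i / k - 1 / real n <= real (grid n k i) / real n & real (grid n k i) / real n <= real i / k" if "0 < n" for n :: nat
 proof -
  have n: "0 < real n" using that by simp
  have "real n * (real i / k) - 1 <= real (grid n k i)" using grid_bounds(2)[OF assms, of n i] by linarith
  hence "(real n * (real i / k) - 1) / n <= real (grid n k i) / n" by (intro divide_right_mono) auto
  moreover have "real (grid n k i) / n <= (real n * (real i / k)) / n"
   using grid_bounds(1)[OF assms] by (intro divide_right_mono) auto
  ultimately show ?thesis using n by (simp add: diff_divide_distrib)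
 qed
 thus "\<forall>\<^sub>F n in sequentially. real i / k - 1 / real n <= real (grid n k i) / real n"
  "\<forall>\<^sub>F n in sequentially. real (grid n k i) / real n <= real i / k"
  by (auto intro!: eventually_at_top_linorderI[of 1])
qed simp

lemma block_length_tendsto:
 assumes "0 < k"
 shows "(%n. real (grid n k (Suc i) - grid n k i) / real n) ----> 1 / k"
proof -
 have "(%n. real (grid n k (Suc i)) / real n - real (grid n k i) / real n) ----> real (Suc i) / k - real i / k"
  by (intro tendsto_diff grid_tendsto assms)
 moreover have "real (Suc i) / k - real i / k = 1 / k" by (simp add: diff_divide_distrib[symmetric])
 moreover have "real (grid n k (Suc i) - grid n k i) / n = real (grid n k (Suc i)) / n - real (grid n k i) / n" for n
  using grid_mono[of i "Suc i" n k] by (simp add: of_nat_diff diff_divide_distrib)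
 ultimately show ?thesis by simp
qed

lemma block_length_le: "0 < k ==> k <= n ==> real (grid n k (Suc i) - grid n k i) <= 2 * (real n / k)"
proof -
 assume k: "0 < k" "k <= n"
 have "real (grid n k (Suc i) - grid n k i) = real (grid n k (Suc i)) - real (grid n k i)"
  using grid_mono[of i "Suc i" n k] by (simp add: of_nat_diff)
 also have "... <= real n * (real (Suc i) / k) - (real n * (real i / k) - 1)"
  using grid_bounds(1)[OF k(1), of n "Suc i"] grid_bounds(2)[OF k(1), of n i] by linarith
 also have "... = real n / k + 1" by (simp add: field_simps add_divide_distrib)
 also have "1 <= real n / k" using k by simp
 finally show ?thesis by simp
qed

end

context signed_walk
begin

text \<open>The number of time blocks up to a fixed time is of order \<open>k\<close>, and each of them fails to have
  a single split with probability of order \<open>1 / k\<^sup>2\<close>.\<close>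

lemma prob_bad_block:
 assumes et: "0 < et" and e: "0 < e"
 obtains C where "!!k. 0 < k ==> T < real k ==> \<forall>\<^sub>F n in sequentially.
  prob {om : space M. EX i. real i / k <= T & \<not> split1 (e / (2 * scl et n)) (rev (block n k i (walk (n * k) om)))}
   <= (real k * |T| + 1) * (C / k)\<^sup>2"
proof -
 obtain C0 L0 where C0: "0 < C0" "1 <= L0" "!!l n y. L0 <= l ==> xs <= y ==> y <= 1 ==>
   \<P> (chain n y) {zs. \<not> split1 l zs} <= (C0 * n * l powr (- al))\<^sup>2" by (rule no_split1) blast
 \<comment> \<open>For \<open>l = e / (2 * scl et n)\<close> one has
   \<open>l powr (- al) = D / n\<close>, so a block of at most \<open>2 * n / k\<close> steps fails
   with probability at most the square of \<open>2 * C0 * D / k\<close>.\<close>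
 define D where "D = (2 / e) powr al * (et powr al / d_const al)"
 have D: "0 <= D" using d_const_pos by (simp add: D_def)
 show ?thesis
 proof (rule that[of "2 * C0 * D"])
  fix k :: nat assume k: "0 < k" "T < real k"
  define I where "I = {i. real i / k <= T}"
  have I: "I \<subseteq> {..nat \<lfloor>real k * |T|\<rfloor>}"
  proof
   fix i assume "i : I"
   hence "real i <= real k * T" using k by (simp add: I_def field_simps)
   also have "... <= real k * |T|" by (intro mult_left_mono) auto
   finally show "i : {..nat \<lfloor>real k * |T|\<rfloor>}" by (simp add: le_nat_floor)
  qed
  hence fI: "finite I" by (rule finite_subset) simp
  have cI: "real (card I) <= real k * |T| + 1"
  proof -
   have "card I <= Suc (nat \<lfloor>real k * |T|\<rfloor>)" using card_mono[OF _ I] by simp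
   hence "real (card I) <= real (nat \<lfloor>real k * |T|\<rfloor>) + 1" by linarith
   also have "real (nat \<lfloor>real k * |T|\<rfloor>) <= real k * |T|" by (intro of_nat_floor) simp
   finally show ?thesis by simp
  qed
  have Ik: "i < k * k" if "i : I" for i
  proof -
   have "real i / k < real k" using that k by (simp add: I_def)
   hence "real i < real (k * k)" using k by (simp add: field_simps)
   thus ?thesis by (simp only: of_nat_less_iff)
  qed
  have "\<forall>\<^sub>F n in sequentially. scl et n < e / (2 * L0)"
   using scl_tendsto e C0 by (intro order_tendstoD(2)[OF scl_tendsto]) auto
  moreover have "\<forall>\<^sub>F n in sequentially. k <= n" by (rule eventually_ge_at_top)
  ultimately show "\<forall>\<^sub>F n in sequentially.
   prob {om : space M. EX i. real i / k <= T & \<not> split1 (e / (2 * scl et n)) (rev (block n k i (walk (n * k) om)))}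
    <= (real k * |T| + 1) * (2 * C0 * D / k)\<^sup>2"
  proof eventually_elim
   case (elim n)
   have n: "0 < n" using elim(2) k by simp
   have c: "0 < scl et n" by (rule scl_pos[OF et n])
   define l where "l = e / (2 * scl et n)"
   have l: "L0 <= l" using elim(1) c C0 by (simp add: l_def field_simps)
   have lp: "l powr (- al) = D / n"
   proof -
    have "l powr (- al) = (2 / e) powr al * scl et n powr al"
     using e c by (simp add: l_def powr_minus powr_divide powr_mult field_simps)
    also have "... = D / n" unfolding scl_powr[OF et n] D_def by (simp add: field_simps)
    finally show ?thesis .
   qed
   define bad where "bad = {zs. EX i:I. \<not> split1 l (rev (block n k i zs))}"
   have "|expectation (%om. indicator bad (walk (n * k) om)) - 0| <= (real k * |T| + 1) * (2 * C0 * D / k)\<^sup>2"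
   proof (rule expectation_walk_bounds[where B = 1])
    fix y assume y: "xs <= y" "y <= 1"
    have one: "\<P> (chain (n * k) y) {zs. \<not> split1 l (rev (block n k i (rev zs)))} <= (2 * C0 * D / k)\<^sup>2"
     if i: "i : I" for i
    proof (rule prob_no_split1_block[OF _ k(1) Ik[OF i] y])
     fix y assume y: "xs <= y" "y <= 1"
     let ?m = "grid n k (Suc i) - grid n k i"
     have "\<P> (chain ?m y) {zs. \<not> split1 l zs} <= (C0 * ?m * l powr (- al))\<^sup>2" by (rule C0(3)[OF l y])
     also have "... <= (2 * C0 * D / k)\<^sup>2"
     proof (rule power_mono)
     have "C0 * ?m * l powr (- al) <= C0 * (2 * (real n / k)) * (D / n)"
     unfolding lp using block_length_le[OF k(1) elim(2), of i] C0 D by (intro mult_mono) auto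
     also have "... = 2 * C0 * D / k" using n by simp
     finally show "C0 * ?m * l powr (- al) <= 2 * C0 * D / k" .
     qed (use C0 in simp)
     finally show "\<P> (chain ?m y) {zs. \<not> split1 l zs} <= (2 * C0 * D / k)\<^sup>2" .
    qed
    have "(%zs. indicator bad (rev zs) :: real) = indicator (\<Union>i\<in>I. {zs. \<not> split1 l (rev (block n k i (rev zs)))})"
     by (auto simp: bad_def indicator_def fun_eq_iff)
    hence "\<E> (chain (n * k) y) (%zs. indicator bad (rev zs))
     = \<P> (chain (n * k) y) (\<Union>i\<in>I. {zs. \<not> split1 l (rev (block n k i (rev zs)))})" by simp
    also have "... <= (\<Sum>i\<in>I. \<P> (chain (n * k) y) {zs. \<not> split1 l (rev (block n k i (rev zs)))})"
     using fI by (intro measure_pmf.finite_measure_subadditive_finite) auto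
    also have "... <= (\<Sum>i\<in>I. (2 * C0 * D / k)\<^sup>2)" by (intro sum_mono one)
    also have "... = real (card I) * (2 * C0 * D / k)\<^sup>2" by simp
    also have "... <= (real k * |T| + 1) * (2 * C0 * D / k)\<^sup>2" using cI by (intro mult_right_mono) auto
    finally have "\<E> (chain (n * k) y) (%zs. indicator bad (rev zs)) <= (real k * |T| + 1) * (2 * C0 * D / k)\<^sup>2" .
    moreover have "0 <= \<E> (chain (n * k) y) (%zs. indicator bad (rev zs) :: real)" by simp
    ultimately show "|\<E> (chain (n * k) y) (%zs. indicator bad (rev zs)) - 0| <= (real k * |T| + 1) * (2 * C0 * D / k)\<^sup>2"
     by simp
   qed (simp add: indicator_def)
   moreover have "expectation (%om. indicator bad (walk (n * k) om)) = prob {om : space M. walk (n * k) om : bad}"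
   proof -
    have "expectation (%om. indicator bad (walk (n * k) om) :: real) = expectation (indicator {om : space M. walk (n * k) om : bad} :: _ => real)"
     by (intro Bochner_Integration.integral_cong) (auto simp: indicator_def)
    thus ?thesis by (simp add: Int_absorb2)
   qed
   ultimately show ?case by (simp add: bad_def I_def l_def Bex_def)
  qed
 qed
qed

end

lemma spath_cong: "(!!i. i <= k * k ==> v i = w i) ==> spath k v = spath k w" by (auto simp: spath_def intro!: restrict_ext)

lemma cmeas_spath:
 assumes "!!i. (%om. v om i) : borel_measurable N"
 shows "cmeas N (%om. spath k (v om))" unfolding cmeas_def
proof (intro conjI ballI allI impI)
 fix t :: real assume "0 <= t"
 thus "(%om. spath k (v om) t) : borel_measurable N" using assms by (simp add: spath_def)
qed simp

text \<open>Step path of the partial sums of increments listed latest first, the order of the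
  reversed chain.\<close>

definition ipath :: "nat => real list => real => real" where "ipath k us = spath k (%i. sum_list (drop (k * k - i) us))"

text \<open>Each value of the path is a sum of increments, so it moves by at most their total
  change.\<close>

lemma llip_ipath:
 assumes "plip L G"
 shows "llip L (%us. G (ipath k us))" unfolding llip_def
proof (intro allI impI)
 fix us vs :: "real list" assume len: "length us = length vs"
 let ?d = "\<Sum>(u, v)\<leftarrow>zip us vs. |u - v|"
 have nn: "0 <= (\<Sum>(u, v)\<leftarrow>zip us vs. |u - v| )" for us vs :: "real list" by (rule sum_list_nonneg) auto
 have le: "|sum_list (drop m us) - sum_list (drop m vs) | <= ?d" for m using len
 proof (induction us vs arbitrary: m rule: list_induct2)
  case (Cons u us v vs)
  show ?case
  proof (cases m)
   case 0
   thus ?thesis using Cons.IH[of 0] by simp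
  next
   case (Suc m')
   thus ?thesis using Cons.IH[of m'] by simp
  qed
 qed simp
 have L: "0 <= L" using assms by (simp add: plip_def)
 have "|G (ipath k us) - G (ipath k vs) | <= L * pdist (ipath k us) (ipath k vs)"
  using assms by (rule path_lipschitzD) (auto simp: ipath_def)
 also have "pdist (ipath k us) (ipath k vs) <= ?d" unfolding ipath_def by (rule pdist_spath_le) (use nn le in auto)
 finally show "|G (ipath k us) - G (ipath k vs) | <= L * ?d" using L by (simp add: mult_left_mono)
qed

lemma drop_map_rev: "i <= r ==> drop (r - i) (map f (rev [0..<r])) = map f (rev [0..<i])"
 by (simp add: drop_map rev_map drop_rev take_map)

context sthaler
begin

text \<open>The marginal at time \<open>0\<close> is the stable law scaled by
  \<open>0 powr (1 / al)\<close>, which is \<open>0\<close>.\<close>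

lemma stable_process_initial:
 assumes "stable_process al et be N W"
 shows "AE om in N. W om 0 = 0"
proof -
 interpret N: prob_space N using assms by (simp add: stable_process_def)
 from assms obtain nuu where nuu: "stable_law al et be nuu" "!!t. 0 <= t ==> distr N borel (%om. W om t) = distr nuu borel (%x. t powr (1 / al) * x)"
  unfolding stable_process_def by blast
 interpret nuu: real_distribution nuu using nuu(1) by (simp add: stable_law_def)
 have W0: "(%om. W om 0) : borel_measurable N" using assms by (simp add: stable_process_def)
 have "N.prob {om : space N. W om 0 = 0} = measure (distr N borel (%om. W om 0)) {0}"
  using W0 by (subst measure_distr) (auto intro!: arg_cong[where f = N.prob])
 also have "... = nuu.prob UNIV" unfolding nuu(2)[OF order_refl] by (subst measure_distr) (auto simp: vimage_def)
 also have "... = 1" using nuu.prob_space by simp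
 finally have "AE om in N. om : {om : space N. W om 0 = 0}" by (rule N.AE_prob_1)
 thus ?thesis by eventually_elim simp
qed

text \<open>The increments over cells of length \<open>1 / k\<close> are independent, and each has
  the law of the value at \<open>1 / k\<close> because the process starts at \<open>0\<close> almost
  surely.\<close>

lemma stable_process_sampled:
 assumes et: "0 < et" and W: "stable_process al et be N W" and k: "0 < k"
  and G: "plip L G" "!!f. f : cadlag_space ==> |G f| <= B"
 shows "iter_int (distr N borel (%om. W om (1 / k))) (k * k) (%us. G (ipath k us))
  = (\<integral>om. G (spath k (%i. W om (real i / k))) \<partial>N)"
proof -
 interpret N: prob_space N using W by (simp add: stable_process_def)
 have Wm: "(%om. W om t) : borel_measurable N" if "0 <= t" for t using W that by (simp add: stable_process_def)
 define X where "X = (%i om. W om (real (Suc i) / k) - W om (real i / k))"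
 have W0: "AE om in N. W om 0 = 0" by (rule stable_process_initial[OF W])
 have ind: "N.indep_vars (%_. borel) X {..<k * k}"
 proof -
  have "ALL (m::nat) s. 0 <= s 0 & (ALL i<m. s i <= s (Suc i)) -->
    N.indep_vars (%_. borel) (%i om. W om (s (Suc i)) - W om (s i)) {..<m}" using W unfolding stable_process_def by blast
  from this[rule_format, of "%i. real i / k" "k * k"] show ?thesis unfolding X_def by (simp add: divide_right_mono)
 qed
 have law: "distr N borel (X j) = distr N borel (%om. W om (1 / k))" for j
 proof -
  have "ALL s>=0. ALL t>=0. distr N borel (%om. W om (s + t) - W om s) = distr N borel (%om. W om t - W om 0)"
   using W unfolding stable_process_def by blast
  from this[rule_format, of "real j / k" "1 / k"]
  have "distr N borel (X j) = distr N borel (%om. W om (1 / k) - W om 0)"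
   unfolding X_def by (simp add: add_divide_distrib add.commute)
  also have "... = distr N borel (%om. W om (1 / k))" using W0 Wm[of "1 / k"] Wm[of 0] by (intro distr_cong_AE) auto
  finally show ?thesis .
 qed
 have GB: "|G (ipath k us) | <= B" for us by (simp add: G(2) ipath_def)
 have "iter_int (distr N borel (%om. W om (1 / k))) (k * k) (%us. G (ipath k us))
   = (\<integral>om. G (ipath k (map (%j. X j om) (rev [0..<k * k]))) \<partial>N)"
  by (rule N.iter_int_indep[OF ind law llip_ipath[OF G(1)] GB])
 also have "... = (\<integral>om. G (spath k (%i. W om (real i / k))) \<partial>N)"
 proof (rule integral_cong_AE)
  have Xm: "X j : borel_measurable N" for j unfolding X_def by (intro borel_measurable_diff Wm) auto
  show "(%om. G (ipath k (map (%j. X j om) (rev [0..<k * k])))) : borel_measurable N"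
   using Xm by (intro llip_measurable[OF llip_ipath[OF G(1)]]) auto
  show "(%om. G (spath k (%i. W om (real i / k)))) : borel_measurable N" by (intro plip_measurable[OF G(1)] cmeas_spath Wm) simp
  show "AE om in N. G (ipath k (map (%j. X j om) (rev [0..<k * k]))) = G (spath k (%i. W om (real i / k)))" using W0
  proof (rule AE_mp, intro AE_I2 impI)
   fix om assume 0: "W om 0 = 0"
   have "sum_list (map (%j. X j om) (rev [0..<i])) = W om (real i / k)" for i by (induction i) (simp_all add: 0 X_def)
   hence "sum_list (drop (k * k - i) (map (%j. X j om) (rev [0..<k * k]))) = W om (real i / k)" if "i <= k * k" for i
    using that by (simp add: drop_map_rev)
   thus "G (ipath k (map (%j. X j om) (rev [0..<k * k]))) = G (spath k (%i. W om (real i / k)))"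
    unfolding ipath_def by (intro arg_cong[where f = G] spath_cong)
  qed
 qed
 finally show ?thesis .
qed

lemma stable_process_sampled_tendsto:
 assumes W: "stable_process al et be N W" and G: "plip L G" "!!f. f : cadlag_space ==> |G f| <= B"
 shows "(%k. \<integral>om. G (spath k (%i. W om (real i / k))) \<partial>N) ----> (\<integral>om. G (W om) \<partial>N)"
proof -
 interpret N: prob_space N using W by (simp add: stable_process_def)
 have Wm: "(%om. W om t) : borel_measurable N" if "0 <= t" for t using W that by (simp add: stable_process_def)
 have Wc: "W om : cadlag_space" if "om : space N" for om using W that by (simp add: stable_process_def)
 show ?thesis
 proof (rule integral_dominated_convergence[where w = "%_. B"])
  show "(%om. G (W om)) : borel_measurable N"
   by (rule plip_measurable[OF G(1)]) (use Wm Wc in \<open>auto simp: cmeas_def\<close>)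
  show "(%om. G (spath k (%i. W om (real i / k)))) : borel_measurable N" for k
   by (intro plip_measurable[OF G(1)] cmeas_spath Wm) simp
  show "AE om in N. (%k. G (spath k (%i. W om (real i / k)))) ----> G (W om)"
  proof (rule AE_I2)
   fix om assume "om : space N"
   hence "W om : cadlag_space" by (rule Wc)
   moreover from this have "cadlag (W om)" by (simp add: cadlag_space_iff)
   ultimately show "(%k. G (spath k (%i. W om (real i / k)))) ----> G (W om)"
    by (intro plip_tendsto[OF G(1)] spath_converges) auto
  qed
 qed (auto simp: G(2))
qed

end

context signed_walk
begin

text \<open>For fixed \<open>k\<close> the sampled path is a Lipschitz function of finitely many
  block sums, whose joint convergence is uniform in the starting state.\<close>

lemma sampled_walk_tendsto:
 assumes et: "0 < et" and W: "stable_process al et be N W" and k: "0 < k"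
  and G: "plip L G" "!!f. f : cadlag_space ==> |G f| <= B"
 shows "(%n. expectation (%om. G (spath k (%i. scl et n * csum (take (grid n k i) (walk (n * k) om))))))
  ----> (\<integral>om. G (spath k (%i. W om (real i / k))) \<partial>N)"
proof -
 from W obtain nuu where nuu: "stable_law al et be nuu" "!!t. 0 <= t ==> distr N borel (%om. W om t) = distr nuu borel (%x. t powr (1 / al) * x)"
  unfolding stable_process_def by blast
 interpret nuu: real_distribution nuu using nuu(1) by (simp add: stable_law_def)
 define muu where "muu = distr nuu borel (%x. (1 / real k) powr ga * x)"
 have muu: "distr N borel (%om. W om (1 / k)) = muu" using nuu(2)[of "1 / k"] by (simp add: muu_def)
 define F where "F = (%us. G (ipath k us))"
 have F: "llip L F" "|F us| <= B" for us unfolding F_def by (rule llip_ipath[OF G(1)]) (simp add: G(2) ipath_def)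
 define Ns where "Ns = map (%i n. grid n k (Suc i) - grid n k i) (rev [0..<k * k])"
 have Ns: "map (%N. N n) Ns = blens n k" "length Ns = k * k" for n by (simp_all add: Ns_def blens_def o_def)
 have tot: "(\<Sum>N\<leftarrow>Ns. N n) = n * k" for n
  unfolding Ns using sum_blens[of "k * k" k n] grid_last[OF k, of n] by (simp add: blens_def)
 have lim: "iter_int muu (length Ns) F = (\<integral>om. G (spath k (%i. W om (real i / k))) \<partial>N)"
  using stable_process_sampled[OF et W k G] unfolding muu F_def Ns(2) .
 show ?thesis
 proof (rule tendstoI)
  fix e :: real assume "0 < e"
  hence e2: "0 < e / 2" by simp
  have "\<forall>\<^sub>F n in sequentially. ALL y. xs <= y --> y <= 1 -->
   |\<E> (chain (\<Sum>N\<leftarrow>Ns. N n) y) (%zs. F (blocks (scl et n) (map (%N. N n) Ns) zs))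
    - iter_int muu (length Ns) F| < e / 2"
  proof (rule blocks_weak_conv[OF _ _ F e2])
   show "real_distribution muu" unfolding muu_def by (intro nuu.real_distribution_distr) simp
   fix u :: "real => real" and b a :: real and K
   assume u: "!!x. isCont u x" "!!x. |u x| <= b" and K: "K : set Ns" and a: "0 < a"
   from K obtain i where "K = (%n. grid n k (Suc i) - grid n k i)" by (auto simp: Ns_def)
   hence "(%n. real (K n) / real n) ----> 1 / k" using block_length_tendsto[OF k] by simp
   from block_weak_conv[OF et nuu(1) this u a]
   show "\<forall>\<^sub>F n in sequentially. ALL y. xs <= y --> y <= 1 -->
    |\<E> (chain (K n) y) (%zs. u (scl et n * csum zs)) - (\<integral>x. u x \<partial>muu) | < a" unfolding muu_def .
  qed
  thus "\<forall>\<^sub>F n in sequentially. dist (expectation (%om. G (spath k (%i. scl et n * csum (take (grid n k i) (walk (n * k) om))))))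
   (\<integral>om. G (spath k (%i. W om (real i / k))) \<partial>N) < e" unfolding tot unfolding Ns
  proof (rule eventually_mono)
   fix n assume *: "ALL y. xs <= y --> y <= 1 -->
    |\<E> (chain (n * k) y) (%zs. F (blocks (scl et n) (blens n k) zs)) - iter_int muu (k * k) F| < e / 2"
   let ?f = "%zs. G (spath k (%i. scl et n * csum (take (grid n k i) zs)))"
   have "|expectation (%om. ?f (walk (n * k) om)) - iter_int muu (k * k) F| <= e / 2"
   proof (rule expectation_walk_bounds[where B = B and f = ?f])
    fix y assume y: "xs <= y" "y <= 1"
    have "\<E> (chain (n * k) y) (%zs. ?f (rev zs)) = \<E> (chain (n * k) y) (%zs. F (blocks (scl et n) (blens n k) zs))"
    proof (rule expectation_chain_cong)
     fix zs :: "(bool \<times> nat) list" assume "length zs = n * k"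
     thus "?f (rev zs) = F (blocks (scl et n) (blens n k) zs)" unfolding F_def ipath_def
     by (intro arg_cong[where f = G] spath_cong) (rule csum_take_rev_blocks[OF k])
    qed
    thus "|\<E> (chain (n * k) y) (%zs. ?f (rev zs)) - iter_int muu (k * k) F| <= e / 2" using * y by (simp add: less_imp_le)
   qed (simp add: G(2))
   thus "dist (expectation (%om. ?f (walk (n * k) om))) (\<integral>om. G (spath k (%i. W om (real i / k))) \<partial>N) < e"
    using `0 < e` unfolding lim[unfolded Ns(2), symmetric] dist_real_def by linarith
  qed
 qed
qed

end

section \<open>Weak convergence of the walk\<close>

context sthaler
begin

lemma scale_path_W_path: "scale_path et (W_path al be d y n) =
  (\<lambda>t\<in>{0..}. scl et n * ((\<Sum>j<nat \<lfloor>real n * t\<rfloor>. d j * real (return_time ga j y)) - real n * t * be * ell))"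
 using ga_pos unfolding scale_path_def W_path_def scl_def Let_def l_const_eq by (auto intro!: restrict_ext)

end

context signed_walk
begin

definition swalk :: "real => nat => 'a => real => real" where
 "swalk et n om = scale_path et (W_path al be (%j. de j om) (y0 om) n)"

lemma cmeas_swalk: "cmeas M (swalk et n)" unfolding cmeas_def
proof (intro conjI ballI allI impI)
 fix om
 have "cadlag (%t. (\<Sum>j<nat \<lfloor>real n * t\<rfloor>. de j om * real (return_time ga j (y0 om))) + (- (real n * be * ell)) * t)"
  by (intro cadlag_add cadlag_linear cadlag_floor) simp
 hence "cadlag (%t. scl et n * ((\<Sum>j<nat \<lfloor>real n * t\<rfloor>. de j om * real (return_time ga j (y0 om))) + (- (real n * be * ell)) * t))"
  by (rule cadlag_cmult)
 hence "cadlag (swalk et n om)" unfolding swalk_def scale_path_W_path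
  by (rule cadlag_cong[THEN iffD1, rotated]) (simp add: algebra_simps)
 thus "swalk et n om : cadlag_space" by (simp add: cadlag_space_iff swalk_def scale_path_W_path)
next
 fix t :: real assume "0 <= t"
 thus "(%om. swalk et n om t) : borel_measurable M" unfolding swalk_def scale_path_W_path by simp
qed

text \<open>The step path through the values at multiples of \<open>1 / k\<close> approximates the scaled walk
  on the event that every block has a single split.\<close>

lemma swalk_weak_conv:
 assumes et: "0 < et" and W: "stable_process al et be N W"
 shows "lwconv M (swalk et) N W" unfolding lwconv_def
proof (intro allI impI, elim conjE)
 fix G :: "(real => real) => real" and L B
 assume G: "plip L G" and GB: "ALL f:cadlag_space. |G f| <= B"
 have GB': "|G f| <= B" if "f : cadlag_space" for f using GB that by blast
 have L: "0 <= L" using G by (simp add: plip_def)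
 have B: "0 <= B" using GB'[of "spath 1 (%_. 0)"] by simp
 have Zm: "(%om. G (swalk et n om)) : borel_measurable M" for n by (rule plip_measurable[OF G cmeas_swalk])
 have Zc: "swalk et n om : cadlag_space" if "om : space M" for n om using cmeas_swalk that by (simp add: cmeas_def)
 show "(%n. expectation (%om. G (swalk et n om))) ----> (\<integral>om. G (W om) \<partial>N)"
 proof (rule tendstoI)
  fix ep :: real assume ep: "0 < ep"
  define e where "e = min 1 (ep / 4 / (L + 1))"
  have e: "0 < e" using ep L by (simp add: e_def)
  have Le: "L * e <= ep / 4"
  proof -
   have "L * e <= (L + 1) * (ep / 4 / (L + 1))" using L e by (intro mult_mono) (auto simp: e_def)
   also have "... = ep / 4" using L by (intro nonzero_mult_div_cancel_left[of "L + 1", unfolded times_divide_eq_right[symmetric]]) simp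
   finally show ?thesis .
  qed
  define T where "T = 1 / e + e"
  have T: "0 < T" using e by (simp add: T_def add_pos_pos)
  obtain C where C: "!!k. 0 < k ==> T < real k ==> \<forall>\<^sub>F n in sequentially.
   prob {om : space M. EX i. real i / k <= T & \<not> split1 (e / (2 * scl et n)) (rev (block n k i (walk (n * k) om)))}
    <= (real k * |T| + 1) * (C / k)\<^sup>2" by (rule prob_bad_block[OF et e]) blast
  define S where "S = (%k. \<integral>om. G (spath k (%i. W om (real i / k))) \<partial>N)"
  define X where "X = (%k n om. G (spath k (%i. scl et n * csum (take (grid n k i) (walk (n * k) om)))))"
  \<comment> \<open>The mesh is fixed before \<open>n\<close> grows. The tolerance is split into
    four: time change, bad blocks, convergence for fixed \<open>k\<close>, and sampling of the
    limit.\<close>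
  have "\<forall>\<^sub>F k in sequentially. 0 < k & 1 / real k < e & T < real k
    & 2 * B * ((real k * |T| + 1) * (C / k)\<^sup>2) < ep / 4 & dist (S k) (\<integral>om. G (W om) \<partial>N) < ep / 4"
  proof (intro eventually_conj)
   show "\<forall>\<^sub>F k in sequentially. 0 < k" by (rule eventually_gt_at_top)
   show "\<forall>\<^sub>F k in sequentially. 1 / real k < e" using e by (intro order_tendstoD(2)[OF lim_1_over_n])
   show "\<forall>\<^sub>F k in sequentially. T < real k"
    using filterlim_real_sequentially by (simp add: filterlim_at_top_dense)
   have "S ----> (\<integral>om. G (W om) \<partial>N)" unfolding S_def by (rule stable_process_sampled_tendsto[OF W G GB'])
   thus "\<forall>\<^sub>F k in sequentially. dist (S k) (\<integral>om. G (W om) \<partial>N) < ep / 4" using ep by (intro tendstoD) auto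
   have "(%k. 2 * B * (C\<^sup>2 * ( |T| * (1 / real k) + (1 / real k) * (1 / real k)))) ----> 2 * B * (C\<^sup>2 * ( |T| * 0 + 0 * 0))"
    by (intro tendsto_intros lim_1_over_n)
   moreover have "C\<^sup>2 * ( |T| * (1 / real k) + (1 / real k) * (1 / real k)) = (real k * |T| + 1) * (C / k)\<^sup>2" for k :: nat
    by (cases "k = 0") (simp_all add: power2_eq_square field_simps)
   ultimately show "\<forall>\<^sub>F k in sequentially. 2 * B * ((real k * |T| + 1) * (C / real k)\<^sup>2) < ep / 4"
    using ep by (intro order_tendstoD(2)) auto
  qed
  then obtain k where k: "0 < k" "1 / real k < e" "T < real k"
   "2 * B * ((real k * |T| + 1) * (C / k)\<^sup>2) < ep / 4" "dist (S k) (\<integral>om. G (W om) \<partial>N) < ep / 4"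
   unfolding eventually_sequentially by blast
  have Xm: "X k n : borel_measurable M" for n unfolding X_def by (rule measurable_compose[OF walk_measurable[of "n * k"]]) simp
  have "\<forall>\<^sub>F n in sequentially. dist (expectation (X k n)) (S k) < ep / 4"
   unfolding X_def S_def using sampled_walk_tendsto[OF et W k(1) G GB'] ep by (intro tendstoD) auto
  moreover have "\<forall>\<^sub>F n in sequentially. scl et n * |be * ell| < e / 2"
  proof -
   have "(%n. scl et n * |be * ell| ) ----> 0 * |be * ell|" by (intro tendsto_intros scl_tendsto)
   thus ?thesis using e by (intro order_tendstoD(2)) auto
  qed
  moreover have "\<forall>\<^sub>F n in sequentially. k <= n" by (rule eventually_ge_at_top)
  ultimately show "\<forall>\<^sub>F n in sequentially. dist (expectation (%om. G (swalk et n om))) (\<integral>om. G (W om) \<partial>N) < ep"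
   using C[OF k(1,3)]
  proof eventually_elim
   case (elim n)
   have n: "0 < n" using elim(3) k(1) by simp
   have c: "0 < scl et n" by (rule scl_pos[OF et n])
   define bad where "bad = {om : space M. EX i. real i / k <= T &
    \<not> split1 (e / (2 * scl et n)) (rev (block n k i (walk (n * k) om)))}"
   have bad_sets: "bad : sets M"
   proof -
    have "bad = walk (n * k) -` {zs. EX i. real i / k <= T & \<not> split1 (e / (2 * scl et n)) (rev (block n k i zs))} \<inter> space M"
     by (auto simp: bad_def)
    thus ?thesis using measurable_sets[OF walk_measurable] by simp
   qed
   have ib: "integrable M (indicator bad :: _ => real)"
    by (rule integrable_const_bound[where B = 1]) (use bad_sets in \<open>auto simp: indicator_def\<close>)
   have XB: "|X k n om| <= B" for om unfolding X_def by (rule GB') simp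
   have iZ: "integrable M (%om. G (swalk et n om))" using Zm Zc GB' by (intro integrable_const_bound[where B = B]) auto
   have iX: "integrable M (X k n)" using Xm XB by (intro integrable_const_bound[where B = B]) auto
   have "|expectation (%om. G (swalk et n om)) - expectation (X k n) |
     = |expectation (%om. G (swalk et n om) - X k n om) |" using iZ iX by simp
   also have "... <= expectation (%om. |G (swalk et n om) - X k n om| )" by (rule integral_abs_bound)
   also have "... <= expectation (%om. L * e + 2 * B * indicator bad om)"
   proof (rule integral_mono_AE)
    show "integrable M (%om. |G (swalk et n om) - X k n om| )" using iZ iX by auto
    show "integrable M (%om. L * e + 2 * B * indicator bad om)"
     using ib by (intro Bochner_Integration.integrable_add integrable_mult_right) auto
    show "AE om in M. |G (swalk et n om) - X k n om| <= L * e + 2 * B * indicator bad om" using AE_wevent[of "n * k"]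
    proof (rule AE_mp, intro AE_I2 impI)
     fix om assume om: "om : space M" "om : wevent (walk (n * k) om)"
     show "|G (swalk et n om) - X k n om| <= L * e + 2 * B * indicator bad om"
     proof (cases "om : bad")
     case True
     have "0 <= L * e" using L e by simp
     hence "|G (swalk et n om) - X k n om| <= L * e + 2 * B" using GB'[OF Zc[OF om(1), of n]] XB[of om] by linarith
     thus ?thesis using True by simp
     next
     case False
     have len: "length (walk (n * k) om) = n * k" by (simp add: walk_def)
     have "pdist (swalk et n om) (spath k (%i. scl et n * csum (take (grid n k i) (walk (n * k) om)))) <= e"
     unfolding swalk_def scale_path_W_path
     proof (rule pdist_walk_spath[OF k(1) _ _ elim(3) len c])
     show "1 / real k <= e" "1 / e + e < real k" using k by (auto simp: T_def)
     show "scl et n * |be * ell| <= e / 2" using elim(2) by simp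
     show "de j om * real (return_time ga j (y0 om)) = jump (walk (n * k) om ! j)" if "j < n * k" for j
     using om(2) that len by (auto simp: wevent_def jump_def simp del: of_nat_Suc)
     show "split1 (e / (2 * scl et n)) (rev (block n k i (walk (n * k) om)))" if "real i / k <= 1 / e + e" for i
     using False that om(1) by (auto simp: bad_def T_def)
     qed
     hence "L * pdist (swalk et n om) (spath k (%i. scl et n * csum (take (grid n k i) (walk (n * k) om)))) <= L * e"
     using L by (intro mult_left_mono)
     moreover have "|G (swalk et n om) - X k n om|
     <= L * pdist (swalk et n om) (spath k (%i. scl et n * csum (take (grid n k i) (walk (n * k) om))))"
     unfolding X_def by (rule path_lipschitzD[OF G Zc[OF om(1)]]) simp
     ultimately show ?thesis using False by simp
     qed
    qed
   qed
   also have "... = L * e + 2 * B * prob bad" using bad_sets ib by (simp add: prob_space)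
   also have "... <= ep / 4 + 2 * B * ((real k * |T| + 1) * (C / k)\<^sup>2)"
    using Le elim(4) B unfolding bad_def[symmetric] by (intro add_mono mult_left_mono) auto
   finally show ?case using elim(1) k(4,5) unfolding dist_real_def by linarith
  qed
 qed
qed

end

context prob_space
begin

lemma sigma_sets_const: "sigma_sets (space M) {(%_. c) -` A \<inter> space M | A. A : S} \<subseteq> {{}, space M}"
 by (rule sigma_algebra.sigma_sets_subset[OF sigma_algebra_trivial]) auto

text \<open>Constants generate the trivial sigma-algebra; this serves the deterministic signs of
  skewness \<open>1\<close> and \<open>- 1\<close>.\<close>

lemma indep_vars_const: "(!!i. i : I ==> c i : space (M' i)) ==> indep_vars M' (%i _. c i) I" unfolding indep_vars_def
proof (intro conjI ballI indep_setsI)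
 fix i assume "!!i. i : I ==> c i : space (M' i)" "i : I"
 thus "sigma_sets (space M) {(%_. c i) -` A \<inter> space M |A. A : sets (M' i)} \<subseteq> events"
  by (intro order_trans[OF sigma_sets_const]) auto
next
 fix A J assume J: "J ~= {}" "finite J"
  and A: "ALL j:J. A j : sigma_sets (space M) {(%_. c j) -` A \<inter> space M |A. A : sets (M' j)}"
 have *: "A j : {{}, space M}" if "j : J" for j by (rule subsetD[OF sigma_sets_const A[rule_format, OF that]])
 show "prob (\<Inter>j\<in>J. A j) = (\<Prod>j\<in>J. prob (A j))"
 proof (cases "EX j:J. A j = {}")
  case True
  then obtain j where "j : J" "A j = {}" by blast
  hence "(\<Inter>j\<in>J. A j) = {}" "prob (A j) = 0" by auto
  moreover from `j : J` this have "(\<Prod>j\<in>J. prob (A j)) = 0" using J by (intro prod_zero) auto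
  ultimately show ?thesis by simp
 next
  case False
  hence "A j = space M" if "j : J" for j using *[OF that] that by auto
  thus ?thesis using J by (simp add: prob_space)
 qed
qed auto

lemma indep_var_const:
 assumes "c : space S" "random_variable T Y"
 shows "indep_var S (%_. c) T Y" unfolding indep_var_eq indep_sets2_eq
proof (intro conjI ballI)
 show "random_variable S (%_. c)" "random_variable T Y" using assms by auto
 show "sigma_sets (space M) {(%_. c) -` A \<inter> space M |A. A : sets S} \<subseteq> events"
  by (rule order_trans[OF sigma_sets_const]) auto
 show sub: "sigma_sets (space M) {Y -` A \<inter> space M |A. A : sets T} \<subseteq> events"
  using assms(2) by (intro sets.sigma_sets_subset) auto
 fix a d assume a: "a : sigma_sets (space M) {(%_. c) -` A \<inter> space M |A. A : sets S}"
  and d: "d : sigma_sets (space M) {Y -` A \<inter> space M |A. A : sets T}"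
 from subsetD[OF sigma_sets_const a] consider "a = {}" | "a = space M" by auto
 moreover have "space M \<inter> d = d" using sets.sets_into_space[OF subsetD[OF sub d]] by (rule Int_absorb1)
 ultimately show "prob (a \<inter> d) = prob a * prob d" by cases (simp_all add: prob_space)
qed

end

lemma stable_process_scale:
 assumes et: "0 < et" and W: "stable_process al 1 be N W"
 shows "stable_process al et be N (%om. scale_path et (W om))"
proof -
 interpret N: prob_space N using W by (simp add: stable_process_def)
 have Wm: "(%om. W om t) : borel_measurable N" if "0 <= t" for t using W that by (simp add: stable_process_def)
 have Wc: "W om : cadlag_space" if "om : space N" for om using W that by (simp add: stable_process_def)
 have sc: "scale_path et f t = et * f t" if "0 <= t" for f t using that by (simp add: scale_path_def)
 have c: "scale_path et (W om) : cadlag_space" if "om : space N" for om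
 proof -
  have "cadlag (%t. et * W om t)" using Wc[OF that] by (intro cadlag_cmult) (simp add: cadlag_space_iff)
  hence "cadlag (scale_path et (W om))" by (rule cadlag_cong[THEN iffD1, rotated]) (simp add: sc)
  thus ?thesis by (simp add: cadlag_space_iff scale_path_def)
 qed
 have ind: "N.indep_vars (%_. borel) (%i om. scale_path et (W om) (s (Suc i)) - scale_path et (W om) (s i)) {..<m}"
  if s: "0 <= s 0 & (ALL i<m. s i <= s (Suc i))" for m :: nat and s
 proof -
  have pos: "0 <= s i" if "i <= m" for i using that
  proof (induction i)
   case (Suc i)
   thus ?case using s order_trans[of 0 "s i" "s (Suc i)"] by auto
  qed (use s in simp)
  have "ALL (m::nat) s. 0 <= s 0 & (ALL i<m. s i <= s (Suc i)) -->
    N.indep_vars (%_. borel) (%i om. W om (s (Suc i)) - W om (s i)) {..<m}" using W unfolding stable_process_def by blast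
  from this[rule_format, OF s] have "N.indep_vars (%_. borel) (%i om. et * (W om (s (Suc i)) - W om (s i))) {..<m}"
   by (rule N.indep_vars_compose2[where Y = "%_ x. et * x"]) auto
  thus ?thesis by (rule N.indep_vars_cong[THEN iffD1, rotated -1]) (auto simp: sc pos algebra_simps Suc_leI)
 qed
 have distr_scale: "distr N borel (%om. et * f om) = distr (distr N borel f) borel (%x. et * x)"
  if "f : borel_measurable N" for f using that by (subst distr_distr) (auto simp: o_def)
 have stat: "distr N borel (%om. scale_path et (W om) (s + t) - scale_path et (W om) s)
   = distr N borel (%om. scale_path et (W om) t - scale_path et (W om) 0)" if "0 <= s" "0 <= t" for s t
 proof -
  have "ALL s>=0. ALL t>=0. distr N borel (%om. W om (s + t) - W om s) = distr N borel (%om. W om t - W om 0)"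
   using W unfolding stable_process_def by blast
  hence "distr N borel (%om. et * (W om (s + t) - W om s)) = distr N borel (%om. et * (W om t - W om 0))"
   using that Wm by (simp add: distr_scale)
  thus ?thesis using that by (simp add: sc right_diff_distrib)
 qed
 from W obtain nuu where nuu: "stable_law al 1 be nuu" "!!t. 0 <= t ==> distr N borel (%om. W om t) = distr nuu borel (%x. t powr (1 / al) * x)"
  unfolding stable_process_def by blast
 interpret nuu: real_distribution nuu using nuu(1) by (simp add: stable_law_def)
 have law: "stable_law al et be (distr nuu borel (%x. et * x))" unfolding stable_law_def
 proof (intro conjI allI)
  show "real_distribution (distr nuu borel (%x. et * x))" by (intro nuu.real_distribution_distr) simp
  fix t
  have "char (distr nuu borel (%x. et * x)) t = char nuu (et * t)"
   unfolding char_def by (subst integral_distr) (auto simp: ac_simps)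
  also have "... = stable_cf al 1 be (et * t)" using nuu(1) by (simp add: stable_law_def)
  also have "... = stable_cf al et be t" using et by (simp add: stable_cf_def abs_mult powr_mult sgn_mult)
  finally show "char (distr nuu borel (%x. et * x)) t = stable_cf al et be t" .
 qed
 have marg: "distr N borel (%om. scale_path et (W om) t) = distr (distr nuu borel (%x. et * x)) borel (%x. t powr (1 / al) * x)"
  if "0 <= t" for t using that Wm[OF that] by (simp add: sc distr_scale nuu(2) distr_distr o_def mult.left_commute)
 show ?thesis unfolding stable_process_def using N.prob_space_axioms c Wm ind stat law marg
  by (intro conjI ballI allI impI exI[of _ "distr nuu borel (%x. et * x)"]) (auto simp: sc)
qed

text \<open>Kept general in the signs and in the scale, so that the scaled walks and the
  deterministic signs are further instances.\<close>

lemma W_path_weak_conv: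
 fixes al be :: real
 assumes al: "al : {0<..<1} \<union> {1<..<2}" and be: "be : {-1..1}" and M: "prob_space M"
  and y0: "y0 : measurable M (mu_Y (1 / al))" "distr M (mu_Y (1 / al)) y0 = mu_Y (1 / al)"
  and indep: "prob_space.indep_vars M (%_. borel) de UNIV" and plus: "!!j. measure M {om : space M. de j om = 1} = (1 + be) / 2"
  and minus: "!!j. measure M {om : space M. de j om = -1} = (1 - be) / 2" and indep': "prob_space.indep_var M
   (Pi\<^sub>M UNIV (%_. borel)) (%om j. de j om) (Pi\<^sub>M UNIV (%_. borel)) (%om j. real (return_time (1 / al) j (y0 om)))"
  and et: "0 < et" and W: "stable_process al et be N W"
 defines "Z \<equiv> %n om. scale_path et (W_path al be (%j. de j om) (y0 om) n)"
 shows "lwconv M Z N W" and "converges_weakly M1_topology M Z N W"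
proof -
 define ga where "ga = 1 / al"
 have al_eq: "al = 1 / ga" by (simp add: ga_def)
 have "0 < ga" "ga ~= 1" "1 / 2 < ga" using al by (auto simp: ga_def field_simps)
 moreover have "- 1 <= be" "be <= 1" using be by auto
 ultimately have st: "sthaler ga be" by unfold_locales
 have b: "sthaler.b be = (1 + be) / 2" by (rule sthaler.b_def[OF st])
 have "signed_walk ga be M y0 de"
 proof (intro signed_walk.intro signed_walk_axioms.intro st M)
  show "measure M {om : space M. de j om = 1} = sthaler.b be" for j by (simp add: b plus)
  show "measure M {om : space M. de j om = -1} = 1 - sthaler.b be" for j by (simp add: b minus field_simps)
 qed (use y0 indep indep' in \<open>simp_all add: ga_def\<close>)
 then interpret signed_walk ga be M y0 de .
 have Z: "Z = swalk et" unfolding Z_def swalk_def[abs_def] al_eq ..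
 show conv: "lwconv M Z N W" unfolding Z using swalk_weak_conv[OF et] W unfolding al_eq by blast
 have "cmeas N W" "prob_space N" using W by (auto simp: stable_process_def cmeas_def)
 thus "converges_weakly M1_topology M Z N W" using conv M cmeas_swalk unfolding Z by (intro lwconv_imp_converges_weakly) auto
qed

theorem theorem3p1:
  fixes \<alpha> \<beta> :: real
    and M :: "'a measure" and y0 :: "'a \<Rightarrow> real" and \<delta> :: "nat \<Rightarrow> 'a \<Rightarrow> real"
  assumes \<alpha>: "\<alpha> \<in> {0<..<1} \<union> {1<..<2}"
    and \<beta>: "\<beta> \<in> {-1..1}"
    and M: "prob_space M"
    and y0: "y0 \<in> measurable M (mu_Y (1 / \<alpha>))" "distr M (mu_Y (1 / \<alpha>)) y0 = mu_Y (1 / \<alpha>)"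
    and \<delta>_indep: "prob_space.indep_vars M (\<lambda>_. borel) \<delta> UNIV"
    and \<delta>_plus: "\<And>j. measure M {\<omega> \<in> space M. \<delta> j \<omega> = 1} = (1 + \<beta>) / 2"
    and \<delta>_minus: "\<And>j. measure M {\<omega> \<in> space M. \<delta> j \<omega> = -1} = (1 - \<beta>) / 2"
    and \<delta>_\<tau>_indep: "prob_space.indep_var M
      (Pi\<^sub>M UNIV (\<lambda>_. borel)) (\<lambda>\<omega> j. \<delta> j \<omega>)
      (Pi\<^sub>M UNIV (\<lambda>_. borel)) (\<lambda>\<omega> j. real (return_time (1 / \<alpha>) j (y0 \<omega>)))"
  shows "(\<forall>(N :: 'b measure) W. stable_process \<alpha> 1 \<beta> N W \<longrightarrow>
            converges_weakly M1_topology
              M (\<lambda>n \<omega>. W_path \<alpha> \<beta> (\<lambda>j. \<delta> j \<omega>) (y0 \<omega>) n) N W)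
       \<and> (\<forall>\<eta>>0. \<forall>(N :: 'b measure) W (N' :: 'c measure) W'.
            stable_process \<alpha> 1 \<beta> N W \<and> stable_process \<alpha> \<eta> \<beta> N' W' \<longrightarrow>
            equal_in_law M1_topology N' W' N (\<lambda>\<omega>. scale_path \<eta> (W \<omega>)))
       \<and> (\<forall>\<eta>>0. \<forall>(N' :: 'c measure) W'. stable_process \<alpha> \<eta> \<beta> N' W' \<longrightarrow>
            converges_weakly M1_topology
              M (\<lambda>n \<omega>. scale_path \<eta> (W_path \<alpha> \<beta> (\<lambda>j. \<delta> j \<omega>) (y0 \<omega>) n)) N' W')
       \<and> (\<forall>\<sigma>\<in>{1, -1}. \<forall>(N :: 'b measure) W. stable_process \<alpha> 1 \<sigma> N W \<longrightarrow>
            converges_weakly M1_topology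
              M (\<lambda>n \<omega>. W_path \<alpha> \<sigma> (\<lambda>_. \<sigma>) (y0 \<omega>) n) N W)"
proof -
  interpret prob_space M by (rule M)
  note conv = W_path_weak_conv[OF \<alpha> \<beta> M y0 \<delta>_indep \<delta>_plus \<delta>_minus \<delta>_\<tau>_indep]
  have scale_1: "scale_path 1 (W_path a c d y n) = W_path a c d y n" for a c d y n
    by (auto simp: scale_path_def W_path_def Let_def intro!: restrict_ext)
  have 1: "converges_weakly M1_topology M (\<lambda>n \<omega>. W_path \<alpha> \<beta> (\<lambda>j. \<delta> j \<omega>) (y0 \<omega>) n) N W"
    if "stable_process \<alpha> 1 \<beta> N W" for N :: "'b measure" and W
    using conv(2)[OF _ that] by (simp add: scale_1)
  have 2: "equal_in_law M1_topology N' W' N (\<lambda>\<omega>. scale_path \<eta> (W \<omega>))"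
    if \<eta>: "0 < \<eta>" and W: "stable_process \<alpha> 1 \<beta> N W" and W': "stable_process \<alpha> \<eta> \<beta> N' W'"
    for \<eta> and N :: "'b measure" and W and N' :: "'c measure" and W'
  proof -
    have W\<eta>: "stable_process \<alpha> \<eta> \<beta> N (\<lambda>\<omega>. scale_path \<eta> (W \<omega>))" by (rule stable_process_scale[OF \<eta> W])
    show ?thesis
    \<comment> \<open>Both processes are limits of the same scaled walks, so their laws agree by
      uniqueness of the limit.\<close>
    proof (rule lwconv_unique)
      show "prob_space N'" "cmeas N' W'" "prob_space N" "cmeas N (\<lambda>\<omega>. scale_path \<eta> (W \<omega>))"
        using W' W\<eta> by (auto simp: stable_process_def cmeas_def)
    qed (rule conv(1)[OF \<eta>] W' W\<eta>)+
  qed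
  have 4: "converges_weakly M1_topology M (\<lambda>n \<omega>. W_path \<alpha> \<sigma> (\<lambda>_. \<sigma>) (y0 \<omega>) n) N W"
    if \<sigma>: "\<sigma> \<in> {1, -1}" and W: "stable_process \<alpha> 1 \<sigma> N W" for \<sigma> and N :: "'b measure" and W
  proof -
    have "converges_weakly M1_topology M (\<lambda>n \<omega>. scale_path 1 (W_path \<alpha> \<sigma> (\<lambda>j. \<sigma>) (y0 \<omega>) n)) N W"
    \<comment> \<open>With constant signs the independence conditions hold trivially, and the
      skewness of the limit is the sign itself.\<close>
    proof (rule W_path_weak_conv(2)[OF \<alpha> _ M y0 _ _ _ _ _ W, of "\<lambda>_ _. \<sigma>"])
      show "indep_vars (\<lambda>_. borel) (\<lambda>_ _. \<sigma>) UNIV" by (rule indep_vars_const) simp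
      show "indep_var (Pi\<^sub>M UNIV (\<lambda>_. borel)) (\<lambda>\<omega> j. \<sigma>)
          (Pi\<^sub>M UNIV (\<lambda>_. borel)) (\<lambda>\<omega> j. real (return_time (1 / \<alpha>) j (y0 \<omega>)))"
        by (intro indep_var_const indep_var_rv2[OF \<delta>_\<tau>_indep]) (simp add: space_PiM)
    qed (use \<sigma> prob_space in auto)
    then show ?thesis by (simp add: scale_1)
  qed
  show ?thesis using 1 2 4 conv(2) by blast
qed

end
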